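(* Let $(M,d,\mu)$ be a metric measure space satisfying the volume doubling property, let $\phi_j$ be a scale function, set $\phi:=\phi_j$, and let $\psi$ be a scale function such that $\int_0^\infty(1\wedge t)\frac{dt}{t\,\psi(\phi^{-1}(t))}<\infty$. Assume that $(\mathcal{E},\mathcal{F})$ is a regular Dirichlet form of pure-jump type on $L^2(M;\mu)$ that enjoys the jump type heat kernel estimate $\mathrm{HK}(\phi_j)$, with associated $\mu$-symmetric Hunt process $X$, and let $S$ be an independent subordinator whose Bernstein function is $$\overline{\phi}(\lambda):=\int_0^\infty(1-e^{-\lambda t})\frac{dt}{t\,\psi(\phi^{-1}(t))},\qquad\lambda>0.$$ Then the jump kernel $J(x,y)$ of the subordinate process $X_{S_t}$ satisfies $$J(x,y)\simeq\frac{1}{V(x,r)}\,\overline{\phi}\bigl(\phi_j(r)^{-1}\bigr),\qquad r:=d(x,y)>0.$$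
   Context: **Space.** $(M,d)$ is a locally compact separable metric space and $\mu$ is a Radon measure on $M$ with full support. $B(x,r)=\{y\in M: d(x,y)<r\}$, $V(x,r)=\mu(B(x,r))$. Volume doubling property: there exist $C\ge1$, $d_2>0$ with $V(x,R)/V(x,r)\le C(R/r)^{d_2}$ for all $x\in M$, $0<r\le R$. $a\wedge b=\min(a,b)$. **Scale functions.** For $0<\alpha_1\le\alpha_2$, a continuous function $\psi:[0,\infty)\to[0,\infty)$ satisfies $LU(\alpha_1,\alpha_2)$ if it is strictly increasing, $\psi(0)=0$, $\psi(1)=1$, and there is $C\ge1$ with $C^{-1}(R/r)^{\alpha_1}\le\psi(R)/\psi(r)\le C(R/r)^{\alpha_2}$ for $0<r\le R$. A function satisfying $LU(\alpha_1,\alpha_2)$ for some $0<\alpha_1\le\alpha_2$ is called a scale function. **Dirichlet forms.** A regular Dirichlet form on $L^2(M;\mu)$ is of pure-jump type if $\mathcal{E}(f,f)=\int_{M\times M\setminus\mathrm{diag}}(f(x)-f(y))^2J(dx,dy)$ (no strongly local part and no killing), $J$ being the (symmetric Radon) jumping measure. The jump kernel $J(x,y)$ is the density of the jumping measure with respect to $\mu\otimes\mu$, i.e. $J(dx,dy)=J(x,y)\mu(dx)\mu(dy)$ off the diagonal; estimates on it are understood for $\mu\otimes\mu$-a.e. $(x,y)$ with $x\ne y$. The jump kernel of the subordinate process is that of its associated Dirichlet form; by a known theorem of Ôkura it is $J(x,y)=\frac12\int_0^\infty p(t,x,y)\,\nu(dt)$, where $p$ is the heat kernel of $(\mathcal{E},\mathcal{F})$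 and $\nu$ the Lévy measure of $S$. $f\simeq g$ means there is a constant $C>0$ with $C^{-1}f\le g\le Cf$ (here $C$ is independent of $x,y$). **Heat kernel estimates $\mathrm{HK}(\phi_j)$.** For $t>0$, $x,y\in M$ put $$p^{(j)}(t,x,y):=\frac{1}{V(x,\phi_j^{-1}(t))}\wedge\frac{t}{V(x,d(x,y))\phi_j(d(x,y))}$$ (the last fraction being read as $+\infty$ if $x=y$). $\mathrm{HK}(\phi_j)$ holds for a pure-jump type regular Dirichlet form $(\mathcal{E},\mathcal{F})$ if there exist a heat kernel $p(t,x,y)$ of $(\mathcal{E},\mathcal{F})$, a properly exceptional set $\mathcal{N}$ (in particular $\mu(\mathcal{N})=0$) and constants $c_1,c_2>0$ such that $c_1p^{(j)}(t,x,y)\le p(t,x,y)\le c_2p^{(j)}(t,x,y)$ for all $t>0$ and $x,y\in M\setminus\mathcal{N}$. **Subordinators.** A subordinator is a non-negative Lévy process $S_t$; its Bernstein function $\Phi$ is given by $E[e^{-\lambda S_t}]=e^{-t\Phi(\lambda)}$, $\Phi(\lambda)=b\lambda+\int_0^\infty(1-e^{-\lambda t})\nu(dt)$ with $b\ge0$ and $\nu$ a Lévy measure on $(0,\infty)$. In the claim $b=0$ and $\nu(dt)=\frac{dt}{t\psi(\phi^{-1}(t))}$. *)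

theory Defs
  imports "HOL-Probability.Probability"
begin

section \<open>Metric measure spaces and scale functions\<close>

text \<open>The space \<open>M\<close> is the universe of a type of class \<open>metric_space\<close> and
  \<open>second_countable_topology\<close>; for metric spaces the latter is separability.\<close>

definition radon_measure :: "'b::topological_space measure \<Rightarrow> bool" where
  "radon_measure \<mu> \<longleftrightarrow> sets \<mu> = sets borel \<and> (\<forall>K. compact K \<longrightarrow> emeasure \<mu> K < \<infinity>)"

definition full_support :: "'b::topological_space measure \<Rightarrow> bool" where
  "full_support \<mu> \<longleftrightarrow> (\<forall>U. open U \<and> U \<noteq> {} \<longrightarrow> emeasure \<mu> U > 0)"

definition volume_doubling :: "'a::metric_space measure \<Rightarrow> bool" where
  "volume_doubling \<mu> \<longleftrightarrow> (\<exists>C\<ge>1. \<exists>d2>0. \<forall>x r R. 0 < r \<and> r \<le> R \<longrightarrow>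
     emeasure \<mu> (ball x R) / emeasure \<mu> (ball x r) \<le> ennreal (C * (R / r) powr d2))"

text \<open>Under volume doubling and local compactness all balls have finite measure, so the
  real-valued volume loses nothing.\<close>

definition vol :: "'a::metric_space measure \<Rightarrow> 'a \<Rightarrow> real \<Rightarrow> real" where
  "vol \<mu> x r = measure \<mu> (ball x r)"

definition LU :: "real \<Rightarrow> real \<Rightarrow> (real \<Rightarrow> real) \<Rightarrow> bool" where
  "LU \<alpha>1 \<alpha>2 \<psi> \<longleftrightarrow>
     continuous_on {0..} \<psi> \<and> strict_mono_on {0..} \<psi> \<and> \<psi> 0 = 0 \<and> \<psi> 1 = 1 \<and>
     (\<exists>C\<ge>1. \<forall>r R. 0 < r \<and> r \<le> R \<longrightarrow>
        inverse C * (R / r) powr \<alpha>1 \<le> \<psi> R / \<psi> r \<and> \<psi> R / \<psi> r \<le> C * (R / r) powr \<alpha>2)"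

definition scale_function :: "(real \<Rightarrow> real) \<Rightarrow> bool" where
  "scale_function \<psi> \<longleftrightarrow> (\<exists>\<alpha>1 \<alpha>2. 0 < \<alpha>1 \<and> \<alpha>1 \<le> \<alpha>2 \<and> LU \<alpha>1 \<alpha>2 \<psi>)"

definition scale_inv :: "(real \<Rightarrow> real) \<Rightarrow> real \<Rightarrow> real" where
  "scale_inv \<phi> = the_inv_into {0..} \<phi>"


section \<open>Dirichlet forms\<close>

text \<open>Elements of \<open>L\<^sup>2\<close> are represented by Borel functions; a form domain is a set of such
  functions that is closed under almost everywhere equality. The values of a form outside its
  domain carry no meaning.\<close>

definition L2 :: "'a measure \<Rightarrow> ('a \<Rightarrow> real) set" where
  "L2 \<mu> = {f \<in> borel_measurable \<mu>. integrable \<mu> (\<lambda>x. (f x)\<^sup>2)}"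

definition L2_inner :: "'a measure \<Rightarrow> ('a \<Rightarrow> real) \<Rightarrow> ('a \<Rightarrow> real) \<Rightarrow> real" where
  "L2_inner \<mu> f g = (LINT x|\<mu>. f x * g x)"

definition C_c :: "('a::topological_space \<Rightarrow> real) set" where
  "C_c = {f. continuous_on UNIV f \<and> compact (closure {x. f x \<noteq> 0})}"

type_synonym 'a form = "('a \<Rightarrow> real) \<Rightarrow> ('a \<Rightarrow> real) \<Rightarrow> real"

definition E1_sq :: "'a measure \<Rightarrow> 'a form \<Rightarrow> ('a \<Rightarrow> real) \<Rightarrow> real" where
  "E1_sq \<mu> E u = E u u + L2_inner \<mu> u u"

text \<open>Nonnegative definite symmetric bilinear forms on a linear space of functions.\<close>

definition symmetric_form :: "('a \<Rightarrow> real) set \<Rightarrow> 'a form \<Rightarrow> bool" where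
  "symmetric_form F E \<longleftrightarrow>
     (\<lambda>x. 0) \<in> F \<and>
     (\<forall>u\<in>F. \<forall>v\<in>F. (\<lambda>x. u x + v x) \<in> F) \<and>
     (\<forall>u\<in>F. \<forall>c. (\<lambda>x. c * u x) \<in> F) \<and>
     (\<forall>u\<in>F. \<forall>v\<in>F. \<forall>w\<in>F. E (\<lambda>x. u x + v x) w = E u w + E v w) \<and>
     (\<forall>u\<in>F. \<forall>w\<in>F. \<forall>c. E (\<lambda>x. c * u x) w = c * E u w) \<and>
     (\<forall>u\<in>F. \<forall>v\<in>F. E u v = E v u) \<and>
     (\<forall>u\<in>F. 0 \<le> E u u)"

definition dirichlet_form :: "'a measure \<Rightarrow> 'a form \<Rightarrow> ('a \<Rightarrow> real) set \<Rightarrow> bool" where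
  "dirichlet_form \<mu> E F \<longleftrightarrow>
     F \<subseteq> L2 \<mu> \<and>
     symmetric_form F E \<and>
     (\<forall>u\<in>F. \<forall>v\<in>borel_measurable \<mu>. (AE x in \<mu>. u x = v x) \<longrightarrow>
        v \<in> F \<and> (\<forall>w\<in>F. E v w = E u w)) \<and>
     \<comment> \<open>densely defined\<close>
     (\<forall>f\<in>L2 \<mu>. \<forall>\<epsilon>>0. \<exists>u\<in>F. L2_inner \<mu> (\<lambda>x. f x - u x) (\<lambda>x. f x - u x) < \<epsilon>) \<and>
     \<comment> \<open>closed\<close>
     (\<forall>u. (\<forall>n. u n \<in> F) \<and>
          (\<forall>\<epsilon>>0. \<exists>n0. \<forall>m\<ge>n0. \<forall>n\<ge>n0. E1_sq \<mu> E (\<lambda>x. u m x - u n x) < \<epsilon>) \<longrightarrow>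
          (\<exists>v\<in>F. (\<lambda>n. E1_sq \<mu> E (\<lambda>x. u n x - v x)) \<longlonglongrightarrow> 0)) \<and>
     \<comment> \<open>Markovian\<close>
     (\<forall>u\<in>F. (\<lambda>x. min (max (u x) 0) 1) \<in> F \<and>
          E (\<lambda>x. min (max (u x) 0) 1) (\<lambda>x. min (max (u x) 0) 1) \<le> E u u)"

definition regular_dirichlet_form ::
  "'a::metric_space measure \<Rightarrow> 'a form \<Rightarrow> ('a \<Rightarrow> real) set \<Rightarrow> bool" where
  "regular_dirichlet_form \<mu> E F \<longleftrightarrow>
     dirichlet_form \<mu> E F \<and>
     (\<forall>u\<in>F. \<forall>\<epsilon>>0. \<exists>v\<in>F \<inter> C_c. E1_sq \<mu> E (\<lambda>x. u x - v x) < \<epsilon>) \<and>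
     (\<forall>f\<in>C_c. \<forall>\<epsilon>>0. \<exists>v\<in>F \<inter> C_c. \<forall>x. \<bar>f x - v x\<bar> < \<epsilon>)"

text \<open>A symmetric Radon measure on the complement of the diagonal, regarded as a Borel measure
  on the product that does not charge the diagonal.\<close>

definition offdiag_radon ::
  "('a \<times> 'a::{metric_space,second_countable_topology}) measure \<Rightarrow> bool" where
  "offdiag_radon Jm \<longleftrightarrow>
     sets Jm = sets borel \<and> emeasure Jm {(x, y). x = y} = 0 \<and>
     (\<forall>K. compact K \<and> K \<inter> {(x, y). x = y} = {} \<longrightarrow> emeasure Jm K < \<infinity>) \<and>
     (\<forall>A\<in>sets borel. emeasure Jm {(x, y). (y, x) \<in> A} = emeasure Jm A)"

text \<open>As in the Beurling--Deny theorem, representations of a regular Dirichlet form are formulated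
  on \<open>F \<inter> C_c\<close>: on all of \<open>F\<close> quasi-continuous versions would be required.\<close>

definition pure_jump ::
  "'a::{metric_space,second_countable_topology} form \<Rightarrow> ('a \<Rightarrow> real) set \<Rightarrow> bool" where
  "pure_jump E F \<longleftrightarrow> (\<exists>Jm. offdiag_radon Jm \<and>
     (\<forall>u\<in>F \<inter> C_c. integrable Jm (\<lambda>(x, y). (u x - u y)\<^sup>2) \<and>
        E u u = (LINT (x, y)|Jm. (u x - u y)\<^sup>2)))"

definition strongly_local :: "('a::metric_space \<Rightarrow> real) set \<Rightarrow> 'a form \<Rightarrow> bool" where
  "strongly_local D E \<longleftrightarrow> (\<forall>u\<in>D. \<forall>v\<in>D.
     (\<exists>U c. open U \<and> closure {x. u x \<noteq> 0} \<subseteq> U \<and> (\<forall>x\<in>U. v x = c)) \<longrightarrow> E u v = 0)"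

text \<open>\<open>Jm\<close> is the jumping measure of \<open>(E, F)\<close>: the jump part in the Beurling--Deny decomposition,
  with strongly local part \<open>Ec\<close> and killing measure \<open>k\<close>.  There is no factor \<open>1/2\<close> in front of
  the jump part.\<close>

definition jumping_measure ::
  "'a::{metric_space,second_countable_topology} form \<Rightarrow> ('a \<Rightarrow> real) set
     \<Rightarrow> ('a \<times> 'a) measure \<Rightarrow> bool" where
  "jumping_measure E F Jm \<longleftrightarrow> offdiag_radon Jm \<and>
     (\<exists>Ec k. symmetric_form (F \<inter> C_c) Ec \<and> strongly_local (F \<inter> C_c) Ec \<and> radon_measure k \<and>
        (\<forall>u\<in>F \<inter> C_c. \<forall>v\<in>F \<inter> C_c.
           integrable Jm (\<lambda>(x, y). (u x - u y) * (v x - v y)) \<and>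
           E u v = Ec u v + (LINT (x, y)|Jm. (u x - u y) * (v x - v y)) + (LINT x|k. u x * v x)))"

definition jump_kernel ::
  "'a::{metric_space,second_countable_topology} measure \<Rightarrow> 'a form \<Rightarrow> ('a \<Rightarrow> real) set
     \<Rightarrow> ('a \<Rightarrow> 'a \<Rightarrow> real) \<Rightarrow> bool" where
  "jump_kernel \<mu> E F J \<longleftrightarrow>
     (\<lambda>(x, y). J x y) \<in> borel_measurable borel \<and> (\<forall>x y. 0 \<le> J x y) \<and>
     jumping_measure E F
       (density (\<mu> \<Otimes>\<^sub>M \<mu>) (\<lambda>(x, y). ennreal (J x y) * indicator {(x, y). x \<noteq> y} (x, y)))"

text \<open>The quadratic form of a symmetric Markov semigroup \<open>T\<close> on \<open>L\<^sup>2\<close>: the limit, as \<open>t\<close> decreases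
  to \<open>0\<close>, of the approximating forms \<open>t\<^sup>-\<^sup>1 (u - T\<^sub>t u, v)\<close>.\<close>

definition semigroup_domain ::
  "'a measure \<Rightarrow> (real \<Rightarrow> ('a \<Rightarrow> real) \<Rightarrow> 'a \<Rightarrow> real) \<Rightarrow> ('a \<Rightarrow> real) set" where
  "semigroup_domain \<mu> T = {u \<in> L2 \<mu>.
     \<exists>l. ((\<lambda>t. L2_inner \<mu> (\<lambda>x. u x - T t u x) u / t) \<longlongrightarrow> l) (at_right 0)}"

definition semigroup_form ::
  "'a measure \<Rightarrow> (real \<Rightarrow> ('a \<Rightarrow> real) \<Rightarrow> 'a \<Rightarrow> real) \<Rightarrow> 'a form" where
  "semigroup_form \<mu> T u v =
     Lim (at_right 0) (\<lambda>t. L2_inner \<mu> (\<lambda>x. u x - T t u x) v / t)"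


section \<open>Hunt processes\<close>

text \<open>The state space is the one-point compactification of \<open>M\<close>, whose additional point
  \<open>None\<close> is the cemetery; it is isolated if \<open>M\<close> is compact.  The time set is \<open>[0, \<infinity>]\<close>.\<close>

abbreviation state_top :: "'a::metric_space option topology" where
  "state_top \<equiv> Alexandroff_compactification euclidean"

definition state_borel :: "'a::metric_space option measure" where
  "state_borel = sigma UNIV {U. openin state_top U}"

definition right_continuous_filtration :: "(ennreal \<Rightarrow> 'w measure) \<Rightarrow> bool" where
  "right_continuous_filtration G \<longleftrightarrow> (\<forall>t<\<infinity>. sets (G t) = (\<Inter>s\<in>{t<..}. sets (G s)))"

definition strong_markov ::
  "'w measure \<Rightarrow> ('a::metric_space option \<Rightarrow> 'w measure) \<Rightarrow> (ennreal \<Rightarrow> 'w \<Rightarrow> 'a option)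
     \<Rightarrow> (ennreal \<Rightarrow> 'w measure) \<Rightarrow> bool" where
  "strong_markov W P X G \<longleftrightarrow>
     (\<forall>x \<sigma> s B A. stopping_time G \<sigma> \<and> B \<in> sets state_borel \<and>
        A \<in> sets (filtration.pre_sigma (space W) G \<sigma>) \<longrightarrow>
        measure (P x) {\<omega> \<in> A. X (\<sigma> \<omega> + s) \<omega> \<in> B} =
          (LINT \<omega>:A|P x. measure (P (X (\<sigma> \<omega>) \<omega>)) {\<eta> \<in> space W. X s \<eta> \<in> B}))"

definition quasi_left_continuous ::
  "'w measure \<Rightarrow> ('a::metric_space option \<Rightarrow> 'w measure) \<Rightarrow> (ennreal \<Rightarrow> 'w \<Rightarrow> 'a option)
     \<Rightarrow> (ennreal \<Rightarrow> 'w measure) \<Rightarrow> bool" where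
  "quasi_left_continuous W P X G \<longleftrightarrow>
     (\<forall>x \<sigma>n \<sigma>. (\<forall>n. stopping_time G (\<sigma>n n)) \<and>
        (\<forall>\<omega>\<in>space W. incseq (\<lambda>n. \<sigma>n n \<omega>) \<and> \<sigma> \<omega> = (SUP n. \<sigma>n n \<omega>)) \<longrightarrow>
        (AE \<omega> in P x. \<sigma> \<omega> < \<infinity> \<longrightarrow>
           limitin state_top (\<lambda>n. X (\<sigma>n n \<omega>) \<omega>) (X (\<sigma> \<omega>) \<omega>) sequentially))"

text \<open>All measures \<open>P x\<close> live on the measurable space \<open>W\<close>.  The strong Markov property and
  quasi-left-continuity are required with respect to some admissible right-continuous filtration.\<close>

definition hunt_process ::
  "'w measure \<Rightarrow> ('a::metric_space option \<Rightarrow> 'w measure) \<Rightarrow> (ennreal \<Rightarrow> 'w \<Rightarrow> 'a option) \<Rightarrow> bool"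
where
  "hunt_process W P X \<longleftrightarrow>
     (\<forall>x. prob_space (P x) \<and> sets (P x) = sets W) \<and>
     (\<forall>t. X t \<in> measurable W state_borel) \<and>
     (\<forall>t. \<forall>B\<in>sets state_borel.
        (\<lambda>x. measure (P x) {\<omega> \<in> space W. X t \<omega> \<in> B}) \<in> borel_measurable state_borel) \<and>
     (\<forall>x. AE \<omega> in P x. X 0 \<omega> = x) \<and>
     (\<forall>t. AE \<omega> in P None. X t \<omega> = None) \<and>
     (\<forall>\<omega>\<in>space W. X \<infinity> \<omega> = None \<and>
        (\<forall>s t. s \<le> t \<and> X s \<omega> = None \<longrightarrow> X t \<omega> = None)) \<and>
     (\<forall>\<omega>\<in>space W. \<forall>t<\<infinity>. limitin state_top (\<lambda>s. X s \<omega>) (X t \<omega>) (at_right t)) \<and>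
     (\<forall>\<omega>\<in>space W. \<forall>t. 0 < t \<and> t < \<infinity> \<longrightarrow>
        (\<exists>l. limitin state_top (\<lambda>s. X s \<omega>) l (at_left t))) \<and>
     (\<exists>\<theta>. \<forall>t<\<infinity>. \<forall>\<omega>\<in>space W.
        \<theta> t \<omega> \<in> space W \<and> (\<forall>s. X s (\<theta> t \<omega>) = X (s + t) \<omega>)) \<and>
     (\<exists>G. filtration (space W) G \<and> (\<forall>t. sets (G t) \<subseteq> sets W) \<and>
        right_continuous_filtration G \<and> (\<forall>t. X t \<in> measurable (G t) state_borel) \<and>
        strong_markov W P X G \<and> quasi_left_continuous W P X G)"

text \<open>The transition semigroup of a process with real time; functions on \<open>M\<close> are extended by
  \<open>0\<close> to the cemetery.\<close>

definition transition ::
  "('a option \<Rightarrow> 'w measure) \<Rightarrow> (real \<Rightarrow> 'w \<Rightarrow> 'a option)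
     \<Rightarrow> real \<Rightarrow> ('a \<Rightarrow> real) \<Rightarrow> 'a \<Rightarrow> real" where
  "transition P Z t f x = (LINT \<omega>|P (Some x). case_option 0 f (Z t \<omega>))"

abbreviation real_time :: "(ennreal \<Rightarrow> 'w \<Rightarrow> 'a option) \<Rightarrow> real \<Rightarrow> 'w \<Rightarrow> 'a option" where
  "real_time X \<equiv> (\<lambda>t. X (ennreal t))"

definition mu_symmetric ::
  "'a::metric_space measure \<Rightarrow> ('a option \<Rightarrow> 'w measure) \<Rightarrow> (ennreal \<Rightarrow> 'w \<Rightarrow> 'a option) \<Rightarrow> bool"
where
  "mu_symmetric \<mu> P X \<longleftrightarrow>
     (\<forall>t>0. \<forall>f g :: 'a \<Rightarrow> ennreal. f \<in> borel_measurable borel \<and> g \<in> borel_measurable borel \<longrightarrow>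
        (\<integral>\<^sup>+ x. f x * (\<integral>\<^sup>+ \<omega>. case_option 0 g (real_time X t \<omega>) \<partial>P (Some x)) \<partial>\<mu>) =
        (\<integral>\<^sup>+ x. g x * (\<integral>\<^sup>+ \<omega>. case_option 0 f (real_time X t \<omega>) \<partial>P (Some x)) \<partial>\<mu>))"

definition associated_process ::
  "'a measure \<Rightarrow> 'a form \<Rightarrow> ('a \<Rightarrow> real) set \<Rightarrow> ('a option \<Rightarrow> 'w measure)
     \<Rightarrow> (ennreal \<Rightarrow> 'w \<Rightarrow> 'a option) \<Rightarrow> bool" where
  "associated_process \<mu> E F P X \<longleftrightarrow>
     F = semigroup_domain \<mu> (transition P (real_time X)) \<and>
     (\<forall>u\<in>F. \<forall>v\<in>F. E u v = semigroup_form \<mu> (transition P (real_time X)) u v)"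

definition properly_exceptional ::
  "'a::metric_space measure \<Rightarrow> ('a option \<Rightarrow> 'w measure) \<Rightarrow> (ennreal \<Rightarrow> 'w \<Rightarrow> 'a option)
     \<Rightarrow> 'a set \<Rightarrow> bool" where
  "properly_exceptional \<mu> P X N \<longleftrightarrow> N \<in> null_sets \<mu> \<and>
     (\<forall>x. x \<notin> N \<longrightarrow> (AE \<omega> in P (Some x). \<forall>t<\<infinity>. X t \<omega> \<notin> Some ` N \<and>
        (0 < t \<longrightarrow> (\<forall>l. limitin state_top (\<lambda>s. X s \<omega>) l (at_left t) \<longrightarrow> l \<notin> Some ` N))))"


section \<open>Heat kernel estimates\<close>

text \<open>An integral kernel of the heat semigroup \<open>T\<close> on \<open>L\<^sup>2\<close>.\<close>

definition heat_kernel ::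
  "'a::{metric_space,second_countable_topology} measure
     \<Rightarrow> (real \<Rightarrow> ('a \<Rightarrow> real) \<Rightarrow> 'a \<Rightarrow> real) \<Rightarrow> (real \<Rightarrow> 'a \<Rightarrow> 'a \<Rightarrow> real) \<Rightarrow> bool" where
  "heat_kernel \<mu> T p \<longleftrightarrow>
     (\<lambda>(t, x, y). p t x y) \<in> borel_measurable (restrict_space borel ({0<..} \<times> UNIV \<times> UNIV)) \<and>
     (\<forall>t>0. \<forall>x y. 0 \<le> p t x y) \<and>
     (\<forall>t>0. \<forall>f\<in>L2 \<mu>. AE x in \<mu>.
        integrable \<mu> (\<lambda>y. p t x y * f y) \<and> T t f x = (LINT y|\<mu>. p t x y * f y))"

definition jump_profile ::
  "'a::metric_space measure \<Rightarrow> (real \<Rightarrow> real) \<Rightarrow> real \<Rightarrow> 'a \<Rightarrow> 'a \<Rightarrow> real" where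
  "jump_profile \<mu> \<phi> t x y =
     (if x = y then 1 / vol \<mu> x (scale_inv \<phi> t)
      else min (1 / vol \<mu> x (scale_inv \<phi> t)) (t / (vol \<mu> x (dist x y) * \<phi> (dist x y))))"

definition HK ::
  "'a::{metric_space,second_countable_topology} measure \<Rightarrow> ('a option \<Rightarrow> 'w measure)
     \<Rightarrow> (ennreal \<Rightarrow> 'w \<Rightarrow> 'a option) \<Rightarrow> (real \<Rightarrow> real) \<Rightarrow> bool" where
  "HK \<mu> P X \<phi> \<longleftrightarrow> (\<exists>p N c1 c2.
     heat_kernel \<mu> (transition P (real_time X)) p \<and> properly_exceptional \<mu> P X N \<and>
     0 < c1 \<and> 0 < c2 \<and>
     (\<forall>t>0. \<forall>x y. x \<notin> N \<and> y \<notin> N \<longrightarrow>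
        c1 * jump_profile \<mu> \<phi> t x y \<le> p t x y \<and> p t x y \<le> c2 * jump_profile \<mu> \<phi> t x y))"


section \<open>Subordination\<close>

definition levy_process :: "'w measure \<Rightarrow> (real \<Rightarrow> 'w \<Rightarrow> real) \<Rightarrow> bool" where
  "levy_process Q S \<longleftrightarrow>
     prob_space Q \<and>
     (\<forall>t\<ge>0. S t \<in> borel_measurable Q) \<and>
     (AE \<omega> in Q. S 0 \<omega> = 0) \<and>
     \<comment> \<open>independent increments\<close>
     (\<forall>n (ts :: nat \<Rightarrow> real). mono ts \<and> 0 \<le> ts 0 \<longrightarrow>
        prob_space.indep_vars Q (\<lambda>_. borel) (\<lambda>i \<omega>. S (ts (Suc i)) \<omega> - S (ts i) \<omega>) {..<n}) \<and>
     \<comment> \<open>stationary increments\<close>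
     (\<forall>s\<ge>0. \<forall>t\<ge>0. distr Q borel (\<lambda>\<omega>. S (s + t) \<omega> - S s \<omega>) = distr Q borel (S t)) \<and>
     (AE \<omega> in Q. (\<forall>t\<ge>0. continuous (at_right t) (\<lambda>s. S s \<omega>)) \<and>
        (\<forall>t>0. \<exists>l. ((\<lambda>s. S s \<omega>) \<longlongrightarrow> l) (at_left t)))"

definition subordinator :: "'w measure \<Rightarrow> (real \<Rightarrow> 'w \<Rightarrow> real) \<Rightarrow> (real \<Rightarrow> real) \<Rightarrow> bool" where
  "subordinator Q S \<Phi> \<longleftrightarrow>
     levy_process Q S \<and> (AE \<omega> in Q. \<forall>t\<ge>0. 0 \<le> S t \<omega>) \<and>
     (\<forall>t\<ge>0. \<forall>l>0. (LINT \<omega>|Q. exp (- l * S t \<omega>)) = exp (- t * \<Phi> l))"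

definition generated_events :: "'w measure \<Rightarrow> 't set \<Rightarrow> ('t \<Rightarrow> 'w \<Rightarrow> 'b) \<Rightarrow> 'b measure \<Rightarrow> 'w set set"
where
  "generated_events W I Z N = sigma_sets (space W) {Z t -` B \<inter> space W | t B. t \<in> I \<and> B \<in> sets N}"

definition independent_subordinator ::
  "'w measure \<Rightarrow> ('a::metric_space option \<Rightarrow> 'w measure) \<Rightarrow> (ennreal \<Rightarrow> 'w \<Rightarrow> 'a option)
     \<Rightarrow> (real \<Rightarrow> 'w \<Rightarrow> real) \<Rightarrow> (real \<Rightarrow> real) \<Rightarrow> bool" where
  "independent_subordinator W P X S \<Phi> \<longleftrightarrow> (\<forall>x. subordinator (P x) S \<Phi> \<and>
     prob_space.indep_set (P x)
       (generated_events W UNIV X state_borel) (generated_events W {0..} S borel))"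

definition subordinate_process ::
  "(ennreal \<Rightarrow> 'w \<Rightarrow> 'a option) \<Rightarrow> (real \<Rightarrow> 'w \<Rightarrow> real) \<Rightarrow> real \<Rightarrow> 'w \<Rightarrow> 'a option" where
  "subordinate_process X S t \<omega> = X (ennreal (S t \<omega>)) \<omega>"

text \<open>The jump kernel of the subordinate process is that of the Dirichlet form of its transition
  semigroup.\<close>

definition subordinate_jump_kernel ::
  "'a::{metric_space,second_countable_topology} measure \<Rightarrow> ('a option \<Rightarrow> 'w measure)
     \<Rightarrow> (ennreal \<Rightarrow> 'w \<Rightarrow> 'a option) \<Rightarrow> (real \<Rightarrow> 'w \<Rightarrow> real) \<Rightarrow> ('a \<Rightarrow> 'a \<Rightarrow> real) \<Rightarrow> bool" where
  "subordinate_jump_kernel \<mu> P X S J \<longleftrightarrow>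
     (let T = transition P (subordinate_process X S)
      in jump_kernel \<mu> (semigroup_form \<mu> T) (semigroup_domain \<mu> T) J)"

definition levy_density :: "(real \<Rightarrow> real) \<Rightarrow> (real \<Rightarrow> real) \<Rightarrow> real \<Rightarrow> real" where
  "levy_density \<phi> \<psi> t = 1 / (t * \<psi> (scale_inv \<phi> t))"

definition bernstein_fun :: "(real \<Rightarrow> real) \<Rightarrow> (real \<Rightarrow> real) \<Rightarrow> real \<Rightarrow> real" where
  "bernstein_fun \<phi> \<psi> l = (LINT t:{0<..}|lborel. (1 - exp (- l * t)) * levy_density \<phi> \<psi> t)"

end

theory Submission
  imports Defs
begin

text \<open>Write \<open>Q\<^sub>s\<close> for the heat semigroup, \<open>\<nu>\<close> for the Levy measure and \<open>\<eta>\<^sub>t\<close> for the law of \<open>S\<^sub>t\<close>. By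
  independence the approximating forms of the subordinate semigroup are \<open>t\<^sup>-\<^sup>1 \<integral> g d\<eta>\<^sub>t\<close> with
  \<open>g(s) = (u - Q\<^sub>s u, u)\<close>, a bounded increasing midpoint concave function. The Laplace transforms
  show that \<open>\<eta>\<^sub>t / t\<close> converges to \<open>\<nu>\<close> away from \<open>0\<close>, and concavity controls small \<open>s\<close>; hence the
  subordinate form is \<open>\<integral> g d\<nu>\<close>, finite exactly on its domain. Inserting the heat kernel \<open>p\<close> splits it into a
  jump part with density \<open>J(x, y) = 1/2 \<integral> p(s, x, y) \<nu>(ds)\<close> and a killing part. The jumping measure is unique,
  since the domain contains the core of \<open>F\<close> and \<open>E(u, v) = -2 \<integral> u(x) v(y) J(dx, dy)\<close> whenever \<open>u\<close> and
  \<open>v\<close> have disjoint supports. Finally, the heat kernel bounds give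
  \<open>J(x, y) \<simeq> V(x, r)\<^sup>-\<^sup>1 \<integral> min 1 (s / \<phi>(r)) \<nu>(ds)\<close>, and the integral is comparable to the Bernstein function at
  \<open>1 / \<phi>(r)\<close>.\<close>

text \<open>The delicate point is the mass of \<open>\<eta>\<^sub>t\<close> near \<open>0\<close>.
  Laplace transforms control \<open>\<eta>\<^sub>t / t\<close> only after weighting by
  \<open>1 - exp (-s)\<close>, which is of order \<open>s\<close> at \<open>0\<close>. For
  \<open>u\<close> in \<open>F\<close> the function \<open>g\<close> is of that order too, but the
  representation of the subordinate form is demanded on all continuous compactly supported functions
  of a domain that may be larger, where \<open>g\<close> is merely known to be
  \<open>\<nu>\<close>-integrable. Nonnegativity of \<open>g\<close> gives one direction by Fatou.
  The other rests on the bound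
  \<open>\<integral> g d\<eta>\<^sub>t \<le> 4 t \<integral> g d\<nu>\<close>, whose constant
  depends neither on \<open>t\<close> nor on \<open>g\<close>, so that it may be applied to
  \<open>g\<close> cut off at a small level. The factor \<open>1/2\<close> in \<open>J\<close>
  arises because \<open>(u - Q\<^sub>s u, u)\<close> contains half of the double integral of the
  squared differences, whereas the jump part of a form is taken without such a factor. The killing
  part records that the heat kernel is only known to have mass at most one. Uniqueness of the
  jumping measure is required since the estimate concerns every version of the jump kernel, not just
  the constructed one.\<close>

section \<open>Laplace transforms and concave functions\<close>

text \<open>With \<open>z = exp (-s)\<close> the half line becomes \<open>(0, 1]\<close> and the
  transforms at the integers \<open>k\<close> become moments, so polynomial approximation on
  \<open>[0, 1]\<close> reaches every continuous \<open>G\<close>. The filter is left general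
  because the result is used both for a limit in \<open>t\<close> and for a constant
  sequence.\<close>

lemma weierstrass_laplace:
  fixes M :: "'i \<Rightarrow> real measure" and N :: "real measure" and G :: "real \<Rightarrow> real"
  assumes M: "\<forall>\<^sub>F i in F. finite_measure (M i) \<and> sets (M i) = sets borel \<and> (AE s in M i. 0 \<le> s)"
    and N: "finite_measure N" "sets N = sets borel" "AE s in N. 0 \<le> s"
    and conv: "\<And>k::nat. ((\<lambda>i. \<integral>s. exp (-(real k * s)) \<partial>M i) \<longlongrightarrow> (\<integral>s. exp (-(real k * s)) \<partial>N)) F"
    and G: "continuous_on UNIV G"
  shows "((\<lambda>i. \<integral>s. G (exp (-s)) \<partial>M i) \<longlongrightarrow> (\<integral>s. G (exp (-s)) \<partial>N)) F"
proof (rule tendstoI)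
  fix e :: real assume e: "e > 0"
  define C where "C = measure N (space N) + 1"
  have C: "C > 0" unfolding C_def by (simp add: add_nonneg_pos)
  \<comment> \<open>\<open>C\<close> bounds the mass of \<open>N\<close> and eventually that of
    \<open>M i\<close>, so replacing \<open>G\<close> by \<open>q\<close> costs at most
    \<open>e/4\<close> on each side.\<close>
  define d where "d = e / (4 * C)"
  have d: "d > 0" using e C by (simp add: d_def)
  obtain q where q: "real_polynomial_function q" "\<And>z. z \<in> {0..1} \<Longrightarrow> \<bar>G z - q z\<bar> < d"
    using Stone_Weierstrass_real_polynomial_function[of "{0..1}" G d] G d continuous_on_subset by blast
  obtain a n where qa: "q = (\<lambda>x. \<Sum>i\<le>n. a i * x ^ i)"
    using q(1) real_polynomial_function_iff_sum by blast
  obtain b where b: "\<And>z. z \<in> {0..1} \<Longrightarrow> \<bar>G z\<bar> \<le> b"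
  proof -
    have "compact (G ` {0..1})"
      by (intro compact_continuous_image continuous_on_subset[OF G]) auto
    then have "bounded (G ` {0..1})" by (rule compact_imp_bounded)
    then obtain a where "\<forall>x\<in>{0..1}. \<bar>G x\<bar> \<le> a" unfolding bounded_iff by auto
    then show ?thesis using that by blast
  qed
  have Gm[measurable]: "G \<in> borel_measurable borel"
    using G by (rule borel_measurable_continuous_onI)
  have int_exp: "integrable K (\<lambda>s. exp (-(real k * s)))"
    if "finite_measure K" "sets K = sets borel" "AE s in K. 0 \<le> s" for K :: "real measure" and k :: nat
  proof -
    interpret finite_measure K by fact
    note that(2)[measurable_cong]
    show ?thesis
      by (rule integrable_const_bound[where B=1]) (use that(3) in auto)
  qed
  have q_int: "integrable K (\<lambda>s. q (exp (-s)))"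
      "(\<integral>s. q (exp (-s)) \<partial>K) = (\<Sum>i\<le>n. a i * (\<integral>s. exp (-(real i * s)) \<partial>K))"
    if K: "finite_measure K" "sets K = sets borel" "AE s in K. 0 \<le> s" for K
  proof -
    have qe: "q (exp (-s)) = (\<Sum>i\<le>n. a i * exp (-(real i * s)))" for s
      unfolding qa by (intro sum.cong refl) (simp add: exp_of_nat_mult[symmetric])
    show "integrable K (\<lambda>s. q (exp (-s)))"
      unfolding qe by (intro Bochner_Integration.integrable_sum integrable_mult_right int_exp K)
    show "(\<integral>s. q (exp (-s)) \<partial>K) = (\<Sum>i\<le>n. a i * (\<integral>s. exp (-(real i * s)) \<partial>K))"
      unfolding qe by (subst Bochner_Integration.integral_sum) (auto intro!: int_exp K)
  qed
  have close: "\<bar>(\<integral>s. G (exp (-s)) \<partial>K) - (\<integral>s. q (exp (-s)) \<partial>K)\<bar> \<le> d * measure K (space K)"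
    if K: "finite_measure K" "sets K = sets borel" "AE s in K. 0 \<le> s" for K
  proof -
    interpret finite_measure K by fact
    note K(2)[measurable_cong]
    have G_int: "integrable K (\<lambda>s. G (exp (-s)))"
      by (rule integrable_const_bound[where B=b]) (use K(3) b in \<open>auto elim!: eventually_mono\<close>)
    have "\<bar>(\<integral>s. G (exp (-s)) \<partial>K) - (\<integral>s. q (exp (-s)) \<partial>K)\<bar> = \<bar>\<integral>s. (G (exp (-s)) - q (exp (-s))) \<partial>K\<bar>"
      by (subst Bochner_Integration.integral_diff[OF G_int q_int(1)[OF K]]) simp
    also have "\<dots> \<le> (\<integral>s. \<bar>G (exp (-s)) - q (exp (-s))\<bar> \<partial>K)"
      using integral_norm_bound[of K "\<lambda>s. G (exp (-s)) - q (exp (-s))"] by simp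
    also have "\<dots> \<le> (\<integral>s. d \<partial>K)"
      by (intro integral_mono_AE integrable_abs Bochner_Integration.integrable_diff G_int q_int(1) K)
        (use K(3) q(2) in \<open>auto elim!: eventually_mono intro!: less_imp_le\<close>)
    finally show ?thesis by (simp add: mult.commute)
  qed
  have "((\<lambda>i. \<Sum>k\<le>n. a k * (\<integral>s. exp (-(real k * s)) \<partial>M i)) \<longlongrightarrow> (\<Sum>k\<le>n. a k * (\<integral>s. exp (-(real k * s)) \<partial>N))) F"
    by (intro tendsto_intros conv)
  then have ev1: "\<forall>\<^sub>F i in F. \<bar>(\<Sum>k\<le>n. a k * (\<integral>s. exp (-(real k * s)) \<partial>M i)) - (\<Sum>k\<le>n. a k * (\<integral>s. exp (-(real k * s)) \<partial>N))\<bar> < e/4"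
    using e by (auto dest!: tendstoD[where e="e/4"] simp: dist_real_def)
  \<comment> \<open>The case \<open>k = 0\<close> of the hypothesis is convergence of the total
    masses.\<close>
  have "\<forall>\<^sub>F i in F. (\<integral>s. exp (-(real 0 * s)) \<partial>M i) < C"
    by (rule order_tendstoD(2)[OF conv]) (simp add: C_def)
  then have ev2: "\<forall>\<^sub>F i in F. measure (M i) (space (M i)) < C" by simp
  show "\<forall>\<^sub>F i in F. dist (\<integral>s. G (exp (-s)) \<partial>M i) (\<integral>s. G (exp (-s)) \<partial>N) < e"
    using M ev1 ev2
  proof eventually_elim
    case (elim i)
    have 1: "\<bar>(\<integral>s. G (exp (-s)) \<partial>M i) - (\<integral>s. q (exp (-s)) \<partial>M i)\<bar> \<le> d * C"
      using close[of "M i"] elim d by (smt (verit, best) mult_left_mono)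
    have 2: "\<bar>(\<integral>s. G (exp (-s)) \<partial>N) - (\<integral>s. q (exp (-s)) \<partial>N)\<bar> \<le> d * C"
      using close[OF N] d unfolding C_def by (smt (verit, best) mult_left_mono)
    have 3: "\<bar>(\<integral>s. q (exp (-s)) \<partial>M i) - (\<integral>s. q (exp (-s)) \<partial>N)\<bar> < e/4"
      using elim q_int(2)[of "M i"] q_int(2)[OF N] by simp
    have "d * C = e/4" using C by (simp add: d_def)
    then show ?case using 1 2 3 e unfolding dist_real_def by linarith
  qed
qed

text \<open>For a constant sequence \<open>weierstrass_laplace\<close> gives equal integrals of all
  functions \<open>G (exp (-s))\<close>, and these recover the distribution functions. It serves to
  show that the law of \<open>S t\<close> is the same under every starting point.\<close>

lemma laplace_unique:
  fixes M N :: "real measure"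
  assumes M: "prob_space M" "sets M = sets borel" "AE s in M. 0 \<le> s"
    and N: "prob_space N" "sets N = sets borel" "AE s in N. 0 \<le> s"
    and eq: "\<And>l. l > 0 \<Longrightarrow> (\<integral>s. exp (-(l * s)) \<partial>M) = (\<integral>s. exp (-(l * s)) \<partial>N)"
  shows "M = N"
proof -
  interpret M: prob_space M by fact
  interpret N: prob_space N by fact
  note M(2)[measurable_cong] N(2)[measurable_cong]
  have MU: "space M = UNIV" using sets_eq_imp_space_eq[OF M(2)] by simp
  have NU: "space N = UNIV" using sets_eq_imp_space_eq[OF N(2)] by simp
  have rd: "real_distribution M" "real_distribution N"
    using M N MU NU by (auto simp: real_distribution_def real_distribution_axioms_def)
  have G: "(\<integral>s. G (exp (-s)) \<partial>M) = (\<integral>s. G (exp (-s)) \<partial>N)" if "continuous_on UNIV G" for G :: "real \<Rightarrow> real"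
  proof -
    have *: "(\<integral>s. exp (-(real k * s)) \<partial>M) = (\<integral>s. exp (-(real k * s)) \<partial>N)" for k :: nat
      by (cases "k = 0") (auto intro!: eq simp: M.prob_space N.prob_space)
    have "((\<lambda>i::nat. \<integral>s. G (exp (-s)) \<partial>M) \<longlongrightarrow> (\<integral>s. G (exp (-s)) \<partial>N)) sequentially"
      by (rule weierstrass_laplace) (use M N that * in \<open>auto intro: M.finite_measure_axioms N.finite_measure_axioms\<close>)
    then show ?thesis by (simp add: LIMSEQ_const_iff)
  qed
  have "cdf M a = cdf N a" for a
  proof -
    \<comment> \<open>Continuous ramps in \<open>z\<close> that equal \<open>1\<close> for
      \<open>z \<ge> exp (-a)\<close>; placing the slope on the other side makes the limit include
      the endpoint \<open>s = a\<close>.\<close>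
    define g where "g n z = min 1 (max 0 (1 - real n * (exp (-a) - z)))" for n :: nat and z :: real
    have gc: "continuous_on UNIV (g n)" for n unfolding g_def by (intro continuous_intros)
    have lim: "(\<lambda>n. g n (exp (-s))) \<longlonglongrightarrow> indicator {..a} s" for s
    proof (cases "s \<le> a")
      case True
      have "1 - real n * (exp (-a) - exp (-s)) \<ge> 1" for n
        using True by (simp add: mult_nonneg_nonpos)
      then have "g n (exp (-s)) = 1" for n
        unfolding g_def by (smt (verit, best))
      then show ?thesis using True by simp
    next
      case False
      then have c: "exp (-a) - exp (-s) > 0" by simp
      then obtain n0 :: nat where n0: "1 / (exp (-a) - exp (-s)) < real n0" using reals_Archimedean2 by blast
      have "g n (exp (-s)) = 0" if "n \<ge> n0" for n
      proof -
        have "1 / (exp (-a) - exp (-s)) < real n" using n0 that by simp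
        then have "1 < real n * (exp (-a) - exp (-s))" using c by (simp add: divide_simps)
        then show ?thesis unfolding g_def by simp
      qed
      then show ?thesis using False
        by (auto intro!: tendsto_eventually eventually_sequentiallyI[of n0])
    qed
    have "(\<lambda>n. \<integral>s. g n (exp (-s)) \<partial>K) \<longlonglongrightarrow> (\<integral>s. indicator {..a} s \<partial>K)" if "real_distribution K" for K
    proof -
      interpret real_distribution K by fact
      have [measurable]: "g n \<in> borel_measurable borel" for n using gc by (rule borel_measurable_continuous_onI)
      show ?thesis
        by (rule integral_dominated_convergence[where w="\<lambda>_. 1"]) (use lim in \<open>auto simp: g_def\<close>)
    qed
    from this[OF rd(1)] this[OF rd(2)] G[OF gc]
    have "(\<integral>s. indicator {..a} s \<partial>M) = ((\<integral>s. indicator {..a} s \<partial>N)::real)"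
      using LIMSEQ_unique by auto
    then show ?thesis by (simp add: cdf_def MU NU)
  qed
  then show ?thesis using cdf_unique[OF rd] by auto
qed

section \<open>Summation by parts and midpoint concave functions\<close>

lemma sum_weighted_le_of_partial_sums_le:
  fixes x y d :: "nat \<Rightarrow> real"
  assumes le: "\<And>K. K \<le> N \<Longrightarrow> (\<Sum>k<K. x k) \<le> (\<Sum>k<K. y k)"
    and d: "\<And>k. d (Suc k) \<le> d k" "\<And>k. 0 \<le> d k"
  shows "(\<Sum>k<N. d k * x k) \<le> (\<Sum>k<N. d k * y k)"
proof -
  \<comment> \<open>For decreasing nonnegative \<open>d\<close> this writes both weighted sums as
    combinations of partial sums with nonnegative coefficients.\<close>
  have abel: "(\<Sum>k<K. d k * z k) = (\<Sum>k<K. (d k - d (Suc k)) * (\<Sum>j<Suc k. z j)) + d K * (\<Sum>j<K. z j)" for z :: "nat \<Rightarrow> real" and K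
    by (induction K) (auto simp: algebra_simps)
  show ?thesis unfolding abel
    by (intro add_mono sum_mono mult_left_mono le) (use d in auto)
qed

text \<open>Collects what the semigroup gives for \<open>gap u\<close>, with \<open>B\<close> the
  squared norm of \<open>u\<close>. The midpoint form of concavity is what one inequality between
  inner products at half times yields; continuity follows from it
  (\<open>g_continuous\<close>).\<close>

locale midconcave =
  fixes g :: "real \<Rightarrow> real" and B :: real
  assumes g0: "\<And>s. s \<le> 0 \<Longrightarrow> g s = 0"
    and mono_g: "mono g"
    and bdd: "\<And>s. g s \<le> B"
    and mid: "\<And>a b. 0 \<le> a \<Longrightarrow> 0 \<le> b \<Longrightarrow> g a + g b \<le> 2 * g ((a + b) / 2)"
    and lim0: "(g \<longlongrightarrow> 0) (at_right 0)"
begin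

lemma g_mono: "a \<le> b \<Longrightarrow> g a \<le> g b"
  using mono_g by (auto simp: mono_def)

lemma g_nonneg: "0 \<le> g s"
  using g0[of 0] g0[of s] g_mono[of 0 s] by (cases "s \<le> 0") auto

lemma g_measurable[measurable]: "g \<in> borel_measurable borel"
  using mono_g by (rule borel_measurable_mono)

lemma increment_decreasing:
  assumes "\<delta> \<ge> 0"
  shows "g ((real k + 2) * \<delta>) - g ((real k + 1) * \<delta>) \<le> g ((real k + 1) * \<delta>) - g (real k * \<delta>)"
proof -
  have "((real k + 2) * \<delta> + real k * \<delta>) / 2 = (real k + 1) * \<delta>" by (simp add: field_simps)
  then show ?thesis using mid[of "(real k + 2) * \<delta>" "real k * \<delta>"] assms by simp
qed

lemma increment_le:
  assumes "\<delta> \<ge> 0"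
  shows "g ((real k + 1) * \<delta>) - g (real k * \<delta>) \<le> g \<delta>"
proof (induction k)
  case (Suc k)
  then show ?case using increment_decreasing[OF assms, of k] by (simp add: algebra_simps)
qed (simp add: g0)

text \<open>A point \<open>s\<close> off the grid of mesh \<open>\<delta>\<close> is handled by
  stretching the mesh, which accounts for the argument \<open>2 * \<delta>\<close> on the
  right.\<close>

lemma increment_le':
  assumes "\<delta> \<ge> 0" "s \<ge> 0"
  shows "g (s + \<delta>) - g s \<le> g (2 * \<delta>)"
proof (cases "\<delta> = 0 \<or> s < \<delta>")
  case True
  then show ?thesis using g_mono[of "s + \<delta>" "2 * \<delta>"] g_nonneg[of s] g_nonneg[of "2*\<delta>"] assms by auto
next
  case False
  then have d: "\<delta> > 0" "\<delta> \<le> s" using assms by auto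
  define k where "k = nat \<lfloor>s / \<delta>\<rfloor>"
  have fl: "\<lfloor>s / \<delta>\<rfloor> \<ge> 1" using d by (simp add: le_floor_iff)
  then have k1: "real k \<ge> 1" unfolding k_def by linarith
  have k2: "real k \<le> s / \<delta>" "s / \<delta> < real k + 1" unfolding k_def using fl by linarith+
  \<comment> \<open>The mesh is widened until \<open>s\<close> is its \<open>k\<close>-th grid
    point; as \<open>s < (k + 1) * \<delta>\<close> and \<open>k \<ge> 1\<close>, the new mesh is at
    most \<open>2 * \<delta>\<close>.\<close>
  define e where "e = s / real k"
  have "s < (real k + 1) * \<delta>" using k2 d by (simp add: field_simps)
  also have "\<dots> \<le> (2 * real k) * \<delta>" using k1 d by (intro mult_right_mono) auto
  finally have "s \<le> 2 * real k * \<delta>" by simp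
  then have e: "\<delta> \<le> e" "e \<le> 2 * \<delta>" "real k * e = s" using k1 k2 d
    by (auto simp: e_def field_simps)
  have "g (s + \<delta>) - g s \<le> g (s + e) - g s" using e by (auto intro: g_mono)
  also have "\<dots> \<le> g e" using increment_le[of e k] e d by (simp add: algebra_simps)
  also have "\<dots> \<le> g (2 * \<delta>)" using e by (auto intro: g_mono)
  finally show ?thesis .
qed

lemma small: "e > 0 \<Longrightarrow> \<exists>d>0. \<forall>s. s \<le> d \<longrightarrow> g s < e"
proof -
  assume e: "e > 0"
  have "\<forall>\<^sub>F x in at_right 0. g x < e" using order_tendstoD(2)[OF lim0 e] .
  then obtain b where b: "b > 0" "\<And>y. y > 0 \<Longrightarrow> y < b \<Longrightarrow> g y < e"
    unfolding eventually_at_right_field by auto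
  show ?thesis
    by (rule exI[of _ "b/2"]) (use b in \<open>auto intro: le_less_trans[OF g_mono b(2)[of "b/2"]]\<close>)
qed

text \<open>The function is its own modulus of continuity: its increment over a distance
  \<open>h\<close> is at most \<open>g (2 * h)\<close>, which is small near \<open>0\<close> by
  \<open>lim0\<close>.\<close>

lemma g_continuous: "continuous_on UNIV g"
proof -
  have nonneg_dist: "\<bar>g x - g y\<bar> \<le> g (2 * \<bar>x - y\<bar>)" for x y
  proof (induction x y rule: linorder_wlog)
    case (le a b)
    show ?case
    proof (cases "a \<le> 0")
      case True
      then show ?thesis using g0[of a] g_nonneg[of b] g_mono[of b "2 * \<bar>a - b\<bar>"] g0[of b] g_nonneg le
        by (cases "b \<le> 0") auto
    next
      case False
      then show ?thesis using increment_le'[of "b - a" a] g_mono[OF le] le by simp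
    qed
  qed (simp add: abs_minus_commute)
  show ?thesis
    unfolding continuous_on_iff
  proof (intro ballI allI impI)
    fix x e :: real assume "e > 0"
    then obtain d where d: "d > 0" "\<And>s. s \<le> d \<Longrightarrow> g s < e" using small by blast
    show "\<exists>d>0. \<forall>x'\<in>UNIV. dist x' x < d \<longrightarrow> dist (g x') (g x) < e"
      by (rule exI[of _ "d/2"]) (use d nonneg_dist in \<open>auto simp: dist_real_def intro!: le_less_trans[OF nonneg_dist]\<close>)
  qed
qed

text \<open>Repeated halving towards \<open>0\<close> compares \<open>g\<close> with its chord at
  dyadic fractions of \<open>\<delta>\<close>; rounding \<open>s / \<delta>\<close> to such a
  fraction costs the factor \<open>2\<close>.\<close>

lemma ray_le:
  assumes "0 \<le> s" "s \<le> \<delta>" "\<delta> > 0"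
  shows "g \<delta> * (s / \<delta>) \<le> 2 * g s"
proof (cases "s = 0")
  case False
  then have s: "s > 0" using assms by simp
  have half: "g \<delta> * (1/2)^n \<le> g (\<delta> * (1/2)^n)" for n :: nat
  proof (induction n)
    case (Suc n)
    have "g (\<delta> * (1/2)^n) \<le> 2 * g (\<delta> * (1/2)^Suc n)"
      using mid[of "\<delta> * (1/2)^n" 0] assms by (simp add: g0)
    then show ?case using Suc by simp
  qed simp
  \<comment> \<open>The first power of \<open>1/2\<close> below \<open>s / \<delta>\<close>; the
    preceding power is still at least \<open>s / \<delta>\<close>.\<close>
  define n where "n = (LEAST n. (1/2::real)^n < s / \<delta>)"
  have ex: "\<exists>n. (1/2::real)^n < s / \<delta>" using real_arch_pow_inv[of "s/\<delta>" "1/2"] s assms by simp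
  have n: "(1/2::real)^n < s / \<delta>" unfolding n_def using ex by (rule LeastI_ex)
  have "n \<noteq> 0" using n assms by (cases n) (auto simp: field_simps)
  then obtain m where m: "n = Suc m" by (cases n) auto
  have nl: "\<not> (1/2::real)^m < s / \<delta>" using not_less_Least[of m "\<lambda>n. (1/2::real)^n < s / \<delta>"] m n_def by simp
  have "g \<delta> * (s / \<delta>) \<le> g \<delta> * (1/2)^m" using nl g_nonneg[of \<delta>] by (intro mult_left_mono) auto
  also have "\<dots> = 2 * (g \<delta> * (1/2)^n)" by (simp add: m)
  also have "\<dots> \<le> 2 * g (\<delta> * (1/2)^n)" using half[of n] by simp
  also have "\<dots> \<le> 2 * g s"
    using n assms by (intro mult_left_mono g_mono) (auto simp: field_simps)
  finally show ?thesis .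
qed (simp add: g0)

text \<open>Lets the bounds for concave functions be applied to the part of \<open>g\<close> near
  \<open>0\<close> alone, which is how small values of the subordinator are controlled.\<close>

lemma truncate: "0 < a \<Longrightarrow> midconcave (\<lambda>s. g (min s a)) B"
proof
  fix x y :: real assume a: "0 < a" and xy: "0 \<le> x" "0 \<le> y"
  have "g (min x a) + g (min y a) \<le> 2 * g ((min x a + min y a) / 2)"
    using mid[of "min x a" "min y a"] a xy by simp
  also have "\<dots> \<le> 2 * g (min ((x + y) / 2) a)"
    by (intro mult_left_mono g_mono) (auto simp: min_def)
  finally show "g (min x a) + g (min y a) \<le> 2 * g (min ((x + y) / 2) a)" .
next
  assume a: "0 < a"
  have "\<forall>\<^sub>F s in at_right 0. g s = g (min s a)"
    using eventually_at_right_less[of 0] eventually_at_right_real[OF a] by eventually_elim (simp add: min_def)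
  then show "((\<lambda>s. g (min s a)) \<longlongrightarrow> 0) (at_right 0)"
    using lim0 tendsto_cong by fast
qed (use bdd in \<open>auto simp: g0 mono_def intro: g_mono\<close>)

end

section \<open>Laplace exponents and the laws \<open>\<eta> t\<close> for small
  \<open>t\<close>\<close>

lemma one_minus_exp_le: "0 \<le> x \<Longrightarrow> 1 - exp (-x) \<le> min x 1" for x :: real
  using exp_ge_add_one_self[of "-x"] by auto

text \<open>Together with \<open>one_minus_exp_le\<close> this makes \<open>min x 1\<close> and
  \<open>1 - exp (-x)\<close> interchangeable up to a factor \<open>2\<close>: truncations suit
  concave functions, exponentials suit Laplace transforms.\<close>

lemma min_le_one_minus_exp:
  fixes x :: real assumes "0 \<le> x" shows "min x 1 \<le> 2 * (1 - exp (-x))"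
proof -
  have "exp (-min x 1) \<le> 1 - min x 1 / 2"
  proof -
    have "exp (min x 1 / 2) \<ge> 1 + min x 1 / 2" by (rule exp_ge_add_one_self)
    have "1 + min x 1 \<le> exp (min x 1)" by (rule exp_ge_add_one_self)
    then have "exp (-min x 1) \<le> 1 / (1 + min x 1)" using assms
      by (simp add: exp_minus inverse_eq_divide frac_le)
    also have "\<dots> \<le> 1 - min x 1 / 2"
      using assms mult_left_le_one_le[of x x] by (cases "x \<le> 1") (auto simp: divide_simps min_def algebra_simps)
    finally show ?thesis .
  qed
  moreover have "exp (-x) \<le> exp (-min x 1)" by simp
  ultimately show ?thesis by argo
qed

text \<open>The exponent has no linear term: \<open>\<eta> t\<close> are the laws of a subordinator
  without drift, of which only the one-dimensional Laplace transforms are recorded.\<close>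

locale levy_laplace =
  fixes \<nu> :: "real measure" and \<eta> :: "real \<Rightarrow> real measure"
  assumes sets_nu: "sets \<nu> = sets borel" and nu_pos: "AE s in \<nu>. 0 < s"
    and nu_int: "integrable \<nu> (\<lambda>s. min 1 s)"
    and eta_prob: "\<And>t. t > 0 \<Longrightarrow> prob_space (\<eta> t)"
    and sets_eta: "\<And>t. t > 0 \<Longrightarrow> sets (\<eta> t) = sets borel"
    and eta_nonneg: "\<And>t. t > 0 \<Longrightarrow> AE s in \<eta> t. 0 \<le> s"
    and laplace: "\<And>t l. t > 0 \<Longrightarrow> l > 0 \<Longrightarrow>
      (\<integral>s. exp (-(l * s)) \<partial>\<eta> t) = exp (- (t * (\<integral>s. (1 - exp (-(l * s))) \<partial>\<nu>)))"
begin

declare sets_nu[measurable_cong] sets_eta[measurable_cong]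

lemma int_min: "a \<ge> 0 \<Longrightarrow> integrable \<nu> (\<lambda>s. min s a)"
proof (rule Bochner_Integration.integrable_bound[OF integrable_mult_right[OF nu_int, of "max 1 a"]])
  assume a: "a \<ge> 0"
  show "AE s in \<nu>. norm (min s a) \<le> norm (max 1 a * min 1 s)"
    using nu_pos
  proof eventually_elim
    case (elim s)
    have "min s a \<le> max 1 a * min 1 s"
    proof (cases "s \<le> 1")
      case True
      then have "s \<le> max 1 a * s" using elim by (simp add: mult_le_cancel_right1)
      then show ?thesis using True by simp
    qed simp
    then show ?case using elim a by simp
  qed
qed simp

lemma int_exp_nu: "l \<ge> 0 \<Longrightarrow> integrable \<nu> (\<lambda>s. 1 - exp (-(l * s)))"
proof (rule Bochner_Integration.integrable_bound[OF integrable_mult_right[OF int_min[of 1], of "max 1 l"]])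
  assume l: "l \<ge> 0"
  show "AE s in \<nu>. norm (1 - exp (-(l * s))) \<le> norm (max 1 l * min s 1)"
    using nu_pos
  proof eventually_elim
    case (elim s)
    have "1 - exp (-(l * s)) \<le> min (l * s) 1" using elim l by (intro one_minus_exp_le) simp
    also have "\<dots> \<le> max 1 l * min s 1"
    proof (cases "s \<le> 1")
      case True
      then have "l * s \<le> max 1 l * s" using elim by (simp add: mult_le_cancel_right1)
      then show ?thesis using True by simp
    qed simp
    finally show ?case using elim l by simp
  qed
qed simp_all

lemma int_bounded_eta:
  assumes "t > 0" "f \<in> borel_measurable borel" "\<And>s. s \<ge> 0 \<Longrightarrow> \<bar>f s\<bar> \<le> b"
  shows "integrable (\<eta> t) (f :: real \<Rightarrow> real)"
proof -
  interpret prob_space "\<eta> t" using eta_prob assms by blast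
  have [measurable]: "f \<in> borel_measurable (\<eta> t)" using assms(2) sets_eta[OF assms(1)] by (simp cong: measurable_cong_sets)
  show ?thesis
    by (rule integrable_const_bound[where B=b]) (use eta_nonneg[OF assms(1)] assms(3) in auto)
qed

text \<open>The cut-off at level \<open>a\<close> is compared with
  \<open>1 - exp (-(s / a))\<close>, whose integral under \<open>\<eta> t\<close> is explicit at the
  frequency \<open>1 / a\<close>; the inequality \<open>1 - exp (-y) \<le> y\<close> then produces
  the factor \<open>t\<close>. The factor \<open>2\<close> comes from the first comparison.\<close>

lemma eta_min_le:
  assumes t: "t > 0" and a: "a > 0"
  shows "(\<integral>s. min s a \<partial>\<eta> t) \<le> 2 * t * (\<integral>s. min s a \<partial>\<nu>)"
proof -
  interpret prob_space "\<eta> t" using eta_prob t by blast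
  have i1: "integrable (\<eta> t) (\<lambda>s. min s a)"
    by (rule int_bounded_eta[OF t, of _ a]) (use a in auto)
  have i2: "integrable (\<eta> t) (\<lambda>s. exp (-((1/a) * s)))"
    by (rule int_bounded_eta[OF t, of _ 1]) (use a in auto)
  have "(\<integral>s. min s a \<partial>\<eta> t) \<le> (\<integral>s. (2 * a) * (1 - exp (-((1/a) * s))) \<partial>\<eta> t)"
  proof (rule integral_mono_AE[OF i1])
    show "integrable (\<eta> t) (\<lambda>s. (2 * a) * (1 - exp (-((1/a) * s))))"
      using i2 by simp
    show "AE s in \<eta> t. min s a \<le> (2 * a) * (1 - exp (-((1/a) * s)))"
      using eta_nonneg[OF t]
    proof eventually_elim
      case (elim s)
      then have "min (s/a) 1 \<le> 2 * (1 - exp (-(s/a)))" using a by (intro min_le_one_minus_exp) auto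
      then have "a * min (s/a) 1 \<le> a * (2 * (1 - exp (-(s/a))))" using a by (intro mult_left_mono) auto
      moreover have "a * min (s/a) 1 = min s a" using a by (auto simp: min_def field_simps)
      ultimately show ?case by (simp add: algebra_simps)
    qed
  qed
  also have "\<dots> = 2 * a * (1 - exp (- (t * (\<integral>s. (1 - exp (-((1/a) * s))) \<partial>\<nu>))))"
    using laplace[OF t, of "1/a"] a i2 by (simp add: prob_space Bochner_Integration.integral_diff)
  also have "\<dots> \<le> 2 * a * (t * (\<integral>s. (1 - exp (-((1/a) * s))) \<partial>\<nu>))"
    using a exp_ge_add_one_self[of "- (t * (\<integral>s. (1 - exp (-((1/a) * s))) \<partial>\<nu>))"] by (intro mult_left_mono) auto
  also have "\<dots> = 2 * t * (\<integral>s. a * (1 - exp (-((1/a) * s))) \<partial>\<nu>)" by simp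
  also have "\<dots> \<le> 2 * t * (\<integral>s. min s a \<partial>\<nu>)"
  proof (rule mult_left_mono[OF integral_mono_AE])
    show "integrable \<nu> (\<lambda>s. a * (1 - exp (-((1/a) * s))))" using int_exp_nu[of "1/a"] a by simp
    show "integrable \<nu> (\<lambda>s. min s a)" using a by (intro int_min) auto
    show "AE s in \<nu>. a * (1 - exp (-((1/a) * s))) \<le> min s a"
      using nu_pos
    proof eventually_elim
      case (elim s)
      then have "a * (1 - exp (-(s/a))) \<le> a * min (s/a) 1" using a
        by (intro mult_left_mono one_minus_exp_le) auto
      moreover have "a * min (s/a) 1 = min s a" using a by (auto simp: min_def field_simps)
      ultimately show ?case by simp
    qed
  qed (use t in auto)
  finally show ?thesis .
qed

text \<open>A concave function is a mixture of the functions \<open>s \<mapsto> min s a\<close>, for which the estimate follows from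
  the Laplace transform.\<close>

lemma nn_integral_eta_le:
  assumes g: "midconcave g B" and t: "t > 0"
  shows "(\<integral>\<^sup>+ s. ennreal (g s) \<partial>\<eta> t) \<le> ennreal (4 * t) * (\<integral>\<^sup>+ s. ennreal (g s) \<partial>\<nu>)"
proof -
  interpret midconcave g B by fact
  interpret prob_space "\<eta> t" using eta_prob t by blast
  note sets_eta[OF t, measurable_cong]
  \<comment> \<open>With \<open>4 ^ n\<close> cells of this mesh the grid reaches up to
    \<open>2 ^ n\<close>, so the grids become fine and exhaust the half line simultaneously.\<close>
  define \<delta> where "\<delta> n = (1/2::real)^n" for n :: nat
  have dpos: "\<delta> n > 0" for n by (simp add: \<delta>_def)
  define d where "d n k = g ((real k + 1) * \<delta> n) - g (real k * \<delta> n)" for n k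
  \<comment> \<open>The ramp from \<open>0\<close> to \<open>1\<close> across the
    \<open>k\<close>-th cell; weighted with the increments \<open>d n k\<close>, the ramps form the
    piecewise linear interpolation \<open>L n\<close> of \<open>g\<close>, constant beyond the last
    cell.\<close>
  define e where "e n k s = max 0 (min 1 (s / \<delta> n - real k))" for n k and s :: real
  define L where "L n s = (\<Sum>k<4^n. d n k * e n k s)" for n s
  have d0: "0 \<le> d n k" for n k
    unfolding d_def using dpos[of n] by (simp add: g_mono mult_right_mono)
  have ddec: "d n (Suc k) \<le> d n k" for n k
    using increment_decreasing[OF less_imp_le[OF dpos[of n]], of k] unfolding d_def by (simp add: add.commute)
  have sumd: "(\<Sum>k<K. d n k) = g (real K * \<delta> n)" for n K
    by (induction K) (auto simp: d_def g0 add.commute)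
  have e01: "0 \<le> e n k s" "e n k s \<le> 1" for n k s by (auto simp: e_def)
  have em[measurable]: "e n k \<in> borel_measurable borel" for n k unfolding e_def by measurable
  have Lm[measurable]: "L n \<in> borel_measurable borel" for n unfolding L_def by measurable
  have L0: "0 \<le> L n s" for n s unfolding L_def by (intro sum_nonneg mult_nonneg_nonneg d0 e01)
  have sume: "(\<Sum>k<K. e n k s) = min s (real K * \<delta> n) / \<delta> n" if "s \<ge> 0" for n K s
  proof -
    have "(\<Sum>k<K. max 0 (min 1 (y - real k))) = min y (real K)" if "y \<ge> 0" for y
      by (induction K) (use that in \<open>auto simp: min_def max_def\<close>)
    from this[of "s / \<delta> n"] have "(\<Sum>k<K. e n k s) = min (s / \<delta> n) (real K)"
      using that dpos[of n] by (simp add: e_def)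
    also have "\<dots> = min s (real K * \<delta> n) / \<delta> n" using dpos[of n] by (auto simp: min_def field_simps)
    finally show ?thesis .
  qed
  have ie_eta: "integrable (\<eta> t) (e n k)" for n k
    by (rule int_bounded_eta[OF t, of _ 1]) (use e01 in auto)
  have ie_nu: "integrable \<nu> (e n k)" for n k
  proof (rule Bochner_Integration.integrable_bound)
    show "integrable \<nu> (\<lambda>s. min s (real (Suc k) * \<delta> n) / \<delta> n)"
      using int_min[of "real (Suc k) * \<delta> n"] dpos[of n] by simp
    show "AE s in \<nu>. norm (e n k s) \<le> norm (min s (real (Suc k) * \<delta> n) / \<delta> n)"
      using nu_pos
    proof eventually_elim
      case (elim s)
      have "e n k s \<le> (\<Sum>k<Suc k. e n k s)"
        using e01 by (simp add: sum_nonneg)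
      also have "\<dots> = min s (real (Suc k) * \<delta> n) / \<delta> n" using elim by (intro sume) auto
      finally have "e n k s \<le> \<bar>min s (real (Suc k) * \<delta> n) / \<delta> n\<bar>" by (rule order_trans[OF _ abs_ge_self])
      then show ?case using e01[of n k s] by (simp only: real_norm_def abs_of_nonneg)
    qed
  qed simp
  \<comment> \<open>The first \<open>K\<close> ramps add up to
    \<open>min s (real K * \<delta> n) / \<delta> n\<close>, to which \<open>eta_min_le\<close>
    applies.\<close>
  have part: "(\<Sum>k<K. integral\<^sup>L (\<eta> t) (e n k)) \<le> (\<Sum>k<K. 2 * t * integral\<^sup>L \<nu> (e n k))" for K n
  proof (cases "K = 0")
    case False
    have a: "real K * \<delta> n > 0" using False dpos[of n] by simp
    have "(\<Sum>k<K. integral\<^sup>L (\<eta> t) (e n k)) = (\<integral>s. (\<Sum>k<K. e n k s) \<partial>\<eta> t)"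
      by (rule Bochner_Integration.integral_sum[symmetric]) (rule ie_eta)
    also have "\<dots> = (\<integral>s. min s (real K * \<delta> n) / \<delta> n \<partial>\<eta> t)"
      by (rule integral_cong_AE) (use eta_nonneg[OF t] sume in \<open>auto elim!: eventually_mono\<close>)
    also have "\<dots> \<le> 2 * t * (\<integral>s. min s (real K * \<delta> n) / \<delta> n \<partial>\<nu>)"
      using eta_min_le[OF t a] dpos[of n] by (simp add: divide_right_mono)
    also have "(\<integral>s. min s (real K * \<delta> n) / \<delta> n \<partial>\<nu>) = (\<integral>s. (\<Sum>k<K. e n k s) \<partial>\<nu>)"
      by (rule integral_cong_AE) (use nu_pos sume in \<open>auto elim!: eventually_mono\<close>)
    also have "\<dots> = (\<Sum>k<K. integral\<^sup>L \<nu> (e n k))"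
      by (rule Bochner_Integration.integral_sum) (rule ie_nu)
    finally show ?thesis by (simp add: sum_distrib_left)
  qed simp
  have iL_eta: "integrable (\<eta> t) (L n)" for n unfolding L_def by (intro Bochner_Integration.integrable_sum integrable_mult_right ie_eta)
  have iL_nu: "integrable \<nu> (L n)" for n unfolding L_def by (intro Bochner_Integration.integrable_sum integrable_mult_right ie_nu)
  \<comment> \<open>Only partial sums of ramps have been compared; as concavity makes the weights
    \<open>d n k\<close> decrease in \<open>k\<close>, summation by parts transfers the inequality
    to \<open>L n\<close>.\<close>
  have IL: "integral\<^sup>L (\<eta> t) (L n) \<le> 2 * t * integral\<^sup>L \<nu> (L n)" for n
  proof -
    have "integral\<^sup>L (\<eta> t) (L n) = (\<Sum>k<4^n. d n k * integral\<^sup>L (\<eta> t) (e n k))"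
      unfolding L_def by (subst Bochner_Integration.integral_sum) (auto intro: ie_eta)
    also have "\<dots> \<le> (\<Sum>k<4^n. d n k * (2 * t * integral\<^sup>L \<nu> (e n k)))"
      by (rule sum_weighted_le_of_partial_sums_le) (use part ddec d0 in auto)
    also have "\<dots> = 2 * t * (\<Sum>k<4^n. d n k * integral\<^sup>L \<nu> (e n k))"
      by (simp add: sum_distrib_left mult_ac)
    also have "(\<Sum>k<4^n. d n k * integral\<^sup>L \<nu> (e n k)) = integral\<^sup>L \<nu> (L n)"
      unfolding L_def by (subst Bochner_Integration.integral_sum) (auto intro: ie_nu)
    finally show ?thesis .
  qed
  \<comment> \<open>On the first cell this is \<open>ray_le\<close>; on a later cell the value at
    the right endpoint is at most \<open>g (real j * \<delta> n) + g (\<delta> n)\<close>, hence at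
    most \<open>2 * g s\<close>. This second factor \<open>2\<close> makes the final constant
    \<open>4\<close>.\<close>
  have Lg: "L n s \<le> 2 * g s" if "s \<ge> 0" for n s
  proof -
    define j where "j = nat \<lfloor>s / \<delta> n\<rfloor>"
    have "s / \<delta> n \<ge> 0" using that dpos[of n] by simp
    then have j: "real j \<le> s / \<delta> n" "s / \<delta> n < real j + 1" unfolding j_def by linarith+
    then have j': "real j * \<delta> n \<le> s" "s < (real j + 1) * \<delta> n" using dpos[of n] by (auto simp: field_simps)
    have ez: "e n k s = 0" if "k \<ge> Suc j" for k using j that unfolding e_def by (auto simp: max_def)
    have up: "L n s \<le> (\<Sum>k<Suc j. d n k * e n k s)"
    proof -
      have "L n s \<le> (\<Sum>k<max (4^n) (Suc j). d n k * e n k s)"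
        unfolding L_def by (rule sum_mono2) (auto intro!: mult_nonneg_nonneg d0 e01)
      also have "\<dots> = (\<Sum>k<Suc j. d n k * e n k s)"
        by (rule sum.mono_neutral_right) (auto simp: ez)
      finally show ?thesis .
    qed
    show ?thesis
    proof (cases "j = 0")
      case True
      have "L n s \<le> g (\<delta> n) * (s / \<delta> n)"
        using up True j j' dpos[of n] that by (simp add: d_def e_def g0)
      also have "\<dots> \<le> 2 * g s" using ray_le[OF that _ dpos[of n]] j' True by simp
      finally show ?thesis .
    next
      case False
      have "L n s \<le> (\<Sum>k<Suc j. d n k)"
        by (rule order_trans[OF up], rule sum_mono) (use d0 e01 in \<open>auto intro: mult_right_le_one_le\<close>)
      also have "\<dots> = g ((real j + 1) * \<delta> n)" unfolding sumd by (simp add: add.commute)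
      also have "\<dots> \<le> g (real j * \<delta> n) + g (\<delta> n)" using increment_le[OF less_imp_le[OF dpos[of n]], of j] by simp
      also have "g (\<delta> n) \<le> g (real j * \<delta> n)" using False dpos[of n] by (intro g_mono) auto
      also have "g (real j * \<delta> n) \<le> g s" by (rule g_mono[OF j'(1)])
      finally show ?thesis by simp
    qed
  qed
  \<comment> \<open>From below the interpolation misses \<open>g\<close> by at most the modulus of
    continuity over one mesh, which is what Fatou's lemma needs.\<close>
  have Lge: "g s - g (2 * \<delta> n) \<le> L n s" if s: "s \<ge> 0" and N: "s < 2^n" for n s
  proof -
    define j where "j = nat \<lfloor>s / \<delta> n\<rfloor>"
    have "s / \<delta> n \<ge> 0" using that dpos[of n] by simp
    then have j: "real j \<le> s / \<delta> n" "s / \<delta> n < real j + 1" unfolding j_def by linarith+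
    then have j': "real j * \<delta> n \<le> s" "s < (real j + 1) * \<delta> n" using dpos[of n] by (auto simp: field_simps)
    have "s / \<delta> n < 4 ^ n" using N power_mult_distrib[of "2::real" 2 n] by (simp add: \<delta>_def power_divide field_simps)
    then have "real j < 4 ^ n" using j(1) by (rule le_less_trans[rotated])
    then have jN: "j \<le> 4 ^ n" by (simp add: of_nat_less_numeral_power_cancel_iff)
    have "g s - g (2 * \<delta> n) \<le> g (real j * \<delta> n)"
    proof -
      have "g s \<le> g (real j * \<delta> n + \<delta> n)" using j' by (intro g_mono) (simp add: algebra_simps)
      then show ?thesis using increment_le'[of "\<delta> n" "real j * \<delta> n"] dpos[of n] by simp
    qed
    also have "\<dots> = (\<Sum>k<j. d n k * e n k s)"
      unfolding sumd[symmetric] by (intro sum.cong) (use j in \<open>auto simp: e_def\<close>)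
    also have "\<dots> \<le> L n s" unfolding L_def
      by (rule sum_mono2) (use jN in \<open>auto intro!: mult_nonneg_nonneg d0 e01\<close>)
    finally show ?thesis .
  qed
  have lim_L: "ennreal (g s) \<le> liminf (\<lambda>n. ennreal (L n s))" if s: "s \<ge> 0" for s
  proof -
    have l1: "(\<lambda>n. g (2 * \<delta> n)) \<longlonglongrightarrow> g (2 * 0)"
      by (rule continuous_on_tendsto_compose[OF g_continuous])
         (auto intro!: tendsto_intros simp: \<delta>_def LIMSEQ_realpow_zero)
    then have l2: "(\<lambda>n. ennreal (g s - g (2 * \<delta> n))) \<longlonglongrightarrow> ennreal (g s - 0)"
      by (intro tendsto_ennrealI tendsto_diff tendsto_const) (simp add: g0)
    obtain n0 where "s < 2 ^ n0" using real_arch_pow[of 2 s] by auto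
    then have "s < 2 ^ n" if "n \<ge> n0" for n
      using that by (meson less_le_trans one_le_numeral power_increasing)
    then have "\<forall>\<^sub>F n in sequentially. ennreal (g s - g (2 * \<delta> n)) \<le> ennreal (L n s)"
      by (intro eventually_sequentiallyI[of n0] ennreal_leI Lge s)
    then have "liminf (\<lambda>n. ennreal (g s - g (2 * \<delta> n))) \<le> liminf (\<lambda>n. ennreal (L n s))"
      by (rule Liminf_mono)
    moreover have "liminf (\<lambda>n. ennreal (g s - g (2 * \<delta> n))) = ennreal (g s - 0)"
      using lim_imp_Liminf[OF _ l2] by simp
    ultimately show ?thesis by simp
  qed
  have "(\<integral>\<^sup>+ s. ennreal (g s) \<partial>\<eta> t) \<le> (\<integral>\<^sup>+ s. liminf (\<lambda>n. ennreal (L n s)) \<partial>\<eta> t)"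
    by (rule nn_integral_mono_AE) (use eta_nonneg[OF t] lim_L in \<open>auto elim!: eventually_mono\<close>)
  also have "\<dots> \<le> liminf (\<lambda>n. \<integral>\<^sup>+ s. ennreal (L n s) \<partial>\<eta> t)"
    by (rule nn_integral_liminf) (use t in measurable)
  also have "\<dots> \<le> liminf (\<lambda>n::nat. ennreal (4 * t) * (\<integral>\<^sup>+ s. ennreal (g s) \<partial>\<nu>))"
  proof (rule Liminf_mono, rule always_eventually, rule allI)
    fix n
    have "(\<integral>\<^sup>+ s. ennreal (L n s) \<partial>\<eta> t) = ennreal (integral\<^sup>L (\<eta> t) (L n))"
      by (rule nn_integral_eq_integral[OF iL_eta]) (use L0 in auto)
    also have "\<dots> \<le> ennreal (2 * t * integral\<^sup>L \<nu> (L n))" by (rule ennreal_leI[OF IL])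
    also have "\<dots> = ennreal (2 * t) * ennreal (integral\<^sup>L \<nu> (L n))" using t by (intro ennreal_mult) (auto intro!: integral_nonneg_AE simp: L0)
    also have "ennreal (integral\<^sup>L \<nu> (L n)) = (\<integral>\<^sup>+ s. ennreal (L n s) \<partial>\<nu>)"
      by (rule nn_integral_eq_integral[OF iL_nu, symmetric]) (use L0 in auto)
    also have "\<dots> \<le> (\<integral>\<^sup>+ s. ennreal (2 * g s) \<partial>\<nu>)"
      by (rule nn_integral_mono_AE) (use nu_pos in \<open>auto elim!: eventually_mono intro!: ennreal_leI Lg\<close>)
    also have "\<dots> = (\<integral>\<^sup>+ s. ennreal 2 * ennreal (g s) \<partial>\<nu>)" by (simp add: ennreal_mult g_nonneg)
    also have "\<dots> = ennreal 2 * (\<integral>\<^sup>+ s. ennreal (g s) \<partial>\<nu>)" by (rule nn_integral_cmult) measurable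
    also have "ennreal (2 * t) * (ennreal 2 * (\<integral>\<^sup>+ s. ennreal (g s) \<partial>\<nu>)) = ennreal (4 * t) * (\<integral>\<^sup>+ s. ennreal (g s) \<partial>\<nu>)"
    proof -
      have "ennreal (4 * t) = ennreal (2 * t) * ennreal 2"
        using t by (subst ennreal_mult[symmetric]) simp_all
      then show ?thesis by (simp only: mult.assoc)
    qed
    finally show "(\<integral>\<^sup>+ s. ennreal (L n s) \<partial>\<eta> t) \<le> ennreal (4 * t) * (\<integral>\<^sup>+ s. ennreal (g s) \<partial>\<nu>)"
      by (simp add: mult_left_mono)
  qed
  also have "\<dots> = ennreal (4 * t) * (\<integral>\<^sup>+ s. ennreal (g s) \<partial>\<nu>)" by (simp add: Liminf_const)
  finally show ?thesis .
qed

text \<open>Away from \<open>0\<close> the claim is weak convergence of finite measures: weighted by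
  \<open>1 - exp (-s)\<close> both sides have finite mass, and \<open>weierstrass_laplace\<close>
  applies once the integrand divided by the weight is a continuous function of
  \<open>exp (-s)\<close>.\<close>

lemma tail_convergence:
  assumes g: "midconcave g B" and \<delta>: "\<delta> > 0"
  shows "((\<lambda>t. (\<integral>s. (g s - g (min s \<delta>)) \<partial>\<eta> t) / t) \<longlongrightarrow> (\<integral>s. (g s - g (min s \<delta>)) \<partial>\<nu>)) (at_right 0)"
proof -
  interpret midconcave g B by fact
  \<comment> \<open>The limit of \<open>g\<close> at infinity, needed to extend the integrand
    continuously to \<open>z = 0\<close>.\<close>
  define S where "S = (SUP s. g s)"
  have bb: "bdd_above (range g)" using bdd by (auto intro!: bdd_aboveI2)
  have gS: "g s \<le> S" for s unfolding S_def by (rule cSUP_upper[OF _ bb]) simp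
  define H where "H z = (if z \<le> 0 then S else g (max \<delta> (- ln z))) - g \<delta>" for z :: real
  \<comment> \<open>\<open>H\<close> vanishes for \<open>z \<ge> exp (-\<delta>)\<close>, so
    bounding the divisor \<open>1 - z\<close> from below by \<open>1 - exp (-\<delta>)\<close>
    changes nothing and removes the singularity at \<open>z = 1\<close>.\<close>
  define G where "G z = H z / max (1 - z) (1 - exp (-\<delta>))" for z :: real
  have cH: "isCont H z" for z
  proof -
    consider "z < 0" | "z > 0" | "z = 0" by linarith
    then show ?thesis
    proof cases
      case 1
      have "\<forall>\<^sub>F x in nhds z. H x = S - g \<delta>"
        using eventually_nhds_in_open[of "{..<0}" z] 1 by (auto elim!: eventually_mono simp: H_def)
      then show ?thesis by (subst isCont_cong) auto
    next
      case 2
      have "\<forall>\<^sub>F x in nhds z. H x = g (max \<delta> (- ln x)) - g \<delta>"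
        using eventually_nhds_in_open[of "{0<..}" z] 2 by (auto elim!: eventually_mono simp: H_def)
      moreover have "isCont (\<lambda>x. g (max \<delta> (- ln x)) - g \<delta>) z"
      proof -
        have cg: "isCont g y" for y using g_continuous by (simp add: continuous_on_eq_continuous_at)
        have "isCont ln z" using 2 by (intro isCont_ln) simp
        then have "isCont (\<lambda>x. max \<delta> (- ln x)) z"
          by (rule continuous_max[OF continuous_const continuous_minus])
        then have "isCont (\<lambda>x. g (max \<delta> (- ln x))) z"
          by (rule isCont_o2[OF _ cg])
        then show ?thesis by (rule continuous_diff[OF _ continuous_const])
      qed
      ultimately show ?thesis by (subst isCont_cong) auto
    next
      case 3
      show ?thesis unfolding continuous_at_eps_delta
      proof (intro allI impI)
        fix e :: real assume e: "e > 0"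
        have "\<exists>R. S - e < g R" unfolding S_def using less_cSUP_iff[OF _ bb, of "(SUP s. g s) - e"] e by auto
        then obtain R where R: "S - e < g R" by blast
        have "dist (H x) (H z) < e" if "dist x z < exp (-R)" for x
        proof (cases "x \<le> 0")
          case False
          then have "x < exp (-R)" "x > 0" using that 3 by (simp_all add: dist_real_def)
          then have "ln x < ln (exp (-R))" by (subst ln_less_cancel_iff) auto
          then have "ln x < -R" by simp
          then have "g R \<le> g (max \<delta> (- ln x))" by (intro g_mono) auto
          then show ?thesis using R False 3 gS[of "max \<delta> (- ln x)"] by (auto simp: H_def dist_real_def)
        qed (use 3 e in \<open>simp add: H_def\<close>)
        then show "\<exists>d>0. \<forall>x'. dist x' z < d \<longrightarrow> dist (H x') (H z) < e" by (intro exI[of _ "exp (-R)"]) auto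
      qed
    qed
  qed
  have ed: "1 - exp (-\<delta>) > 0" using \<delta> by simp
  have cG: "continuous_on UNIV G"
  proof -
    have "max (1 - z) (1 - exp (-\<delta>)) \<noteq> 0" for z using ed by (auto simp: max_def)
    moreover have "continuous_on UNIV H" using cH by (simp add: continuous_at_imp_continuous_on)
    ultimately show ?thesis unfolding G_def by (intro continuous_intros) auto
  qed
  have Geq: "G (exp (-s)) * (1 - exp (-s)) = g s - g (min s \<delta>)" for s
  proof (cases "s \<ge> \<delta>")
    case True
    then have "max (1 - exp (-s)) (1 - exp (-\<delta>)) = 1 - exp (-s)" "1 - exp (-s) > 0" using \<delta> by auto
    then show ?thesis using True by (simp add: G_def H_def max_def)
  next
    case False
    then show ?thesis by (simp add: G_def H_def max_def)
  qed
  have [measurable]: "G \<in> borel_measurable borel" using cG by (rule borel_measurable_continuous_onI)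
  define Nu where "Nu = density \<nu> (\<lambda>s. ennreal (1 - exp (-s)))"
  define Et where "Et t = density (\<eta> t) (\<lambda>s. ennreal ((1 - exp (-s)) / t))" for t
  have nu1: "AE s in \<nu>. 0 \<le> 1 - exp (-s)" using nu_pos by (auto elim!: eventually_mono)
  have eta1: "AE s in \<eta> t. 0 \<le> (1 - exp (-s)) / t" if "t > 0" for t using eta_nonneg[OF that] that by (auto elim!: eventually_mono)
  have intNu: "(\<integral>s. f s \<partial>Nu) = (\<integral>s. (1 - exp (-s)) * f s \<partial>\<nu>)" if "f \<in> borel_measurable borel" for f :: "real \<Rightarrow> real"
    unfolding Nu_def using that nu1 sets_nu by (subst integral_density) (auto simp: measurable_cong_sets[OF sets_nu refl])
  have intEt: "(\<integral>s. f s \<partial>Et t) = (\<integral>s. ((1 - exp (-s)) / t) * f s \<partial>\<eta> t)" if "f \<in> borel_measurable borel" "t > 0" for f :: "real \<Rightarrow> real" and t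
    unfolding Et_def using that eta1 by (subst integral_density) (auto simp: measurable_cong_sets[OF sets_eta refl])
  have finNu: "finite_measure Nu"
  proof
    have "emeasure Nu (space Nu) = (\<integral>\<^sup>+s. ennreal (1 - exp (-s)) \<partial>\<nu>)"
      unfolding Nu_def by (subst emeasure_density) (auto intro!: nn_integral_cong)
    also have "\<dots> = ennreal (\<integral>s. (1 - exp (-s)) \<partial>\<nu>)"
      using int_exp_nu[of 1] nu1 by (intro nn_integral_eq_integral) auto
    finally show "emeasure Nu (space Nu) \<noteq> \<infinity>" by simp
  qed
  have inte: "integrable (\<eta> t) (\<lambda>s. exp (-(l * s)))" if "t > 0" "l \<ge> 0" for t l
    by (rule int_bounded_eta[OF that(1), of _ 1]) (use that in auto)
  have finEt: "finite_measure (Et t)" if t: "t > 0" for t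
  proof
    have "emeasure (Et t) (space (Et t)) = (\<integral>\<^sup>+s. ennreal ((1 - exp (-s)) / t) \<partial>\<eta> t)"
      unfolding Et_def using t by (subst emeasure_density) (auto intro!: nn_integral_cong)
    also have "\<dots> = ennreal (\<integral>s. ((1 - exp (-s)) / t) \<partial>\<eta> t)"
    proof (rule nn_integral_eq_integral)
      interpret prob_space "\<eta> t" using eta_prob t by blast
      show "integrable (\<eta> t) (\<lambda>s. (1 - exp (-s)) / t)"
        using inte[OF t, of 1] by simp
    qed (use eta1[OF t] in auto)
    finally show "emeasure (Et t) (space (Et t)) \<noteq> \<infinity>" by simp
  qed
  define \<Phi> where "\<Phi> l = (\<integral>s. (1 - exp (-(l * s))) \<partial>\<nu>)" for l
  have lap: "(\<integral>s. exp (-(l * s)) \<partial>\<eta> t) = exp (- (t * \<Phi> l))" if "t > 0" "l \<ge> 0" for t l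
  proof (cases "l = 0")
    case True
    interpret prob_space "\<eta> t" using eta_prob that by blast
    show ?thesis using True by (simp add: \<Phi>_def prob_space)
  qed (use laplace that in \<open>auto simp: \<Phi>_def\<close>)
  have main: "((\<lambda>t. \<integral>s. G (exp (-s)) \<partial>Et t) \<longlongrightarrow> (\<integral>s. G (exp (-s)) \<partial>Nu)) (at_right 0)"
  proof (rule weierstrass_laplace[OF _ finNu _ _ _ cG])
    show "\<forall>\<^sub>F t in at_right 0. finite_measure (Et t) \<and> sets (Et t) = sets borel \<and> (AE s in Et t. 0 \<le> s)"
      using eventually_at_right_less[of 0]
    proof eventually_elim
      case (elim t)
      have "AE s in Et t. 0 \<le> s" unfolding Et_def using elim eta_nonneg[OF elim] by (subst AE_density) auto
      then show ?case using finEt elim sets_eta by (auto simp: Et_def)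
    qed
    show "sets Nu = sets borel" by (simp add: Nu_def sets_nu)
    show "AE s in Nu. 0 \<le> s" unfolding Nu_def using nu_pos by (subst AE_density) (auto elim!: eventually_mono)
    fix k :: nat
    have split: "(1 - exp (-s)) * exp (-(real k * s)) = (1 - exp (-(real (Suc k) * s))) - (1 - exp (-(real k * s)))" for s :: real
      by (simp add: algebra_simps flip: exp_add)
    have 1: "(\<integral>s. exp (-(real k * s)) \<partial>Nu) = \<Phi> (real (Suc k)) - \<Phi> (real k)"
      unfolding \<Phi>_def by (subst intNu, simp, unfold split, subst Bochner_Integration.integral_diff) (auto intro!: int_exp_nu simp del: of_nat_Suc)
    have 2: "(\<integral>s. exp (-(real k * s)) \<partial>Et t) = (exp (- (t * \<Phi> (real k))) - exp (- (t * \<Phi> (real (Suc k))))) / t" if t: "t > 0" for t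
    proof -
      have "(1 - exp (-s)) / t * exp (-(real k * s)) = (exp (-(real k * s)) - exp (-(real (Suc k) * s))) / t" for s :: real
        by (simp add: algebra_simps diff_divide_distrib flip: exp_add)
      then have "(\<integral>s. exp (-(real k * s)) \<partial>Et t) = (\<integral>s. (exp (-(real k * s)) - exp (-(real (Suc k) * s))) / t \<partial>\<eta> t)"
        using t by (subst intEt) simp_all
      also have "\<dots> = (exp (- (t * \<Phi> (real k))) - exp (- (t * \<Phi> (real (Suc k))))) / t"
        using t by (subst integral_divide_zero, subst Bochner_Integration.integral_diff) (auto intro!: inte simp: lap simp del: of_nat_Suc)
      finally show ?thesis .
    qed
    have "((\<lambda>t. (exp (- (t * \<Phi> (real k))) - exp (- (t * \<Phi> (real (Suc k))))) / t) \<longlongrightarrow> \<Phi> (real (Suc k)) - \<Phi> (real k)) (at_right 0)"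
    proof -
      \<comment> \<open>The transform of \<open>Et t\<close> at \<open>k\<close> is the difference
        quotient at \<open>0\<close> of this function of \<open>t\<close>, so the derivative is the
        limit, and it equals the transform of \<open>Nu\<close>.\<close>
      have "((\<lambda>t. exp (- (t * \<Phi> (real k))) - exp (- (t * \<Phi> (real (Suc k))))) has_real_derivative \<Phi> (real (Suc k)) - \<Phi> (real k)) (at 0)"
        by (auto intro!: derivative_eq_intros)
      then have "((\<lambda>t. (exp (- (t * \<Phi> (real k))) - exp (- (t * \<Phi> (real (Suc k))))) / t) \<longlongrightarrow> \<Phi> (real (Suc k)) - \<Phi> (real k)) (at 0)"
        unfolding DERIV_def by simp
      then show ?thesis by (rule filterlim_mono[OF _ order_refl at_le]) simp
    qed
    then show "((\<lambda>t. \<integral>s. exp (-(real k * s)) \<partial>Et t) \<longlongrightarrow> (\<integral>s. exp (-(real k * s)) \<partial>Nu)) (at_right 0)"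
      unfolding 1 by (rule Lim_transform_eventually)
        (use eventually_at_right_less[of 0] in \<open>eventually_elim, simp add: 2\<close>)
  qed
  have eqNu: "(\<integral>s. G (exp (-s)) \<partial>Nu) = (\<integral>s. (g s - g (min s \<delta>)) \<partial>\<nu>)"
    by (subst intNu) (auto simp: Geq[symmetric] mult.commute)
  have eqEt: "(\<integral>s. G (exp (-s)) \<partial>Et t) = (\<integral>s. (g s - g (min s \<delta>)) \<partial>\<eta> t) / t" if "t > 0" for t
  proof -
    have "(\<integral>s. G (exp (-s)) \<partial>Et t) = (\<integral>s. (g s - g (min s \<delta>)) / t \<partial>\<eta> t)"
      using that by (subst intEt) (auto simp: Geq[symmetric] mult.commute)
    then show ?thesis by simp
  qed
  have "\<forall>\<^sub>F t in at_right 0. (\<integral>s. G (exp (-s)) \<partial>Et t) = (\<integral>s. (g s - g (min s \<delta>)) \<partial>\<eta> t) / t"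
    using eventually_at_right_less[of 0] by eventually_elim (rule eqEt)
  with main show ?thesis unfolding eqNu by (rule Lim_transform_eventually)
qed

text \<open>The integrand vanishes below \<open>\<delta>\<close> and is bounded by \<open>B\<close>
  above it, hence is dominated by a multiple of \<open>min s \<delta>\<close>.\<close>

lemma integrable_tail:
  assumes g: "midconcave g B" and \<delta>: "\<delta> > 0"
  shows "integrable \<nu> (\<lambda>s. g s - g (min s \<delta>))"
proof -
  interpret midconcave g B by fact
  show ?thesis
  proof (rule Bochner_Integration.integrable_bound[OF integrable_mult_right[OF int_min[of \<delta>], of "B / \<delta>"]])
    show "AE s in \<nu>. norm (g s - g (min s \<delta>)) \<le> norm (B / \<delta> * min s \<delta>)"
      using nu_pos
    proof eventually_elim
      case (elim s)
      have "g s - g (min s \<delta>) \<le> B / \<delta> * min s \<delta>"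
      proof (cases "s \<le> \<delta>")
        case False
        then show ?thesis using bdd[of s] g_nonneg[of \<delta>] \<delta> by simp
      qed (use elim \<delta> bdd[of 0] g_nonneg[of 0] in \<open>auto intro!: mult_nonneg_nonneg divide_nonneg_nonneg\<close>)
      moreover have "0 \<le> g s - g (min s \<delta>)" by (simp add: g_mono)
      ultimately show ?case by (simp only: real_norm_def abs_of_nonneg order_trans[OF _ abs_ge_self])
    qed
  qed (use \<delta> in auto)
qed

lemma truncated_tendsto_0:
  assumes g: "midconcave g B"
  shows "(\<lambda>n. g (min s (1 / real (Suc n)))) \<longlonglongrightarrow> 0"
proof -
  interpret midconcave g B by fact
  have "(\<lambda>n. min s (1 / real (Suc n))) \<longlonglongrightarrow> min s 0"
    by (intro tendsto_min tendsto_const) (use LIMSEQ_inverse_real_of_nat in \<open>simp add: inverse_eq_divide\<close>)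
  then have "(\<lambda>n. g (min s (1 / real (Suc n)))) \<longlonglongrightarrow> g (min s 0)"
    by (rule continuous_on_tendsto_compose[OF g_continuous]) auto
  then show ?thesis by (simp add: g0)
qed

lemma int_eta: "midconcave g B \<Longrightarrow> t > 0 \<Longrightarrow> integrable (\<eta> t) g"
  by (rule int_bounded_eta[of t g B])
    (auto simp: midconcave.bdd midconcave.g_nonneg midconcave.g_measurable)

text \<open>The tails lie below \<open>g\<close>, so their integrals against \<open>\<nu>\<close>
  stay below \<open>l\<close>; Fatou's lemma as the cut-off tends to \<open>0\<close> gives
  integrability of \<open>g\<close> itself.\<close>

lemma integrable_of_limit:
  assumes g: "midconcave g B" and l: "((\<lambda>t. (\<integral>s. g s \<partial>\<eta> t) / t) \<longlongrightarrow> l) (at_right 0)"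
  shows "integrable \<nu> g"
proof -
  interpret midconcave g B by fact
  let ?\<delta> = "\<lambda>n. 1 / real (Suc n)"
  have le: "(\<integral>s. (g s - g (min s (?\<delta> n))) \<partial>\<nu>) \<le> l" for n
  proof (rule tendsto_le[OF _ l tail_convergence[OF g, of "?\<delta> n"]])
    show "\<forall>\<^sub>F t in at_right 0. (\<integral>s. (g s - g (min s (?\<delta> n))) \<partial>\<eta> t) / t \<le> (\<integral>s. g s \<partial>\<eta> t) / t"
      using eventually_at_right_less[of 0]
    proof eventually_elim
      case (elim t)
      have "integrable (\<eta> t) (\<lambda>s. g (min s (?\<delta> n)))"
        by (rule int_eta[OF truncate elim]) simp
      then show ?case using elim int_eta[OF g elim] g_nonneg
        by (intro divide_right_mono integral_mono) auto
    qed
  qed simp_all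
  have "(\<integral>\<^sup>+s. ennreal (g s) \<partial>\<nu>) \<le> (\<integral>\<^sup>+s. liminf (\<lambda>n. ennreal (g s - g (min s (?\<delta> n)))) \<partial>\<nu>)"
  proof (rule nn_integral_mono)
    fix s
    have "(\<lambda>n. ennreal (g s - g (min s (?\<delta> n)))) \<longlonglongrightarrow> ennreal (g s - 0)"
      by (intro tendsto_ennrealI tendsto_diff tendsto_const truncated_tendsto_0[OF g])
    from lim_imp_Liminf[OF _ this] show "ennreal (g s) \<le> liminf (\<lambda>n. ennreal (g s - g (min s (?\<delta> n))))"
      by simp
  qed
  also have "\<dots> \<le> liminf (\<lambda>n. \<integral>\<^sup>+s. ennreal (g s - g (min s (?\<delta> n))) \<partial>\<nu>)"
    by (rule nn_integral_liminf) measurable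
  also have "\<dots> \<le> liminf (\<lambda>n::nat. ennreal l)"
  proof (rule Liminf_mono, rule always_eventually, rule allI)
    fix n
    have "(\<integral>\<^sup>+s. ennreal (g s - g (min s (?\<delta> n))) \<partial>\<nu>) = ennreal (\<integral>s. (g s - g (min s (?\<delta> n))) \<partial>\<nu>)"
      by (rule nn_integral_eq_integral[OF integrable_tail[OF g]]) (auto simp: g_mono)
    then show "(\<integral>\<^sup>+s. ennreal (g s - g (min s (?\<delta> n))) \<partial>\<nu>) \<le> ennreal l"
      using le[of n] by (simp add: ennreal_leI)
  qed
  also have "\<dots> < \<infinity>" by (simp add: Liminf_const)
  finally show ?thesis
    by (intro integrableI_nonneg) (auto simp: g_nonneg)
qed

text \<open>Split \<open>g\<close> at a level \<open>\<delta>\<close>. The tail converges by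
  \<open>tail_convergence\<close>; \<open>nn_integral_eta_le\<close> for the truncated function
  bounds the head uniformly in \<open>t\<close> by four times its \<open>\<nu>\<close>-integral,
  which dominated convergence makes small.\<close>

lemma limit_of_integrable:
  assumes g: "midconcave g B" and int: "integrable \<nu> g"
  shows "((\<lambda>t. (\<integral>s. g s \<partial>\<eta> t) / t) \<longlongrightarrow> (\<integral>s. g s \<partial>\<nu>)) (at_right 0)"
proof (rule tendstoI)
  interpret midconcave g B by fact
  fix e :: real assume e: "e > 0"
  have ig: "integrable \<nu> (\<lambda>s. g (min s a))" for a
    by (rule Bochner_Integration.integrable_bound[OF int]) (auto simp: g_nonneg g_mono)
  have "(\<lambda>n. \<integral>s. g (min s (1 / real (Suc n))) \<partial>\<nu>) \<longlonglongrightarrow> (\<integral>s. 0 \<partial>\<nu>)"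
    by (rule integral_dominated_convergence[where w=g]) (use int truncated_tendsto_0[OF g] in \<open>auto simp: g_nonneg g_mono\<close>)
  \<comment> \<open>Error budget: the tail contributes one tenth of \<open>e\<close>, the heads
    under \<open>\<eta> t / t\<close> and under \<open>\<nu>\<close> at most four tenths and one
    tenth.\<close>
  then have "\<forall>\<^sub>F n in sequentially. (\<integral>s. g (min s (1 / real (Suc n))) \<partial>\<nu>) < e / 10"
    using e by (intro order_tendstoD) auto
  then obtain n where n: "(\<integral>s. g (min s (1 / real (Suc n))) \<partial>\<nu>) < e / 10"
    using eventually_happens by fastforce
  define \<delta> where "\<delta> = 1 / real (Suc n)"
  have \<delta>: "\<delta> > 0" by (simp add: \<delta>_def)
  define I where "I = (\<integral>s. g (min s \<delta>) \<partial>\<nu>)"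
  have I: "0 \<le> I" "I < e / 10" using n by (auto simp: I_def \<delta>_def g_nonneg)
  have gt: "midconcave (\<lambda>s. g (min s \<delta>)) B" by (rule truncate[OF \<delta>])
  have "\<forall>\<^sub>F t in at_right 0. dist ((\<integral>s. (g s - g (min s \<delta>)) \<partial>\<eta> t) / t) (\<integral>s. (g s - g (min s \<delta>)) \<partial>\<nu>) < e / 10"
    using tendstoD[OF tail_convergence[OF g \<delta>], of "e / 10"] e by simp
  then show "\<forall>\<^sub>F t in at_right 0. dist ((\<integral>s. g s \<partial>\<eta> t) / t) (\<integral>s. g s \<partial>\<nu>) < e"
    using eventually_at_right_less[of 0]
  proof eventually_elim
    case (elim t)
    define It where "It = (\<integral>s. g (min s \<delta>) \<partial>\<eta> t)"
    have "ennreal It = (\<integral>\<^sup>+s. ennreal (g (min s \<delta>)) \<partial>\<eta> t)"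
      unfolding It_def by (rule nn_integral_eq_integral[symmetric, OF int_eta[OF gt elim(2)]]) (auto simp: g_nonneg)
    also have "\<dots> \<le> ennreal (4 * t) * (\<integral>\<^sup>+s. ennreal (g (min s \<delta>)) \<partial>\<nu>)"
      by (rule nn_integral_eta_le[OF gt elim(2)])
    also have "(\<integral>\<^sup>+s. ennreal (g (min s \<delta>)) \<partial>\<nu>) = ennreal I"
      unfolding I_def by (rule nn_integral_eq_integral[OF ig]) (auto simp: g_nonneg)
    also have "ennreal (4 * t) * ennreal I = ennreal (4 * t * I)" using I elim by (simp add: ennreal_mult)
    finally have It: "It \<le> 4 * t * I" using I elim by (subst (asm) ennreal_le_iff) auto
    have It0: "0 \<le> It" unfolding It_def by (auto simp: g_nonneg)
    have 1: "(\<integral>s. (g s - g (min s \<delta>)) \<partial>\<eta> t) = (\<integral>s. g s \<partial>\<eta> t) - It"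
      unfolding It_def by (rule Bochner_Integration.integral_diff[OF int_eta[OF g elim(2)] int_eta[OF gt elim(2)]])
    have 2: "(\<integral>s. (g s - g (min s \<delta>)) \<partial>\<nu>) = (\<integral>s. g s \<partial>\<nu>) - I"
      unfolding I_def by (rule Bochner_Integration.integral_diff[OF int ig])
    have 3: "It / t \<le> 4 * I" "0 \<le> It / t" using It It0 elim by (auto simp: field_simps)
    have "\<bar>((\<integral>s. g s \<partial>\<eta> t) - It) / t - ((\<integral>s. g s \<partial>\<nu>) - I)\<bar> < e / 10"
      using elim(1) unfolding 1 2 dist_real_def .
    then have "\<bar>(\<integral>s. g s \<partial>\<eta> t) / t - It / t - (\<integral>s. g s \<partial>\<nu>) + I\<bar> < e / 10"
      by (simp add: diff_divide_distrib algebra_simps)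
    then show ?case unfolding dist_real_def using 3 I by linarith
  qed
qed

end

section \<open>Scale functions and the Levy measure\<close>

lemma
  assumes "scale_function \<phi>"
  shows scale_zero: "\<phi> 0 = 0"
    and scale_strict_mono: "0 \<le> r \<Longrightarrow> r < R \<Longrightarrow> \<phi> r < \<phi> R"
    and scale_continuous: "continuous_on {0..} \<phi>"
proof -
  show "\<phi> 0 = 0" "continuous_on {0..} \<phi>" using assms by (auto simp: scale_function_def LU_def)
  show "0 \<le> r \<Longrightarrow> r < R \<Longrightarrow> \<phi> r < \<phi> R"
    using assms by (auto simp: scale_function_def LU_def strict_mono_on_def)
qed

lemma scale_le_iff: "scale_function \<phi> \<Longrightarrow> 0 \<le> r \<Longrightarrow> 0 \<le> R \<Longrightarrow> \<phi> r \<le> \<phi> R \<longleftrightarrow> r \<le> R"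
  by (metis scale_strict_mono less_le_not_le linorder_not_le order_le_less)

lemma scale_pos: "scale_function \<phi> \<Longrightarrow> 0 < r \<Longrightarrow> 0 < \<phi> r"
  using scale_strict_mono[of \<phi> 0 r] scale_zero[of \<phi>] by simp

lemma scale_inj: "scale_function \<phi> \<Longrightarrow> inj_on \<phi> {0..}"
  by (intro inj_onI) (metis atLeast_iff order_antisym_conv order_refl scale_le_iff)

text \<open>The lower power bound makes \<open>\<phi>\<close> unbounded, so the intermediate value
  theorem reaches every \<open>t\<close>. Surjectivity is what gives \<open>scale_inv\<close>, an
  inverse on the image, a meaning for all nonnegative times.\<close>

lemma scale_surj:
  assumes s: "scale_function \<phi>" and t: "0 \<le> t"
  shows "\<exists>r\<ge>0. \<phi> r = t"
proof -
  obtain a1 a2 C where a: "0 < a1" "\<phi> 1 = 1" "C \<ge> 1"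
    and low: "\<And>r R. 0 < r \<Longrightarrow> r \<le> R \<Longrightarrow> inverse C * (R / r) powr a1 \<le> \<phi> R / \<phi> r"
    using s unfolding scale_function_def LU_def by blast
  \<comment> \<open>Solves \<open>t \<le> inverse C * R powr a1\<close>, the right side being the
    lower bound for \<open>\<phi> R\<close> obtained by comparison with
    \<open>\<phi> 1 = 1\<close>.\<close>
  define R where "R = max 1 ((C * t) powr (1 / a1))"
  have R: "R \<ge> 1" by (simp add: R_def)
  have "C * t \<le> R powr a1"
  proof (cases "C * t = 0")
    case False
    then have "C * t > 0" using a t by (simp add: less_le)
    then have "C * t = ((C * t) powr (1 / a1)) powr a1" using a by (simp add: powr_powr)
    also have "\<dots> \<le> R powr a1" using a by (intro powr_mono2) (auto simp: R_def)
    finally show ?thesis .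
  next
    case True
    then show ?thesis by (simp only: powr_ge_zero)
  qed
  then have "t \<le> inverse C * R powr a1" using a by (simp add: field_simps)
  also have "\<dots> \<le> \<phi> R" using low[of 1 R] R a by simp
  finally have "t \<le> \<phi> R" .
  then have "\<exists>x\<ge>0. x \<le> R \<and> \<phi> x = t"
    by (intro IVT') (use R t scale_zero[OF s] continuous_on_subset[OF scale_continuous[OF s]] in auto)
  then show ?thesis by auto
qed

lemma
  assumes s: "scale_function \<phi>" and t: "0 \<le> t"
  shows scale_inv_nonneg: "0 \<le> scale_inv \<phi> t" and scale_scale_inv: "\<phi> (scale_inv \<phi> t) = t"
proof -
  obtain r where r: "r \<ge> 0" "\<phi> r = t" using scale_surj[OF s t] by blast
  then have im: "t \<in> \<phi> ` {0..}" by auto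
  show "0 \<le> scale_inv \<phi> t"
    using the_inv_into_into[OF scale_inj[OF s] im, of "{0..}"] by (simp add: scale_inv_def)
  show "\<phi> (scale_inv \<phi> t) = t"
    using f_the_inv_into_f[OF scale_inj[OF s] im] by (simp add: scale_inv_def)
qed

lemma scale_inv_le_iff: "scale_function \<phi> \<Longrightarrow> 0 \<le> r \<Longrightarrow> 0 \<le> t \<Longrightarrow> scale_inv \<phi> t \<le> r \<longleftrightarrow> t \<le> \<phi> r"
  by (metis scale_inv_nonneg scale_le_iff scale_scale_inv)

lemma le_scale_inv_iff: "scale_function \<phi> \<Longrightarrow> 0 \<le> r \<Longrightarrow> 0 \<le> t \<Longrightarrow> r \<le> scale_inv \<phi> t \<longleftrightarrow> \<phi> r \<le> t"
  by (metis scale_inv_nonneg scale_le_iff scale_scale_inv)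

lemma scale_inv_pos: "scale_function \<phi> \<Longrightarrow> 0 < t \<Longrightarrow> 0 < scale_inv \<phi> t"
  by (metis less_eq_real_def order_less_irrefl scale_inv_nonneg scale_scale_inv scale_zero)

lemma scale_inv_mono: "scale_function \<phi> \<Longrightarrow> 0 \<le> s \<Longrightarrow> s \<le> t \<Longrightarrow> scale_inv \<phi> s \<le> scale_inv \<phi> t"
  using scale_inv_le_iff[of \<phi> "scale_inv \<phi> t" s] scale_inv_nonneg[of \<phi> t] scale_scale_inv[of \<phi> t] by simp

lemma levy_density_pos:
  "scale_function \<phi> \<Longrightarrow> scale_function \<psi> \<Longrightarrow> 0 < t \<Longrightarrow> 0 < levy_density \<phi> \<psi> t"
  by (simp add: levy_density_def scale_pos scale_inv_pos)

lemma levy_density_measurable: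
  assumes p: "scale_function \<phi>" "scale_function \<psi>"
  shows "(\<lambda>t. indicator {0<..} t * levy_density \<phi> \<psi> t) \<in> borel_measurable borel"
proof -
  \<comment> \<open>Measurability comes from monotonicity of \<open>\<psi>\<close> composed with the
    inverse of \<open>\<phi>\<close>; the value \<open>0\<close> for \<open>t \<le> 0\<close> keeps
    \<open>m\<close> monotone on the whole line, including negative \<open>t\<close>, where
    \<open>scale_inv\<close> is unspecified.\<close>
  define m where "m t = (if t \<le> 0 then 0 else \<psi> (scale_inv \<phi> t))" for t
  have "mono m"
  proof (rule monoI)
    fix x y :: real assume "x \<le> y"
    then show "m x \<le> m y"
      using scale_inv_mono[OF p(1), of x y] scale_le_iff[OF p(2)] scale_inv_pos[OF p(1), of y]
        scale_pos[OF p(2), of "scale_inv \<phi> y"] scale_inv_pos[OF p(1), of x]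
      by (auto simp: m_def)
  qed
  then have [measurable]: "m \<in> borel_measurable borel" by (rule borel_measurable_mono)
  have "(\<lambda>t. indicator {0<..} t * levy_density \<phi> \<psi> t) = (\<lambda>t. indicator {0<..} t * (1 / (t * m t)))"
    by (auto simp: levy_density_def m_def indicator_def)
  then show ?thesis by simp
qed

text \<open>The indicator confines the measure to positive times; at negative \<open>t\<close> the
  value of \<open>levy_density\<close> carries no meaning.\<close>

definition levy_measure :: "(real \<Rightarrow> real) \<Rightarrow> (real \<Rightarrow> real) \<Rightarrow> real measure" where
  "levy_measure \<phi> \<psi> = density lborel (\<lambda>t. ennreal (indicator {0<..} t * levy_density \<phi> \<psi> t))"

lemma sets_levy_measure[measurable_cong, simp]: "sets (levy_measure \<phi> \<psi>) = sets borel"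
  by (simp add: levy_measure_def)

context
  fixes \<phi> \<psi> :: "real \<Rightarrow> real"
  assumes sc: "scale_function \<phi>" "scale_function \<psi>"
begin

lemma nn_integral_levy_measure:
  assumes [measurable]: "f \<in> borel_measurable borel"
  shows "(\<integral>\<^sup>+s. f s \<partial>levy_measure \<phi> \<psi>) = (\<integral>\<^sup>+t. f t * ennreal (levy_density \<phi> \<psi> t) * indicator {0<..} t \<partial>lborel)"
proof -
  note levy_density_measurable[OF sc, measurable]
  show ?thesis
    unfolding levy_measure_def
    by (subst nn_integral_density, measurable)
      (auto intro!: nn_integral_cong simp: indicator_def mult.commute)
qed

lemma AE_levy_measure_pos: "AE s in levy_measure \<phi> \<psi>. 0 < s"
proof -
  note levy_density_measurable[OF sc, measurable]
  show ?thesis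
    unfolding levy_measure_def by (subst AE_density, measurable) (auto simp: indicator_def)
qed

lemma lebesgue_integral_levy_measure:
  fixes f :: "real \<Rightarrow> real"
  assumes [measurable]: "f \<in> borel_measurable borel"
  shows "(\<integral>s. f s \<partial>levy_measure \<phi> \<psi>) = (LINT t:{0<..}|lborel. f t * levy_density \<phi> \<psi> t)"
proof -
  note levy_density_measurable[OF sc, measurable]
  show ?thesis
    unfolding levy_measure_def set_lebesgue_integral_def
    by (subst integral_density, measurable)
      (auto intro!: Bochner_Integration.integral_cong simp: indicator_def mult.commute
        less_imp_le[OF levy_density_pos[OF sc]])
qed

lemma bernstein_fun_eq: "bernstein_fun \<phi> \<psi> l = (\<integral>s. (1 - exp (-(l * s))) \<partial>levy_measure \<phi> \<psi>)"
  unfolding bernstein_fun_def by (subst lebesgue_integral_levy_measure) simp_all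

lemma integrable_min_levy_measure:
  assumes "(\<integral>\<^sup>+ t\<in>{0<..}. ennreal (min 1 t * levy_density \<phi> \<psi> t) \<partial>lborel) < \<infinity>"
  shows "integrable (levy_measure \<phi> \<psi>) (\<lambda>s. min 1 s)"
proof (rule integrableI_bounded)
  have "(\<integral>\<^sup>+s. ennreal (norm (min 1 s)) \<partial>levy_measure \<phi> \<psi>) = (\<integral>\<^sup>+ t\<in>{0<..}. ennreal (min 1 t * levy_density \<phi> \<psi> t) \<partial>lborel)"
    by (subst nn_integral_levy_measure)
      (auto intro!: nn_integral_cong simp: indicator_def ennreal_mult less_imp_le[OF levy_density_pos[OF sc]])
  then show "(\<integral>\<^sup>+s. ennreal (norm (min 1 s)) \<partial>levy_measure \<phi> \<psi>) < \<infinity>" using assms by simp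
qed simp

text \<open>Both sides are comparable to \<open>1 / \<psi> r\<close>, by the upper scaling of \<open>\<phi>\<close> and the lower scaling
  of \<open>\<psi>\<close>.\<close>

lemma levy_measure_tail_le:
  "\<exists>K\<ge>0. \<forall>r>0. emeasure (levy_measure \<phi> \<psi>) {\<phi> r<..} \<le>
     ennreal K * (\<integral>\<^sup>+s. ennreal (s / \<phi> r) * indicator {0<..\<phi> r} s \<partial>levy_measure \<phi> \<psi>)"
proof -
  obtain a1 a2 C where a: "0 < a1" "a1 \<le> a2" "C \<ge> 1"
    and up: "\<And>r R. 0 < r \<Longrightarrow> r \<le> R \<Longrightarrow> \<phi> R / \<phi> r \<le> C * (R / r) powr a2"
    using sc(1) unfolding scale_function_def LU_def by blast
  obtain b1 b2 D where b: "0 < b1" "D \<ge> 1"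
    and low: "\<And>r R. 0 < r \<Longrightarrow> r \<le> R \<Longrightarrow> inverse D * (R / r) powr b1 \<le> \<psi> R / \<psi> r"
    using sc(2) unfolding scale_function_def LU_def by blast
  \<comment> \<open>Upper scaling bounds \<open>t / A\<close> by \<open>C * (R / r) powr a2\<close>,
    lower scaling bounds \<open>(R / r) powr b1\<close> by a multiple of
    \<open>\<psi> R / \<psi> r\<close>; eliminating \<open>R / r\<close> leaves this
    exponent.\<close>
  define \<gamma> where "\<gamma> = b1 / a2"
  have \<gamma>: "\<gamma> > 0" using a b by (simp add: \<gamma>_def)
  define K where "K = D * C powr \<gamma>"
  have K: "K > 0" using a b by (simp add: K_def)
  show ?thesis
  proof (intro exI[of _ "K / \<gamma>"] conjI allI impI)
    show "0 \<le> K / \<gamma>" using K \<gamma> by simp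
    fix r :: real assume r: "r > 0"
    define A where "A = \<phi> r"
    have A: "A > 0" using r sc by (simp add: A_def scale_pos)
    have psr: "\<psi> r > 0" using r sc by (simp add: scale_pos)
    \<comment> \<open>Beyond \<open>A\<close> the density decays at least like a power below
      \<open>-1\<close>, so the tail integral is at most a multiple of
      \<open>1 / \<psi> r\<close>.\<close>
    have dens: "levy_density \<phi> \<psi> t \<le> K / \<psi> r * (1 / A) * (t / A) powr (-\<gamma> - 1)" if t: "t \<ge> A" for t
    proof -
      define R where "R = scale_inv \<phi> t"
      have t0: "t > 0" using t A by simp
      have R: "r \<le> R" "\<phi> R = t" "R > 0"
        using le_scale_inv_iff[OF sc(1), of r t] t t0 r scale_inv_pos[OF sc(1) t0] scale_scale_inv[OF sc(1), of t]
        by (auto simp: R_def A_def)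
      have "t / A \<le> C * (R / r) powr a2" using up[OF r R(1)] R by (simp add: A_def)
      then have "(t / A) powr \<gamma> \<le> (C * (R / r) powr a2) powr \<gamma>"
        using \<gamma> t0 A by (intro powr_mono2) auto
      also have "\<dots> = C powr \<gamma> * (R / r) powr b1"
        using a by (simp add: powr_mult powr_powr \<gamma>_def)
      finally have 1: "(t / A) powr \<gamma> \<le> C powr \<gamma> * (R / r) powr b1" .
      have "(R / r) powr b1 \<le> D * (\<psi> R / \<psi> r)" using low[OF r R(1)] b by (simp add: field_simps)
      then have "C powr \<gamma> * (R / r) powr b1 \<le> C powr \<gamma> * (D * (\<psi> R / \<psi> r))" by (intro mult_left_mono) auto
      with 1 have "(t / A) powr \<gamma> \<le> K * (\<psi> R / \<psi> r)" by (simp add: K_def mult_ac)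
      then have 2: "\<psi> r * (t / A) powr \<gamma> \<le> K * \<psi> R" using psr by (simp add: field_simps)
      have psR: "\<psi> R > 0" using R sc by (simp add: scale_pos)
      have tp: "(t / A) powr \<gamma> > 0" using t0 A by simp
      have "1 / \<psi> R \<le> K / (\<psi> r * (t / A) powr \<gamma>)"
        using 2 psR psr tp by (simp add: field_simps)
      then have "1 / t * (1 / \<psi> R) \<le> 1 / t * (K / (\<psi> r * (t / A) powr \<gamma>))"
        using t0 by (intro mult_left_mono) auto
      also have "\<dots> = K / \<psi> r * (1 / A) * (t / A) powr (-\<gamma> - 1)"
        using t0 A by (simp add: powr_diff powr_minus field_simps)
      finally show ?thesis by (simp add: levy_density_def R_def)
    qed
    have "emeasure (levy_measure \<phi> \<psi>) {A<..} = (\<integral>\<^sup>+s. indicator {A<..} s \<partial>levy_measure \<phi> \<psi>)"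
      by simp
    also have "\<dots> = (\<integral>\<^sup>+t. indicator {A<..} t * ennreal (levy_density \<phi> \<psi> t) * indicator {0<..} t \<partial>lborel)"
      by (rule nn_integral_levy_measure) simp
    also have "\<dots> \<le> (\<integral>\<^sup>+t. ennreal (K / \<psi> r * (1 / A) * (t / A) powr (-\<gamma> - 1)) * indicator {A..} t \<partial>lborel)"
      by (rule nn_integral_mono) (use dens[OF less_imp_le] in \<open>auto simp: indicator_def intro!: ennreal_leI\<close>)
    also have "\<dots> = ennreal (0 - (- (K / \<psi> r / \<gamma>) * (A / A) powr (-\<gamma>)))"
    proof (rule nn_integral_FTC_atLeast[where F="\<lambda>t. - (K / \<psi> r / \<gamma>) * (t / A) powr (-\<gamma>)"])
      fix x assume x: "A \<le> x"
      then show "((\<lambda>t. - (K / \<psi> r / \<gamma>) * (t / A) powr (-\<gamma>)) has_real_derivative K / \<psi> r * (1 / A) * (x / A) powr (-\<gamma> - 1)) (at x)"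
        using A \<gamma> psr by (auto intro!: derivative_eq_intros simp: powr_diff field_simps)
      show "0 \<le> K / \<psi> r * (1 / A) * (x / A) powr (-\<gamma> - 1)" using K psr A by simp
    next
      have "filterlim (\<lambda>t. 1 / A * t) at_top at_top"
        by (rule filterlim_tendsto_pos_mult_at_top[OF tendsto_const _ filterlim_ident]) (use A in simp)
      then have "((\<lambda>t. (t / A) powr (-\<gamma>)) \<longlongrightarrow> 0) at_top"
        using \<gamma> by (intro tendsto_neg_powr) auto
      then show "((\<lambda>t. - (K / \<psi> r / \<gamma>) * (t / A) powr (-\<gamma>)) \<longlongrightarrow> 0) at_top"
        by (rule tendsto_mult_right_zero)
    qed simp
    also have "\<dots> = ennreal (K / \<gamma>) * ennreal (1 / \<psi> r)"
      using A K \<gamma> psr by (simp flip: ennreal_mult)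
    \<comment> \<open>On \<open>{0<..A}\<close> the density is at least
      \<open>1 / (t * \<psi> r)\<close>; the factor \<open>t / A\<close> turns this into the
      constant \<open>1 / (A * \<psi> r)\<close> on an interval of length \<open>A\<close>.\<close>
    also have "ennreal (1 / \<psi> r) \<le> (\<integral>\<^sup>+s. ennreal (s / A) * indicator {0<..A} s \<partial>levy_measure \<phi> \<psi>)"
    proof -
      have "ennreal (1 / \<psi> r) = (\<integral>\<^sup>+t. ennreal (1 / (A * \<psi> r)) * indicator {0<..A} t \<partial>lborel)"
        using A psr by (simp add: nn_integral_cmult flip: ennreal_mult)
      also have "\<dots> \<le> (\<integral>\<^sup>+t. ennreal (t / A) * indicator {0<..A} t * ennreal (levy_density \<phi> \<psi> t) * indicator {0<..} t \<partial>lborel)"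
      proof (rule nn_integral_mono)
        fix t
        have "1 / (A * \<psi> r) \<le> t / A * levy_density \<phi> \<psi> t" if "0 < t" "t \<le> A"
        proof -
          have "scale_inv \<phi> t \<le> r" using scale_inv_le_iff[OF sc(1), of r t] that r by (simp add: A_def)
          then have "\<psi> (scale_inv \<phi> t) \<le> \<psi> r" using scale_le_iff[OF sc(2)] scale_inv_pos[OF sc(1) that(1)] r by simp
          moreover have "\<psi> (scale_inv \<phi> t) > 0" using scale_pos[OF sc(2) scale_inv_pos[OF sc(1) that(1)]] .
          ultimately show ?thesis using that A psr by (simp add: levy_density_def field_simps)
        qed
        then show "ennreal (1 / (A * \<psi> r)) * indicator {0<..A} t \<le> ennreal (t / A) * indicator {0<..A} t * ennreal (levy_density \<phi> \<psi> t) * indicator {0<..} t"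
          using A less_imp_le[OF levy_density_pos[OF sc]] by (auto simp: indicator_def simp flip: ennreal_mult intro!: ennreal_leI)
      qed
      also have "\<dots> = (\<integral>\<^sup>+s. ennreal (s / A) * indicator {0<..A} s \<partial>levy_measure \<phi> \<psi>)"
        by (rule nn_integral_levy_measure[symmetric]) measurable
      finally show ?thesis .
    qed
    finally show "emeasure (levy_measure \<phi> \<psi>) {\<phi> r<..} \<le>
      ennreal (K / \<gamma>) * (\<integral>\<^sup>+s. ennreal (s / \<phi> r) * indicator {0<..\<phi> r} s \<partial>levy_measure \<phi> \<psi>)"
      by (simp add: A_def mult_left_mono)
  qed
qed

lemma integrable_one_minus_exp_levy_measure:
  assumes fin: "integrable (levy_measure \<phi> \<psi>) (\<lambda>s. min 1 s)" and l: "l \<ge> 0"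
  shows "integrable (levy_measure \<phi> \<psi>) (\<lambda>s. 1 - exp (-(l * s)))"
proof (rule Bochner_Integration.integrable_bound[OF integrable_mult_right[OF fin, of "max 1 l"]])
  show "AE s in levy_measure \<phi> \<psi>. norm (1 - exp (-(l * s))) \<le> norm (max 1 l * min 1 s)"
    using AE_levy_measure_pos
  proof eventually_elim
    case (elim s)
    have "1 - exp (-(l * s)) \<le> min (l * s) 1" using elim l by (intro one_minus_exp_le) simp
    also have "\<dots> \<le> max 1 l * min 1 s"
    proof (cases "s \<le> 1")
      case True
      then have "l * s \<le> max 1 l * s" using elim by (simp add: mult_le_cancel_right1)
      then show ?thesis using True by simp
    qed simp
    finally show ?case using elim l by simp
  qed
qed simp_all

text \<open>The two integrals are those produced by the two heat kernel bounds: the upper one sees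
  all times, while the lower one is used only for \<open>s \<le> \<phi> r\<close>. That large times
  cost no more than a constant is \<open>levy_measure_tail_le\<close>; the summand \<open>1\<close>
  in \<open>1 + K\<close> accounts for the small times.\<close>

lemma bernstein_fun_comparison:
  assumes fin: "integrable (levy_measure \<phi> \<psi>) (\<lambda>s. min 1 s)"
  shows "\<exists>K>0. \<forall>r>0. 0 \<le> bernstein_fun \<phi> \<psi> (inverse (\<phi> r)) \<and>
    (\<integral>\<^sup>+s. ennreal (min 1 (s / \<phi> r)) \<partial>levy_measure \<phi> \<psi>) \<le> ennreal (2 * bernstein_fun \<phi> \<psi> (inverse (\<phi> r))) \<and>
    ennreal (bernstein_fun \<phi> \<psi> (inverse (\<phi> r))) \<le>
      ennreal K * (\<integral>\<^sup>+s. ennreal (s / \<phi> r) * indicator {0<..\<phi> r} s \<partial>levy_measure \<phi> \<psi>)"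
proof -
  obtain K where K: "K \<ge> 0" and tail: "\<And>r. r > 0 \<Longrightarrow> emeasure (levy_measure \<phi> \<psi>) {\<phi> r<..} \<le>
     ennreal K * (\<integral>\<^sup>+s. ennreal (s / \<phi> r) * indicator {0<..\<phi> r} s \<partial>levy_measure \<phi> \<psi>)"
    using levy_measure_tail_le by blast
  show ?thesis
  proof (intro exI[of _ "1 + K"] conjI allI impI)
    show "0 < 1 + K" using K by simp
    fix r :: real assume r: "r > 0"
    define A where "A = \<phi> r"
    have A: "A > 0" using r sc by (simp add: A_def scale_pos)
    let ?N = "levy_measure \<phi> \<psi>"
    let ?B = "bernstein_fun \<phi> \<psi> (inverse (\<phi> r))"
    have int: "integrable ?N (\<lambda>s. 1 - exp (-(inverse A * s)))"
      using A by (intro integrable_one_minus_exp_levy_measure fin) simp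
    have pos: "AE s in ?N. 0 \<le> 1 - exp (-(inverse A * s))" using AE_levy_measure_pos A by (auto elim!: eventually_mono)
    have B: "?B = (\<integral>s. (1 - exp (-(inverse A * s))) \<partial>?N)" by (simp add: bernstein_fun_eq A_def)
    show B0: "0 \<le> ?B" unfolding B using pos by (rule integral_nonneg_AE)
    have nnB: "ennreal ?B = (\<integral>\<^sup>+s. ennreal (1 - exp (-(inverse A * s))) \<partial>?N)"
      unfolding B by (rule nn_integral_eq_integral[symmetric, OF int pos])
    have "(\<integral>\<^sup>+s. ennreal (min 1 (s / A)) \<partial>?N) \<le> (\<integral>\<^sup>+s. ennreal 2 * ennreal (1 - exp (-(inverse A * s))) \<partial>?N)"
    proof (rule nn_integral_mono_AE)
      show "AE s in ?N. ennreal (min 1 (s / A)) \<le> ennreal 2 * ennreal (1 - exp (-(inverse A * s)))"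
        using AE_levy_measure_pos
      proof eventually_elim
        case (elim s)
        have "min (s / A) 1 \<le> 2 * (1 - exp (-(s / A)))" using elim A by (intro min_le_one_minus_exp) simp
        then have "min 1 (s / A) \<le> 2 * (1 - exp (-(inverse A * s)))"
          by (simp add: min.commute divide_inverse mult.commute)
        then have "ennreal (min 1 (s / A)) \<le> ennreal (2 * (1 - exp (-(inverse A * s))))" by (rule ennreal_leI)
        then show ?case using elim A by (subst (asm) ennreal_mult) auto
      qed
    qed
    also have "\<dots> = ennreal 2 * ennreal ?B" unfolding nnB by (rule nn_integral_cmult) measurable
    also have "\<dots> = ennreal (2 * ?B)" using B0 by (simp add: ennreal_mult)
    finally show "(\<integral>\<^sup>+s. ennreal (min 1 (s / \<phi> r)) \<partial>?N) \<le> ennreal (2 * ?B)" by (simp add: A_def)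
    have "ennreal ?B \<le> (\<integral>\<^sup>+s. ennreal (s / A) * indicator {0<..A} s + indicator {A<..} s \<partial>?N)"
      unfolding nnB
    proof (rule nn_integral_mono_AE)
      show "AE s in ?N. ennreal (1 - exp (-(inverse A * s))) \<le> ennreal (s / A) * indicator {0<..A} s + indicator {A<..} s"
        using AE_levy_measure_pos
      proof eventually_elim
        case (elim s)
        have "1 - exp (-(s / A)) \<le> min (s / A) 1" using elim A by (intro one_minus_exp_le) simp
        then have "1 - exp (-(inverse A * s)) \<le> s / A" "1 - exp (-(inverse A * s)) \<le> 1"
          by (simp_all add: divide_inverse mult.commute)
        then show ?case using elim by (cases "s \<le> A") (auto simp: ennreal_leI)
      qed
    qed
    also have "\<dots> = (\<integral>\<^sup>+s. ennreal (s / A) * indicator {0<..A} s \<partial>?N) + emeasure ?N {A<..}"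
      by (subst nn_integral_add) auto
    also have "\<dots> \<le> (\<integral>\<^sup>+s. ennreal (s / A) * indicator {0<..A} s \<partial>?N) + ennreal K * (\<integral>\<^sup>+s. ennreal (s / A) * indicator {0<..A} s \<partial>?N)"
      using tail[OF r] by (intro add_left_mono) (simp add: A_def)
    also have "\<dots> = ennreal (1 + K) * (\<integral>\<^sup>+s. ennreal (s / A) * indicator {0<..A} s \<partial>?N)"
      using K by (simp add: ring_distribs ennreal_plus)
    finally show "ennreal ?B \<le> ennreal (1 + K) * (\<integral>\<^sup>+s. ennreal (s / \<phi> r) * indicator {0<..\<phi> r} s \<partial>?N)"
      by (simp add: A_def)
  qed
qed

end

section \<open>Metric measure spaces and regular forms\<close>

definition off_diagonal :: "('a \<times> 'a) set" where
  "off_diagonal = {(x, y). x \<noteq> y}"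

lemma open_off_diagonal: "open (off_diagonal :: ('a::t2_space \<times> 'a) set)"
proof -
  have "closed {z :: 'a \<times> 'a. fst z = snd z}"
    by (intro closed_Collect_eq continuous_on_fst continuous_on_snd continuous_on_id)
  then have "open (- {z :: 'a \<times> 'a. fst z = snd z})" by (rule open_Compl)
  moreover have "- {z :: 'a \<times> 'a. fst z = snd z} = off_diagonal" by (auto simp: off_diagonal_def)
  ultimately show ?thesis by metis
qed

lemma off_diagonal_sets[measurable]: "off_diagonal \<in> sets (borel \<Otimes>\<^sub>M borel :: ('a::{t2_space,second_countable_topology} \<times> 'a) measure)"
  unfolding borel_prod by (rule borel_open[OF open_off_diagonal])

lemma offdiag_radon_swap:
  fixes Jm :: "('a::{metric_space,second_countable_topology} \<times> 'a) measure"
  assumes "offdiag_radon Jm"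
  shows "distr Jm borel (\<lambda>z. (snd z, fst z)) = Jm"
proof (rule measure_eqI)
  have s: "sets Jm = sets borel" and sym: "\<And>A. A \<in> sets borel \<Longrightarrow> emeasure Jm {(x, y). (y, x) \<in> A} = emeasure Jm A"
    using assms by (auto simp: offdiag_radon_def)
  show "sets (distr Jm borel (\<lambda>z. (snd z, fst z))) = sets Jm" by (simp add: s)
  have m: "(\<lambda>z. (snd z, fst z)) \<in> Jm \<rightarrow>\<^sub>M borel"
    unfolding measurable_cong_sets[OF s refl]
    by (intro borel_measurable_continuous_onI continuous_intros)
  fix A assume "A \<in> sets (distr Jm borel (\<lambda>z. (snd z, fst z)))"
  then have A: "A \<in> sets borel" by simp
  have "(\<lambda>z. (snd z, fst z)) -` A \<inter> space Jm = {(x, y). (y, x) \<in> A}"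
    using sets_eq_imp_space_eq[OF s] by auto
  then show "emeasure (distr Jm borel (\<lambda>z. (snd z, fst z))) A = emeasure Jm A"
    using sym[OF A] by (simp add: emeasure_distr[OF m A])
qed

section \<open>Locally compact doubling spaces and their test functions\<close>

locale metric_measure =
  fixes \<mu> :: "'a::{metric_space,second_countable_topology} measure"
  assumes lc: "locally_compact_space (euclidean :: 'a topology)"
    and radon: "radon_measure \<mu>" and full: "full_support \<mu>" and doubling: "volume_doubling \<mu>"
begin

lemma sets_mu[measurable_cong, simp]: "sets \<mu> = sets borel"
  using radon by (simp add: radon_measure_def)

lemma space_mu[simp]: "space \<mu> = UNIV"
  using sets_eq_imp_space_eq[OF sets_mu] by simp

lemma sets_prod: "sets (\<mu> \<Otimes>\<^sub>M \<mu>) = sets borel"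
  using sets_pair_measure_cong[OF sets_mu sets_mu] by (metis borel_prod)

lemma compact_finite: "compact K \<Longrightarrow> emeasure \<mu> K < \<infinity>"
  using radon by (simp add: radon_measure_def)

lemma small_compact_cball:
  fixes x :: 'a
  assumes "open V" "x \<in> V"
  shows "\<exists>e>0. compact (cball x e) \<and> cball x e \<subseteq> V"
proof -
  obtain U K where U: "open U" "compact K" "x \<in> U" "U \<subseteq> K"
  proof -
    have "\<forall>y. \<exists>U K. open U \<and> compact K \<and> (y::'a) \<in> U \<and> U \<subseteq> K" using lc unfolding locally_compact_space_def by simp
    then have "\<exists>U K. open U \<and> compact K \<and> x \<in> U \<and> U \<subseteq> K" by (rule spec)
    then show ?thesis using that by blast
  qed
  obtain e where e: "e > 0" "cball x e \<subseteq> U \<inter> V"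
  proof -
    have "\<exists>e>0. cball x e \<subseteq> U \<inter> V" using open_contains_cball[of "U \<inter> V"] U assms by blast
    then show ?thesis using that by blast
  qed
  have "compact (K \<inter> cball x e)" using U(2) by (intro compact_Int_closed) auto
  moreover have "K \<inter> cball x e = cball x e" using e U by auto
  ultimately show ?thesis using e by auto
qed

lemma emeasure_ball_pos: "0 < r \<Longrightarrow> 0 < emeasure \<mu> (ball x r)"
  using full by (auto simp: full_support_def)

text \<open>A small ball lies in a compact one and so has finite measure; doubling bounds its ratio
  to every larger ball. This justifies the real-valued \<open>vol\<close> and makes
  \<open>\<mu>\<close> sigma-finite.\<close>

lemma emeasure_ball_finite: "emeasure \<mu> (ball x R) < \<infinity>"
proof -
  obtain e where e: "e > 0" "compact (cball x e)" using small_compact_cball[of UNIV x] by auto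
  have fe: "emeasure \<mu> (ball x e) < \<infinity>"
  proof (rule le_less_trans[OF emeasure_mono compact_finite[OF e(2)]])
    show "ball x e \<subseteq> cball x e" by (rule ball_subset_cball)
  qed auto
  show ?thesis
  proof (cases "R \<le> e")
    case True
    then have "emeasure \<mu> (ball x R) \<le> emeasure \<mu> (ball x e)" by (intro emeasure_mono subset_ball) auto
    then show ?thesis using fe by (rule le_less_trans)
  next
    case False
    then obtain C d2 where "emeasure \<mu> (ball x R) / emeasure \<mu> (ball x e) \<le> ennreal (C * (R / e) powr d2)"
      using doubling e unfolding volume_doubling_def by (meson less_eq_real_def linorder_not_le)
    then have "emeasure \<mu> (ball x R) / emeasure \<mu> (ball x e) \<noteq> \<infinity>" by (auto simp: top_unique)
    then have "emeasure \<mu> (ball x R) \<noteq> \<infinity>"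
      using fe by (auto simp: ennreal_top_divide split: if_splits)
    then show ?thesis by (simp add: less_top)
  qed
qed

lemma vol_pos: "0 < r \<Longrightarrow> 0 < vol \<mu> x r"
  using emeasure_ball_pos[of r x] emeasure_ball_finite[of x r]
  by (simp add: vol_def measure_def enn2real_positive_iff)

lemma vol_mono: "r \<le> R \<Longrightarrow> vol \<mu> x r \<le> vol \<mu> x R"
  unfolding vol_def
  by (rule measure_mono_fmeasurable) (use emeasure_ball_finite in \<open>auto simp: fmeasurable_def subset_ball\<close>)

lemma vol_mono': "ball x r \<subseteq> ball y R \<Longrightarrow> vol \<mu> x r \<le> vol \<mu> y R"
  unfolding vol_def
  by (rule measure_mono_fmeasurable) (use emeasure_ball_finite in \<open>auto simp: fmeasurable_def\<close>)

sublocale sigma_finite_measure \<mu>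
proof
  fix x0 :: 'a
  have "UNIV = (\<Union>n. ball x0 (real n))" using reals_Archimedean2 by (auto simp: set_eq_iff)
  then show "\<exists>A. countable A \<and> A \<subseteq> sets \<mu> \<and> \<Union>A = space \<mu> \<and> (\<forall>a\<in>A. emeasure \<mu> a \<noteq> \<infinity>)"
    using emeasure_ball_finite[of x0] by (intro exI[of _ "range (\<lambda>n. ball x0 (real n))"]) (auto simp: less_top)
qed

sublocale pair: pair_sigma_finite \<mu> \<mu> ..

lemma compact_subset_open_margin:
  fixes K :: "'a set"
  assumes K: "compact K" "K \<noteq> {}" and V: "open V" "K \<subseteq> V"
  shows "\<exists>e>0. \<forall>x. infdist x K \<le> e \<longrightarrow> x \<in> V"
proof (cases "V = UNIV")
  case False
  have "continuous_on K (\<lambda>x. infdist x (- V))" by (intro continuous_intros)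
  from continuous_attains_inf[OF K this] obtain x where x: "x \<in> K" "\<And>y. y \<in> K \<Longrightarrow> infdist x (-V) \<le> infdist y (-V)" by auto
  define e where "e = infdist x (- V)"
  have e: "e > 0" unfolding e_def using V x False by (intro infdist_pos_not_in_closed) (auto simp: closed_Compl)
  have "y \<in> V" if y: "infdist y K \<le> e / 2" for y
  proof (rule ccontr)
    assume "y \<notin> V"
    have "\<exists>k\<in>K. dist y k < e"
    proof (rule ccontr)
      assume "\<not> ?thesis"
      then have "e \<le> infdist y K" unfolding infdist_notempty[OF K(2)] by (intro cINF_greatest K) auto
      then show False using y e by simp
    qed
    then obtain k where k: "k \<in> K" "dist y k < e" by blast
    have "e \<le> infdist k (-V)" using x k by (simp add: e_def)
    also have "\<dots> \<le> dist k y" using \<open>y \<notin> V\<close> by (intro infdist_le) simp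
    finally show False using k by (simp add: dist_commute)
  qed
  then show ?thesis using e by (intro exI[of _ "e/2"]) auto
qed (use zero_less_one in blast)

lemma compact_open_neighbourhood:
  fixes K :: "'a set"
  assumes K: "compact K" and V: "open V" "K \<subseteq> V"
  shows "\<exists>W. open W \<and> K \<subseteq> W \<and> compact (closure W) \<and> closure W \<subseteq> V"
proof -
  obtain e where e: "\<And>x. x \<in> K \<Longrightarrow> e x > 0 \<and> compact (cball x (e x)) \<and> cball x (e x) \<subseteq> V"
    using small_compact_cball[OF V(1)] V(2) by (metis subsetD)
  obtain D where D: "D \<subseteq> K" "finite D" "K \<subseteq> (\<Union>x\<in>D. ball x (e x))"
    by (rule compactE_image[OF K, of K "\<lambda>x. ball x (e x)"]) (use e in auto)
  have cp: "compact (\<Union>x\<in>D. cball x (e x))" using D e by (intro compact_UN) auto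
  have sub: "closure (\<Union>x\<in>D. ball x (e x)) \<subseteq> (\<Union>x\<in>D. cball x (e x))"
    by (rule closure_minimal) (use compact_imp_closed[OF cp] in \<open>auto\<close>)
  have "compact (closure (\<Union>x\<in>D. ball x (e x)))"
    using compact_Int_closed[OF cp closed_closure] sub by (metis inf.absorb_iff2)
  then show ?thesis using D e sub
    by (intro exI[of _ "\<Union>x\<in>D. ball x (e x)"]) (auto, blast)
qed

lemma C_c_Urysohn:
  fixes K :: "'a set"
  assumes K: "compact K" and V: "open V" "K \<subseteq> V"
  shows "\<exists>f\<in>C_c. (\<forall>x. 0 \<le> f x \<and> f x \<le> 1) \<and> (\<forall>x\<in>K. f x = (1::real)) \<and> closure {x. f x \<noteq> 0} \<subseteq> V"
proof (cases "K = {}")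
  case True
  then show ?thesis by (intro bexI[of _ "\<lambda>_. 0"]) (auto simp: C_c_def)
next
  case False
  obtain W where W: "open W" "K \<subseteq> W" "compact (closure W)" "closure W \<subseteq> V"
    using compact_open_neighbourhood[OF K V] by blast
  obtain e where e: "e > 0" "\<And>x. infdist x K \<le> e \<Longrightarrow> x \<in> W"
    using compact_subset_open_margin[OF K False W(1,2)] by blast
  define f where "f x = max 0 (1 - infdist x K / e)" for x
  have cl: "closure {x. f x \<noteq> 0} \<subseteq> closure W"
    by (rule closure_mono) (use e in \<open>auto simp: f_def max_def field_simps split: if_splits\<close>)
  have "compact (closure {x. f x \<noteq> 0})"
    using compact_Int_closed[OF W(3) closed_closure] cl by (metis inf.absorb_iff2)
  moreover have "continuous_on UNIV f" unfolding f_def using e by (intro continuous_intros) auto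
  ultimately have "f \<in> C_c" by (simp add: C_c_def)
  then show ?thesis
    by (rule bexI[rotated]) (use cl W e infdist_nonneg[of _ K] in \<open>auto simp: f_def\<close>)
qed

text \<open>By local compactness the members of a countable basis with compact closure inside
  \<open>V\<close> cover \<open>V\<close>; Urysohn functions for the finite unions of these closures
  are eventually \<open>1\<close> at each point of \<open>V\<close>. This is the bridge from test
  functions to Borel sets.\<close>

lemma C_c_approx_open:
  fixes V :: "'a set"
  assumes V: "open V"
  shows "\<exists>f::nat \<Rightarrow> 'a \<Rightarrow> real. \<forall>n. f n \<in> C_c \<and> (\<forall>x. 0 \<le> f n x \<and> f n x \<le> 1) \<and>
    closure {x. f n x \<noteq> 0} \<subseteq> V \<and> (\<forall>x. (\<lambda>n. f n x) \<longlonglongrightarrow> indicator V x)"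
proof -
  obtain B :: "'a set set" where B: "countable B" "topological_basis B" using ex_countable_basis by blast
  \<comment> \<open>The empty set is added so that \<open>from_nat_into\<close> enumerates a
    nonempty family even if no basis element qualifies.\<close>
  define BB where "BB = insert {} {b\<in>B. compact (closure b) \<and> closure b \<subseteq> V}"
  have BB: "countable BB" "BB \<noteq> {}" using B by (auto simp: BB_def)
  define K where "K n = (\<Union>i\<le>n. closure (from_nat_into BB i))" for n :: nat
  have inBB: "from_nat_into BB i \<in> BB" for i using BB(2) by (rule from_nat_into)
  have BBp: "compact (closure b)" "closure b \<subseteq> V" if "b \<in> BB" for b using that by (auto simp: BB_def)
  have "compact (K n)" "K n \<subseteq> V" for n
    unfolding K_def by (intro compact_UN BBp inBB UN_least finite_atMost)+
  then have "\<exists>f\<in>C_c. (\<forall>x. 0 \<le> f x \<and> f x \<le> 1) \<and> (\<forall>x\<in>K n. f x = (1::real)) \<and> closure {x. f x \<noteq> 0} \<subseteq> V" for n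
    by (intro C_c_Urysohn V)
  then obtain f where f: "\<And>n. f n \<in> C_c" "\<And>n x. 0 \<le> f n x" "\<And>n x. f n x \<le> 1" "\<And>n x. x \<in> K n \<Longrightarrow> f n x = (1::real)"
     "\<And>n. closure {x. f n x \<noteq> 0} \<subseteq> V" by metis
  have "(\<lambda>n. f n x) \<longlonglongrightarrow> indicator V x" for x
  proof (cases "x \<in> V")
    case True
    obtain e where e: "e > 0" "compact (cball x e)" "cball x e \<subseteq> V" using small_compact_cball[OF V True] by auto
    obtain b where b: "b \<in> B" "x \<in> b" "b \<subseteq> ball x e"
      using topological_basisE[OF B(2), of "ball x e" x] e by auto
    have cb: "closure b \<subseteq> cball x e" using b ball_subset_cball by (intro closure_minimal) auto
    have "compact (closure b)" using compact_Int_closed[OF e(2) closed_closure] cb by (metis inf.absorb_iff2)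
    then have "b \<in> BB" using b cb e by (auto simp: BB_def)
    then obtain i where i: "from_nat_into BB i = b" using from_nat_into_surj[OF BB(1)] by blast
    have "x \<in> K n" if "n \<ge> i" for n unfolding K_def using that i b closure_subset by blast
    then have "\<forall>\<^sub>F n in sequentially. f n x = 1" by (intro eventually_sequentiallyI[of i] f)
    then show ?thesis using True by (simp add: tendsto_eventually)
  next
    case False
    then have "x \<notin> closure {x. f n x \<noteq> 0}" for n using f(5)[of n] by (rule contra_subsetD[rotated])
    then have "x \<notin> {x. f n x \<noteq> 0}" for n by (rule contra_subsetD[OF closure_subset])
    then have "f n x = 0" for n by simp
    then show ?thesis using False by simp
  qed
  then show ?thesis using f by (intro exI[of _ f]) auto
qed

lemma C_c_bounded: "f \<in> C_c \<Longrightarrow> \<exists>M>0. \<forall>x::'a. \<bar>f x\<bar> \<le> (M::real)"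
proof -
  assume f: "f \<in> C_c"
  then have "continuous_on (closure {x. f x \<noteq> 0}) f" "compact (closure {x. f x \<noteq> 0})"
    using continuous_on_subset[of UNIV f] by (simp_all add: C_c_def)
  then have "compact (f ` closure {x. f x \<noteq> 0})" by (rule compact_continuous_image)
  then obtain M where M: "M > 0" "\<forall>y\<in>f ` closure {x. f x \<noteq> 0}. norm y \<le> M"
    using compact_imp_bounded bounded_pos by metis
  have "\<bar>f x\<bar> \<le> M" for x
    using M closure_subset[of "{x. f x \<noteq> 0}"] by (cases "f x = 0") auto
  then show ?thesis using M by blast
qed

lemma C_c_measurable: "f \<in> C_c \<Longrightarrow> f \<in> borel_measurable borel"
  by (auto simp: C_c_def intro: borel_measurable_continuous_onI)

lemma C_c_integrable:
  assumes f: "f \<in> C_c" shows "integrable \<mu> (f :: 'a \<Rightarrow> real)"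
proof -
  obtain M where M: "M > 0" "\<And>x. \<bar>f x\<bar> \<le> M" using C_c_bounded[OF f] by blast
  let ?K = "closure {x. f x \<noteq> 0}"
  have "compact ?K" using f by (simp add: C_c_def)
  then have "integrable \<mu> (\<lambda>x. M * indicator ?K x :: real)"
    using compact_finite by (intro integrable_mult_right integrable_real_indicator) auto
  then show ?thesis
  proof (rule Bochner_Integration.integrable_bound)
    show "f \<in> borel_measurable \<mu>" using C_c_measurable[OF f] by simp
    show "AE x in \<mu>. norm (f x) \<le> norm (M * indicator ?K x)"
      using M closure_subset[of "{x. f x \<noteq> 0}"] by (intro AE_I2) (auto simp: indicator_def)
  qed
qed

section \<open>Square integrable functions and bilinear identities\<close>

lemma L2_integrable_mult: "u \<in> L2 \<mu> \<Longrightarrow> v \<in> L2 \<mu> \<Longrightarrow> integrable \<mu> (\<lambda>x. u x * v x)"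
proof (rule Bochner_Integration.integrable_bound)
  assume u: "u \<in> L2 \<mu>" and v: "v \<in> L2 \<mu>"
  show "integrable \<mu> (\<lambda>x. (u x)\<^sup>2 + (v x)\<^sup>2)" using u v by (simp add: L2_def)
  show "(\<lambda>x. u x * v x) \<in> borel_measurable \<mu>" using u v by (auto simp: L2_def intro: borel_measurable_times)
  have "\<bar>a * b\<bar> \<le> a\<^sup>2 + b\<^sup>2" for a b :: real
  proof -
    have "2 * \<bar>a * b\<bar> \<le> a\<^sup>2 + b\<^sup>2" using sum_squares_bound[of "\<bar>a\<bar>" "\<bar>b\<bar>"] by (simp add: abs_mult)
    moreover have "0 \<le> \<bar>a * b\<bar>" by simp
    ultimately show ?thesis by linarith
  qed
  then show "AE x in \<mu>. norm (u x * v x) \<le> norm ((u x)\<^sup>2 + (v x)\<^sup>2)" by simp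
qed

lemma L2_measurable: "u \<in> L2 \<mu> \<Longrightarrow> u \<in> borel_measurable borel"
  by (simp add: L2_def cong: measurable_cong_sets)

lemma L2_scale: "u \<in> L2 \<mu> \<Longrightarrow> (\<lambda>x. c * u x) \<in> L2 \<mu>"
  by (auto simp: L2_def power_mult_distrib)

lemma L2_add: "u \<in> L2 \<mu> \<Longrightarrow> v \<in> L2 \<mu> \<Longrightarrow> (\<lambda>x. u x + v x) \<in> L2 \<mu>"
  using L2_integrable_mult[of u v] integrable_mult_right[of 2 \<mu> "\<lambda>x. u x * v x"]
  by (auto simp: L2_def power2_sum mult.assoc intro!: borel_measurable_add)

lemma L2_diff: "u \<in> L2 \<mu> \<Longrightarrow> v \<in> L2 \<mu> \<Longrightarrow> (\<lambda>x. u x - v x) \<in> L2 \<mu>"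
  using L2_add[of u "\<lambda>x. -1 * v x"] L2_scale[of v "-1"] by simp

lemma L2_inner_commute: "L2_inner \<mu> u v = L2_inner \<mu> v u"
  by (simp add: L2_inner_def mult.commute)

lemma L2_inner_diff_left:
  "u \<in> L2 \<mu> \<Longrightarrow> v \<in> L2 \<mu> \<Longrightarrow> w \<in> L2 \<mu> \<Longrightarrow> L2_inner \<mu> (\<lambda>x. u x - v x) w = L2_inner \<mu> u w - L2_inner \<mu> v w"
  unfolding L2_inner_def by (simp add: left_diff_distrib L2_integrable_mult)

lemma L2_inner_diff_right:
  "u \<in> L2 \<mu> \<Longrightarrow> v \<in> L2 \<mu> \<Longrightarrow> w \<in> L2 \<mu> \<Longrightarrow> L2_inner \<mu> w (\<lambda>x. u x - v x) = L2_inner \<mu> w u - L2_inner \<mu> w v"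
  using L2_inner_diff_left by (simp add: L2_inner_commute)

lemma L2_inner_add_left:
  "u \<in> L2 \<mu> \<Longrightarrow> v \<in> L2 \<mu> \<Longrightarrow> w \<in> L2 \<mu> \<Longrightarrow> L2_inner \<mu> (\<lambda>x. u x + v x) w = L2_inner \<mu> u w + L2_inner \<mu> v w"
  unfolding L2_inner_def by (simp add: ring_distribs L2_integrable_mult)

lemma L2_inner_self_nonneg: "0 \<le> L2_inner \<mu> u u"
  unfolding L2_inner_def by (rule integral_nonneg_AE) simp

lemma L2_inner_cong_AE:
  assumes "AE x in \<mu>. u x = u' x" "u \<in> L2 \<mu>" "u' \<in> L2 \<mu>" "v \<in> L2 \<mu>"
  shows "L2_inner \<mu> u v = L2_inner \<mu> u' v"
  unfolding L2_inner_def
  by (rule integral_cong_AE) (use assms in \<open>auto simp: L2_def intro: borel_measurable_times\<close>)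

lemma L2_inner_le:
  assumes "u \<in> L2 \<mu>" "v \<in> L2 \<mu>"
  shows "2 * L2_inner \<mu> u v \<le> L2_inner \<mu> u u + L2_inner \<mu> v v"
proof -
  have "0 \<le> L2_inner \<mu> (\<lambda>x. u x - v x) (\<lambda>x. u x - v x)" by (rule L2_inner_self_nonneg)
  also have "\<dots> = L2_inner \<mu> u u + L2_inner \<mu> v v - 2 * L2_inner \<mu> u v"
    using assms by (simp add: L2_inner_diff_left L2_inner_diff_right L2_diff L2_inner_commute[of v u])
  finally show ?thesis by simp
qed

lemma L2_positive_part: "u \<in> L2 \<mu> \<Longrightarrow> (\<lambda>x. max (u x) 0) \<in> L2 \<mu>"
proof -
  assume u: "u \<in> L2 \<mu>"
  then have [measurable]: "u \<in> borel_measurable borel" by (rule L2_measurable)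
  have "integrable \<mu> (\<lambda>x. (max (u x) 0)\<^sup>2)"
    by (rule Bochner_Integration.integrable_bound[of \<mu> "\<lambda>x. (u x)\<^sup>2"]) (use u in \<open>auto simp: L2_def max_def\<close>)
  then show ?thesis by (simp add: L2_def)
qed

text \<open>Identities between kernels are first obtained for nonnegative integrals, where Fubini
  asks for no integrability; splitting both arguments into positive and negative parts carries them
  over to all of \<open>L2\<close>.\<close>

lemma bilinear_eq_of_nonneg:
  fixes BL BR :: "('a \<Rightarrow> real) \<Rightarrow> ('a \<Rightarrow> real) \<Rightarrow> real"
  assumes l: "\<And>u v w. u \<in> L2 \<mu> \<Longrightarrow> v \<in> L2 \<mu> \<Longrightarrow> w \<in> L2 \<mu> \<Longrightarrow> BL (\<lambda>x. u x - v x) w = BL u w - BL v w"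
      "\<And>u v w. u \<in> L2 \<mu> \<Longrightarrow> v \<in> L2 \<mu> \<Longrightarrow> w \<in> L2 \<mu> \<Longrightarrow> BR (\<lambda>x. u x - v x) w = BR u w - BR v w"
    and r: "\<And>u v w. u \<in> L2 \<mu> \<Longrightarrow> v \<in> L2 \<mu> \<Longrightarrow> w \<in> L2 \<mu> \<Longrightarrow> BL w (\<lambda>x. u x - v x) = BL w u - BL w v"
      "\<And>u v w. u \<in> L2 \<mu> \<Longrightarrow> v \<in> L2 \<mu> \<Longrightarrow> w \<in> L2 \<mu> \<Longrightarrow> BR w (\<lambda>x. u x - v x) = BR w u - BR w v"
    and eq: "\<And>u v. u \<in> L2 \<mu> \<Longrightarrow> v \<in> L2 \<mu> \<Longrightarrow> (\<And>x. 0 \<le> u x) \<Longrightarrow> (\<And>x. 0 \<le> v x) \<Longrightarrow> BL u v = BR u v"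
    and uv: "u \<in> L2 \<mu>" "v \<in> L2 \<mu>"
  shows "BL u v = BR u v"
proof -
  define p where "p w x = max (w x) (0::real)" for w :: "'a \<Rightarrow> real" and x
  have p: "p w \<in> L2 \<mu>" "0 \<le> p w x" if "w \<in> L2 \<mu>" for w x
    using L2_positive_part[OF that] by (auto simp: p_def[abs_def])
  have m: "(\<lambda>x. - w x) \<in> L2 \<mu>" if "w \<in> L2 \<mu>" for w using L2_scale[OF that, of "-1"] by simp
  have dec: "w = (\<lambda>x. p w x - p (\<lambda>x. - w x) x)" for w by (auto simp: p_def)
  have "BL u v = BL (\<lambda>x. p u x - p (\<lambda>x. - u x) x) (\<lambda>x. p v x - p (\<lambda>x. - v x) x)" using dec by metis
  also have "\<dots> = BR (\<lambda>x. p u x - p (\<lambda>x. - u x) x) (\<lambda>x. p v x - p (\<lambda>x. - v x) x)"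
    using uv by (simp add: l r L2_diff p m eq)
  also have "\<dots> = BR u v" using dec by metis
  finally show ?thesis .
qed

text \<open>Finitely many balls of radius \<open>\<delta> / 2\<close> cover \<open>A\<close>, and
  each lies in the \<open>\<delta>\<close>-ball about any of its points. This keeps the factor
  \<open>1 / V(x, r)\<close> of the jump kernel bounded on compact sets off the diagonal.\<close>

lemma compact_volume_lower_bound:
  assumes A: "compact A" and \<delta>: "\<delta> > 0"
  shows "\<exists>c>0. \<forall>x\<in>A. c \<le> vol \<mu> x \<delta>"
proof -
  obtain D where D: "D \<subseteq> A" "finite D" "A \<subseteq> (\<Union>a\<in>D. ball a (\<delta> / 2))"
    by (rule compactE_image[OF A, of A "\<lambda>a. ball a (\<delta> / 2)"])
      (use \<delta> in \<open>auto intro: centre_in_ball[THEN iffD2]\<close>)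
  define c where "c = Min (insert 1 ((\<lambda>a. vol \<mu> a (\<delta> / 2)) ` D))"
  have "c > 0" unfolding c_def using D \<delta> by (auto intro: vol_pos)
  moreover have "c \<le> vol \<mu> x \<delta>" if x: "x \<in> A" for x
  proof -
    obtain a where a: "a \<in> D" "x \<in> ball a (\<delta> / 2)" using subsetD[OF D(3) x] by (rule UN_E)
    have "c \<le> vol \<mu> a (\<delta> / 2)" unfolding c_def using D a by (intro Min_le) auto
    also have "ball a (\<delta> / 2) \<subseteq> ball x \<delta>"
    proof
      fix y assume "y \<in> ball a (\<delta> / 2)"
      then show "y \<in> ball x \<delta>" using a dist_triangle[of x y a] by (simp add: dist_commute)
    qed
    then have "vol \<mu> a (\<delta> / 2) \<le> vol \<mu> x \<delta>" by (rule vol_mono')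
    finally show ?thesis .
  qed
  ultimately show ?thesis by blast
qed

lemma C_c_closed:
  fixes u v :: "'a \<Rightarrow> real"
  assumes "u \<in> C_c" "v \<in> C_c"
  shows "(\<lambda>x. u x + v x) \<in> C_c" "(\<lambda>x. u x - v x) \<in> C_c" "(\<lambda>x. c * u x) \<in> C_c"
proof -
  have cpt: "compact (closure {x. w x \<noteq> 0})" if "{x. w x \<noteq> 0} \<subseteq> {x. u x \<noteq> 0} \<union> {x. v x \<noteq> 0}" for w :: "'a \<Rightarrow> real"
  proof -
    let ?K = "closure {x. u x \<noteq> 0} \<union> closure {x. v x \<noteq> 0}"
    have K: "compact ?K" using assms by (auto simp: C_c_def)
    have "closure {x. w x \<noteq> 0} \<subseteq> ?K" using closure_mono[OF that] by simp
    then show ?thesis using compact_Int_closed[OF K closed_closure] by (metis inf.absorb_iff2)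
  qed
  have cont: "continuous_on UNIV u" "continuous_on UNIV v" using assms by (auto simp: C_c_def)
  show "(\<lambda>x. u x + v x) \<in> C_c" unfolding C_c_def using cont by (intro CollectI conjI continuous_intros cpt) auto
  show "(\<lambda>x. u x - v x) \<in> C_c" unfolding C_c_def using cont by (intro CollectI conjI continuous_intros cpt) auto
  show "(\<lambda>x. c * u x) \<in> C_c" unfolding C_c_def using cont by (intro CollectI conjI continuous_intros cpt) auto
qed

lemma C_c_zero: "(\<lambda>x. 0) \<in> (C_c :: ('a \<Rightarrow> real) set)"
  by (simp add: C_c_def)

text \<open>Disjoint closures allow test functions on the two sides whose joint energy has neither a
  local nor a killing part; compact closures make the rectangle have finite measure. These sets are
  stable under intersection and generate, so they determine a jumping measure.\<close>

definition separated_rectangles :: "('a \<times> 'a) set set" where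
  "separated_rectangles = {U \<times> V | U V. open U \<and> open V \<and> compact (closure U) \<and> compact (closure V) \<and>
     closure U \<inter> closure V = {}}"

lemma separated_rectangle_subset: "R \<in> separated_rectangles \<Longrightarrow> open R \<and> R \<subseteq> off_diagonal"
proof -
  assume "R \<in> separated_rectangles"
  then obtain U V where R: "R = U \<times> V" "open U" "open V" "closure U \<inter> closure V = {}"
    unfolding separated_rectangles_def by blast
  have "U \<inter> V = {}" using R(4) closure_subset[of U] closure_subset[of V] by blast
  then have "R \<subseteq> off_diagonal" by (auto simp: R(1) off_diagonal_def)
  then show "open R \<and> R \<subseteq> off_diagonal" using open_Times[OF R(2,3)] by (simp add: R(1))
qed

lemma Int_stable_separated_rectangles: "Int_stable separated_rectangles"
proof (rule Int_stableI)
  fix R1 R2 assume "R1 \<in> separated_rectangles" "R2 \<in> separated_rectangles"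
  then obtain U V U' V' where R: "R1 = U \<times> V" "R2 = U' \<times> V'"
    and o: "open U" "open V" "open U'" "open V'" and c: "compact (closure U)" "compact (closure V)"
    and d: "closure U \<inter> closure V = {}"
    unfolding separated_rectangles_def by blast
  have sub: "closure (U \<inter> U') \<subseteq> closure U" "closure (V \<inter> V') \<subseteq> closure V" by (intro closure_mono; blast)+
  have "compact (closure (U \<inter> U'))" "compact (closure (V \<inter> V'))"
    using compact_Int_closed[OF c(1) closed_closure] compact_Int_closed[OF c(2) closed_closure] sub
    by (metis inf.absorb_iff2)+
  moreover have "closure (U \<inter> U') \<inter> closure (V \<inter> V') = {}" using d sub by blast
  moreover have "R1 \<inter> R2 = (U \<inter> U') \<times> (V \<inter> V')" unfolding R by (rule Times_Int_Times)
  moreover have "open (U \<inter> U')" "open (V \<inter> V')" using o by (simp_all add: open_Int)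
  ultimately show "R1 \<inter> R2 \<in> separated_rectangles"
    unfolding separated_rectangles_def by (intro CollectI exI[of _ "U \<inter> U'"] exI[of _ "V \<inter> V'"] conjI)
qed

text \<open>Around an off-diagonal point, balls of radius below a third of the distance of its
  coordinates have disjoint closures and can be shrunk to be relatively compact; the Lindelof
  property makes the cover countable.\<close>

lemma separated_rectangles_cover:
  assumes S: "open S" "S \<subseteq> off_diagonal"
  shows "\<exists>D. countable D \<and> D \<subseteq> separated_rectangles \<and> \<Union>D = S"
proof -
  let ?R = "{R \<in> separated_rectangles. R \<subseteq> S}"
  obtain D where D: "D \<subseteq> ?R" "countable D" "\<Union>D = \<Union>?R"
    by (rule Lindelof[of ?R]) (use separated_rectangle_subset in auto)
  have "S \<subseteq> \<Union>?R"
  proof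
    fix z assume z: "z \<in> S"
    obtain x y where xy: "z = (x, y)" by (cases z)
    have ne: "x \<noteq> y" using S(2) z by (auto simp: xy off_diagonal_def)
    obtain A B where AB: "open A" "open B" "x \<in> A" "y \<in> B" "A \<times> B \<subseteq> S"
      by (rule open_prod_elim[OF S(1) z]) (auto simp: xy)
    define d where "d = dist x y / 3"
    have d: "d > 0" using ne by (simp add: d_def)
    obtain e1 where e1: "e1 > 0" "compact (cball x e1)" "cball x e1 \<subseteq> A \<inter> ball x d"
      using small_compact_cball[of "A \<inter> ball x d" x] AB d by auto
    obtain e2 where e2: "e2 > 0" "compact (cball y e2)" "cball y e2 \<subseteq> B \<inter> ball y d"
      using small_compact_cball[of "B \<inter> ball y d" y] AB d by auto
    have cl: "closure (ball x e1) \<subseteq> cball x e1" "closure (ball y e2) \<subseteq> cball y e2"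
      by (intro closure_minimal ball_subset_cball closed_cball)+
    have c: "compact (closure (ball x e1))" "compact (closure (ball y e2))"
      using compact_Int_closed[OF e1(2) closed_closure] compact_Int_closed[OF e2(2) closed_closure] cl
      by (metis inf.absorb_iff2)+
    have "ball x d \<inter> ball y d = {}"
    proof (rule ccontr)
      assume "ball x d \<inter> ball y d \<noteq> {}"
      then obtain w where "dist x w < d" "dist y w < d" by auto
      then show False using dist_triangle2[of x y w] zero_le_dist[of x y] unfolding d_def by linarith
    qed
    then have "closure (ball x e1) \<inter> closure (ball y e2) = {}" using cl e1(3) e2(3) by blast
    then have "ball x e1 \<times> ball y e2 \<in> separated_rectangles"
      using c unfolding separated_rectangles_def by (intro CollectI exI[of _ "ball x e1"] exI[of _ "ball y e2"]) simp
    moreover have "ball x e1 \<times> ball y e2 \<subseteq> S"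
      using e1(3) e2(3) AB(5) ball_subset_cball[of x e1] ball_subset_cball[of y e2] by blast
    moreover have "z \<in> ball x e1 \<times> ball y e2" using e1(1) e2(1) by (simp add: xy)
    ultimately show "z \<in> \<Union>?R" by blast
  qed
  then show ?thesis using D by (intro exI[of _ D]) auto
qed

lemma sets_off_diagonal:
  "sets (restrict_space borel off_diagonal) = sigma_sets off_diagonal separated_rectangles"
proof -
  have "sets (restrict_space borel off_diagonal) = (\<inter>) off_diagonal ` sigma_sets UNIV {S :: ('a \<times> 'a) set. open S}"
    by (simp add: sets_restrict_space borel_def)
  also have "\<dots> = sigma_sets off_diagonal ((\<inter>) off_diagonal ` {S :: ('a \<times> 'a) set. open S})"
    by (rule sigma_sets_Int) (use open_off_diagonal in \<open>auto intro: sigma_sets.Basic\<close>)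
  also have "\<dots> = sigma_sets off_diagonal separated_rectangles"
  proof (rule sigma_sets_eqI)
    fix A assume "A \<in> (\<inter>) off_diagonal ` {S :: ('a \<times> 'a) set. open S}"
    then have A: "open A" "A \<subseteq> off_diagonal" using open_off_diagonal by auto
    obtain D where D: "countable D" "D \<subseteq> separated_rectangles" "\<Union>D = A"
      using separated_rectangles_cover[OF A] by (elim exE conjE)
    then have "\<Union>D \<in> sigma_sets off_diagonal separated_rectangles"
      by (intro sigma_sets_UNION) (auto intro: sigma_sets.Basic)
    then show "A \<in> sigma_sets off_diagonal separated_rectangles" by (simp only: D(3))
  next
    fix R assume "R \<in> separated_rectangles"
    then have "open R" "off_diagonal \<inter> R = R" using separated_rectangle_subset[of R] by auto
    then have "R \<in> (\<inter>) off_diagonal ` {S. open S}" by (intro image_eqI[of _ _ R]) auto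
    then show "R \<in> sigma_sets off_diagonal ((\<inter>) off_diagonal ` {S. open S})" by (rule sigma_sets.Basic)
  qed
  finally show ?thesis .
qed

lemma separated_rectangle_finite:
  assumes Jm: "offdiag_radon Jm" and R: "closure U \<inter> closure V = {}" "compact (closure U)" "compact (closure V)"
  shows "emeasure Jm (closure U \<times> closure V) < \<infinity>"
proof -
  have "compact (closure U \<times> closure V)" by (rule compact_Times[OF R(2,3)])
  moreover have "(closure U \<times> closure V) \<inter> {(x, y). x = y} = {}" using R(1) by auto
  ultimately show ?thesis using Jm by (simp add: offdiag_radon_def)
qed

text \<open>Uniqueness of measures on the intersection-stable generator
  \<open>separated_rectangles\<close>, applied to the restrictions to the complement of the
  diagonal; the diagonal is null for both measures.\<close>

lemma offdiag_radon_eqI: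
  assumes J: "offdiag_radon J1" "offdiag_radon J2"
    and eq: "\<And>R. R \<in> separated_rectangles \<Longrightarrow> emeasure J1 R = emeasure J2 R"
  shows "J1 = J2"
proof (rule measure_eqI)
  have s: "sets J1 = sets borel" "sets J2 = sets borel" using J by (auto simp: offdiag_radon_def)
  have od: "off_diagonal \<in> sets (borel :: ('a \<times> 'a) measure)" using open_off_diagonal by (rule borel_open)
  then have od': "off_diagonal \<inter> space J1 \<in> sets J1" "off_diagonal \<inter> space J2 \<in> sets J2"
    using s sets_eq_imp_space_eq[OF s(1)] sets_eq_imp_space_eq[OF s(2)] by auto
  show "sets J1 = sets J2" by (simp add: s)
  have R: "R \<in> sets borel" "R \<subseteq> off_diagonal" if "R \<in> separated_rectangles" for R
    using separated_rectangle_subset[OF that] by auto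
  have res: "emeasure (restrict_space J1 off_diagonal) B = emeasure J1 B"
     "emeasure (restrict_space J2 off_diagonal) B = emeasure J2 B" if "B \<subseteq> off_diagonal" for B
    using that od' by (simp_all add: emeasure_restrict_space)
  have ss: "sets (restrict_space J1 off_diagonal) = sigma_sets off_diagonal separated_rectangles"
    "sets (restrict_space J2 off_diagonal) = sigma_sets off_diagonal separated_rectangles"
    using sets_off_diagonal s by (simp_all add: sets_restrict_space)
  obtain D where D: "countable D" "D \<subseteq> separated_rectangles" "\<Union>D = off_diagonal"
    using separated_rectangles_cover[OF open_off_diagonal order_refl] by blast
  have fin: "emeasure J1 B \<noteq> \<infinity>" if B: "B \<in> separated_rectangles" for B
  proof -
    obtain U V where UV: "B = U \<times> V" "compact (closure U)" "compact (closure V)" "closure U \<inter> closure V = {}"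
      using B unfolding separated_rectangles_def by blast
    have "emeasure J1 B \<le> emeasure J1 (closure U \<times> closure V)"
      using closure_subset[of U] closure_subset[of V] unfolding UV
      by (intro emeasure_mono) (auto simp: s intro!: borel_closed closed_Times)
    also have "\<dots> < \<infinity>" by (rule separated_rectangle_finite[OF J(1) UV(4,2,3)])
    finally show ?thesis by simp
  qed
  have eq_res: "restrict_space J1 off_diagonal = restrict_space J2 off_diagonal"
  proof (rule measure_eqI_generator_eq_countable[OF Int_stable_separated_rectangles _ _ ss, of D])
    show "separated_rectangles \<subseteq> Pow (off_diagonal :: ('a \<times> 'a) set)" using R(2) by blast
    show "emeasure (restrict_space J1 off_diagonal) B = emeasure (restrict_space J2 off_diagonal) B"
      if "B \<in> separated_rectangles" for B
      using eq[OF that] R(2)[OF that] by (simp add: res)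
    show "emeasure (restrict_space J1 off_diagonal) B \<noteq> \<infinity>" if "B \<in> D" for B
      using fin[of B] R(2)[of B] D(2) that by (simp add: res subset_iff)
  qed (use D in auto)
  fix A assume "A \<in> sets J1"
  then have A: "A \<in> sets borel" by (simp add: s)
  have split: "emeasure J A = emeasure J (A \<inter> off_diagonal)" if "offdiag_radon J" for J
  proof (rule emeasure_eq_AE)
    have sJ: "sets J = sets borel" and z: "emeasure J {(x, y). x = y} = 0" using that by (auto simp: offdiag_radon_def)
    have "{(x, y). x = y} = - (off_diagonal :: ('a \<times> 'a) set)" by (auto simp: off_diagonal_def)
    then have "- off_diagonal \<in> null_sets J" using z od by (intro null_setsI) (auto simp: sJ)
    then have "AE w in J. w \<in> off_diagonal" by (rule AE_I') auto
    then show "AE w in J. w \<in> A \<longleftrightarrow> w \<in> A \<inter> off_diagonal" by eventually_elim simp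
    show "A \<in> sets J" "A \<inter> off_diagonal \<in> sets J" using A od by (auto simp: sJ)
  qed
  have "emeasure J1 (A \<inter> off_diagonal) = emeasure J2 (A \<inter> off_diagonal)"
    using res[of "A \<inter> off_diagonal"] eq_res by simp
  then show "emeasure J1 A = emeasure J2 A" using split[OF J(1)] split[OF J(2)] by simp
qed

lemma C_c_product_integrable:
  fixes u v :: "'a \<Rightarrow> real"
  assumes Jm: "offdiag_radon Jm" and u: "u \<in> C_c" and v: "v \<in> C_c"
    and d: "closure {x. u x \<noteq> 0} \<inter> closure {x. v x \<noteq> 0} = {}"
  shows "integrable Jm (\<lambda>z. u (fst z) * v (snd z))"
proof -
  let ?A = "closure {x. u x \<noteq> 0}" and ?B = "closure {x. v x \<noteq> 0}"
  have s: "sets Jm = sets borel" using Jm by (simp add: offdiag_radon_def)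
  obtain M where M: "M > 0" "\<And>x. \<bar>u x\<bar> \<le> M" using C_c_bounded[OF u] by blast
  obtain L where L: "L > 0" "\<And>x. \<bar>v x\<bar> \<le> L" using C_c_bounded[OF v] by blast
  have c: "compact ?A" "compact ?B" using u v by (simp_all add: C_c_def)
  have fin: "emeasure Jm (?A \<times> ?B) < \<infinity>" by (rule separated_rectangle_finite[OF Jm d c])
  have AB: "?A \<times> ?B \<in> sets Jm" unfolding s by (intro borel_closed closed_Times closed_closure)
  have "integrable Jm (\<lambda>z. M * L * indicator (?A \<times> ?B) z :: real)"
    by (intro integrable_mult_right integrable_real_indicator AB fin)
  then show ?thesis
  proof (rule Bochner_Integration.integrable_bound)
    have cont: "continuous_on UNIV u" "continuous_on UNIV v" using u v by (simp_all add: C_c_def)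
    have "continuous_on UNIV (\<lambda>z. u (fst z) * v (snd z))"
      by (intro continuous_on_mult continuous_on_compose2[OF cont(1)] continuous_on_compose2[OF cont(2)]
          continuous_on_fst continuous_on_snd continuous_on_id) auto
    then have "(\<lambda>z. u (fst z) * v (snd z)) \<in> borel_measurable borel" by (rule borel_measurable_continuous_onI)
    then show "(\<lambda>z. u (fst z) * v (snd z)) \<in> borel_measurable Jm" by (simp add: measurable_cong_sets[OF s refl])
    have "norm (u (fst z) * v (snd z)) \<le> norm (M * L * indicator (?A \<times> ?B) z :: real)" for z
    proof (cases "z \<in> ?A \<times> ?B")
      case True
      have "\<bar>u (fst z)\<bar> * \<bar>v (snd z)\<bar> \<le> M * L" using M L by (intro mult_mono) auto
      then show ?thesis using True M L by (simp add: abs_mult)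
    next
      case False
      then have "u (fst z) = 0 \<or> v (snd z) = 0"
        using closure_subset[of "{x. u x \<noteq> 0}"] closure_subset[of "{x. v x \<noteq> 0}"] by (auto simp: mem_Times_iff)
      then show ?thesis by auto
    qed
    then show "AE z in Jm. norm (u (fst z) * v (snd z)) \<le> norm (M * L * indicator (?A \<times> ?B) z :: real)" by simp
  qed
qed

end

locale regular_form = metric_measure \<mu> for \<mu> :: "'a::{metric_space,second_countable_topology} measure" +
  fixes E :: "'a form" and F :: "('a \<Rightarrow> real) set"
  assumes regular: "regular_dirichlet_form \<mu> E F"
begin

lemma dirichlet: "dirichlet_form \<mu> E F"
  using regular unfolding regular_dirichlet_form_def by (rule conjunct1)

lemma symmetric: "symmetric_form F E"
  using dirichlet unfolding dirichlet_form_def by (elim conjE)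

lemma F_zero: "(\<lambda>x. 0) \<in> F"
  and F_add: "u \<in> F \<Longrightarrow> v \<in> F \<Longrightarrow> (\<lambda>x. u x + v x) \<in> F"
  and F_scale: "u \<in> F \<Longrightarrow> (\<lambda>x. c * u x) \<in> F"
  and E_nonneg: "u \<in> F \<Longrightarrow> 0 \<le> E u u"
  using symmetric unfolding symmetric_form_def by (elim conjE, blast)+

lemma F_L2: "F \<subseteq> L2 \<mu>"
  and F_dense: "f \<in> L2 \<mu> \<Longrightarrow> \<epsilon> > 0 \<Longrightarrow> \<exists>u\<in>F. L2_inner \<mu> (\<lambda>x. f x - u x) (\<lambda>x. f x - u x) < \<epsilon>"
  and F_unit: "u \<in> F \<Longrightarrow> (\<lambda>x. min (max (u x) 0) 1) \<in> F"
  using dirichlet unfolding dirichlet_form_def by (elim conjE, blast)+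

lemma core_dense: "u \<in> F \<Longrightarrow> \<epsilon> > 0 \<Longrightarrow> \<exists>v\<in>F \<inter> C_c. E1_sq \<mu> E (\<lambda>x. u x - v x) < \<epsilon>"
  and core_uniform: "f \<in> C_c \<Longrightarrow> \<epsilon> > 0 \<Longrightarrow> \<exists>v\<in>F \<inter> C_c. \<forall>x. \<bar>f x - v x\<bar> < \<epsilon>"
  using regular unfolding regular_dirichlet_form_def by (elim conjE, blast)+

lemma F_diff: "u \<in> F \<Longrightarrow> v \<in> F \<Longrightarrow> (\<lambda>x. u x - v x) \<in> F"
  using F_add[of u "\<lambda>x. -1 * v x"] F_scale[of v "-1"] by simp

text \<open>Chains two densities: \<open>F\<close> in \<open>L2\<close>, and the core in
  \<open>F\<close> for the form norm, which dominates the \<open>L2\<close> norm. Two squared errors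
  below \<open>\<epsilon> / 4\<close> suffice, as a squared sum is at most twice the sum of the
  squares.\<close>

lemma core_dense_L2:
  assumes f: "f \<in> L2 \<mu>" and e: "\<epsilon> > 0"
  shows "\<exists>v\<in>F \<inter> C_c. L2_inner \<mu> (\<lambda>x. f x - v x) (\<lambda>x. f x - v x) < \<epsilon>"
proof -
  obtain u where u: "u \<in> F" "L2_inner \<mu> (\<lambda>x. f x - u x) (\<lambda>x. f x - u x) < \<epsilon> / 4" using F_dense[OF f, of "\<epsilon>/4"] e by auto
  obtain v where v: "v \<in> F \<inter> C_c" "E1_sq \<mu> E (\<lambda>x. u x - v x) < \<epsilon> / 4" using core_dense[OF u(1), of "\<epsilon>/4"] e by auto
  have v2: "L2_inner \<mu> (\<lambda>x. u x - v x) (\<lambda>x. u x - v x) < \<epsilon> / 4"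
    using v E_nonneg[OF F_diff[OF u(1), of v]] by (simp add: E1_sq_def)
  have L: "(\<lambda>x. u x - v x) \<in> L2 \<mu>" "u \<in> L2 \<mu>" "v \<in> L2 \<mu>" using F_diff u v F_L2 by auto
  have "L2_inner \<mu> (\<lambda>x. f x - v x) (\<lambda>x. f x - v x) \<le> (\<integral>x. 2 * ((f x - u x) * (f x - u x)) + 2 * ((u x - v x) * (u x - v x)) \<partial>\<mu>)"
    unfolding L2_inner_def
  proof (rule integral_mono)
    have "2 * ((a-b)*(a-b)) + 2*((b-c)*(b-c)) - (a-c)*(a-c) = ((a-b)-(b-c))\<^sup>2" for a b c :: real
      by (simp add: power2_eq_square algebra_simps)
    then show "(f x - v x) * (f x - v x) \<le> 2 * ((f x - u x) * (f x - u x)) + 2 * ((u x - v x) * (u x - v x))" for x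
      by (metis diff_ge_0_iff_ge zero_le_power2)
  qed (intro Bochner_Integration.integrable_add integrable_mult_right L2_integrable_mult L2_diff L f)+
  also have "\<dots> = 2 * L2_inner \<mu> (\<lambda>x. f x - u x) (\<lambda>x. f x - u x) + 2 * L2_inner \<mu> (\<lambda>x. u x - v x) (\<lambda>x. u x - v x)"
    unfolding L2_inner_def
    by (subst Bochner_Integration.integral_add) (auto intro!: integrable_mult_right L2_integrable_mult L2_diff L f)
  also have "\<dots> < \<epsilon>" using u v2 by simp
  finally show ?thesis using v by blast
qed

text \<open>Regularity approximates uniformly but says nothing about supports. Subtracting the error
  \<open>\<delta> n\<close> and taking the positive part pushes the support of the approximant into
  that of \<open>f n\<close>, and the Markov property keeps the result in \<open>F\<close>.\<close>

lemma core_approx_open: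
  assumes V: "open V"
  shows "\<exists>u::nat \<Rightarrow> 'a \<Rightarrow> real. \<forall>n. u n \<in> F \<inter> C_c \<and> (\<forall>x. 0 \<le> u n x \<and> u n x \<le> 1) \<and>
    closure {x. u n x \<noteq> 0} \<subseteq> V \<and> (\<forall>x. (\<lambda>n. u n x) \<longlonglongrightarrow> indicator V x)"
proof -
  obtain f :: "nat \<Rightarrow> 'a \<Rightarrow> real" where f: "\<And>n. f n \<in> C_c" "\<And>n x. 0 \<le> f n x" "\<And>n x. f n x \<le> 1"
    "\<And>n. closure {x. f n x \<noteq> 0} \<subseteq> V" "\<And>x. (\<lambda>n. f n x) \<longlonglongrightarrow> indicator V x"
    using C_c_approx_open[OF V] by metis
  define \<delta> where "\<delta> n = 1 / real (Suc n)" for n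
  have \<delta>: "0 < \<delta> n" "\<delta> n \<le> 1" for n by (auto simp: \<delta>_def)
  have "\<exists>v\<in>F \<inter> C_c. \<forall>x. \<bar>f n x - v x\<bar> < \<delta> n" for n using core_uniform[OF f(1) \<delta>(1)] .
  then obtain v where v: "\<And>n. v n \<in> F" "\<And>n. v n \<in> C_c" "\<And>n x. \<bar>f n x - v n x\<bar> < \<delta> n" by (metis IntE)
  \<comment> \<open>The Markov property truncates to \<open>[0, 1]\<close> only, so positive parts
    are assembled from it: as \<open>v n \<le> 2\<close>, the first term is the positive part of
    \<open>v n\<close>, the second is the minimum of this with \<open>\<delta> n\<close>, and the
    difference is the positive part of \<open>v n - \<delta> n\<close>.\<close>
  define u where "u n x = min (max (2 * min (max (1/2 * v n x) 0) 1 - \<delta> n * min (max (1 / \<delta> n * v n x) 0) 1) 0) 1" for n x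
  have uF: "u n \<in> F" for n
    unfolding u_def by (intro F_unit F_diff F_scale v)
  have vb: "v n x \<le> 2" for n x using v(3)[of n x] f(3)[of n x] \<delta>(2)[of n] by argo
  have u_alt: "u n x = min (max (v n x - \<delta> n) 0) 1" for n x
  proof -
    have "\<delta> n * min (max (1 / \<delta> n * v n x) 0) 1 = min (max (v n x) 0) (\<delta> n)"
      using \<delta>[of n] by (auto simp: min_def max_def field_simps)
    then show ?thesis using vb[of n x] \<delta>[of n] by (auto simp: u_def min_def max_def)
  qed
  have supp: "{x. u n x \<noteq> 0} \<subseteq> {x. f n x \<noteq> 0}" for n
    using v(3)[of n] by (auto simp: u_alt min_def max_def split: if_splits) (smt (verit, best))+
  then have cl: "closure {x. u n x \<noteq> 0} \<subseteq> closure {x. f n x \<noteq> 0}" for n by (rule closure_mono)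
  have "compact (closure {x. f n x \<noteq> 0})" for n using f(1) by (simp add: C_c_def)
  then have "compact (closure {x. u n x \<noteq> 0})" for n
    using compact_Int_closed[OF _ closed_closure] cl by (metis inf.absorb_iff2)
  moreover have "continuous_on UNIV (u n)" for n
    unfolding u_alt using v(2)[of n] by (intro continuous_intros) (auto simp: C_c_def)
  ultimately have uC: "u n \<in> C_c" for n by (simp add: C_c_def)
  have diff: "\<bar>u n x - f n x\<bar> \<le> 2 * \<delta> n" for n x
    using v(3)[of n x] f(2)[of n x] f(3)[of n x] \<delta>[of n] unfolding u_alt by (auto simp: min_def max_def)
  have lim: "(\<lambda>n. u n x) \<longlonglongrightarrow> indicator V x" for x
  proof -
    have "(\<lambda>n. 2 * \<delta> n) \<longlonglongrightarrow> 2 * 0"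
      unfolding \<delta>_def by (intro tendsto_mult tendsto_const) (use LIMSEQ_inverse_real_of_nat in \<open>simp add: inverse_eq_divide\<close>)
    then have "(\<lambda>n. u n x - f n x) \<longlonglongrightarrow> 0"
      by (intro Lim_null_comparison[of "\<lambda>n. u n x - f n x" "\<lambda>n. 2 * \<delta> n"]) (use diff in auto)
    from tendsto_add[OF this f(5)[of x]] show ?thesis by simp
  qed
  show ?thesis
    by (intro exI[of _ u] allI conjI IntI uF uC lim) (use cl f(4) in \<open>auto simp: u_alt\<close>)
qed

lemma core_ge_on_compact:
  assumes K: "compact K"
  shows "\<exists>v\<in>F \<inter> C_c. \<forall>x\<in>K. v x \<ge> 1/2"
proof -
  obtain f where f: "f \<in> C_c" "\<forall>x\<in>K. f x = (1::real)" using C_c_Urysohn[OF K open_UNIV] by auto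
  obtain v where v: "v \<in> F \<inter> C_c" "\<forall>x. \<bar>f x - v x\<bar> < 1/2" using core_uniform[OF f(1), of "1/2"] by auto
  have "1/2 \<le> v x" if "x \<in> K" for x
    using f(2)[rule_format, OF that] v(2)[rule_format, of x] by (simp add: abs_if field_simps split: if_splits)
  then show ?thesis using v(1) by blast
qed

text \<open>\<open>v\<close> vanishes on a neighbourhood of the support of \<open>u\<close>, which
  removes the strongly local part; \<open>u x * v x = 0\<close> removes the killing part and two of
  the four terms in the product of differences. The other two agree by symmetry of
  \<open>Jm\<close>, hence the factor \<open>2\<close>.\<close>

lemma jumping_measure_disjoint:
  assumes jm: "jumping_measure E' F' Jm" and F: "F \<subseteq> F'" and u: "u \<in> F \<inter> C_c" and v: "v \<in> F \<inter> C_c"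
    and d: "closure {x. u x \<noteq> 0} \<inter> closure {x. v x \<noteq> 0} = {}"
  shows "E' u v = - 2 * (\<integral>z. u (fst z) * v (snd z) \<partial>Jm)"
proof -
  have Jm: "offdiag_radon Jm" using jm by (simp add: jumping_measure_def)
  obtain Ec k where Ec: "strongly_local (F' \<inter> C_c) Ec"
    and rep: "\<forall>u\<in>F' \<inter> C_c. \<forall>v\<in>F' \<inter> C_c. integrable Jm (\<lambda>(x, y). (u x - u y) * (v x - v y)) \<and>
           E' u v = Ec u v + (LINT (x, y)|Jm. (u x - u y) * (v x - v y)) + (LINT x|k. u x * v x)"
    using jm unfolding jumping_measure_def by blast
  have uv: "u \<in> F' \<inter> C_c" "v \<in> F' \<inter> C_c" using u v F by auto
  have prod: "u x * v x = 0" for x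
    using d closure_subset[of "{x. u x \<noteq> 0}"] closure_subset[of "{x. v x \<noteq> 0}"] by auto
  have "open (- closure {x. v x \<noteq> 0})" "closure {x. u x \<noteq> 0} \<subseteq> - closure {x. v x \<noteq> 0}"
    using d by auto
  moreover have "\<forall>x\<in>- closure {x. v x \<noteq> 0}. v x = 0" using closure_subset[of "{x. v x \<noteq> 0}"] by auto
  ultimately have "Ec u v = 0"
    using Ec uv unfolding strongly_local_def by blast
  then have E: "E' u v = (LINT z|Jm. (u (fst z) - u (snd z)) * (v (fst z) - v (snd z)))"
    using rep[rule_format, OF uv] by (simp add: prod case_prod_beta')
  have i1: "integrable Jm (\<lambda>z. u (fst z) * v (snd z))"
    by (rule C_c_product_integrable[OF Jm _ _ d]) (use u v in auto)
  have i2: "integrable Jm (\<lambda>z. v (fst z) * u (snd z))"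
    by (rule C_c_product_integrable[OF Jm]) (use u v d in auto)
  have s: "sets Jm = sets borel" using Jm by (simp add: offdiag_radon_def)
  have swap: "(\<lambda>z. (snd z, fst z)) \<in> Jm \<rightarrow>\<^sub>M borel"
    unfolding measurable_cong_sets[OF s refl]
    by (intro borel_measurable_continuous_onI continuous_intros)
  have "(\<integral>z. v (fst z) * u (snd z) \<partial>Jm) = (\<integral>z. v (fst z) * u (snd z) \<partial>distr Jm borel (\<lambda>z. (snd z, fst z)))"
    by (simp only: offdiag_radon_swap[OF Jm])
  also have "\<dots> = (\<integral>z. u (fst z) * v (snd z) \<partial>Jm)"
    using borel_measurable_integrable[OF i2] by (subst integral_distr[OF swap])
      (simp_all add: measurable_cong_sets[OF s refl] mult.commute)
  finally have sw: "(\<integral>z. v (fst z) * u (snd z) \<partial>Jm) = (\<integral>z. u (fst z) * v (snd z) \<partial>Jm)" .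
  have "(u (fst z) - u (snd z)) * (v (fst z) - v (snd z)) = - (u (fst z) * v (snd z)) - v (fst z) * u (snd z)" for z
  proof -
    have "(u (fst z) - u (snd z)) * (v (fst z) - v (snd z)) =
        u (fst z) * v (fst z) + u (snd z) * v (snd z) - u (fst z) * v (snd z) - v (fst z) * u (snd z)"
      by (simp add: algebra_simps)
    then show ?thesis unfolding prod by simp
  qed
  then have "E' u v = (\<integral>z. - (u (fst z) * v (snd z)) - v (fst z) * u (snd z) \<partial>Jm)" by (simp add: E)
  also have "\<dots> = - (\<integral>z. u (fst z) * v (snd z) \<partial>Jm) - (\<integral>z. v (fst z) * u (snd z) \<partial>Jm)"
    using i1 i2 by simp
  finally show ?thesis by (simp add: sw)
qed

text \<open>Core functions approximating the indicators of the two sides of a separated rectangle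
  recover its measure from \<open>E'\<close> alone. The inclusion \<open>F \<subseteq> F'\<close>
  supplies enough of them without any regularity of \<open>E'\<close>.\<close>

lemma jumping_measure_unique:
  assumes j: "jumping_measure E' F' J1" "jumping_measure E' F' J2" and F: "F \<subseteq> F'"
  shows "J1 = J2"
proof (rule offdiag_radon_eqI)
  show r: "offdiag_radon J1" "offdiag_radon J2" using j by (auto simp: jumping_measure_def)
  fix R assume "R \<in> separated_rectangles"
  then obtain U V where R: "R = U \<times> V" and UV: "open U" "open V" "closure U \<inter> closure V = {}" "compact (closure U)" "compact (closure V)"
    unfolding separated_rectangles_def by blast
  obtain u :: "nat \<Rightarrow> 'a \<Rightarrow> real" where u: "\<And>n. u n \<in> F \<inter> C_c" "\<And>n x. 0 \<le> u n x" "\<And>n x. u n x \<le> 1"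
    "\<And>n. closure {x. u n x \<noteq> 0} \<subseteq> U" "\<And>x. (\<lambda>n. u n x) \<longlonglongrightarrow> indicator U x"
    using core_approx_open[OF UV(1)] by metis
  obtain v :: "nat \<Rightarrow> 'a \<Rightarrow> real" where v: "\<And>n. v n \<in> F \<inter> C_c" "\<And>n x. 0 \<le> v n x" "\<And>n x. v n x \<le> 1"
    "\<And>n. closure {x. v n x \<noteq> 0} \<subseteq> V" "\<And>x. (\<lambda>n. v n x) \<longlonglongrightarrow> indicator V x"
    using core_approx_open[OF UV(2)] by metis
  have d: "closure {x. u n x \<noteq> 0} \<inter> closure {x. v n x \<noteq> 0} = {}" for n
    using u(4)[of n] v(4)[of n] UV(3) closure_subset[of U] closure_subset[of V] by blast
  have lim: "(\<lambda>n. E' (u n) (v n)) \<longlonglongrightarrow> - 2 * measure J R" and fin: "emeasure J R < \<infinity>"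
    if jm: "jumping_measure E' F' J" and rad: "offdiag_radon J" for J
  proof -
    have s: "sets J = sets borel" using rad by (simp add: offdiag_radon_def)
    have Rs: "R \<in> sets J" unfolding s R using UV by (intro borel_open open_Times)
    have cs: "closure U \<times> closure V \<in> sets J" unfolding s by (intro borel_closed closed_Times closed_closure)
    have cf: "emeasure J (closure U \<times> closure V) < \<infinity>" by (rule separated_rectangle_finite[OF rad UV(3-5)])
    show "emeasure J R < \<infinity>"
      by (rule le_less_trans[OF emeasure_mono cf]) (use closure_subset cs in \<open>auto simp: R\<close>)
    have "(\<lambda>n. \<integral>z. u n (fst z) * v n (snd z) \<partial>J) \<longlonglongrightarrow> (\<integral>z. indicator R z \<partial>J)"
    proof (rule integral_dominated_convergence[where w="indicator (closure U \<times> closure V)"])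
      show "(indicator R :: _ \<Rightarrow> real) \<in> borel_measurable J" using Rs by simp
      show "integrable J (indicator (closure U \<times> closure V) :: _ \<Rightarrow> real)" using cs cf by (rule integrable_real_indicator)
      have i: "integrable J (\<lambda>z. u n (fst z) * v n (snd z))" for n
        by (rule C_c_product_integrable[OF rad _ _ d]) (use u v in auto)
      show "(\<lambda>z. u n (fst z) * v n (snd z)) \<in> borel_measurable J" for n
        by (rule borel_measurable_integrable[OF i])
      have "(\<lambda>n. u n (fst z) * v n (snd z)) \<longlonglongrightarrow> indicator R z" for z
        using tendsto_mult[OF u(5)[of "fst z"] v(5)[of "snd z"]] by (simp add: R indicator_times)
      then show "AE z in J. (\<lambda>n. u n (fst z) * v n (snd z)) \<longlonglongrightarrow> indicator R z" by simp
      have "norm (u n (fst z) * v n (snd z)) \<le> indicator (closure U \<times> closure V) z" for n z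
      proof (cases "z \<in> closure U \<times> closure V")
        case True
        then show ?thesis using mult_mono[of "u n (fst z)" 1 "v n (snd z)" 1] u(2,3) v(2,3) by (simp add: abs_mult)
      next
        case False
        then have "u n (fst z) = 0 \<or> v n (snd z) = 0"
          using u(4)[of n] v(4)[of n] closure_subset[of "{x. u n x \<noteq> 0}"] closure_subset[of "{x. v n x \<noteq> 0}"]
            closure_subset[of U] closure_subset[of V] by (auto simp: mem_Times_iff)
        then show ?thesis by auto
      qed
      then show "AE z in J. norm (u n (fst z) * v n (snd z)) \<le> indicator (closure U \<times> closure V) z" for n by simp
    qed
    then have l: "(\<lambda>n. \<integral>z. u n (fst z) * v n (snd z) \<partial>J) \<longlonglongrightarrow> measure J R"
      using Rs by (simp add: sets.Int_space_eq2)
    show "(\<lambda>n. E' (u n) (v n)) \<longlonglongrightarrow> - 2 * measure J R"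
      unfolding jumping_measure_disjoint[OF jm F u(1) v(1) d] by (intro tendsto_mult tendsto_const l)
  qed
  have "- 2 * measure J1 R = - 2 * measure J2 R"
    by (rule LIMSEQ_unique[OF lim[OF j(1) r(1)] lim[OF j(2) r(2)]])
  then have "measure J1 R = measure J2 R" by simp
  then show "emeasure J1 R = emeasure J2 R"
    using fin[OF j(1) r(1)] fin[OF j(2) r(2)] by (simp add: emeasure_eq_ennreal_measure)
qed

end

section \<open>Symmetric kernels and Hunt processes\<close>

lemma space_state_borel[simp]: "space (state_borel :: 'a::metric_space option measure) = UNIV"
  by (simp add: state_borel_def)

lemma openin_state_borel: "openin state_top U \<Longrightarrow> U \<in> sets (state_borel :: 'a::metric_space option measure)"
  by (auto simp: state_borel_def)

lemma measurable_Some_state[measurable]: "Some \<in> borel \<rightarrow>\<^sub>M (state_borel :: 'a::metric_space option measure)"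
  unfolding state_borel_def
proof (rule measurable_measure_of)
  fix U :: "'a option set" assume "U \<in> {U. openin state_top U}"
  then have "openin euclidean {x \<in> topspace euclidean. Some x \<in> U}"
    using continuous_map_Some[of "euclidean :: 'a topology"] unfolding continuous_map_def by blast
  then show "Some -` U \<inter> space borel \<in> sets borel" by (simp add: vimage_def)
qed auto

lemma Some_image_state_borel:
  assumes "B \<in> sets (borel :: 'a::metric_space measure)"
  shows "Some ` B \<in> sets state_borel"
proof -
  have "B \<in> sigma_sets UNIV {S. open S}" using assms by (simp add: borel_def)
  then show ?thesis
  proof induction
    case (Basic a)
    then show ?case by (intro openin_state_borel) simp
  next
    case (Compl a)
    have "Some ` (UNIV :: 'a set) \<in> sets state_borel" by (intro openin_state_borel) simp
    moreover have "Some ` (UNIV - a) = Some ` UNIV - Some ` a" by auto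
    ultimately show ?case using Compl by (metis sets.Diff)
  next
    case (Union a)
    then show ?case by (simp add: image_UN)
  qed simp
qed

lemma measurable_case_option_state[measurable (raw)]:
  assumes [measurable]: "g \<in> borel \<rightarrow>\<^sub>M N" and c: "c \<in> space N"
  shows "case_option c g \<in> (state_borel :: 'a::metric_space option measure) \<rightarrow>\<^sub>M N"
proof (rule measurableI)
  fix A assume A: "A \<in> sets N"
  have S: "Some ` (g -` A \<inter> space borel) \<in> sets state_borel"
    by (intro Some_image_state_borel measurable_sets[OF assms(1) A])
  have "Some ` (UNIV :: 'a set) \<in> sets state_borel" by (intro Some_image_state_borel) simp
  then have "UNIV - Some ` (UNIV :: 'a set) \<in> sets state_borel" by (metis space_state_borel sets.compl_sets)
  moreover have "UNIV - Some ` (UNIV :: 'a set) = {None}" by (auto simp: notin_range_Some)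
  ultimately have None: "{None :: 'a option} \<in> sets state_borel" by simp
  have "case_option c g -` A \<inter> space state_borel = Some ` (g -` A \<inter> space borel) \<union> (if c \<in> A then {None} else {})"
    by (auto split: option.splits)
  then show "case_option c g -` A \<inter> space state_borel \<in> sets state_borel"
    by (cases "c \<in> A") (use S sets.Un[OF S None] in simp_all)
qed (use c measurable_space[OF assms(1)] in \<open>auto split: option.splits\<close>)

lemma measurable_case_option_ennreal[measurable]:
  fixes g :: "'a::metric_space \<Rightarrow> ennreal"
  shows "g \<in> borel_measurable borel \<Longrightarrow> case_option 0 g \<in> borel_measurable state_borel"
  by (rule measurable_case_option_state) simp_all

lemma measurable_case_option_real[measurable]:
  fixes g :: "'a::metric_space \<Rightarrow> real"
  shows "g \<in> borel_measurable borel \<Longrightarrow> case_option 0 g \<in> borel_measurable state_borel"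
  by (rule measurable_case_option_state) simp_all

definition kernel_op :: "('a option \<Rightarrow> 'a option measure) \<Rightarrow> ('a \<Rightarrow> real) \<Rightarrow> 'a \<Rightarrow> real" where
  "kernel_op \<kappa> u x = (\<integral>y. case_option 0 u y \<partial>\<kappa> (Some x))"

text \<open>Instantiated twice: by the transition kernels of \<open>X\<close> and by those of the
  subordinate process. Symmetry is stated for nonnegative functions, so that no integrability
  enters; mass sent to the cemetery is not seen, as functions are extended by
  \<open>0\<close>.\<close>

locale symmetric_kernel = metric_measure \<mu> for \<mu> :: "'a::{metric_space,second_countable_topology} measure" +
  fixes \<kappa> :: "'a option \<Rightarrow> 'a option measure"
  assumes kernel[measurable]: "\<kappa> \<in> state_borel \<rightarrow>\<^sub>M subprob_algebra state_borel"
    and kernel_symmetric: "\<And>f g :: 'a \<Rightarrow> ennreal. f \<in> borel_measurable borel \<Longrightarrow> g \<in> borel_measurable borel \<Longrightarrow>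
      (\<integral>\<^sup>+ x. f x * (\<integral>\<^sup>+ y. case_option 0 g y \<partial>\<kappa> (Some x)) \<partial>\<mu>) =
      (\<integral>\<^sup>+ x. g x * (\<integral>\<^sup>+ y. case_option 0 f y \<partial>\<kappa> (Some x)) \<partial>\<mu>)"
begin

abbreviation "op \<equiv> kernel_op \<kappa>"

lemmas op_def = kernel_op_def

lemma subprob_kappa: "subprob_space (\<kappa> z)"
  using kernel by (rule subprob_space_kernel) simp

lemma measurable_op[measurable]:
  "u \<in> borel_measurable borel \<Longrightarrow> op u \<in> borel_measurable borel"
  unfolding op_def
  by (rule measurable_compose[OF measurable_compose[OF measurable_Some_state kernel]
        integral_measurable_subprob_algebra[OF measurable_case_option_real]])

text \<open>Symmetry against the constant \<open>1\<close> moves the kernel onto that constant,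
  whose image is at most \<open>1\<close>.\<close>

lemma nn_op_le:
  fixes g :: "'a \<Rightarrow> ennreal"
  assumes [measurable]: "g \<in> borel_measurable borel"
  shows "(\<integral>\<^sup>+ x. (\<integral>\<^sup>+ y. case_option 0 g y \<partial>\<kappa> (Some x)) \<partial>\<mu>) \<le> (\<integral>\<^sup>+ x. g x \<partial>\<mu>)"
proof -
  have "(\<integral>\<^sup>+ x. 1 * (\<integral>\<^sup>+ y. case_option 0 g y \<partial>\<kappa> (Some x)) \<partial>\<mu>) =
      (\<integral>\<^sup>+ x. g x * (\<integral>\<^sup>+ y. case_option 0 (\<lambda>_. 1) y \<partial>\<kappa> (Some x)) \<partial>\<mu>)"
    by (rule kernel_symmetric) auto
  also have "\<dots> \<le> (\<integral>\<^sup>+ x. g x * 1 \<partial>\<mu>)"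
  proof (intro nn_integral_mono mult_left_mono)
    fix x
    interpret subprob_space "\<kappa> (Some x)" by (rule subprob_kappa)
    have "(\<integral>\<^sup>+ y. case_option 0 (\<lambda>_. 1) y \<partial>\<kappa> (Some x)) \<le> (\<integral>\<^sup>+ y. 1 \<partial>\<kappa> (Some x))"
      by (intro nn_integral_mono) (auto split: option.splits)
    also have "\<dots> \<le> 1" using emeasure_space_le_1 by simp
    finally show "(\<integral>\<^sup>+ y. case_option 0 (\<lambda>_. 1) y \<partial>\<kappa> (Some x)) \<le> 1" .
  qed simp
  finally show ?thesis by simp
qed

lemma L2_nn_finite: "u \<in> L2 \<mu> \<Longrightarrow> (\<integral>\<^sup>+ x. ennreal ((u x)\<^sup>2) \<partial>\<mu>) = ennreal (L2_inner \<mu> u u)"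
  unfolding L2_inner_def by (subst nn_integral_eq_integral) (auto simp: L2_def power2_eq_square)

text \<open>Jensen's inequality for a measure of mass at most one: the integral of the squared
  deviation from \<open>m = op u x\<close> is nonnegative, and a deficit of mass only improves the
  resulting bound.\<close>

lemma op_sq_le:
  assumes [measurable]: "u \<in> borel_measurable borel"
  shows "ennreal ((op u x)\<^sup>2) \<le> (\<integral>\<^sup>+ y. case_option 0 (\<lambda>x. ennreal ((u x)\<^sup>2)) y \<partial>\<kappa> (Some x))"
    and "(\<integral>\<^sup>+ y. case_option 0 (\<lambda>x. ennreal ((u x)\<^sup>2)) y \<partial>\<kappa> (Some x)) < \<infinity> \<Longrightarrow> integrable (\<kappa> (Some x)) (case_option 0 u)"
proof -
  interpret subprob_space "\<kappa> (Some x)" by (rule subprob_kappa)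
  let ?u = "case_option 0 u"
  have sq: "case_option 0 (\<lambda>x. ennreal ((u x)\<^sup>2)) y = ennreal ((?u y)\<^sup>2)" for y by (cases y) auto
  have both: "integrable (\<kappa> (Some x)) ?u \<and> ennreal ((op u x)\<^sup>2) \<le> (\<integral>\<^sup>+ y. ennreal ((?u y)\<^sup>2) \<partial>\<kappa> (Some x))"
    if fin: "(\<integral>\<^sup>+ y. ennreal ((?u y)\<^sup>2) \<partial>\<kappa> (Some x)) < \<infinity>"
  proof
    have i2: "integrable (\<kappa> (Some x)) (\<lambda>y. (?u y)\<^sup>2)"
      by (rule integrableI_nonneg) (use fin in auto)
    show i1: "integrable (\<kappa> (Some x)) ?u"
      by (rule square_integrable_imp_integrable[OF _ i2]) simp
    define m where "m = op u x"
    have mI: "(\<integral>y. ?u y \<partial>\<kappa> (Some x)) = m" by (simp add: m_def op_def)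
    have "0 \<le> (\<integral>y. (?u y - m)\<^sup>2 \<partial>\<kappa> (Some x))" by simp
    also have "\<dots> = (\<integral>y. (?u y)\<^sup>2 - 2 * m * ?u y + m\<^sup>2 \<partial>\<kappa> (Some x))"
      by (simp add: power2_diff algebra_simps)
    also have "\<dots> = (\<integral>y. (?u y)\<^sup>2 \<partial>\<kappa> (Some x)) - 2 * m * m + m\<^sup>2 * measure (\<kappa> (Some x)) (space (\<kappa> (Some x)))"
      using i1 i2 by (subst Bochner_Integration.integral_add, simp_all add: mI)
    also have "m\<^sup>2 * measure (\<kappa> (Some x)) (space (\<kappa> (Some x))) \<le> m\<^sup>2 * 1"
      by (intro mult_left_mono subprob_measure_le_1) auto
    finally have "m\<^sup>2 \<le> (\<integral>y. (?u y)\<^sup>2 \<partial>\<kappa> (Some x))" by (simp add: power2_eq_square)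
    then have "ennreal (m\<^sup>2) \<le> ennreal (\<integral>y. (?u y)\<^sup>2 \<partial>\<kappa> (Some x))" by (rule ennreal_leI)
    also have "\<dots> = (\<integral>\<^sup>+ y. ennreal ((?u y)\<^sup>2) \<partial>\<kappa> (Some x))"
      by (rule nn_integral_eq_integral[symmetric, OF i2]) simp
    finally show "ennreal ((op u x)\<^sup>2) \<le> (\<integral>\<^sup>+ y. ennreal ((?u y)\<^sup>2) \<partial>\<kappa> (Some x))" by (simp add: m_def)
  qed
  show "ennreal ((op u x)\<^sup>2) \<le> (\<integral>\<^sup>+ y. case_option 0 (\<lambda>x. ennreal ((u x)\<^sup>2)) y \<partial>\<kappa> (Some x))"
    unfolding sq using both by (cases "(\<integral>\<^sup>+ y. ennreal ((?u y)\<^sup>2) \<partial>\<kappa> (Some x)) < \<infinity>") (auto simp: less_top[symmetric] not_less top_unique)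
  show "integrable (\<kappa> (Some x)) (case_option 0 u)" if "(\<integral>\<^sup>+ y. case_option 0 (\<lambda>x. ennreal ((u x)\<^sup>2)) y \<partial>\<kappa> (Some x)) < \<infinity>"
    using both that unfolding sq by auto
qed

lemma op_integrable_AE:
  assumes u: "u \<in> L2 \<mu>"
  shows "AE x in \<mu>. integrable (\<kappa> (Some x)) (case_option 0 u)"
proof -
  note [measurable] = L2_measurable[OF u]
  have "(\<integral>\<^sup>+ x. (\<integral>\<^sup>+ y. case_option 0 (\<lambda>x. ennreal ((u x)\<^sup>2)) y \<partial>\<kappa> (Some x)) \<partial>\<mu>) \<le> ennreal (L2_inner \<mu> u u)"
    using nn_op_le[of "\<lambda>x. ennreal ((u x)\<^sup>2)"] L2_nn_finite[OF u] by simp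
  then have "(\<integral>\<^sup>+ x. (\<integral>\<^sup>+ y. case_option 0 (\<lambda>x. ennreal ((u x)\<^sup>2)) y \<partial>\<kappa> (Some x)) \<partial>\<mu>) \<noteq> \<infinity>"
    by (auto simp: top_unique)
  then have "AE x in \<mu>. (\<integral>\<^sup>+ y. case_option 0 (\<lambda>x. ennreal ((u x)\<^sup>2)) y \<partial>\<kappa> (Some x)) \<noteq> \<infinity>"
    by (intro nn_integral_PInf_AE) measurable
  then show ?thesis
    by eventually_elim (auto intro!: op_sq_le(2) simp: less_top)
qed

lemma op_L2: "u \<in> L2 \<mu> \<Longrightarrow> op u \<in> L2 \<mu>"
  and op_contraction: "u \<in> L2 \<mu> \<Longrightarrow> L2_inner \<mu> (op u) (op u) \<le> L2_inner \<mu> u u"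
proof -
  assume u: "u \<in> L2 \<mu>"
  note [measurable] = L2_measurable[OF u]
  have "(\<integral>\<^sup>+ x. ennreal ((op u x)\<^sup>2) \<partial>\<mu>) \<le> (\<integral>\<^sup>+ x. (\<integral>\<^sup>+ y. case_option 0 (\<lambda>x. ennreal ((u x)\<^sup>2)) y \<partial>\<kappa> (Some x)) \<partial>\<mu>)"
    by (intro nn_integral_mono op_sq_le) measurable
  also have "\<dots> \<le> ennreal (L2_inner \<mu> u u)"
    using nn_op_le[of "\<lambda>x. ennreal ((u x)\<^sup>2)"] L2_nn_finite[OF u] by simp
  finally have le: "(\<integral>\<^sup>+ x. ennreal ((op u x)\<^sup>2) \<partial>\<mu>) \<le> ennreal (L2_inner \<mu> u u)" .
  then have "integrable \<mu> (\<lambda>x. (op u x)\<^sup>2)"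
    by (intro integrableI_nonneg) (auto simp: le_less_trans)
  then show L: "op u \<in> L2 \<mu>" by (simp add: L2_def)
  show "L2_inner \<mu> (op u) (op u) \<le> L2_inner \<mu> u u"
    using le unfolding L2_nn_finite[OF L] by (simp add: L2_inner_self_nonneg)
qed

lemma op_diff:
  assumes "u \<in> L2 \<mu>" "v \<in> L2 \<mu>"
  shows "AE x in \<mu>. op (\<lambda>x. u x - v x) x = op u x - op v x"
  using op_integrable_AE[OF assms(1)] op_integrable_AE[OF assms(2)]
proof eventually_elim
  case (elim x)
  have "case_option 0 (\<lambda>x. u x - v x) y = case_option 0 u y - case_option 0 v y" for y by (cases y) auto
  then show ?case using elim by (simp add: op_def)
qed

lemma inner_op_diff_left:
  assumes "u \<in> L2 \<mu>" "v \<in> L2 \<mu>" "w \<in> L2 \<mu>"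
  shows "L2_inner \<mu> (op (\<lambda>x. u x - v x)) w = L2_inner \<mu> (op u) w - L2_inner \<mu> (op v) w"
  using L2_inner_cong_AE[OF op_diff[OF assms(1,2)]] assms by (simp add: op_L2 L2_diff L2_inner_diff_left)

lemma inner_op_diff_right:
  assumes "u \<in> L2 \<mu>" "v \<in> L2 \<mu>" "w \<in> L2 \<mu>"
  shows "L2_inner \<mu> (op w) (\<lambda>x. u x - v x) = L2_inner \<mu> (op w) u - L2_inner \<mu> (op w) v"
  using assms by (simp add: op_L2 L2_inner_diff_right)

lemma op_nonneg: "(\<And>x. 0 \<le> u x) \<Longrightarrow> 0 \<le> op u x"
  unfolding op_def by (rule integral_nonneg_AE) (auto split: option.splits)

lemma nn_op_eq:
  assumes u: "u \<in> L2 \<mu>" "\<And>x. 0 \<le> u x"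
  shows "AE x in \<mu>. (\<integral>\<^sup>+ y. case_option 0 (\<lambda>x. ennreal (u x)) y \<partial>\<kappa> (Some x)) = ennreal (op u x)"
  using op_integrable_AE[OF u(1)]
proof eventually_elim
  case (elim x)
  have "case_option 0 (\<lambda>x. ennreal (u x)) y = ennreal (case_option 0 u y)" for y by (cases y) auto
  then show ?case
    unfolding op_def using elim by (simp, subst nn_integral_eq_integral) (auto simp: u split: option.splits)
qed

lemma inner_op_nonneg:
  assumes u: "u \<in> L2 \<mu>" "\<And>x. 0 \<le> u x" and v: "v \<in> L2 \<mu>" "\<And>x. 0 \<le> v x"
  shows "ennreal (L2_inner \<mu> (op u) v) =
    (\<integral>\<^sup>+ x. ennreal (v x) * (\<integral>\<^sup>+ y. case_option 0 (\<lambda>x. ennreal (u x)) y \<partial>\<kappa> (Some x)) \<partial>\<mu>)"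
proof -
  have "ennreal (L2_inner \<mu> (op u) v) = (\<integral>\<^sup>+ x. ennreal (op u x * v x) \<partial>\<mu>)"
    unfolding L2_inner_def
    by (rule nn_integral_eq_integral[symmetric, OF L2_integrable_mult]) (auto simp: op_L2 u v op_nonneg)
  also have "\<dots> = (\<integral>\<^sup>+ x. ennreal (v x) * (\<integral>\<^sup>+ y. case_option 0 (\<lambda>x. ennreal (u x)) y \<partial>\<kappa> (Some x)) \<partial>\<mu>)"
    by (rule nn_integral_cong_AE, use nn_op_eq[OF u] in eventually_elim)
      (simp add: ennreal_mult mult.commute op_nonneg u v)
  finally show ?thesis .
qed

lemma op_symmetric:
  assumes "u \<in> L2 \<mu>" "v \<in> L2 \<mu>"
  shows "L2_inner \<mu> (op u) v = L2_inner \<mu> (op v) u"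
proof (rule bilinear_eq_of_nonneg[where BR="\<lambda>u v. L2_inner \<mu> (op v) u", OF _ _ _ _ _ assms])
  fix u v assume uv: "u \<in> L2 \<mu>" "v \<in> L2 \<mu>" "\<And>x. 0 \<le> u x" "\<And>x. 0 \<le> v x"
  note [measurable] = L2_measurable[OF uv(1)] L2_measurable[OF uv(2)]
  have nn: "0 \<le> L2_inner \<mu> (op a) b" if "\<And>x. 0 \<le> a x" "\<And>x. 0 \<le> b x" for a b
    unfolding L2_inner_def op_def
    by (intro integral_nonneg_AE AE_I2 mult_nonneg_nonneg) (auto split: option.splits simp: that)
  have "ennreal (L2_inner \<mu> (op u) v) = ennreal (L2_inner \<mu> (op v) u)"
    using uv by (simp add: inner_op_nonneg kernel_symmetric)
  then show "L2_inner \<mu> (op u) v = L2_inner \<mu> (op v) u" using nn uv by simp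
qed (auto simp: inner_op_diff_left inner_op_diff_right)

lemma inner_op_add_left:
  assumes "u \<in> L2 \<mu>" "v \<in> L2 \<mu>" "w \<in> L2 \<mu>"
  shows "L2_inner \<mu> (op (\<lambda>x. u x + v x)) w = L2_inner \<mu> (op u) w + L2_inner \<mu> (op v) w"
proof -
  have m: "(\<lambda>x. - v x) \<in> L2 \<mu>" using L2_scale[OF assms(2), of "-1"] by simp
  have "case_option 0 (\<lambda>x. - v x) y = - case_option 0 v y" for y by (cases y) auto
  then have "op (\<lambda>x. - v x) = (\<lambda>x. - op v x)" by (simp add: op_def fun_eq_iff)
  then have "L2_inner \<mu> (op (\<lambda>x. - v x)) w = - L2_inner \<mu> (op v) w" by (simp add: L2_inner_def)
  then show ?thesis using inner_op_diff_left[OF assms(1) m assms(3)] by simp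
qed

text \<open>The approximating form of a semigroup before division by the time.\<close>

definition defect :: "('a \<Rightarrow> real) \<Rightarrow> ('a \<Rightarrow> real) \<Rightarrow> real" where
  "defect u v = L2_inner \<mu> u v - L2_inner \<mu> (op u) v"

lemma defect_eq: "u \<in> L2 \<mu> \<Longrightarrow> v \<in> L2 \<mu> \<Longrightarrow> L2_inner \<mu> (\<lambda>x. u x - op u x) v = defect u v"
  by (simp add: defect_def L2_inner_diff_left op_L2)

lemma defect_nonneg: "u \<in> L2 \<mu> \<Longrightarrow> 0 \<le> defect u u"
  using L2_inner_le[OF op_L2, of u u] op_contraction[of u] by (simp add: defect_def)

lemma defect_add:
  assumes "u \<in> L2 \<mu>" "v \<in> L2 \<mu>"
  shows "defect (\<lambda>x. u x + v x) (\<lambda>x. u x + v x) = defect u u + 2 * defect u v + defect v v"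
proof -
  have r: "L2_inner \<mu> w (\<lambda>x. u x + v x) = L2_inner \<mu> w u + L2_inner \<mu> w v" if "w \<in> L2 \<mu>" for w
    using L2_inner_add_left[OF assms that] by (simp add: L2_inner_commute)
  show ?thesis using assms
    by (simp add: defect_def r L2_add op_L2 L2_inner_add_left inner_op_add_left op_symmetric[of v u] L2_inner_commute[of v u])
qed

lemma defect_diff:
  assumes "u \<in> L2 \<mu>" "v \<in> L2 \<mu>"
  shows "defect (\<lambda>x. u x - v x) (\<lambda>x. u x - v x) = defect u u - 2 * defect u v + defect v v"
  using assms
  by (simp add: defect_def L2_diff op_L2 L2_inner_diff_left L2_inner_diff_right inner_op_diff_left
      op_symmetric[of v u] L2_inner_commute[of v u])

lemma defect_scale:
  "u \<in> L2 \<mu> \<Longrightarrow> defect (\<lambda>x. c * u x) (\<lambda>x. c * u x) = c\<^sup>2 * defect u u"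
proof -
  have "case_option 0 (\<lambda>x. c * u x) y = c * case_option 0 u y" for y by (cases y) auto
  then have o: "op (\<lambda>x. c * u x) = (\<lambda>x. c * op u x)" by (simp add: op_def fun_eq_iff)
  have "L2_inner \<mu> (\<lambda>x. c * a x) (\<lambda>x. c * b x) = c\<^sup>2 * L2_inner \<mu> a b" for a b
    by (simp add: L2_inner_def power2_eq_square mult_ac flip: Bochner_Integration.integral_mult_right_zero)
  then show ?thesis by (simp add: defect_def o right_diff_distrib)
qed

end

text \<open>A neighbourhood of the cemetery is the complement of a difference of two images of open
  subsets of \<open>M\<close>, so these images generate; unlike the full topology they do not
  involve the cemetery.\<close>

lemma sets_state_borel: "sets (state_borel :: 'a::metric_space option measure) = sigma_sets UNIV {Some ` U |U. open U}"
proof -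
  let ?G = "{Some ` U |U::'a set. open U}"
  interpret G: sigma_algebra UNIV "sigma_sets UNIV ?G" by (rule sigma_algebra_sigma_sets) simp
  have "{U. openin state_top U} \<subseteq> sigma_sets UNIV ?G"
  proof
    fix A :: "'a option set" assume "A \<in> {U. openin state_top U}"
    then consider U where "open U" "A = Some ` U" | C where "closed C" "A = insert None (Some ` (UNIV - C))"
      by (auto simp: openin_Alexandroff_compactification)
    then show "A \<in> sigma_sets UNIV ?G"
    proof cases
      case 2
      have 1: "Some ` (UNIV :: 'a set) \<in> sigma_sets UNIV ?G" "Some ` (- C) \<in> sigma_sets UNIV ?G"
        using 2 by (auto intro!: sigma_sets.Basic simp: open_Compl)
      have "A = UNIV - (Some ` UNIV - Some ` (- C))"
        unfolding 2 by (auto simp: notin_range_Some)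
      then show ?thesis using G.Diff[OF G.top G.Diff[OF 1]] by simp
    qed (auto intro: sigma_sets.Basic)
  qed
  then have "sigma_sets UNIV {U. openin state_top U} \<subseteq> sigma_sets UNIV ?G" by (rule sigma_sets_mono)
  moreover have "sigma_sets UNIV ?G \<subseteq> sigma_sets UNIV {U. openin state_top U}"
    by (rule sigma_sets_mono) (auto intro: sigma_sets.Basic)
  ultimately show ?thesis by (auto simp: state_borel_def)
qed

text \<open>The delicate case is an open set \<open>U\<close> containing \<open>0\<close>: the
  points of \<open>M\<close> mapped outside \<open>U\<close> form a closed subset of the compact
  support, so the preimage of \<open>U\<close> is a neighbourhood of the cemetery.\<close>

lemma continuous_map_case_option:
  fixes f :: "'a::metric_space \<Rightarrow> real"
  assumes "f \<in> C_c"
  shows "continuous_map state_top euclidean (case_option 0 f)"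
  unfolding continuous_map_def
proof (intro conjI allI impI)
  fix U :: "real set" assume "openin euclidean U"
  then have U: "open U" by simp
  have cont: "continuous_on UNIV f" and cpt: "compact (closure {x. f x \<noteq> 0})" using assms by (auto simp: C_c_def)
  show "openin state_top {x \<in> topspace state_top. case_option 0 f x \<in> U}"
  proof (cases "0 \<in> U")
    case False
    then have "{x \<in> topspace state_top. case_option 0 f x \<in> U} = Some ` (f -` U)"
      by (auto split: option.splits)
    moreover have "open (f -` U)" using U cont by (rule open_vimage)
    ultimately show ?thesis by simp
  next
    case True
    let ?C = "f -` (- U)"
    have clC: "closed ?C" using cont U by (intro closed_vimage) (auto simp: closed_Compl)
    have "?C \<subseteq> closure {x. f x \<noteq> 0}" using True closure_subset by (fastforce)
    then have "compact ?C" using compact_Int_closed[OF cpt clC] by (metis inf.absorb_iff2)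
    moreover have "{x \<in> topspace state_top. case_option 0 f x \<in> U} = insert None (Some ` (UNIV - ?C))"
    proof (rule set_eqI)
      fix z :: "'a option"
      show "z \<in> {x \<in> topspace state_top. case_option 0 f x \<in> U} \<longleftrightarrow> z \<in> insert None (Some ` (UNIV - ?C))"
        using True by (cases z) auto
    qed
    ultimately show ?thesis using clC unfolding openin_Alexandroff_compactification by auto
  qed
qed simp

context metric_measure
begin

lemma indicator_Some_image_limit:
  fixes f :: "nat \<Rightarrow> 'a \<Rightarrow> real"
  assumes "\<And>x. (\<lambda>n. f n x) \<longlonglongrightarrow> indicator U x"
  shows "(\<lambda>n. case_option 0 (f n) y) \<longlonglongrightarrow> indicator (Some ` U) y"
proof (cases y)
  case (Some x)
  have "indicator (Some ` U) (Some x) = (indicator U x :: real)" by (auto simp: indicator_def)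
  then show ?thesis using assms[of x] Some by simp
qed (simp add: indicator_def)

text \<open>Images of open sets generate, and their indicators are limits of \<open>C_c\<close>
  functions extended by \<open>0\<close>. These are also the functions along which right continuity
  of the paths can be exploited.\<close>

lemma measurable_state_borelI:
  fixes Y :: "'c \<Rightarrow> 'a option"
  assumes "\<And>f. f \<in> C_c \<Longrightarrow> (\<lambda>a. case_option (0::real) f (Y a)) \<in> borel_measurable N"
  shows "Y \<in> N \<rightarrow>\<^sub>M state_borel"
proof (rule measurable_sigma_sets[OF sets_state_borel])
  fix A :: "'a option set" assume "A \<in> {Some ` U |U. open U}"
  then obtain U where U: "open U" "A = Some ` U" by auto
  obtain f :: "nat \<Rightarrow> 'a \<Rightarrow> real" where f: "\<And>n. f n \<in> C_c" "\<And>x. (\<lambda>n. f n x) \<longlonglongrightarrow> indicator U x"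
    using C_c_approx_open[OF U(1)] by metis
  have "(\<lambda>a. indicator A (Y a) :: real) \<in> borel_measurable N"
    by (rule borel_measurable_LIMSEQ_real[OF indicator_Some_image_limit[OF f(2), folded U(2)] assms[OF f(1)]])
  then have "(\<lambda>a. indicator A (Y a) :: real) -` {1} \<inter> space N \<in> sets N" by (rule measurable_sets) simp
  moreover have "(\<lambda>a. indicator A (Y a) :: real) -` {1} \<inter> space N = Y -` A \<inter> space N" by (auto simp: indicator_def)
  ultimately show "Y -` A \<inter> space N \<in> sets N" by simp
qed auto

end

text \<open>The first multiple of \<open>1 / real (Suc m)\<close> strictly to the right of
  \<open>max 0 s\<close>: strictness is demanded by the filter \<open>at_right\<close>, and there
  are only countably many values. The maximum matches \<open>ennreal\<close>, which sends negative
  reals to \<open>0\<close>.\<close>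

definition grid_time :: "nat \<Rightarrow> real \<Rightarrow> real" where
  "grid_time m s = (real_of_int \<lfloor>real (Suc m) * max 0 s\<rfloor> + 1) / real (Suc m)"

lemma grid_time_bounds: "max 0 s < grid_time m s" "grid_time m s \<le> max 0 s + 1 / real (Suc m)"
proof -
  have "real (Suc m) * max 0 s < real_of_int \<lfloor>real (Suc m) * max 0 s\<rfloor> + 1" by linarith
  then show "max 0 s < grid_time m s" unfolding grid_time_def by (subst pos_less_divide_eq) (auto simp: mult.commute)
  have "real_of_int \<lfloor>real (Suc m) * max 0 s\<rfloor> + 1 \<le> real (Suc m) * max 0 s + 1" by linarith
  then have "grid_time m s \<le> (real (Suc m) * max 0 s + 1) / real (Suc m)" unfolding grid_time_def by (intro divide_right_mono) auto
  also have "\<dots> = max 0 s + 1 / real (Suc m)" by (subst add_divide_distrib) simp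
  finally show "grid_time m s \<le> max 0 s + 1 / real (Suc m)" .
qed

lemma grid_time_at_right: "filterlim (\<lambda>m. ennreal (grid_time m s)) (at_right (ennreal s)) sequentially"
proof -
  have e: "ennreal s = ennreal (max 0 s)" by (cases "s \<ge> 0") (auto simp: ennreal_neg)
  have "(\<lambda>m. max 0 s + 1 / real (Suc m)) \<longlonglongrightarrow> max 0 s + 0"
    by (intro tendsto_add tendsto_const) (use LIMSEQ_inverse_real_of_nat in \<open>simp add: inverse_eq_divide\<close>)
  then have up: "(\<lambda>m. max 0 s + 1 / real (Suc m)) \<longlonglongrightarrow> max 0 s" by simp
  have "(\<lambda>m. grid_time m s) \<longlonglongrightarrow> max 0 s"
  proof (rule tendsto_sandwich[OF _ _ tendsto_const up])
    show "\<forall>\<^sub>F m in sequentially. max 0 s \<le> grid_time m s"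
      by (intro always_eventually allI less_imp_le grid_time_bounds(1))
    show "\<forall>\<^sub>F m in sequentially. grid_time m s \<le> max 0 s + 1 / real (Suc m)"
      by (intro always_eventually allI grid_time_bounds(2))
  qed
  then have t: "(\<lambda>m. ennreal (grid_time m s)) \<longlonglongrightarrow> ennreal s" unfolding e by (rule tendsto_ennrealI)
  have "ennreal s < ennreal (grid_time m s)" for m
    unfolding e using grid_time_bounds(1)[of s m] by (intro ennreal_lessI) auto
  then have "ennreal (grid_time m s) \<in> {ennreal s<..} \<and> ennreal (grid_time m s) \<noteq> ennreal s" for m
    by (metis greaterThan_iff less_irrefl)
  then have "\<forall>\<^sub>F m in sequentially. ennreal (grid_time m s) \<in> {ennreal s<..} \<and> ennreal (grid_time m s) \<noteq> ennreal s"
    by (intro always_eventually allI)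
  then show ?thesis unfolding filterlim_at using t by (rule conjI)
qed

section \<open>Transition kernels of the Hunt process\<close>

locale hunt = regular_form \<mu> E F for \<mu> :: "'a::{metric_space,second_countable_topology} measure" and E F +
  fixes W :: "'w measure" and P :: "'a option \<Rightarrow> 'w measure" and X :: "ennreal \<Rightarrow> 'w \<Rightarrow> 'a option"
  assumes process: "hunt_process W P X" and mu_sym: "mu_symmetric \<mu> P X"
    and associated: "associated_process \<mu> E F P X"
begin

lemma prob_P: "prob_space (P z)" and sets_P[measurable_cong]: "sets (P z) = sets W"
  and X_measurable[measurable]: "X t \<in> W \<rightarrow>\<^sub>M state_borel"
  and X_kernel: "B \<in> sets state_borel \<Longrightarrow> (\<lambda>x. measure (P x) {\<omega> \<in> space W. X t \<omega> \<in> B}) \<in> borel_measurable state_borel"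
  and X_start: "AE \<omega> in P z. X 0 \<omega> = z"
  and X_cemetery: "AE \<omega> in P None. X t \<omega> = None"
  and X_right_continuous: "\<omega> \<in> space W \<Longrightarrow> t < \<infinity> \<Longrightarrow> limitin state_top (\<lambda>s. X s \<omega>) (X t \<omega>) (at_right t)"
proof -
  note h1 = process[unfolded hunt_process_def]
  note h2 = conjunct2[OF h1] note h3 = conjunct2[OF h2] note h4 = conjunct2[OF h3]
  note h5 = conjunct2[OF h4] note h6 = conjunct2[OF h5] note h7 = conjunct2[OF h6]
  show "prob_space (P z)" "sets (P z) = sets W" using conjunct1[OF h1] by simp_all
  show "X t \<in> W \<rightarrow>\<^sub>M state_borel" using conjunct1[OF h2] by simp
  show "B \<in> sets state_borel \<Longrightarrow> (\<lambda>x. measure (P x) {\<omega> \<in> space W. X t \<omega> \<in> B}) \<in> borel_measurable state_borel"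
    using conjunct1[OF h3] by simp
  show "AE \<omega> in P z. X 0 \<omega> = z" using conjunct1[OF h4] by (rule spec)
  show "AE \<omega> in P None. X t \<omega> = None" using conjunct1[OF h5] by (rule spec)
  show "\<omega> \<in> space W \<Longrightarrow> t < \<infinity> \<Longrightarrow> limitin state_top (\<lambda>s. X s \<omega>) (X t \<omega>) (at_right t)"
    using conjunct1[OF h7] by simp
qed

lemma space_P[simp]: "space (P z) = space W"
  using sets_eq_imp_space_eq[OF sets_P] .

text \<open>The strong Markov property at the constant stopping time \<open>a\<close>, with the
  whole space as the conditioning event.\<close>

lemma markov:
  assumes B: "B \<in> sets state_borel"
  shows "measure (P z) {\<omega> \<in> space W. X (a + b) \<omega> \<in> B} =
    (\<integral>\<omega>. measure (P (X a \<omega>)) {\<eta> \<in> space W. X b \<eta> \<in> B} \<partial>P z)"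
proof -
  obtain G where G: "filtration (space W) G" "strong_markov W P X G"
  proof -
    have "\<exists>G. filtration (space W) G \<and> (\<forall>t. sets (G t) \<subseteq> sets W) \<and>
        right_continuous_filtration G \<and> (\<forall>t. X t \<in> measurable (G t) state_borel) \<and>
        strong_markov W P X G \<and> quasi_left_continuous W P X G"
      using process unfolding hunt_process_def by (elim conjE)
    then show ?thesis using that by (elim exE conjE)
  qed
  interpret filtration "space W" G by fact
  have st: "stopping_time G (\<lambda>_. a)" by (rule stopping_time_const)
  have "space W \<in> sets (pre_sigma (\<lambda>_. a))"
  proof (rule sets_pre_sigmaI[OF st])
    fix t show "{\<omega> \<in> space W. a \<le> t} \<in> sets (G t)"
      using sets.top[of "G t"] space_F[of t] by (cases "a \<le> t") auto
  qed
  then have "measure (P z) {\<omega> \<in> space W. X (a + b) \<omega> \<in> B} =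
      (LINT \<omega>:space W|P z. measure (P (X a \<omega>)) {\<eta> \<in> space W. X b \<eta> \<in> B})"
    using G(2) st B unfolding strong_markov_def by blast
  also have "\<dots> = (\<integral>\<omega>. measure (P (X a \<omega>)) {\<eta> \<in> space W. X b \<eta> \<in> B} \<partial>P z)"
    unfolding set_lebesgue_integral_def by (rule Bochner_Integration.integral_cong) auto
  finally show ?thesis .
qed

lemma X_grid:
  assumes "\<omega> \<in> space W" "f \<in> C_c"
  shows "(\<lambda>m. case_option (0::real) f (X (ennreal (grid_time m s)) \<omega>)) \<longlonglongrightarrow> case_option 0 f (X (ennreal s) \<omega>)"
proof -
  have "limitin state_top (\<lambda>s. X s \<omega>) (X (ennreal s) \<omega>) (at_right (ennreal s))"
    by (rule X_right_continuous[OF assms(1)]) simp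
  from continuous_map_limit[OF continuous_map_case_option[OF assms(2)] this]
  have "((\<lambda>s. case_option 0 f (X s \<omega>)) \<longlongrightarrow> case_option 0 f (X (ennreal s) \<omega>)) (at_right (ennreal s))"
    by (simp add: o_def)
  from filterlim_compose[OF this grid_time_at_right] show ?thesis by simp
qed

text \<open>Indexed by real times because the laws of the subordinator live on the real line;
  negative times act as time \<open>0\<close>.\<close>

definition K :: "real \<Rightarrow> 'a option \<Rightarrow> 'a option measure" where
  "K s z = distr (P z) state_borel (X (ennreal s))"

lemma sets_K[simp, measurable_cong]: "sets (K s z) = sets state_borel"
  by (simp add: K_def)

lemma space_K[simp]: "space (K s z) = UNIV"
  by (simp add: K_def)

lemma prob_K: "prob_space (K s z)"
proof -
  interpret prob_space "P z" by (rule prob_P)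
  show ?thesis unfolding K_def by (rule prob_space_distr) measurable
qed

lemma measure_K: "B \<in> sets state_borel \<Longrightarrow> measure (K s z) B = measure (P z) {\<omega> \<in> space W. X (ennreal s) \<omega> \<in> B}"
  unfolding K_def by (subst measure_distr) (auto intro!: arg_cong2[where f=measure])

lemma integral_K:
  fixes g :: "'a option \<Rightarrow> real"
  shows "g \<in> borel_measurable state_borel \<Longrightarrow> (\<integral>y. g y \<partial>K s z) = (\<integral>\<omega>. g (X (ennreal s) \<omega>) \<partial>P z)"
  unfolding K_def by (rule integral_distr) measurable

lemma nn_integral_K:
  shows "g \<in> borel_measurable state_borel \<Longrightarrow> (\<integral>\<^sup>+y. g y \<partial>K s z) = (\<integral>\<^sup>+\<omega>. g (X (ennreal s) \<omega>) \<partial>P z)"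
  unfolding K_def by (rule nn_integral_distr) measurable

lemma K_kernel_fixed: "K s \<in> state_borel \<rightarrow>\<^sub>M subprob_algebra state_borel"
proof (rule measurable_subprob_algebra)
  fix A :: "'a option set" assume A: "A \<in> sets state_borel"
  interpret prob_space "K s z" for z by (rule prob_K)
  show "(\<lambda>z. emeasure (K s z) A) \<in> borel_measurable state_borel"
    unfolding emeasure_eq_measure using X_kernel[OF A] by (simp add: measure_K[OF A])
qed (auto intro: prob_space_imp_subprob_space prob_K)

lemma K_grid:
  assumes f: "f \<in> C_c"
  shows "(\<lambda>m. \<integral>y. case_option (0::real) f y \<partial>K (grid_time m s) z) \<longlonglongrightarrow> (\<integral>y. case_option 0 f y \<partial>K s z)"
proof -
  note [measurable] = C_c_measurable[OF f]
  obtain M where M: "M > 0" "\<And>x. \<bar>f x\<bar> \<le> M" using C_c_bounded[OF f] by blast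
  interpret prob_space "P z" by (rule prob_P)
  have "(\<lambda>m. \<integral>\<omega>. case_option (0::real) f (X (ennreal (grid_time m s)) \<omega>) \<partial>P z) \<longlonglongrightarrow> (\<integral>\<omega>. case_option 0 f (X (ennreal s) \<omega>) \<partial>P z)"
  proof (rule integral_dominated_convergence[where w="\<lambda>_. M"])
    show "AE \<omega> in P z. (\<lambda>m. case_option (0::real) f (X (ennreal (grid_time m s)) \<omega>)) \<longlonglongrightarrow> case_option 0 f (X (ennreal s) \<omega>)"
      by (intro AE_I2 X_grid[OF _ f]) simp
    show "AE \<omega> in P z. norm (case_option (0::real) f (X (ennreal (grid_time m s)) \<omega>)) \<le> M" for m
      using M by (intro AE_I2) (auto split: option.splits)
  qed simp_all
  then show ?thesis by (simp add: integral_K)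
qed

text \<open>The process provides measurability in the starting point at each fixed time. Joint
  measurability in time follows from right continuity, since along \<open>grid_time\<close> only
  countably many times occur.\<close>

lemma K_integral_measurable:
  assumes f: "f \<in> C_c"
  shows "(\<lambda>p. \<integral>y. case_option (0::real) f y \<partial>K (fst p) (snd p)) \<in> borel_measurable (borel \<Otimes>\<^sub>M state_borel)"
proof -
  note [measurable] = C_c_measurable[OF f]
  have fm: "(\<lambda>z. \<integral>y. case_option (0::real) f y \<partial>K s z) \<in> borel_measurable state_borel" for s
    by (rule measurable_compose[OF K_kernel_fixed integral_measurable_subprob_algebra]) measurable
  have "(\<lambda>p. (\<lambda>(i::int) p. \<integral>y. case_option (0::real) f y \<partial>K ((real_of_int i + 1) / real (Suc m)) (snd p)) (\<lfloor>real (Suc m) * max 0 (fst p)\<rfloor>) p)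
      \<in> borel_measurable ((borel :: real measure) \<Otimes>\<^sub>M state_borel)" for m
  proof (rule measurable_compose_countable[where f="\<lambda>i p. \<integral>y. case_option (0::real) f y \<partial>K ((real_of_int i + 1) / real (Suc m)) (snd p)"])
    show "(\<lambda>p. \<integral>y. case_option (0::real) f y \<partial>K ((real_of_int i + 1) / real (Suc m)) (snd p)) \<in> borel_measurable ((borel :: real measure) \<Otimes>\<^sub>M state_borel)" for i :: int
      by (rule measurable_compose[OF measurable_snd fm])
  qed measurable
  then have "(\<lambda>p. \<integral>y. case_option (0::real) f y \<partial>K (grid_time m (fst p)) (snd p)) \<in> borel_measurable (borel \<Otimes>\<^sub>M state_borel)" for m
    by (simp add: grid_time_def)
  then show ?thesis by (rule borel_measurable_LIMSEQ_real[OF K_grid[OF f]])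
qed

lemma K_kernel: "(\<lambda>(s, z). K s z) \<in> borel \<Otimes>\<^sub>M state_borel \<rightarrow>\<^sub>M subprob_algebra state_borel"
proof (rule measurable_subprob_algebra_generated[OF sets_state_borel])
  have "Some ` U \<inter> Some ` V = Some ` (U \<inter> V)" for U V :: "'a set" by auto
  then show "Int_stable {Some ` U |U::'a set. open U}"
    by (auto simp: Int_stable_def) (metis open_Int)
  fix A :: "'a option set" assume "A \<in> {Some ` U |U. open U}"
  then obtain U where U: "open U" "A = Some ` U" by auto
  obtain f :: "nat \<Rightarrow> 'a \<Rightarrow> real" where f: "\<And>n. f n \<in> C_c" "\<And>n x. 0 \<le> f n x" "\<And>n x. f n x \<le> 1" "\<And>x. (\<lambda>n. f n x) \<longlonglongrightarrow> indicator U x"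
    using C_c_approx_open[OF U(1)] by metis
  have [measurable]: "f n \<in> borel_measurable borel" for n by (rule C_c_measurable[OF f(1)])
  have A[measurable]: "A \<in> sets state_borel" unfolding U(2) by (intro openin_state_borel) (simp add: U)
  have "(\<lambda>p. measure (K (fst p) (snd p)) A) \<in> borel_measurable (borel \<Otimes>\<^sub>M state_borel)"
  proof (rule borel_measurable_LIMSEQ_real)
    fix p :: "real \<times> 'a option"
    interpret prob_space "K (fst p) (snd p)" by (rule prob_K)
    have "(\<lambda>n. \<integral>y. case_option 0 (f n) y \<partial>K (fst p) (snd p)) \<longlonglongrightarrow> (\<integral>y. indicator A y \<partial>K (fst p) (snd p))"
      by (rule integral_dominated_convergence[where w="\<lambda>_. 1"])
        (use f(2,3) in \<open>auto intro!: AE_I2 indicator_Some_image_limit[OF f(4), folded U(2)] split: option.splits\<close>)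
    then show "(\<lambda>n. \<integral>y. case_option 0 (f n) y \<partial>K (fst p) (snd p)) \<longlonglongrightarrow> measure (K (fst p) (snd p)) A"
      by simp
  qed (rule K_integral_measurable[OF f(1)])
  then show "(\<lambda>p. emeasure (case p of (s, z) \<Rightarrow> K s z) A) \<in> borel_measurable (borel \<Otimes>\<^sub>M state_borel)"
    by (simp add: case_prod_beta' finite_measure.emeasure_eq_measure[OF prob_space.finite_measure[OF prob_K]])
next
  have "emeasure (K s z) UNIV = 1" for s z using prob_space.emeasure_space_1[OF prob_K[of s z]] by simp
  then show "(\<lambda>p. emeasure (case p of (s, z) \<Rightarrow> K s z) UNIV) \<in> borel_measurable (borel \<Otimes>\<^sub>M state_borel)"
    by (simp add: case_prod_beta')
qed (auto intro: prob_space_imp_subprob_space prob_K)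

lemma measurable_K[measurable (raw)]:
  assumes [measurable]: "s \<in> borel_measurable N" "z \<in> N \<rightarrow>\<^sub>M state_borel"
  shows "(\<lambda>a. K (s a) (z a)) \<in> N \<rightarrow>\<^sub>M subprob_algebra state_borel"
proof -
  have "(\<lambda>a. (s a, z a)) \<in> N \<rightarrow>\<^sub>M borel \<Otimes>\<^sub>M state_borel" by measurable
  from measurable_compose[OF this K_kernel] show ?thesis by simp
qed

lemma nn_integral_K_start:
  fixes g :: "'a \<Rightarrow> ennreal"
  assumes "s \<le> 0" and [measurable]: "g \<in> borel_measurable borel"
  shows "(\<integral>\<^sup>+y. case_option 0 g y \<partial>K s (Some x)) = g x"
proof -
  interpret prob_space "P (Some x)" by (rule prob_P)
  have "(\<integral>\<^sup>+\<omega>. case_option 0 g (X (ennreal s) \<omega>) \<partial>P (Some x)) = (\<integral>\<^sup>+\<omega>. g x \<partial>P (Some x))"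
    by (rule nn_integral_cong_AE)
      (use X_start[of "Some x"] assms in \<open>auto elim!: eventually_mono simp: ennreal_neg\<close>)
  then show ?thesis using emeasure_space_1 by (simp add: nn_integral_K)
qed

lemma K_symmetric: "symmetric_kernel \<mu> (K s)"
proof
  show "K s \<in> state_borel \<rightarrow>\<^sub>M subprob_algebra state_borel" by (rule K_kernel_fixed)
  fix f g :: "'a \<Rightarrow> ennreal" assume [measurable]: "f \<in> borel_measurable borel" "g \<in> borel_measurable borel"
  show "(\<integral>\<^sup>+ x. f x * (\<integral>\<^sup>+ y. case_option 0 g y \<partial>K s (Some x)) \<partial>\<mu>) =
      (\<integral>\<^sup>+ x. g x * (\<integral>\<^sup>+ y. case_option 0 f y \<partial>K s (Some x)) \<partial>\<mu>)"
  proof (cases "s > 0")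
    case True
    then show ?thesis
      unfolding nn_integral_K[OF measurable_case_option_ennreal[OF \<open>f \<in> _\<close>]]
        nn_integral_K[OF measurable_case_option_ennreal[OF \<open>g \<in> _\<close>]]
      by (intro mu_sym[unfolded mu_symmetric_def, rule_format]) simp_all
  next
    case False
    then show ?thesis by (simp add: nn_integral_K_start mult.commute)
  qed
qed

lemma transition_eq: "u \<in> borel_measurable borel \<Longrightarrow> transition P (real_time X) s u = kernel_op (K s) u"
  by (rule ext) (simp add: transition_def kernel_op_def integral_K)

text \<open>The Chapman-Kolmogorov equation, obtained by integrating \<open>markov\<close> over the
  law of \<open>X\<close> at time \<open>a\<close>.\<close>

lemma K_semigroup:
  assumes ab: "0 \<le> a" "0 \<le> b" and [measurable]: "g \<in> borel_measurable state_borel"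
  shows "(\<integral>\<^sup>+y. g y \<partial>K (a + b) z) = (\<integral>\<^sup>+y. (\<integral>\<^sup>+y'. g y' \<partial>K b y) \<partial>K a z)"
proof -
  have "K (a + b) z = K a z \<bind> K b"
  proof (rule measure_eqI)
    have kb: "K b \<in> K a z \<rightarrow>\<^sub>M subprob_algebra state_borel" by measurable
    show "sets (K (a + b) z) = sets (K a z \<bind> K b)"
      by (subst sets_bind[where N=state_borel]) auto
    fix B assume "B \<in> sets (K (a + b) z)"
    then have B[measurable]: "B \<in> sets state_borel" by simp
    interpret ab: prob_space "K (a + b) z" by (rule prob_K)
    interpret a: prob_space "K a z" by (rule prob_K)
    interpret b: prob_space "K b y" for y by (rule prob_K)
    have "measure (K (a + b) z) B = (\<integral>\<omega>. measure (P (X (ennreal a) \<omega>)) {\<eta> \<in> space W. X (ennreal b) \<eta> \<in> B} \<partial>P z)"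
      using markov[OF B, of z "ennreal a" "ennreal b"] ab by (simp add: measure_K)
    also have "\<dots> = (\<integral>y. measure (K b y) B \<partial>K a z)"
      using X_kernel[OF B] by (subst integral_K) (simp_all add: measure_K)
    finally have "emeasure (K (a + b) z) B = ennreal (\<integral>y. measure (K b y) B \<partial>K a z)"
      by (simp add: ab.emeasure_eq_measure)
    also have "\<dots> = (\<integral>\<^sup>+y. emeasure (K b y) B \<partial>K a z)"
      unfolding b.emeasure_eq_measure
      by (rule nn_integral_eq_integral[symmetric]) (auto intro!: a.integrable_const_bound[where B=1])
    also have "\<dots> = emeasure (K a z \<bind> K b) B"
      by (subst emeasure_bind[OF _ kb]) auto
    finally show "emeasure (K (a + b) z) B = emeasure (K a z \<bind> K b) B" .
  qed
  then show ?thesis by (simp add: nn_integral_bind[where B=state_borel])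
qed

lemma nn_integral_K_None:
  fixes g :: "'a \<Rightarrow> ennreal"
  assumes [measurable]: "g \<in> borel_measurable borel"
  shows "(\<integral>\<^sup>+y. case_option 0 g y \<partial>K s None) = 0"
proof -
  have "(\<integral>\<^sup>+\<omega>. case_option 0 g (X (ennreal s) \<omega>) \<partial>P None) = (\<integral>\<^sup>+\<omega>. 0 \<partial>P None)"
    by (rule nn_integral_cong_AE) (use X_cemetery[of "ennreal s"] in \<open>auto elim!: eventually_mono\<close>)
  then show ?thesis by (simp add: nn_integral_K)
qed

section \<open>The semigroup on \<open>L2\<close> and the function \<open>gap\<close>\<close>

abbreviation Q :: "real \<Rightarrow> ('a \<Rightarrow> real) \<Rightarrow> 'a \<Rightarrow> real" where
  "Q s \<equiv> kernel_op (K s)"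

text \<open>Chapman-Kolmogorov followed by symmetry of \<open>K a\<close>. This one relation between
  inner products replaces the spectral calculus: boundedness, monotonicity and concavity of
  \<open>gap\<close> all come from it.\<close>

lemma inner_Q_add:
  assumes ab: "0 < a" "0 < b" and uv: "u \<in> L2 \<mu>" "v \<in> L2 \<mu>"
  shows "L2_inner \<mu> (Q (a + b) u) v = L2_inner \<mu> (Q b u) (Q a v)"
proof -
  interpret A: symmetric_kernel \<mu> "K a" by (rule K_symmetric)
  interpret B: symmetric_kernel \<mu> "K b" by (rule K_symmetric)
  interpret AB: symmetric_kernel \<mu> "K (a + b)" by (rule K_symmetric)
  show ?thesis
  proof (rule bilinear_eq_of_nonneg[where BR="\<lambda>u v. L2_inner \<mu> (Q b u) (Q a v)", OF _ _ _ _ _ uv])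
    fix u v assume uv: "u \<in> L2 \<mu>" "v \<in> L2 \<mu>" "\<And>x. 0 \<le> u x" "\<And>x. 0 \<le> v x"
    note [measurable] = L2_measurable[OF uv(1)] L2_measurable[OF uv(2)]
    let ?u = "\<lambda>x. ennreal (u x)" and ?v = "\<lambda>x. ennreal (v x)"
    have "ennreal (L2_inner \<mu> (Q (a + b) u) v) = (\<integral>\<^sup>+ x. ?v x * (\<integral>\<^sup>+ y. case_option 0 ?u y \<partial>K (a + b) (Some x)) \<partial>\<mu>)"
      using uv by (simp add: AB.inner_op_nonneg)
    also have "\<dots> = (\<integral>\<^sup>+ x. ?v x * (\<integral>\<^sup>+ y. case_option 0 (\<lambda>x. \<integral>\<^sup>+ y'. case_option 0 ?u y' \<partial>K b (Some x)) y \<partial>K a (Some x)) \<partial>\<mu>)"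
    proof (intro nn_integral_cong arg_cong2[where f="(*)"] refl)
      fix x
      \<comment> \<open>The process stays at the cemetery, so the inner integral vanishes there and
        is again a function on \<open>M\<close> extended by \<open>0\<close>.\<close>
      have in_eq: "(\<integral>\<^sup>+ y'. case_option 0 ?u y' \<partial>K b y) = case_option 0 (\<lambda>x. \<integral>\<^sup>+ y'. case_option 0 ?u y' \<partial>K b (Some x)) y" for y
        by (cases y) (simp_all add: nn_integral_K_None)
      have "(\<integral>\<^sup>+ y. case_option 0 ?u y \<partial>K (a + b) (Some x)) = (\<integral>\<^sup>+ y. (\<integral>\<^sup>+ y'. case_option 0 ?u y' \<partial>K b y) \<partial>K a (Some x))"
        by (rule K_semigroup) (use ab in simp_all)
      also have "\<dots> = (\<integral>\<^sup>+ y. case_option 0 (\<lambda>x. \<integral>\<^sup>+ y'. case_option 0 ?u y' \<partial>K b (Some x)) y \<partial>K a (Some x))"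
        by (rule nn_integral_cong) (rule in_eq)
      finally show "(\<integral>\<^sup>+ y. case_option 0 ?u y \<partial>K (a + b) (Some x)) =
          (\<integral>\<^sup>+ y. case_option 0 (\<lambda>x. \<integral>\<^sup>+ y'. case_option 0 ?u y' \<partial>K b (Some x)) y \<partial>K a (Some x))" .
    qed
    also have "\<dots> = (\<integral>\<^sup>+ x. (\<integral>\<^sup>+ y'. case_option 0 ?u y' \<partial>K b (Some x)) * (\<integral>\<^sup>+ y. case_option 0 ?v y \<partial>K a (Some x)) \<partial>\<mu>)"
      by (rule A.kernel_symmetric) measurable
    also have "\<dots> = (\<integral>\<^sup>+ x. ennreal (Q b u x * Q a v x) \<partial>\<mu>)"
    proof (rule nn_integral_cong_AE)
      show "AE x in \<mu>. (\<integral>\<^sup>+ y'. case_option 0 ?u y' \<partial>K b (Some x)) * (\<integral>\<^sup>+ y. case_option 0 ?v y \<partial>K a (Some x)) = ennreal (Q b u x * Q a v x)"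
        using B.nn_op_eq[OF uv(1,3)] A.nn_op_eq[OF uv(2,4)]
        by eventually_elim (simp add: ennreal_mult A.op_nonneg B.op_nonneg uv)
    qed
    also have "\<dots> = ennreal (L2_inner \<mu> (Q b u) (Q a v))"
      unfolding L2_inner_def
      by (rule nn_integral_eq_integral[OF L2_integrable_mult]) (auto simp: A.op_L2 B.op_L2 uv A.op_nonneg B.op_nonneg)
    finally have "ennreal (L2_inner \<mu> (Q (a + b) u) v) = ennreal (L2_inner \<mu> (Q b u) (Q a v))" .
    moreover have "0 \<le> L2_inner \<mu> (Q (a + b) u) v" "0 \<le> L2_inner \<mu> (Q b u) (Q a v)"
      unfolding L2_inner_def by (auto intro!: integral_nonneg_AE AE_I2 simp: A.op_nonneg B.op_nonneg AB.op_nonneg uv)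
    ultimately show "L2_inner \<mu> (Q (a + b) u) v = L2_inner \<mu> (Q b u) (Q a v)" by simp
  next
    fix u v w assume uvw: "u \<in> L2 \<mu>" "v \<in> L2 \<mu>" "w \<in> L2 \<mu>"
    show "L2_inner \<mu> (Q b w) (Q a (\<lambda>x. u x - v x)) = L2_inner \<mu> (Q b w) (Q a u) - L2_inner \<mu> (Q b w) (Q a v)"
      using A.inner_op_diff_left[OF uvw(1,2) B.op_L2[OF uvw(3)]] by (simp add: L2_inner_commute)
  qed (simp_all add: AB.inner_op_diff_left AB.inner_op_diff_right B.inner_op_diff_left A.op_L2)
qed

lemma Q_start:
  assumes s: "s \<le> 0" and u[measurable]: "u \<in> borel_measurable borel"
  shows "Q s u = u"
proof
  fix x
  interpret prob_space "P (Some x)" by (rule prob_P)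
  have "(\<integral>\<omega>. case_option 0 u (X (ennreal s) \<omega>) \<partial>P (Some x)) = (\<integral>\<omega>. u x \<partial>P (Some x))"
    by (rule integral_cong_AE) (use X_start[of "Some x"] s in \<open>auto elim!: eventually_mono simp: ennreal_neg\<close>)
  then show "Q s u x = u x" using prob_space by (simp add: kernel_op_def integral_K)
qed

definition gap :: "('a \<Rightarrow> real) \<Rightarrow> real \<Rightarrow> real" where
  "gap u s = symmetric_kernel.defect \<mu> (K s) u u"

lemma gap_eq: "gap u s = L2_inner \<mu> u u - L2_inner \<mu> (Q s u) u"
  by (simp add: gap_def symmetric_kernel.defect_def[OF K_symmetric])

lemma gap_start: "u \<in> L2 \<mu> \<Longrightarrow> s \<le> 0 \<Longrightarrow> gap u s = 0"
  by (simp add: gap_eq Q_start L2_measurable)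

lemma gap_nonneg: "u \<in> L2 \<mu> \<Longrightarrow> 0 \<le> gap u s"
  unfolding gap_def by (rule symmetric_kernel.defect_nonneg[OF K_symmetric])

lemma Q_L2: "u \<in> L2 \<mu> \<Longrightarrow> Q s u \<in> L2 \<mu>"
  by (rule symmetric_kernel.op_L2[OF K_symmetric])

lemma inner_Q_half: "u \<in> L2 \<mu> \<Longrightarrow> 0 < s \<Longrightarrow> L2_inner \<mu> (Q s u) u = L2_inner \<mu> (Q (s / 2) u) (Q (s / 2) u)"
  using inner_Q_add[of "s / 2" "s / 2" u u] by simp

lemma gap_le: "u \<in> L2 \<mu> \<Longrightarrow> gap u s \<le> L2_inner \<mu> u u"
  using inner_Q_half[of u s] L2_inner_self_nonneg[of "Q (s / 2) u"] gap_start[of u s] L2_inner_self_nonneg[of u]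
  by (cases "s > 0") (auto simp: gap_eq)

text \<open>It has to be seen that the norm of \<open>w = Q (t / 2) u\<close> decreases in
  \<open>t\<close>. Its square is the pairing of \<open>Q (s / 2) u\<close> with
  \<open>Q ((t - s) / 2) w\<close>; bounding twice this pairing by the two squared norms and using
  contractivity absorbs one copy of the square.\<close>

lemma gap_mono:
  assumes u: "u \<in> L2 \<mu>" shows "mono (gap u)"
proof (rule monoI)
  fix s t :: real assume st: "s \<le> t"
  show "gap u s \<le> gap u t"
  proof (cases "s \<le> 0 \<or> s = t")
    case True
    then show ?thesis using gap_start[OF u, of s] gap_nonneg[OF u, of t] by auto
  next
    case False
    then have s: "0 < s" "s < t" using st by auto
    interpret C: symmetric_kernel \<mu> "K ((t - s) / 2)" by (rule K_symmetric)
    let ?w = "Q (t / 2) u"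
    have w: "?w \<in> L2 \<mu>" by (rule Q_L2[OF u])
    have sp: "(t - s) / 2 + s / 2 = t / 2" by (simp add: field_simps)
    have "L2_inner \<mu> ?w ?w = L2_inner \<mu> (Q (s / 2) u) (Q ((t - s) / 2) ?w)"
      using inner_Q_add[of "(t - s) / 2" "s / 2" u ?w] s u w unfolding sp by simp
    then have "2 * L2_inner \<mu> ?w ?w \<le> L2_inner \<mu> (Q (s / 2) u) (Q (s / 2) u) + L2_inner \<mu> (Q ((t - s) / 2) ?w) (Q ((t - s) / 2) ?w)"
      using L2_inner_le[OF Q_L2[OF u, of "s / 2"] Q_L2[OF w, of "(t - s) / 2"]] by simp
    also have "L2_inner \<mu> (Q ((t - s) / 2) ?w) (Q ((t - s) / 2) ?w) \<le> L2_inner \<mu> ?w ?w"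
      by (rule C.op_contraction[OF w])
    finally show ?thesis using inner_Q_half[OF u, of s] inner_Q_half[OF u, of t] s by (simp add: gap_eq)
  qed
qed

text \<open>At half times \<open>(Q a u, u)\<close> and \<open>(Q b u, u)\<close> are the squared
  norms of \<open>Q (a / 2) u\<close> and \<open>Q (b / 2) u\<close>, and the value at the midpoint
  is the inner product of these two functions.\<close>

lemma gap_midpoint:
  assumes u: "u \<in> L2 \<mu>" and ab: "0 \<le> a" "0 \<le> b"
  shows "gap u a + gap u b \<le> 2 * gap u ((a + b) / 2)"
proof -
  have half: "L2_inner \<mu> (Q s u) u = L2_inner \<mu> (Q (s / 2) u) (Q (s / 2) u)" if "0 \<le> s" for s
    using inner_Q_half[OF u, of s] that by (cases "s = 0") (auto simp: Q_start L2_measurable[OF u])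
  have mix: "L2_inner \<mu> (Q ((a + b) / 2) u) u = L2_inner \<mu> (Q (a / 2) u) (Q (b / 2) u)"
  proof (cases "a = 0 \<or> b = 0")
    case True
    then show ?thesis by (auto simp: Q_start L2_measurable[OF u] L2_inner_commute)
  next
    case False
    then show ?thesis using inner_Q_add[of "b / 2" "a / 2" u u] ab u by (simp add: add_divide_distrib add.commute)
  qed
  show ?thesis
    using L2_inner_le[OF Q_L2[OF u, of "a / 2"] Q_L2[OF u, of "b / 2"]] half ab mix by (simp add: gap_eq)
qed

lemma grid_time_0: "grid_time m 0 = 1 / real (Suc m)"
  by (simp add: grid_time_def)

text \<open>For core functions right continuity of the paths at time \<open>0\<close> gives
  pointwise convergence, and integrability of \<open>f\<close> passes it to the inner product. A
  sequence of times is enough, as \<open>gap f\<close> is monotone.\<close>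

lemma gap_core_limit:
  assumes f: "f \<in> F \<inter> C_c"
  shows "(\<lambda>m. gap f (1 / real (Suc m))) \<longlonglongrightarrow> 0"
proof -
  have fL: "f \<in> L2 \<mu>" and fC: "f \<in> C_c" using f F_L2 by auto
  note [measurable] = C_c_measurable[OF fC]
  obtain M where M: "M > 0" "\<And>x. \<bar>f x\<bar> \<le> M" using C_c_bounded[OF fC] by blast
  have Qm[measurable]: "Q s f \<in> borel_measurable borel" for s by (rule L2_measurable[OF Q_L2[OF fL]])
  have Qb: "\<bar>Q s f x\<bar> \<le> M" for s x
  proof -
    interpret prob_space "K s (Some x)" by (rule prob_K)
    have "\<bar>Q s f x\<bar> \<le> (\<integral>y. \<bar>case_option 0 f y\<bar> \<partial>K s (Some x))"
      unfolding kernel_op_def by (rule integral_abs_bound)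
    also have "\<dots> \<le> (\<integral>y. M \<partial>K s (Some x))"
      by (rule integral_mono) (use M in \<open>auto intro!: integrable_const_bound[where B=M] AE_I2 split: option.splits\<close>)
    finally show ?thesis using prob_space by simp
  qed
  have "(\<lambda>m. L2_inner \<mu> (Q (1 / real (Suc m)) f) f) \<longlonglongrightarrow> L2_inner \<mu> f f"
    unfolding L2_inner_def
  proof (rule integral_dominated_convergence[where w="\<lambda>x. M * \<bar>f x\<bar>"])
    show "integrable \<mu> (\<lambda>x. M * \<bar>f x\<bar>)" by (intro integrable_mult_right integrable_abs C_c_integrable fC)
    show "AE x in \<mu>. (\<lambda>m. Q (1 / real (Suc m)) f x * f x) \<longlonglongrightarrow> f x * f x"
    proof (intro AE_I2 tendsto_mult tendsto_const)
      fix x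
      have "(\<lambda>m. Q (1 / real (Suc m)) f x) \<longlonglongrightarrow> Q 0 f x"
        using K_grid[OF fC, of 0 "Some x"] unfolding grid_time_0 kernel_op_def .
      then show "(\<lambda>m. Q (1 / real (Suc m)) f x) \<longlonglongrightarrow> f x" by (simp add: Q_start)
    qed
    show "AE x in \<mu>. norm (Q (1 / real (Suc m)) f x * f x) \<le> M * \<bar>f x\<bar>" for m
    proof (rule AE_I2)
      fix x
      have "\<bar>Q (1 / real (Suc m)) f x\<bar> \<le> M" by (rule Qb)
      then show "norm (Q (1 / real (Suc m)) f x * f x) \<le> M * \<bar>f x\<bar>"
        by (simp only: real_norm_def abs_mult) (rule mult_right_mono, auto)
    qed
  qed measurable
  then have "(\<lambda>m. L2_inner \<mu> f f - L2_inner \<mu> (Q (1 / real (Suc m)) f) f) \<longlonglongrightarrow> L2_inner \<mu> f f - L2_inner \<mu> f f"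
    by (intro tendsto_diff tendsto_const)
  then show ?thesis by (simp add: gap_eq)
qed

lemma gap_diff_le:
  assumes "u \<in> L2 \<mu>" "v \<in> L2 \<mu>"
  shows "gap (\<lambda>x. u x - v x) s \<le> 2 * gap u s + 2 * gap v s"
    and "gap (\<lambda>x. u x + v x) s \<le> 2 * gap u s + 2 * gap v s"
proof -
  interpret symmetric_kernel \<mu> "K s" by (rule K_symmetric)
  have "0 \<le> defect (\<lambda>x. u x + v x) (\<lambda>x. u x + v x)" "0 \<le> defect (\<lambda>x. u x - v x) (\<lambda>x. u x - v x)"
    using assms by (auto intro: defect_nonneg L2_add L2_diff)
  then show "gap (\<lambda>x. u x - v x) s \<le> 2 * gap u s + 2 * gap v s" "gap (\<lambda>x. u x + v x) s \<le> 2 * gap u s + 2 * gap v s"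
    using assms by (simp_all add: gap_def defect_add defect_diff)
qed

text \<open>Strong continuity at \<open>0\<close>: approximate \<open>u\<close> in \<open>L2\<close>
  by a core function, bound the error by \<open>gap_le\<close> uniformly in time, and pass from a
  sequence of times to all small times by monotonicity.\<close>

lemma gap_limit:
  assumes u: "u \<in> L2 \<mu>"
  shows "(gap u \<longlongrightarrow> 0) (at_right 0)"
proof (rule order_tendstoI)
  fix a :: real assume "a < 0"
  then show "\<forall>\<^sub>F s in at_right 0. a < gap u s" using gap_nonneg[OF u] by (intro always_eventually) (auto intro: less_le_trans)
next
  fix e :: real assume e: "0 < e"
  obtain f where f: "f \<in> F \<inter> C_c" "L2_inner \<mu> (\<lambda>x. u x - f x) (\<lambda>x. u x - f x) < e / 4"
    using core_dense_L2[OF u, of "e / 4"] e by auto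
  have fL: "f \<in> L2 \<mu>" using f F_L2 by auto
  have "\<forall>\<^sub>F m in sequentially. gap f (1 / real (Suc m)) < e / 4"
    using order_tendstoD(2)[OF gap_core_limit[OF f(1)], of "e / 4"] e by simp
  then obtain m where m: "gap f (1 / real (Suc m)) < e / 4" using eventually_happens by fastforce
  have "gap u s < e" if "s < 1 / real (Suc m)" for s
  proof -
    have "gap u s \<le> 2 * gap (\<lambda>x. u x - f x) s + 2 * gap f s"
      using gap_diff_le(2)[OF L2_diff[OF u fL] fL, of s] by simp
    also have "gap (\<lambda>x. u x - f x) s \<le> L2_inner \<mu> (\<lambda>x. u x - f x) (\<lambda>x. u x - f x)" by (rule gap_le[OF L2_diff[OF u fL]])
    also have "gap f s \<le> gap f (1 / real (Suc m))" using gap_mono[OF fL] that by (auto simp: mono_def)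
    finally show ?thesis using m f(2) by linarith
  qed
  then show "\<forall>\<^sub>F s in at_right 0. gap u s < e"
    unfolding eventually_at_right_field by (intro exI[of _ "1 / real (Suc m)"]) auto
qed

lemma midconcave_gap: "u \<in> L2 \<mu> \<Longrightarrow> midconcave (gap u) (L2_inner \<mu> u u)"
  by unfold_locales (auto intro: gap_start gap_mono gap_le gap_midpoint gap_limit)

lemma transition_L2_eq: "u \<in> L2 \<mu> \<Longrightarrow> transition P (real_time X) s u = Q s u"
  by (rule transition_eq[OF L2_measurable])

lemma F_gap_limit:
  assumes "u \<in> F"
  shows "\<exists>l. ((\<lambda>t. gap u t / t) \<longlongrightarrow> l) (at_right 0)"
proof -
  have u: "u \<in> L2 \<mu>" using assms F_L2 by auto
  obtain l where "((\<lambda>t. L2_inner \<mu> (\<lambda>x. u x - transition P (real_time X) t u x) u / t) \<longlongrightarrow> l) (at_right 0)"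
    using assms associated unfolding associated_process_def semigroup_domain_def by auto
  moreover have "L2_inner \<mu> (\<lambda>x. u x - transition P (real_time X) t u x) u = gap u t" for t
    unfolding transition_L2_eq[OF u] gap_def by (rule symmetric_kernel.defect_eq[OF K_symmetric u u])
  ultimately show ?thesis by auto
qed

text \<open>Membership in \<open>F\<close> means that \<open>gap u t / t\<close> converges, hence is
  bounded near \<open>0\<close>; elsewhere \<open>gap u\<close> is bounded by the squared norm. The
  function \<open>min 1 s\<close> is the one that the Levy measure integrates.\<close>

lemma F_gap_le:
  assumes "u \<in> F"
  shows "\<exists>C\<ge>0. \<forall>s>0. gap u s \<le> C * min 1 s"
proof -
  have u: "u \<in> L2 \<mu>" using assms F_L2 by auto
  obtain l where l: "((\<lambda>t. gap u t / t) \<longlongrightarrow> l) (at_right 0)" using F_gap_limit[OF assms] by blast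
  have "\<forall>\<^sub>F t in at_right 0. gap u t / t < \<bar>l\<bar> + 1" by (rule order_tendstoD(2)[OF l]) simp
  then obtain b where b: "b > 0" "\<And>t. 0 < t \<Longrightarrow> t < b \<Longrightarrow> gap u t / t < \<bar>l\<bar> + 1"
    unfolding eventually_at_right_field by auto
  define B where "B = L2_inner \<mu> u u"
  have B: "0 \<le> B" unfolding B_def by (rule L2_inner_self_nonneg)
  \<comment> \<open>The summands cover small times, times beyond \<open>1\<close>, and times between
    \<open>b\<close> and \<open>1\<close>, where \<open>B \<le> (B / b) * s\<close>.\<close>
  define C where "C = \<bar>l\<bar> + 1 + B + B / b"
  have C: "C \<ge> 0" "\<bar>l\<bar> + 1 \<le> C" "B \<le> C" "B / b \<le> C" using B b by (auto simp: C_def)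
  have "gap u s \<le> C * min 1 s" if s: "s > 0" for s
  proof -
    have gB: "gap u s \<le> B" unfolding B_def by (rule gap_le[OF u])
    consider "s \<ge> 1" | "s < 1" "s < b" | "s < 1" "b \<le> s" by linarith
    then show ?thesis
    proof cases
      case 2
      then have "gap u s \<le> (\<bar>l\<bar> + 1) * s" using b(2)[OF s] s by (simp add: field_simps)
      also have "\<dots> \<le> C * s" using C s by (intro mult_right_mono) auto
      finally show ?thesis using 2 by simp
    next
      case 3
      have "B \<le> (B / b) * s" using B b 3 by (simp add: field_simps mult_left_mono)
      also have "\<dots> \<le> C * s" using C s by (intro mult_right_mono) auto
      finally show ?thesis using 3 gB by simp
    qed (use gB C in auto)
  qed
  then show ?thesis using C by blast
qed

end

section \<open>The form of the subordinate process\<close>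

locale subordination = hunt \<mu> E F W P X
  for \<mu> :: "'a::{metric_space,second_countable_topology} measure" and E F
    and W :: "'w measure" and P :: "'a option \<Rightarrow> 'w measure" and X :: "ennreal \<Rightarrow> 'w \<Rightarrow> 'a option" +
  fixes S :: "real \<Rightarrow> 'w \<Rightarrow> real" and \<phi> \<psi> :: "real \<Rightarrow> real"
  assumes scales: "scale_function \<phi>" "scale_function \<psi>"
    and levy_finite: "(\<integral>\<^sup>+ t\<in>{0<..}. ennreal (min 1 t * levy_density \<phi> \<psi> t) \<partial>lborel) < \<infinity>"
    and indep: "independent_subordinator W P X S (bernstein_fun \<phi> \<psi>)"
begin

section \<open>Laws of the subordinator and of the subordinate process\<close>

abbreviation \<nu> :: "real measure" where "\<nu> \<equiv> levy_measure \<phi> \<psi>"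

lemma S_subordinator: "subordinator (P z) S (bernstein_fun \<phi> \<psi>)"
  and S_indep: "prob_space.indep_set (P z) (generated_events W UNIV X state_borel) (generated_events W {0..} S borel)"
  using indep unfolding independent_subordinator_def by simp_all

lemma S_measurable: "t \<ge> 0 \<Longrightarrow> S t \<in> borel_measurable W"
  using S_subordinator[of None] unfolding subordinator_def levy_process_def
  by (simp add: measurable_cong_sets[OF sets_P refl])

lemma S_nonneg: "t \<ge> 0 \<Longrightarrow> AE \<omega> in P z. 0 \<le> S t \<omega>"
proof -
  assume t: "t \<ge> 0"
  have "AE \<omega> in P z. \<forall>t\<ge>0. 0 \<le> S t \<omega>" using S_subordinator[of z] unfolding subordinator_def by (elim conjE)
  then show ?thesis by eventually_elim (use t in blast)
qed

lemma S_laplace: "t \<ge> 0 \<Longrightarrow> l > 0 \<Longrightarrow> (LINT \<omega>|P z. exp (- l * S t \<omega>)) = exp (- t * bernstein_fun \<phi> \<psi> l)"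
  using S_subordinator[of z] unfolding subordinator_def by blast

text \<open>The choice of \<open>P None\<close> is immaterial: by \<open>S_law\<close> every
  starting point gives the same law.\<close>

definition \<eta> :: "real \<Rightarrow> real measure" where
  "\<eta> t = distr (P None) borel (S t)"

lemma S_law:
  assumes t: "t > 0" shows "distr (P z) borel (S t) = \<eta> t"
proof -
  have [measurable]: "S t \<in> borel_measurable W" using S_measurable t by simp
  have p: "prob_space (distr (P z) borel (S t))" for z
    by (rule prob_space.prob_space_distr[OF prob_P]) measurable
  have n: "AE s in distr (P z) borel (S t). 0 \<le> s" for z
    using S_nonneg[of t z] t by (subst AE_distr_iff) auto
  have l: "(\<integral>s. exp (-(l * s)) \<partial>distr (P z) borel (S t)) = exp (- t * bernstein_fun \<phi> \<psi> l)" if "l > 0" for l z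
    using S_laplace[of t l z] t that by (subst integral_distr) auto
  show ?thesis unfolding \<eta>_def
    by (rule laplace_unique) (use p n l in auto)
qed

lemma nu_integrable: "integrable \<nu> (\<lambda>s. min 1 s)"
  by (rule integrable_min_levy_measure[OF scales levy_finite])

lemma S_measurable_pos[measurable]: "t > 0 \<Longrightarrow> S t \<in> borel_measurable W"
  by (rule S_measurable) simp

sublocale levy_laplace \<nu> \<eta>
proof (rule levy_laplace.intro, goal_cases)
  case 1
  show ?case by simp
next
  case 2
  show ?case by (rule AE_levy_measure_pos[OF scales])
next
  case 3
  show ?case by (rule nu_integrable)
next
  case (4 t)
  then show ?case unfolding \<eta>_def by (intro prob_space.prob_space_distr[OF prob_P]) measurable
next
  case (5 t)
  show ?case by (simp add: \<eta>_def)
next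
  case (6 t)
  then show ?case unfolding \<eta>_def using S_nonneg[of t None] by (subst AE_distr_iff) auto
next
  case (7 t l)
  then have "(LINT s|\<eta> t. exp (-(l * s))) = (LINT \<omega>|P None. exp (- l * S t \<omega>))"
    unfolding \<eta>_def by (subst integral_distr) auto
  then show ?case using S_laplace[of t l None] 7 by (simp add: bernstein_fun_eq[OF scales])
qed

text \<open>\<open>S\<close> is independent only of the events generated by \<open>X\<close>, hence the joint law of \<open>X\<close> and \<open>S t\<close>
  is identified as a product on this sub-\<open>\<sigma>\<close>-algebra.\<close>

definition WX :: "'w measure" where
  "WX = sigma (space W) {X t -` B \<inter> space W | t B. B \<in> sets state_borel}"

lemma space_WX[simp]: "space WX = space W"
  unfolding WX_def by (rule space_measure_of) auto

lemma sets_WX: "sets WX = generated_events W UNIV X state_borel"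
  unfolding WX_def generated_events_def by (subst sets_measure_of) auto

lemma X_measurable_WX[measurable]: "X t \<in> WX \<rightarrow>\<^sub>M state_borel"
  by (rule measurableI) (auto simp: sets_WX generated_events_def)

text \<open>Right continuity along \<open>grid_time\<close> again, now for the paths. The
  measurability holds relative to \<open>WX\<close>, on which independence from \<open>S\<close> is
  available.\<close>

lemma X_joint_measurable: "(\<lambda>p. X (ennreal (snd p)) (fst p)) \<in> WX \<Otimes>\<^sub>M borel \<rightarrow>\<^sub>M state_borel"
proof (rule measurable_state_borelI)
  fix f :: "'a \<Rightarrow> real" assume f: "f \<in> C_c"
  note [measurable] = C_c_measurable[OF f]
  have "(\<lambda>p. case_option (0::real) f (X (ennreal ((real_of_int \<lfloor>real (Suc m) * max 0 (snd p)\<rfloor> + 1) / real (Suc m))) (fst p)))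
      \<in> borel_measurable (WX \<Otimes>\<^sub>M (borel :: real measure))" for m
  proof (rule measurable_compose_countable[where f="\<lambda>i p. case_option (0::real) f (X (ennreal ((real_of_int i + 1) / real (Suc m))) (fst p))"])
    show "(\<lambda>p. case_option (0::real) f (X (ennreal ((real_of_int i + 1) / real (Suc m))) (fst p))) \<in> borel_measurable (WX \<Otimes>\<^sub>M (borel :: real measure))" for i :: int
      by measurable
  qed measurable
  then have m: "(\<lambda>p. case_option (0::real) f (X (ennreal (grid_time m (snd p))) (fst p))) \<in> borel_measurable (WX \<Otimes>\<^sub>M borel)" for m
    by (simp add: grid_time_def)
  show "(\<lambda>p. case_option (0::real) f (X (ennreal (snd p)) (fst p))) \<in> borel_measurable (WX \<Otimes>\<^sub>M borel)"
  proof (rule borel_measurable_LIMSEQ_real[OF _ m])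
    fix p assume "p \<in> space (WX \<Otimes>\<^sub>M (borel :: real measure))"
    then have "fst p \<in> space W" by (auto simp: space_pair_measure)
    then show "(\<lambda>m. case_option (0::real) f (X (ennreal (grid_time m (snd p))) (fst p))) \<longlonglongrightarrow> case_option 0 f (X (ennreal (snd p)) (fst p))"
      by (rule X_grid[OF _ f])
  qed
qed

lemma id_WX: "(\<lambda>\<omega>. \<omega>) \<in> P z \<rightarrow>\<^sub>M WX"
proof (rule measurableI)
  fix A assume "A \<in> sets WX"
  then have A: "A \<in> sigma_sets (space W) {X t -` B \<inter> space W | t B. t \<in> UNIV \<and> B \<in> sets state_borel}"
    by (simp add: sets_WX generated_events_def)
  have "{X t -` B \<inter> space W | t B. t \<in> UNIV \<and> B \<in> sets state_borel} \<subseteq> sets W" by auto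
  then have "A \<in> sets W" using A sets.sigma_sets_subset[of _ W] by blast
  then show "(\<lambda>\<omega>. \<omega>) -` A \<inter> space (P z) \<in> sets (P z)"
    using sets.sets_into_space[of A W] by (simp add: sets_P Int_absorb2)
qed simp

text \<open>Independence is the product formula on rectangles whose first side is an event of
  \<open>X\<close>, and such rectangles determine a law on
  \<open>WX \<Otimes>\<^sub>M borel\<close>.\<close>

lemma joint_law:
  assumes t: "t > 0"
  shows "distr (P z) (WX \<Otimes>\<^sub>M borel) (\<lambda>\<omega>. (\<omega>, S t \<omega>)) = distr (P z) WX (\<lambda>\<omega>. \<omega>) \<Otimes>\<^sub>M \<eta> t"
proof (rule pair_measure_eqI[symmetric])
  interpret prob_space "P z" by (rule prob_P)
  note id_WX[measurable] sets_eta[OF t, measurable_cong]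
  have [measurable]: "S t \<in> borel_measurable W" using S_measurable t by simp
  show "sigma_finite_measure (distr (P z) WX (\<lambda>\<omega>. \<omega>))"
    by (intro finite_measure.sigma_finite_measure prob_space.finite_measure prob_space_distr id_WX)
  show "sigma_finite_measure (\<eta> t)"
    by (intro finite_measure.sigma_finite_measure prob_space.finite_measure eta_prob t)
  show "sets (distr (P z) WX (\<lambda>\<omega>. \<omega>) \<Otimes>\<^sub>M \<eta> t) = sets (distr (P z) (WX \<Otimes>\<^sub>M borel) (\<lambda>\<omega>. (\<omega>, S t \<omega>)))"
    by (simp cong: sets_pair_measure_cong add: sets_eta t)
  fix A B assume "A \<in> sets (distr (P z) WX (\<lambda>\<omega>. \<omega>))" "B \<in> sets (\<eta> t)"
  then have A[measurable]: "A \<in> sets WX" and B[measurable]: "B \<in> sets borel" by (auto simp: sets_eta t)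
  have AW: "A \<subseteq> space W" using sets.sets_into_space[OF A] by simp
  have gA: "A \<in> generated_events W UNIV X state_borel" using A by (simp add: sets_WX)
  have gB: "S t -` B \<inter> space W \<in> generated_events W {0..} S borel"
    unfolding generated_events_def using t B by (intro sigma_sets.Basic CollectI exI[of _ t] exI[of _ B]) simp
  have "emeasure (distr (P z) WX (\<lambda>\<omega>. \<omega>)) A = ennreal (prob A)"
    using AW by (subst emeasure_distr) (auto simp: emeasure_eq_measure Int_absorb2)
  moreover have "emeasure (\<eta> t) B = ennreal (prob (S t -` B \<inter> space W))"
    unfolding S_law[OF t, of z, symmetric] by (subst emeasure_distr) (auto simp: emeasure_eq_measure)
  moreover have "emeasure (distr (P z) (WX \<Otimes>\<^sub>M borel) (\<lambda>\<omega>. (\<omega>, S t \<omega>))) (A \<times> B) = ennreal (prob (A \<inter> (S t -` B \<inter> space W)))"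
    using AW by (subst emeasure_distr) (auto simp: emeasure_eq_measure intro!: arg_cong[where f=prob])
  ultimately show "emeasure (distr (P z) WX (\<lambda>\<omega>. \<omega>)) A * emeasure (\<eta> t) B =
      emeasure (distr (P z) (WX \<Otimes>\<^sub>M borel) (\<lambda>\<omega>. (\<omega>, S t \<omega>))) (A \<times> B)"
    using indep_setD[OF S_indep gA gB] by (simp add: ennreal_mult)
qed

definition \<tau> :: "real \<Rightarrow> 'a option \<Rightarrow> 'a option measure" where
  "\<tau> t z = distr (P z) state_borel (subordinate_process X S t)"

lemma subordinate_measurable:
  assumes t: "t > 0"
  shows "subordinate_process X S t \<in> P z \<rightarrow>\<^sub>M state_borel"
proof -
  have [measurable]: "S t \<in> borel_measurable W" using S_measurable t by simp
  have "(\<lambda>\<omega>. (\<omega>, S t \<omega>)) \<in> P z \<rightarrow>\<^sub>M WX \<Otimes>\<^sub>M borel"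
    by (intro measurable_Pair id_WX) measurable
  from measurable_compose[OF this X_joint_measurable] show ?thesis
    by (simp add: subordinate_process_def[abs_def])
qed

text \<open>Inserting the random time into \<open>X\<close> evaluates a jointly measurable function
  under the product law of \<open>joint_law\<close>; Fubini then freezes the time \<open>s\<close>
  and averages over \<open>\<eta> t\<close>.\<close>

lemma nn_integral_tau:
  assumes t: "t > 0" and g[measurable]: "g \<in> borel_measurable state_borel"
  shows "(\<integral>\<^sup>+y. g y \<partial>\<tau> t z) = (\<integral>\<^sup>+s. (\<integral>\<^sup>+y. g y \<partial>K s z) \<partial>\<eta> t)"
proof -
  have [measurable]: "S t \<in> borel_measurable W" using S_measurable t by simp
  note X_joint_measurable[measurable] id_WX[measurable] sets_eta[OF t, measurable_cong]
  interpret D: prob_space "distr (P z) WX (\<lambda>\<omega>. \<omega>)" by (rule prob_space.prob_space_distr[OF prob_P id_WX])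
  interpret Et: prob_space "\<eta> t" by (rule eta_prob[OF t])
  interpret pair_sigma_finite "distr (P z) WX (\<lambda>\<omega>. \<omega>)" "\<eta> t" ..
  have "(\<integral>\<^sup>+y. g y \<partial>\<tau> t z) = (\<integral>\<^sup>+\<omega>. g (X (ennreal (S t \<omega>)) \<omega>) \<partial>P z)"
    unfolding \<tau>_def by (subst nn_integral_distr[OF subordinate_measurable[OF t]]) (simp_all add: subordinate_process_def)
  also have "\<dots> = (\<integral>\<^sup>+p. g (X (ennreal (snd p)) (fst p)) \<partial>distr (P z) (WX \<Otimes>\<^sub>M borel) (\<lambda>\<omega>. (\<omega>, S t \<omega>)))"
    by (subst nn_integral_distr) auto
  also have "\<dots> = (\<integral>\<^sup>+p. g (X (ennreal (snd p)) (fst p)) \<partial>(distr (P z) WX (\<lambda>\<omega>. \<omega>) \<Otimes>\<^sub>M \<eta> t))"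
    by (simp add: joint_law[OF t])
  also have "\<dots> = (\<integral>\<^sup>+s. (\<integral>\<^sup>+\<omega>. g (X (ennreal s) \<omega>) \<partial>distr (P z) WX (\<lambda>\<omega>. \<omega>)) \<partial>\<eta> t)"
    by (subst nn_integral_snd[symmetric]) auto
  also have "\<dots> = (\<integral>\<^sup>+s. (\<integral>\<^sup>+y. g y \<partial>K s z) \<partial>\<eta> t)"
    by (intro nn_integral_cong) (subst nn_integral_distr, auto simp: nn_integral_K)
  finally show ?thesis .
qed

lemma tau_symmetric:
  assumes t: "t > 0" shows "symmetric_kernel \<mu> (\<tau> t)"
proof
  note sets_eta[OF t, measurable_cong]
  interpret Et: prob_space "\<eta> t" by (rule eta_prob[OF t])
  interpret pm: pair_sigma_finite \<mu> "\<eta> t" ..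
  show "\<tau> t \<in> state_borel \<rightarrow>\<^sub>M subprob_algebra state_borel"
  proof (rule measurable_subprob_algebra)
    fix z
    show "subprob_space (\<tau> t z)" unfolding \<tau>_def
      by (intro prob_space_imp_subprob_space prob_space.prob_space_distr[OF prob_P] subordinate_measurable t)
    show "sets (\<tau> t z) = sets state_borel" by (simp add: \<tau>_def)
  next
    fix A :: "'a option set" assume [measurable]: "A \<in> sets state_borel"
    have "emeasure (\<tau> t z) A = (\<integral>\<^sup>+s. (\<integral>\<^sup>+y. indicator A y \<partial>K s z) \<partial>\<eta> t)" for z
      using nn_integral_tau[OF t, of "indicator A" z] by (simp add: \<tau>_def)
    then show "(\<lambda>z. emeasure (\<tau> t z) A) \<in> borel_measurable state_borel" by simp
  qed
  fix f g :: "'a \<Rightarrow> ennreal" assume [measurable]: "f \<in> borel_measurable borel" "g \<in> borel_measurable borel"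
  have sw: "(\<integral>\<^sup>+ x. f x * (\<integral>\<^sup>+ y. case_option 0 g y \<partial>\<tau> t (Some x)) \<partial>\<mu>) =
      (\<integral>\<^sup>+ s. (\<integral>\<^sup>+ x. f x * (\<integral>\<^sup>+ y. case_option 0 g y \<partial>K s (Some x)) \<partial>\<mu>) \<partial>\<eta> t)"
    if [measurable]: "f \<in> borel_measurable borel" "g \<in> borel_measurable borel" for f g :: "'a \<Rightarrow> ennreal"
  proof -
    have "(\<integral>\<^sup>+ x. f x * (\<integral>\<^sup>+ y. case_option 0 g y \<partial>\<tau> t (Some x)) \<partial>\<mu>) =
        (\<integral>\<^sup>+ x. (\<integral>\<^sup>+ s. f x * (\<integral>\<^sup>+ y. case_option 0 g y \<partial>K s (Some x)) \<partial>\<eta> t) \<partial>\<mu>)"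
      by (simp add: nn_integral_tau[OF t] nn_integral_cmult)
    also have "\<dots> = (\<integral>\<^sup>+ s. (\<integral>\<^sup>+ x. f x * (\<integral>\<^sup>+ y. case_option 0 g y \<partial>K s (Some x)) \<partial>\<mu>) \<partial>\<eta> t)"
      by (rule pm.Fubini'[symmetric]) measurable
    finally show ?thesis .
  qed
  show "(\<integral>\<^sup>+ x. f x * (\<integral>\<^sup>+ y. case_option 0 g y \<partial>\<tau> t (Some x)) \<partial>\<mu>) =
      (\<integral>\<^sup>+ x. g x * (\<integral>\<^sup>+ y. case_option 0 f y \<partial>\<tau> t (Some x)) \<partial>\<mu>)"
    by (simp add: sw symmetric_kernel.kernel_symmetric[OF K_symmetric, of f g])
qed

section \<open>The subordinate semigroup and its form\<close>

abbreviation T :: "real \<Rightarrow> ('a \<Rightarrow> real) \<Rightarrow> 'a \<Rightarrow> real" where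
  "T \<equiv> transition P (subordinate_process X S)"

lemma T_eq:
  assumes t: "t > 0" and [measurable]: "u \<in> borel_measurable borel"
  shows "T t u = kernel_op (\<tau> t) u"
  by (rule ext) (simp add: transition_def kernel_op_def \<tau>_def integral_distr[OF subordinate_measurable[OF t]])

lemma inner_Q_measurable[measurable]:
  assumes [measurable]: "u \<in> borel_measurable borel" "v \<in> borel_measurable borel"
  shows "(\<lambda>s. L2_inner \<mu> (Q s u) v) \<in> borel_measurable borel"
proof -
  have [measurable]: "(\<lambda>p. \<integral>y. case_option 0 u y \<partial>K (fst p) (Some (snd p))) \<in> borel_measurable (borel \<Otimes>\<^sub>M \<mu>)"
    by (rule measurable_compose[OF _ integral_measurable_subprob_algebra]) measurable
  show ?thesis
    unfolding L2_inner_def kernel_op_def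
    by (rule borel_measurable_lebesgue_integral) (simp add: case_prod_beta')
qed

lemma inner_Q_bound:
  assumes u: "u \<in> L2 \<mu>" and v: "v \<in> L2 \<mu>"
  shows "\<bar>L2_inner \<mu> (Q s u) v\<bar> \<le> L2_inner \<mu> u u + L2_inner \<mu> v v"
proof -
  interpret symmetric_kernel \<mu> "K s" by (rule K_symmetric)
  have m: "(\<lambda>x. - v x) \<in> L2 \<mu>" using L2_scale[OF v, of "-1"] by simp
  have "L2_inner \<mu> (Q s u) (\<lambda>x. - v x) = - L2_inner \<mu> (Q s u) v" "L2_inner \<mu> (\<lambda>x. - v x) (\<lambda>x. - v x) = L2_inner \<mu> v v"
    by (simp_all add: L2_inner_def)
  then show ?thesis
    using L2_inner_le[OF op_L2[OF u] v] L2_inner_le[OF op_L2[OF u] m] op_contraction[OF u]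
      L2_inner_self_nonneg[of u] L2_inner_self_nonneg[of v] by linarith
qed

lemma inner_Q_integrable:
  assumes t: "t > 0" and u: "u \<in> L2 \<mu>" and v: "v \<in> L2 \<mu>"
  shows "integrable (\<eta> t) (\<lambda>s. L2_inner \<mu> (Q s u) v)"
  by (rule int_bounded_eta[OF t, of _ "L2_inner \<mu> u u + L2_inner \<mu> v v"])
    (use u v in \<open>auto intro: inner_Q_bound inner_Q_measurable L2_measurable\<close>)

lemma inner_tau:
  assumes t: "t > 0" and uv: "u \<in> L2 \<mu>" "v \<in> L2 \<mu>"
  shows "L2_inner \<mu> (kernel_op (\<tau> t) u) v = (\<integral>s. L2_inner \<mu> (Q s u) v \<partial>\<eta> t)"
proof -
  interpret T: symmetric_kernel \<mu> "\<tau> t" by (rule tau_symmetric[OF t])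
  interpret Ks: symmetric_kernel \<mu> "K s" for s by (rule K_symmetric)
  note sets_eta[OF t, measurable_cong]
  interpret Et: prob_space "\<eta> t" by (rule eta_prob[OF t])
  interpret pm: pair_sigma_finite \<mu> "\<eta> t" ..
  show ?thesis
  proof (rule bilinear_eq_of_nonneg[where BR="\<lambda>u v. \<integral>s. L2_inner \<mu> (Q s u) v \<partial>\<eta> t", OF _ _ _ _ _ uv])
    fix u v assume uv: "u \<in> L2 \<mu>" "v \<in> L2 \<mu>" "\<And>x. 0 \<le> u x" "\<And>x. 0 \<le> v x"
    note [measurable] = L2_measurable[OF uv(1)] L2_measurable[OF uv(2)]
    let ?u = "\<lambda>x. ennreal (u x)" and ?v = "\<lambda>x. ennreal (v x)"
    have nn: "0 \<le> L2_inner \<mu> (Q s u) v" for s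
      unfolding L2_inner_def by (auto intro!: integral_nonneg_AE AE_I2 simp: Ks.op_nonneg uv)
    have "ennreal (L2_inner \<mu> (kernel_op (\<tau> t) u) v) = (\<integral>\<^sup>+ x. ?v x * (\<integral>\<^sup>+ y. case_option 0 ?u y \<partial>\<tau> t (Some x)) \<partial>\<mu>)"
      using uv by (simp add: T.inner_op_nonneg)
    also have "\<dots> = (\<integral>\<^sup>+ x. (\<integral>\<^sup>+ s. ?v x * (\<integral>\<^sup>+ y. case_option 0 ?u y \<partial>K s (Some x)) \<partial>\<eta> t) \<partial>\<mu>)"
      by (simp add: nn_integral_tau[OF t] nn_integral_cmult)
    also have "\<dots> = (\<integral>\<^sup>+ s. (\<integral>\<^sup>+ x. ?v x * (\<integral>\<^sup>+ y. case_option 0 ?u y \<partial>K s (Some x)) \<partial>\<mu>) \<partial>\<eta> t)"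
      by (rule pm.Fubini'[symmetric]) measurable
    also have "\<dots> = (\<integral>\<^sup>+ s. ennreal (L2_inner \<mu> (Q s u) v) \<partial>\<eta> t)"
      using uv by (intro nn_integral_cong) (simp add: Ks.inner_op_nonneg)
    also have "\<dots> = ennreal (\<integral>s. L2_inner \<mu> (Q s u) v \<partial>\<eta> t)"
      by (rule nn_integral_eq_integral[OF inner_Q_integrable[OF t uv(1,2)]]) (use nn in auto)
    finally have "ennreal (L2_inner \<mu> (kernel_op (\<tau> t) u) v) = ennreal (\<integral>s. L2_inner \<mu> (Q s u) v \<partial>\<eta> t)" .
    moreover have "0 \<le> L2_inner \<mu> (kernel_op (\<tau> t) u) v"
      unfolding L2_inner_def by (auto intro!: integral_nonneg_AE AE_I2 simp: T.op_nonneg uv)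
    moreover have "0 \<le> (\<integral>s. L2_inner \<mu> (Q s u) v \<partial>\<eta> t)" using nn by (intro integral_nonneg_AE) auto
    ultimately show "L2_inner \<mu> (kernel_op (\<tau> t) u) v = (\<integral>s. L2_inner \<mu> (Q s u) v \<partial>\<eta> t)" by simp
  qed (simp_all add: T.inner_op_diff_left T.inner_op_diff_right Ks.inner_op_diff_left Ks.inner_op_diff_right inner_Q_integrable[OF t])
qed

lemma defect_tau:
  assumes t: "t > 0" and u: "u \<in> L2 \<mu>"
  shows "symmetric_kernel.defect \<mu> (\<tau> t) u u = (\<integral>s. gap u s \<partial>\<eta> t)"
proof -
  interpret Et: prob_space "\<eta> t" by (rule eta_prob[OF t])
  have "(\<integral>s. gap u s \<partial>\<eta> t) = (\<integral>s. L2_inner \<mu> u u - L2_inner \<mu> (Q s u) u \<partial>\<eta> t)" by (simp add: gap_eq)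
  also have "\<dots> = L2_inner \<mu> u u - (\<integral>s. L2_inner \<mu> (Q s u) u \<partial>\<eta> t)"
    using inner_Q_integrable[OF t u u] Et.prob_space by simp
  finally show ?thesis using inner_tau[OF t u u] by (simp add: symmetric_kernel.defect_def[OF tau_symmetric[OF t]])
qed

lemma inner_T_defect:
  assumes t: "t > 0" and u: "u \<in> L2 \<mu>" and v: "v \<in> L2 \<mu>"
  shows "L2_inner \<mu> (\<lambda>x. u x - T t u x) v = symmetric_kernel.defect \<mu> (\<tau> t) u v"
  unfolding T_eq[OF t L2_measurable[OF u]] by (rule symmetric_kernel.defect_eq[OF tau_symmetric[OF t] u v])

text \<open>For the concave function \<open>gap u\<close>, existence of the limit of the
  approximating forms and integrability against \<open>\<nu>\<close> are equivalent by
  \<open>integrable_of_limit\<close> and \<open>limit_of_integrable\<close>.\<close>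

lemma domain_eq: "semigroup_domain \<mu> T = {u \<in> L2 \<mu>. integrable \<nu> (gap u)}"
proof -
  have "(\<exists>l. ((\<lambda>t. L2_inner \<mu> (\<lambda>x. u x - T t u x) u / t) \<longlongrightarrow> l) (at_right 0)) \<longleftrightarrow> integrable \<nu> (gap u)" if u: "u \<in> L2 \<mu>" for u
  proof -
    have ev: "\<forall>\<^sub>F t in at_right 0. L2_inner \<mu> (\<lambda>x. u x - T t u x) u / t = (\<integral>s. gap u s \<partial>\<eta> t) / t"
      using eventually_at_right_less[of 0] by eventually_elim (simp add: inner_T_defect u defect_tau)
    show ?thesis
      unfolding tendsto_cong[OF ev]
      using integrable_of_limit[OF midconcave_gap[OF u]] limit_of_integrable[OF midconcave_gap[OF u]] by blast
  qed
  then show ?thesis unfolding semigroup_domain_def by blast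
qed

lemma domain_add:
  assumes u: "u \<in> semigroup_domain \<mu> T" and v: "v \<in> semigroup_domain \<mu> T"
  shows "(\<lambda>x. u x + v x) \<in> semigroup_domain \<mu> T" and "(\<lambda>x. u x - v x) \<in> semigroup_domain \<mu> T"
proof -
  have uL: "u \<in> L2 \<mu>" "v \<in> L2 \<mu>" and ui: "integrable \<nu> (gap u)" "integrable \<nu> (gap v)"
    using u v by (auto simp: domain_eq)
  have b: "integrable \<nu> (\<lambda>s. 2 * gap u s + 2 * gap v s)" using ui by simp
  have "integrable \<nu> (gap (\<lambda>x. u x + v x))"
    by (rule Bochner_Integration.integrable_bound[OF b])
      (use midconcave.g_measurable[OF midconcave_gap[OF L2_add[OF uL]]] gap_diff_le(2)[OF uL] gap_nonneg[OF L2_add[OF uL]] in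
        \<open>auto intro!: AE_I2 intro: order_trans[OF _ abs_ge_self]\<close>)
  then show "(\<lambda>x. u x + v x) \<in> semigroup_domain \<mu> T" by (simp add: domain_eq L2_add uL)
  have "integrable \<nu> (gap (\<lambda>x. u x - v x))"
    by (rule Bochner_Integration.integrable_bound[OF b])
      (use midconcave.g_measurable[OF midconcave_gap[OF L2_diff[OF uL]]] gap_diff_le(1)[OF uL] gap_nonneg[OF L2_diff[OF uL]] in
        \<open>auto intro!: AE_I2 intro: order_trans[OF _ abs_ge_self]\<close>)
  then show "(\<lambda>x. u x - v x) \<in> semigroup_domain \<mu> T" by (simp add: domain_eq L2_diff uL)
qed

lemma gap_scale: "u \<in> L2 \<mu> \<Longrightarrow> gap (\<lambda>x. c * u x) s = c\<^sup>2 * gap u s"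
  unfolding gap_def by (rule symmetric_kernel.defect_scale[OF K_symmetric])

lemma domain_scale: "u \<in> semigroup_domain \<mu> T \<Longrightarrow> (\<lambda>x. c * u x) \<in> semigroup_domain \<mu> T"
proof -
  assume "u \<in> semigroup_domain \<mu> T"
  then have u: "u \<in> L2 \<mu>" "integrable \<nu> (gap u)" by (auto simp: domain_eq)
  have "gap (\<lambda>x. c * u x) = (\<lambda>s. c\<^sup>2 * gap u s)" by (rule ext) (rule gap_scale[OF u(1)])
  then show ?thesis using u by (simp add: domain_eq L2_scale)
qed

text \<open>On \<open>F\<close> the function \<open>gap u\<close> is bounded by a multiple of
  \<open>min 1 s\<close>. The inclusion brings the core of \<open>F\<close> into the subordinate
  domain, where it serves for uniqueness of the jumping measure and for the Radon property of the
  killing measure.\<close>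

lemma F_subset_domain: "F \<subseteq> semigroup_domain \<mu> T"
proof
  fix u assume uF: "u \<in> F"
  then have u: "u \<in> L2 \<mu>" using F_L2 by auto
  obtain C where C: "C \<ge> 0" "\<And>s. s > 0 \<Longrightarrow> gap u s \<le> C * min 1 s" using F_gap_le[OF uF] by blast
  have "integrable \<nu> (gap u)"
  proof (rule Bochner_Integration.integrable_bound[OF integrable_mult_right[OF nu_integrable, of C]])
    show "gap u \<in> borel_measurable \<nu>" using midconcave.g_measurable[OF midconcave_gap[OF u]] by simp
    show "AE s in \<nu>. norm (gap u s) \<le> norm (C * min 1 s)"
      using nu_pos by eventually_elim (use C gap_nonneg[OF u] in \<open>simp add: abs_mult\<close>)
  qed
  then show "u \<in> semigroup_domain \<mu> T" by (simp add: domain_eq u)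
qed

text \<open>The limit lemma concerns concave functions, that is, the diagonal of the form; other
  values are reached by polarization, which relies on symmetry of the defect.\<close>

lemma form_eq:
  assumes u: "u \<in> semigroup_domain \<mu> T" and v: "v \<in> semigroup_domain \<mu> T"
  shows "semigroup_form \<mu> T u v = ((\<integral>s. gap (\<lambda>x. u x + v x) s \<partial>\<nu>) - (\<integral>s. gap (\<lambda>x. u x - v x) s \<partial>\<nu>)) / 4"
proof -
  have uL: "u \<in> L2 \<mu>" "v \<in> L2 \<mu>" using u v by (auto simp: domain_eq)
  note a = L2_add[OF uL] and d = L2_diff[OF uL]
  have ia: "integrable \<nu> (gap (\<lambda>x. u x + v x))" and id: "integrable \<nu> (gap (\<lambda>x. u x - v x))"
    using domain_add[OF u v] by (auto simp: domain_eq)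
  have "((\<lambda>t. ((\<integral>s. gap (\<lambda>x. u x + v x) s \<partial>\<eta> t) / t - (\<integral>s. gap (\<lambda>x. u x - v x) s \<partial>\<eta> t) / t) / 4) \<longlongrightarrow>
      ((\<integral>s. gap (\<lambda>x. u x + v x) s \<partial>\<nu>) - (\<integral>s. gap (\<lambda>x. u x - v x) s \<partial>\<nu>)) / 4) (at_right 0)"
    by (intro tendsto_divide tendsto_diff tendsto_const limit_of_integrable[OF midconcave_gap[OF a] ia]
        limit_of_integrable[OF midconcave_gap[OF d] id]) simp
  moreover have "\<forall>\<^sub>F t in at_right 0. ((\<integral>s. gap (\<lambda>x. u x + v x) s \<partial>\<eta> t) / t - (\<integral>s. gap (\<lambda>x. u x - v x) s \<partial>\<eta> t) / t) / 4
      = L2_inner \<mu> (\<lambda>x. u x - T t u x) v / t"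
    using eventually_at_right_less[of 0]
  proof eventually_elim
    case (elim t)
    interpret Tt: symmetric_kernel \<mu> "\<tau> t" by (rule tau_symmetric[OF elim])
    show ?case
      unfolding inner_T_defect[OF elim uL] defect_tau[OF elim a, symmetric] defect_tau[OF elim d, symmetric]
        Tt.defect_add[OF uL] Tt.defect_diff[OF uL]
      by (simp add: diff_divide_distrib[symmetric])
  qed
  ultimately have "((\<lambda>t. L2_inner \<mu> (\<lambda>x. u x - T t u x) v / t) \<longlongrightarrow>
      ((\<integral>s. gap (\<lambda>x. u x + v x) s \<partial>\<nu>) - (\<integral>s. gap (\<lambda>x. u x - v x) s \<partial>\<nu>)) / 4) (at_right 0)"
    by (rule Lim_transform_eventually)
  then show ?thesis unfolding semigroup_form_def by (intro tendsto_Lim) simp_all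
qed

end

section \<open>The jump kernel\<close>

locale heat = subordination \<mu> E F W P X S \<phi> \<psi>
  for \<mu> :: "'a::{metric_space,second_countable_topology} measure" and E F
    and W :: "'w measure" and P :: "'a option \<Rightarrow> 'w measure" and X :: "ennreal \<Rightarrow> 'w \<Rightarrow> 'a option"
    and S :: "real \<Rightarrow> 'w \<Rightarrow> real" and \<phi> \<psi> :: "real \<Rightarrow> real" +
  fixes p :: "real \<Rightarrow> 'a \<Rightarrow> 'a \<Rightarrow> real" and N :: "'a set" and c1 c2 :: real
  assumes kernel_p: "heat_kernel \<mu> (transition P (real_time X)) p"
    and N_null: "N \<in> null_sets \<mu>" and c1_pos: "0 < c1" and c2_pos: "0 < c2"
    and p_bounds: "\<And>t x y. 0 < t \<Longrightarrow> x \<notin> N \<Longrightarrow> y \<notin> N \<Longrightarrow>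
        c1 * jump_profile \<mu> \<phi> t x y \<le> p t x y \<and> p t x y \<le> c2 * jump_profile \<mu> \<phi> t x y"
begin

text \<open>The heat kernel is known to be measurable only for positive times; extension by
  \<open>0\<close> makes it measurable over the whole line, and values in \<open>ennreal\<close>
  allow Fubini without integrability.\<close>

definition q :: "real \<Rightarrow> 'a \<Rightarrow> 'a \<Rightarrow> ennreal" where
  "q t x y = ennreal (indicator {0<..} t * p t x y)"

lemma q_measurable: "(\<lambda>z. q (fst z) (fst (snd z)) (snd (snd z))) \<in> borel_measurable (borel \<Otimes>\<^sub>M borel \<Otimes>\<^sub>M borel)"
proof -
  let ?\<Omega> = "{0<..} \<times> UNIV \<times> UNIV :: (real \<times> 'a \<times> 'a) set"
  have "open ?\<Omega>" by (intro open_Times) auto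
  then have O: "?\<Omega> \<inter> space borel \<in> sets borel" by simp
  have "(\<lambda>(t, x, y). p t x y) \<in> borel_measurable (restrict_space borel ?\<Omega>)"
    using kernel_p unfolding heat_kernel_def by (rule conjunct1)
  then have "(\<lambda>z. indicator ?\<Omega> z *\<^sub>R (case z of (t, x, y) \<Rightarrow> p t x y)) \<in> borel_measurable borel"
    by (rule iffD1[OF borel_measurable_restrict_space_iff[OF O]])
  moreover have "indicator ?\<Omega> z *\<^sub>R (case z of (t, x, y) \<Rightarrow> p t x y) = indicator {0<..} (fst z) * p (fst z) (fst (snd z)) (snd (snd z))" for z
    by (cases z) (auto simp: indicator_def)
  ultimately have "(\<lambda>z. indicator {0<..} (fst z) * p (fst z) (fst (snd z)) (snd (snd z))) \<in> borel_measurable (borel :: (real \<times> 'a \<times> 'a) measure)"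
    by simp
  then have "(\<lambda>z. q (fst z) (fst (snd z)) (snd (snd z))) \<in> borel_measurable (borel :: (real \<times> 'a \<times> 'a) measure)"
    unfolding q_def by measurable
  moreover have "borel \<Otimes>\<^sub>M borel \<Otimes>\<^sub>M borel = (borel :: (real \<times> 'a \<times> 'a) measure)" by (simp add: borel_prod)
  ultimately show ?thesis by simp
qed

lemma measurable_q[measurable (raw)]:
  assumes [measurable]: "f \<in> borel_measurable M" "g \<in> M \<rightarrow>\<^sub>M borel" "h \<in> M \<rightarrow>\<^sub>M borel"
  shows "(\<lambda>a. q (f a) (g a) (h a)) \<in> borel_measurable M"
proof -
  have "(\<lambda>a. (f a, g a, h a)) \<in> M \<rightarrow>\<^sub>M borel \<Otimes>\<^sub>M borel \<Otimes>\<^sub>M borel" by measurable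
  from measurable_compose[OF this q_measurable] show ?thesis by simp
qed

lemma p_nonneg: "t > 0 \<Longrightarrow> 0 \<le> p t x y"
  using conjunct1[OF conjunct2[OF kernel_p[unfolded heat_kernel_def]]] by simp

lemma p_operator: "t > 0 \<Longrightarrow> f \<in> L2 \<mu> \<Longrightarrow> AE x in \<mu>. integrable \<mu> (\<lambda>y. p t x y * f y) \<and> Q t f x = (LINT y|\<mu>. p t x y * f y)"
proof -
  assume t: "t > 0" and f: "f \<in> L2 \<mu>"
  from conjunct2[OF conjunct2[OF kernel_p[unfolded heat_kernel_def]], rule_format, OF t f]
  show ?thesis unfolding transition_L2_eq[OF f] .
qed

lemma q_pos: "s > 0 \<Longrightarrow> q s x y = ennreal (p s x y)"
  by (simp add: q_def)

lemma K_density_finite: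
  assumes s: "s > 0" and B[measurable]: "B \<in> sets borel" and fin: "emeasure \<mu> B < \<infinity>"
  shows "AE x in \<mu>. (\<integral>\<^sup>+ y. indicator B y * q s x y \<partial>\<mu>) = (\<integral>\<^sup>+ y. case_option 0 (indicator B) y \<partial>K s (Some x))"
proof -
  have "(\<lambda>x. (indicator B x :: real)\<^sup>2) = indicator B" by (auto simp: indicator_def)
  then have u: "(indicator B :: 'a \<Rightarrow> real) \<in> L2 \<mu>" using fin by (simp add: L2_def)
  have e: "ennreal (indicator B x) = indicator B x" for x :: 'a by (auto simp: indicator_def)
  have "AE x in \<mu>. (\<integral>\<^sup>+ y. case_option 0 (indicator B) y \<partial>K s (Some x)) = ennreal (Q s (indicator B) x)"
    using symmetric_kernel.nn_op_eq[OF K_symmetric u, of s] by (simp add: e)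
  with p_operator[OF s u] show ?thesis
  proof eventually_elim
    case (elim x)
    have "(\<integral>\<^sup>+ y. indicator B y * q s x y \<partial>\<mu>) = (\<integral>\<^sup>+ y. ennreal (p s x y * indicator B y) \<partial>\<mu>)"
      using s p_nonneg by (intro nn_integral_cong) (auto simp: q_pos indicator_def)
    also have "\<dots> = ennreal (LINT y|\<mu>. p s x y * indicator B y)"
      using elim by (intro nn_integral_eq_integral) (auto simp: p_nonneg s)
    finally show ?case using elim by simp
  qed
qed

text \<open>The heat kernel represents the semigroup on \<open>L2\<close>. Indicators of sets of
  finite measure, exhaustion by balls and monotone approximation extend this to all nonnegative
  Borel functions; the exceptional set of points \<open>x\<close> may depend on
  \<open>g\<close>.\<close>

lemma K_density:
  fixes g :: "'a \<Rightarrow> ennreal"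
  assumes s: "s > 0" and g: "g \<in> borel_measurable borel"
  shows "AE x in \<mu>. (\<integral>\<^sup>+ y. g y * q s x y \<partial>\<mu>) = (\<integral>\<^sup>+ y. case_option 0 g y \<partial>K s (Some x))"
  using g
proof (induction rule: borel_measurable_induct)
  case (cong f g)
  then have "f = g" by auto
  then show ?case using cong by simp
next
  case (set A)
  note [measurable] = set
  obtain x0 :: 'a where True by blast
  define D where "D n = A \<inter> ball x0 (real n)" for n :: nat
  have D[measurable]: "D n \<in> sets borel" for n unfolding D_def by measurable
  have Dinc: "incseq D" unfolding D_def incseq_def by (auto simp: subset_ball)
  have DU: "(\<Union>n. D n) = A" unfolding D_def using reals_Archimedean2 by auto
  have ind: "indicator A x = (SUP n. indicator (D n) x :: ennreal)" for x
  proof (cases "x \<in> A")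
    case True
    then obtain n where n: "x \<in> D n" using DU by blast
    have "indicator A x \<le> (SUP n. indicator (D n) x :: ennreal)"
      by (rule SUP_upper2[of n]) (use n True in simp_all)
    moreover have "(SUP n. indicator (D n) x :: ennreal) \<le> indicator A x"
      by (rule SUP_least) (use True in \<open>simp add: indicator_def\<close>)
    ultimately show ?thesis by (rule antisym)
  next
    case False
    then have "x \<notin> D n" for n by (simp add: D_def)
    then show ?thesis using False by simp
  qed
  have "emeasure \<mu> (D n) < \<infinity>" for n
    using emeasure_mono[of "D n" "ball x0 (real n)" \<mu>] emeasure_ball_finite[of x0 "real n"] by (auto simp: D_def le_less_trans)
  then have "AE x in \<mu>. \<forall>n. (\<integral>\<^sup>+ y. indicator (D n) y * q s x y \<partial>\<mu>) = (\<integral>\<^sup>+ y. case_option 0 (indicator (D n)) y \<partial>K s (Some x))"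
    unfolding AE_all_countable by (intro allI K_density_finite s D)
  then show ?case
  proof eventually_elim
    case (elim x)
    have inc: "indicator (D m) y \<le> (indicator (D n) y :: ennreal)" if "m \<le> n" for m n y
      using Dinc that by (auto simp: indicator_def incseq_def)
    have Dsub: "y \<in> D n" if "m \<le> n" "y \<in> D m" for m n y
      using Dinc that by (auto simp: incseq_def)
    have "(\<integral>\<^sup>+ y. indicator A y * q s x y \<partial>\<mu>) = (\<integral>\<^sup>+ y. (SUP n. indicator (D n) y * q s x y) \<partial>\<mu>)"
      unfolding ind by (simp add: SUP_mult_right_ennreal)
    also have "\<dots> = (SUP n. \<integral>\<^sup>+ y. indicator (D n) y * q s x y \<partial>\<mu>)"
      by (rule nn_integral_monotone_convergence_SUP) (auto simp: incseq_def le_fun_def intro!: mult_right_mono inc)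
    also have "\<dots> = (SUP n. \<integral>\<^sup>+ y. case_option 0 (indicator (D n)) y \<partial>K s (Some x))" using elim by simp
    also have "\<dots> = (\<integral>\<^sup>+ y. (SUP n. case_option 0 (indicator (D n)) y) \<partial>K s (Some x))"
      by (rule nn_integral_monotone_convergence_SUP[symmetric])
        (auto simp: incseq_def le_fun_def indicator_def intro: Dsub split: option.splits)
    also have "\<dots> = (\<integral>\<^sup>+ y. case_option 0 (indicator A) y \<partial>K s (Some x))"
      by (intro nn_integral_cong) (auto simp: ind split: option.splits)
    finally show ?case .
  qed
next
  case (mult u c)
  note [measurable] = mult.hyps(2)
  show ?case using mult.IH
  proof eventually_elim
    case (elim x)
    have "(\<integral>\<^sup>+ y. c * u y * q s x y \<partial>\<mu>) = c * (\<integral>\<^sup>+ y. u y * q s x y \<partial>\<mu>)"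
      by (simp add: mult.assoc nn_integral_cmult)
    also have "\<dots> = (\<integral>\<^sup>+ y. c * case_option 0 u y \<partial>K s (Some x))" by (simp add: elim nn_integral_cmult)
    also have "\<dots> = (\<integral>\<^sup>+ y. case_option 0 (\<lambda>x. c * u x) y \<partial>K s (Some x))"
      by (intro nn_integral_cong) (auto split: option.splits)
    finally show ?case .
  qed
next
  case (add u v)
  note [measurable] = add.hyps(1) add.hyps(3)
  show ?case using add.IH
  proof eventually_elim
    case (elim x)
    have "(\<integral>\<^sup>+ y. (v y + u y) * q s x y \<partial>\<mu>) = (\<integral>\<^sup>+ y. v y * q s x y \<partial>\<mu>) + (\<integral>\<^sup>+ y. u y * q s x y \<partial>\<mu>)"
      by (simp add: ring_distribs nn_integral_add)
    also have "\<dots> = (\<integral>\<^sup>+ y. case_option 0 v y + case_option 0 u y \<partial>K s (Some x))" by (simp add: elim nn_integral_add)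
    also have "\<dots> = (\<integral>\<^sup>+ y. case_option 0 (\<lambda>x. v x + u x) y \<partial>K s (Some x))"
      by (intro nn_integral_cong) (auto split: option.splits)
    finally show ?case .
  qed
next
  case (seq U)
  note [measurable] = seq.hyps(1)
  have "AE x in \<mu>. \<forall>n. (\<integral>\<^sup>+ y. U n y * q s x y \<partial>\<mu>) = (\<integral>\<^sup>+ y. case_option 0 (U n) y \<partial>K s (Some x))"
    unfolding AE_all_countable using seq.IH by blast
  then show ?case
  proof eventually_elim
    case (elim x)
    have inc: "U m y \<le> U n y" if "m \<le> n" for m n y
      using seq.hyps(3) that by (auto simp: incseq_def le_fun_def)
    have "(\<integral>\<^sup>+ y. (SUP i. U i) y * q s x y \<partial>\<mu>) = (\<integral>\<^sup>+ y. (SUP n. U n y * q s x y) \<partial>\<mu>)"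
      by (simp add: SUP_mult_right_ennreal image_comp)
    also have "\<dots> = (SUP n. \<integral>\<^sup>+ y. U n y * q s x y \<partial>\<mu>)"
      by (rule nn_integral_monotone_convergence_SUP) (auto simp: incseq_def le_fun_def intro!: mult_right_mono inc)
    also have "\<dots> = (SUP n. \<integral>\<^sup>+ y. case_option 0 (U n) y \<partial>K s (Some x))" using elim by simp
    also have "\<dots> = (\<integral>\<^sup>+ y. (SUP n. case_option 0 (U n) y) \<partial>K s (Some x))"
      by (rule nn_integral_monotone_convergence_SUP[symmetric]) (auto simp: incseq_def le_fun_def inc split: option.splits)
    also have "\<dots> = (\<integral>\<^sup>+ y. case_option 0 (SUP i. U i) y \<partial>K s (Some x))"
      by (intro nn_integral_cong) (auto simp: image_comp split: option.splits)
    finally show ?case .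
  qed
qed

lemma q_mass_le:
  assumes s: "s > 0" shows "AE x in \<mu>. (\<integral>\<^sup>+ y. q s x y \<partial>\<mu>) \<le> 1"
proof -
  have "AE x in \<mu>. (\<integral>\<^sup>+ y. 1 * q s x y \<partial>\<mu>) = (\<integral>\<^sup>+ y. case_option 0 (\<lambda>_. 1) y \<partial>K s (Some x))"
    by (rule K_density[OF s]) measurable
  then show ?thesis
proof eventually_elim
  case (elim x)
  interpret prob_space "K s (Some x)" by (rule prob_K)
  have "(\<integral>\<^sup>+ y. case_option 0 (\<lambda>_. 1) y \<partial>K s (Some x)) \<le> (\<integral>\<^sup>+ y. 1 \<partial>K s (Some x))"
    by (intro nn_integral_mono) (auto split: option.splits)
  also have "\<dots> = 1" using emeasure_space_1 by simp
  finally show ?case using elim by simp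
qed
qed

lemma q_rectangle_symmetric:
  fixes f g :: "'a \<Rightarrow> ennreal"
  assumes s: "s > 0" and [measurable]: "f \<in> borel_measurable borel" "g \<in> borel_measurable borel"
  shows "(\<integral>\<^sup>+ x. \<integral>\<^sup>+ y. f x * g y * q s x y \<partial>\<mu> \<partial>\<mu>) = (\<integral>\<^sup>+ x. \<integral>\<^sup>+ y. g x * f y * q s x y \<partial>\<mu> \<partial>\<mu>)"
proof -
  have r: "(\<integral>\<^sup>+ x. \<integral>\<^sup>+ y. f x * g y * q s x y \<partial>\<mu> \<partial>\<mu>) = (\<integral>\<^sup>+ x. f x * (\<integral>\<^sup>+ y. case_option 0 g y \<partial>K s (Some x)) \<partial>\<mu>)"
    if [measurable]: "f \<in> borel_measurable borel" "g \<in> borel_measurable borel" for f g :: "'a \<Rightarrow> ennreal"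
  proof (rule nn_integral_cong_AE)
    show "AE x in \<mu>. (\<integral>\<^sup>+ y. f x * g y * q s x y \<partial>\<mu>) = f x * (\<integral>\<^sup>+ y. case_option 0 g y \<partial>K s (Some x))"
      using K_density[OF s that(2)] by eventually_elim (simp add: mult.assoc nn_integral_cmult)
  qed
  show ?thesis unfolding r[OF assms(2,3)] r[OF assms(3,2)]
    by (rule symmetric_kernel.kernel_symmetric[OF K_symmetric assms(2,3)])
qed

lemma measure_eq_on_rectangles:
  fixes M1 M2 :: "('a \<times> 'a) measure"
  assumes s: "sets M1 = sets (borel \<Otimes>\<^sub>M borel)" "sets M2 = sets (borel \<Otimes>\<^sub>M borel)"
    and eq: "\<And>A B. A \<in> sets borel \<Longrightarrow> B \<in> sets borel \<Longrightarrow> emeasure M1 (A \<times> B) = emeasure M2 (A \<times> B)"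
    and fin: "\<And>x r. emeasure M1 (ball x r \<times> ball x r) \<noteq> \<infinity>"
  shows "M1 = M2"
proof -
  obtain x0 :: 'a where True by blast
  let ?E = "{A \<times> B | A B. A \<in> sets (borel :: 'a measure) \<and> B \<in> sets (borel :: 'a measure)}"
  have sp: "sets (borel \<Otimes>\<^sub>M borel) = sigma_sets UNIV ?E" by (simp add: sets_pair_measure)
  show ?thesis
  proof (rule measure_eqI_generator_eq[where E="?E" and \<Omega>=UNIV and A="\<lambda>n. ball x0 (real n) \<times> ball x0 (real n)"])
    show "Int_stable ?E" by (rule Int_stable_pair_measure_generator)
    have "\<exists>n. dist x0 a < real n \<and> dist x0 b < real n" for a b
      using reals_Archimedean2[of "max (dist x0 a) (dist x0 b)"] by auto
    then show "(\<Union>n. ball x0 (real n) \<times> ball x0 (real n)) = (UNIV :: ('a \<times> 'a) set)" by auto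
    show "range (\<lambda>n. ball x0 (real n) \<times> ball x0 (real n)) \<subseteq> ?E"
    proof (rule image_subsetI)
      fix n :: nat
      show "ball x0 (real n) \<times> ball x0 (real n) \<in> ?E"
        by (intro CollectI exI[of _ "ball x0 (real n)"]) simp
    qed
  qed (use s sp eq fin in auto)
qed

text \<open>No pointwise symmetry of \<open>p\<close> is at hand. Symmetry of the kernels shows that
  the measure with density \<open>q s\<close> and its reflection agree on rectangles, which
  determine it because \<open>q_mass_le\<close> makes products of balls have finite measure.\<close>

lemma q_symmetric:
  assumes s: "s > 0" and h[measurable]: "h \<in> borel_measurable (borel \<Otimes>\<^sub>M borel)"
  shows "(\<integral>\<^sup>+ x. \<integral>\<^sup>+ y. h (x, y) * q s x y \<partial>\<mu> \<partial>\<mu>) = (\<integral>\<^sup>+ x. \<integral>\<^sup>+ y. h (y, x) * q s x y \<partial>\<mu> \<partial>\<mu>)"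
proof -
  define M1 where "M1 = density (\<mu> \<Otimes>\<^sub>M \<mu>) (\<lambda>z. q s (fst z) (snd z))"
  define M2 where "M2 = distr M1 (borel \<Otimes>\<^sub>M borel) (\<lambda>z. (snd z, fst z))"
  have s1: "sets M1 = sets (borel \<Otimes>\<^sub>M borel)" unfolding M1_def by (simp cong: sets_pair_measure_cong)
  note s1[measurable_cong]
  have i1: "(\<integral>\<^sup>+ z. k z \<partial>M1) = (\<integral>\<^sup>+ x. \<integral>\<^sup>+ y. k (x, y) * q s x y \<partial>\<mu> \<partial>\<mu>)"
    if [measurable]: "k \<in> borel_measurable (borel \<Otimes>\<^sub>M borel)" for k
  proof -
    have "(\<integral>\<^sup>+ z. k z \<partial>M1) = (\<integral>\<^sup>+ z. q s (fst z) (snd z) * k z \<partial>(\<mu> \<Otimes>\<^sub>M \<mu>))"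
      unfolding M1_def by (rule nn_integral_density) measurable
    also have "\<dots> = (\<integral>\<^sup>+ x. \<integral>\<^sup>+ y. k (x, y) * q s x y \<partial>\<mu> \<partial>\<mu>)"
      by (subst nn_integral_fst[symmetric]) (auto simp: mult.commute)
    finally show ?thesis .
  qed
  have i2: "(\<integral>\<^sup>+ z. k z \<partial>M2) = (\<integral>\<^sup>+ x. \<integral>\<^sup>+ y. k (y, x) * q s x y \<partial>\<mu> \<partial>\<mu>)"
    if [measurable]: "k \<in> borel_measurable (borel \<Otimes>\<^sub>M borel)" for k
    unfolding M2_def by (subst nn_integral_distr) (simp_all add: i1)
  have e: "indicator (A \<times> B) (x, y) = (indicator A x * indicator B y :: ennreal)" for A B and x y :: 'a
    by (auto simp: indicator_def)
  have r1: "emeasure M1 (A \<times> B) = (\<integral>\<^sup>+ x. \<integral>\<^sup>+ y. indicator A x * indicator B y * q s x y \<partial>\<mu> \<partial>\<mu>)"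
    if [measurable]: "A \<in> sets borel" "B \<in> sets borel" for A B
    using i1[of "indicator (A \<times> B)"] s1 by (simp add: e)
  have r2: "emeasure M2 (A \<times> B) = (\<integral>\<^sup>+ x. \<integral>\<^sup>+ y. indicator B x * indicator A y * q s x y \<partial>\<mu> \<partial>\<mu>)"
    if [measurable]: "A \<in> sets borel" "B \<in> sets borel" for A B
    using i2[of "indicator (A \<times> B)"] by (simp add: M2_def e mult.commute)
  have "M1 = M2"
  proof (rule measure_eq_on_rectangles)
    show "sets M1 = sets (borel \<Otimes>\<^sub>M borel)" by (rule s1)
    show "sets M2 = sets (borel \<Otimes>\<^sub>M borel)" by (simp add: M2_def)
    show "emeasure M1 (A \<times> B) = emeasure M2 (A \<times> B)" if "A \<in> sets borel" "B \<in> sets borel" for A B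
      using q_rectangle_symmetric[OF s, of "indicator A" "indicator B"] that by (simp add: r1 r2)
    fix x r
    have "emeasure M1 (ball x r \<times> ball x r) \<le> (\<integral>\<^sup>+ z. indicator (ball x r) z \<partial>\<mu>)"
      unfolding r1[OF borel_open borel_open, OF open_ball open_ball]
    proof (rule nn_integral_mono_AE)
      show "AE z in \<mu>. (\<integral>\<^sup>+ y. indicator (ball x r) z * indicator (ball x r) y * q s z y \<partial>\<mu>) \<le> indicator (ball x r) z"
        using q_mass_le[OF s]
      proof eventually_elim
        case (elim z)
        have "(\<integral>\<^sup>+ y. indicator (ball x r) z * indicator (ball x r) y * q s z y \<partial>\<mu>) \<le> (\<integral>\<^sup>+ y. indicator (ball x r) z * q s z y \<partial>\<mu>)"
          by (intro nn_integral_mono) (auto simp: indicator_def)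
        also have "\<dots> = indicator (ball x r) z * (\<integral>\<^sup>+ y. q s z y \<partial>\<mu>)" by (rule nn_integral_cmult) measurable
        also have "\<dots> \<le> indicator (ball x r) z * 1" using elim by (intro mult_left_mono) auto
        finally show ?case by simp
      qed
    qed
    then show "emeasure M1 (ball x r \<times> ball x r) \<noteq> \<infinity>" using emeasure_ball_finite[of x r] by (auto simp: top_unique)
  qed
  then show ?thesis using i1[OF h] i2[OF h] by simp
qed

definition jump_mass :: "real \<Rightarrow> ('a \<times> 'a) measure" where
  "jump_mass s = density (\<mu> \<Otimes>\<^sub>M \<mu>) (\<lambda>z. q s (fst z) (snd z))"

lemma sets_jump_mass[measurable_cong, simp]: "sets (jump_mass s) = sets (borel \<Otimes>\<^sub>M borel)"
  unfolding jump_mass_def by (simp cong: sets_pair_measure_cong)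

lemma nn_integral_jump_mass:
  assumes [measurable]: "h \<in> borel_measurable (borel \<Otimes>\<^sub>M borel)"
  shows "(\<integral>\<^sup>+ z. h z \<partial>jump_mass s) = (\<integral>\<^sup>+ x. \<integral>\<^sup>+ y. h (x, y) * q s x y \<partial>\<mu> \<partial>\<mu>)"
proof -
  have "(\<integral>\<^sup>+ z. h z \<partial>jump_mass s) = (\<integral>\<^sup>+ z. q s (fst z) (snd z) * h z \<partial>(\<mu> \<Otimes>\<^sub>M \<mu>))"
    unfolding jump_mass_def by (rule nn_integral_density) measurable
  also have "\<dots> = (\<integral>\<^sup>+ x. \<integral>\<^sup>+ y. h (x, y) * q s x y \<partial>\<mu> \<partial>\<mu>)"
    by (subst nn_integral_fst[symmetric]) (auto simp: mult.commute)
  finally show ?thesis .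
qed

text \<open>Under \<open>jump_mass s\<close> the squares of \<open>u\<close> in either coordinate
  have the same integral \<open>a\<close>, by \<open>q_symmetric\<close>, and the mixed term is
  \<open>(Q s u, u)\<close>; so the double integral equals \<open>a - (Q s u, u)\<close>. The rest,
  the squared norm minus \<open>a\<close>, measures how far the kernel mass falls short of
  \<open>1\<close>.\<close>

lemma gap_energy:
  assumes s: "s > 0" and u: "u \<in> L2 \<mu>"
  shows "ennreal (gap u s) = (\<integral>\<^sup>+ x. \<integral>\<^sup>+ y. ennreal ((u x - u y)\<^sup>2 / 2) * q s x y \<partial>\<mu> \<partial>\<mu>) +
    (\<integral>\<^sup>+ x. ennreal ((u x)\<^sup>2) * (1 - (\<integral>\<^sup>+ y. q s x y \<partial>\<mu>)) \<partial>\<mu>)"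
proof -
  note [measurable] = L2_measurable[OF u]
  let ?m = "jump_mass s" and ?U = "L2_inner \<mu> u u"
  let ?k = "\<lambda>x. \<integral>\<^sup>+ y. q s x y \<partial>\<mu>"
  have U0: "0 \<le> ?U" by (rule L2_inner_self_nonneg)
  have nnU: "(\<integral>\<^sup>+ x. ennreal ((u x)\<^sup>2) \<partial>\<mu>) = ennreal ?U"
    by (rule symmetric_kernel.L2_nn_finite[OF K_symmetric u])
  have a1: "(\<integral>\<^sup>+ z. ennreal ((u (fst z))\<^sup>2) \<partial>?m) = (\<integral>\<^sup>+ x. ennreal ((u x)\<^sup>2) * ?k x \<partial>\<mu>)"
    by (subst nn_integral_jump_mass) (simp_all add: nn_integral_cmult)
  have k_le: "AE x in \<mu>. ennreal ((u x)\<^sup>2) * ?k x \<le> ennreal ((u x)\<^sup>2)"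
    using q_mass_le[OF s] by eventually_elim (metis mult.right_neutral mult_left_mono zero_le)
  have a1_le: "(\<integral>\<^sup>+ z. ennreal ((u (fst z))\<^sup>2) \<partial>?m) \<le> ennreal ?U"
    unfolding a1 nnU[symmetric] using k_le by (rule nn_integral_mono_AE)
  have a2: "(\<integral>\<^sup>+ z. ennreal ((u (snd z))\<^sup>2) \<partial>?m) = (\<integral>\<^sup>+ z. ennreal ((u (fst z))\<^sup>2) \<partial>?m)"
    using q_symmetric[OF s, of "\<lambda>z. ennreal ((u (snd z))\<^sup>2)"] by (simp add: nn_integral_jump_mass)
  have i1: "integrable ?m (\<lambda>z. (u (fst z))\<^sup>2)"
    by (rule integrableI_nonneg) (use a1_le in \<open>auto simp: le_less_trans\<close>)
  have i2: "integrable ?m (\<lambda>z. (u (snd z))\<^sup>2)"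
    by (rule integrableI_nonneg) (use a1_le a2 in \<open>auto simp: le_less_trans\<close>)
  define a where "a = (\<integral>z. (u (fst z))\<^sup>2 \<partial>?m)"
  have a_nn: "(\<integral>\<^sup>+ z. ennreal ((u (fst z))\<^sup>2) \<partial>?m) = ennreal a"
    unfolding a_def by (rule nn_integral_eq_integral[OF i1]) simp
  have a0: "0 \<le> a" unfolding a_def by simp
  have "ennreal (\<integral>z. (u (snd z))\<^sup>2 \<partial>?m) = ennreal a"
    using nn_integral_eq_integral[OF i2] a2 a_nn by simp
  then have a': "(\<integral>z. (u (snd z))\<^sup>2 \<partial>?m) = a" using a0 by simp
  have aU: "a \<le> ?U" using a1_le a_nn U0 by simp
  have i3: "integrable ?m (\<lambda>z. u (fst z) * u (snd z))"
  proof (rule Bochner_Integration.integrable_bound[OF Bochner_Integration.integrable_add[OF i1 i2]])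
    have "\<bar>b * c\<bar> \<le> b\<^sup>2 + c\<^sup>2" for b c :: real
    proof -
      have "2 * \<bar>b * c\<bar> \<le> b\<^sup>2 + c\<^sup>2" using sum_squares_bound[of "\<bar>b\<bar>" "\<bar>c\<bar>"] by (simp add: abs_mult)
      moreover have "0 \<le> \<bar>b * c\<bar>" by simp
      ultimately show ?thesis by linarith
    qed
    then show "AE z in ?m. norm (u (fst z) * u (snd z)) \<le> norm ((u (fst z))\<^sup>2 + (u (snd z))\<^sup>2)" by simp
  qed measurable
  define c where "c = (\<integral>z. u (fst z) * u (snd z) \<partial>?m)"
  have pm[measurable]: "(\<lambda>z. p s (fst z) (snd z)) \<in> borel_measurable (borel \<Otimes>\<^sub>M borel)"
  proof -
    have "(\<lambda>z. enn2real (q s (fst z) (snd z))) \<in> borel_measurable (borel \<Otimes>\<^sub>M borel)" by measurable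
    then show ?thesis using s p_nonneg by (simp add: q_pos)
  qed
  have m_eq: "?m = density (\<mu> \<Otimes>\<^sub>M \<mu>) (\<lambda>z. ennreal (p s (fst z) (snd z)))"
    using s by (simp add: jump_mass_def q_pos)
  have i3': "integrable (\<mu> \<Otimes>\<^sub>M \<mu>) (\<lambda>z. p s (fst z) (snd z) * (u (fst z) * u (snd z)))"
    using i3 unfolding m_eq by (subst (asm) integrable_real_density) (auto simp: p_nonneg s)
  have c_eq: "c = L2_inner \<mu> (Q s u) u"
  proof -
    have "c = (\<integral>z. p s (fst z) (snd z) * (u (fst z) * u (snd z)) \<partial>(\<mu> \<Otimes>\<^sub>M \<mu>))"
      unfolding c_def m_eq by (subst integral_real_density) (auto simp: p_nonneg s)
    also have "\<dots> = (\<integral>x. (\<integral>y. p s x y * (u x * u y) \<partial>\<mu>) \<partial>\<mu>)"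
      using pair.integral_fst'[OF i3'] by simp
    also have "\<dots> = (\<integral>x. Q s u x * u x \<partial>\<mu>)"
    proof (rule integral_cong_AE)
      show "(\<lambda>x. \<integral>y. p s x y * (u x * u y) \<partial>\<mu>) \<in> borel_measurable \<mu>"
        using pair.integrable_fst'[OF i3'] by (auto dest: borel_measurable_integrable)
      show "(\<lambda>x. Q s u x * u x) \<in> borel_measurable \<mu>"
        using L2_measurable[OF Q_L2[OF u]] by simp
      show "AE x in \<mu>. (\<integral>y. p s x y * (u x * u y) \<partial>\<mu>) = Q s u x * u x"
        using p_operator[OF s u]
      proof eventually_elim
        case (elim x)
        have "(\<integral>y. p s x y * (u x * u y) \<partial>\<mu>) = (\<integral>y. u x * (p s x y * u y) \<partial>\<mu>)" by (simp add: mult_ac)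
        then show ?case using elim by (simp add: mult.commute)
      qed
    qed
    finally show ?thesis by (simp add: L2_inner_def)
  qed
  have sq: "(u (fst z) - u (snd z))\<^sup>2 / 2 = (u (fst z))\<^sup>2 / 2 + (u (snd z))\<^sup>2 / 2 - u (fst z) * u (snd z)" for z
    by (simp add: power2_eq_square field_simps)
  have isq: "integrable ?m (\<lambda>z. (u (fst z) - u (snd z))\<^sup>2 / 2)"
    unfolding sq using i1 i2 i3 by simp
  have isqv: "(\<integral>z. (u (fst z) - u (snd z))\<^sup>2 / 2 \<partial>?m) = a - c"
    unfolding sq using i1 i2 i3 by (simp add: a_def[symmetric] a' c_def[symmetric])
  have e1: "(\<integral>\<^sup>+ z. ennreal ((u (fst z) - u (snd z))\<^sup>2 / 2) \<partial>?m) = ennreal (a - c)"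
    unfolding isqv[symmetric] by (rule nn_integral_eq_integral[OF isq]) simp
  have ac: "0 \<le> a - c" unfolding isqv[symmetric] by (rule integral_nonneg_AE) simp
  have e2: "(\<integral>\<^sup>+ x. ennreal ((u x)\<^sup>2) * (1 - ?k x) \<partial>\<mu>) = ennreal (?U - a)"
  proof -
    have "(\<integral>\<^sup>+ x. ennreal ((u x)\<^sup>2) * (1 - ?k x) \<partial>\<mu>) + ennreal a = (\<integral>\<^sup>+ x. ennreal ((u x)\<^sup>2) * (1 - ?k x) + ennreal ((u x)\<^sup>2) * ?k x \<partial>\<mu>)"
      unfolding a_nn[symmetric] a1 by (rule nn_integral_add[symmetric]) measurable
    also have "\<dots> = (\<integral>\<^sup>+ x. ennreal ((u x)\<^sup>2) \<partial>\<mu>)"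
    proof (rule nn_integral_cong_AE)
      show "AE x in \<mu>. ennreal ((u x)\<^sup>2) * (1 - ?k x) + ennreal ((u x)\<^sup>2) * ?k x = ennreal ((u x)\<^sup>2)"
        using q_mass_le[OF s]
        by eventually_elim (simp add: distrib_left[symmetric] diff_add_cancel_ennreal)
    qed
    finally have "(\<integral>\<^sup>+ x. ennreal ((u x)\<^sup>2) * (1 - ?k x) \<partial>\<mu>) + ennreal a = ennreal ?U" using nnU by simp
    then have "(\<integral>\<^sup>+ x. ennreal ((u x)\<^sup>2) * (1 - ?k x) \<partial>\<mu>) = ennreal ?U - ennreal a"
      by (metis ennreal_add_diff_cancel_right ennreal_neq_top)
    then show ?thesis using a0 by (simp add: ennreal_minus)
  qed
  have "ennreal (gap u s) = ennreal ((a - c) + (?U - a))" by (simp add: gap_eq c_eq)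
  also have "\<dots> = ennreal (a - c) + ennreal (?U - a)" using ac aU by (intro ennreal_plus) auto
  finally show ?thesis unfolding e1[symmetric] e2[symmetric] by (simp add: nn_integral_jump_mass)
qed

section \<open>Jump density, killing density and total energy\<close>

lemma sigma_finite_nu: "sigma_finite_measure \<nu>"
  unfolding levy_measure_def
  using sigma_finite_measure.sigma_finite_iff_density_finite[OF lborel.sigma_finite_measure_axioms,
      of "\<lambda>t. ennreal (indicator {0<..} t * levy_density \<phi> \<psi> t)"]
    levy_density_measurable[OF scales] by simp

text \<open>The factor \<open>1/2\<close> is the one from \<open>gap_energy\<close>. Infinite values
  may occur, for instance on the diagonal.\<close>

definition j :: "'a \<Rightarrow> 'a \<Rightarrow> ennreal" where
  "j x y = (\<integral>\<^sup>+ s. ennreal (1/2) * q s x y \<partial>\<nu>)"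

text \<open>Records a possible loss of mass of \<open>X\<close>, so that conservativeness never has
  to be decided.\<close>

definition kill :: "'a \<Rightarrow> ennreal" where
  "kill x = (\<integral>\<^sup>+ s. 1 - (\<integral>\<^sup>+ y. q s x y \<partial>\<mu>) \<partial>\<nu>)"

lemma j_measurable[measurable (raw)]:
  assumes [measurable]: "g \<in> M \<rightarrow>\<^sub>M borel" "h \<in> M \<rightarrow>\<^sub>M borel"
  shows "(\<lambda>a. j (g a) (h a)) \<in> borel_measurable M"
proof -
  interpret nu: sigma_finite_measure \<nu> by (rule sigma_finite_nu)
  show ?thesis unfolding j_def by measurable
qed

lemma kill_measurable[measurable]: "kill \<in> borel_measurable borel"
proof -
  interpret nu: sigma_finite_measure \<nu> by (rule sigma_finite_nu)
  show ?thesis unfolding kill_def by measurable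
qed

lemma nn_integral_j:
  assumes [measurable]: "h \<in> borel_measurable (borel \<Otimes>\<^sub>M borel)"
  shows "(\<integral>\<^sup>+ x. \<integral>\<^sup>+ y. h (x, y) * j x y \<partial>\<mu> \<partial>\<mu>) =
    (\<integral>\<^sup>+ s. (\<integral>\<^sup>+ x. \<integral>\<^sup>+ y. ennreal (1/2) * h (x, y) * q s x y \<partial>\<mu> \<partial>\<mu>) \<partial>\<nu>)"
proof -
  interpret nu: sigma_finite_measure \<nu> by (rule sigma_finite_nu)
  interpret pn: pair_sigma_finite \<mu> \<nu> ..
  have "(\<integral>\<^sup>+ x. \<integral>\<^sup>+ y. h (x, y) * j x y \<partial>\<mu> \<partial>\<mu>) = (\<integral>\<^sup>+ x. \<integral>\<^sup>+ y. \<integral>\<^sup>+ s. ennreal (1/2) * h (x, y) * q s x y \<partial>\<nu> \<partial>\<mu> \<partial>\<mu>)"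
    unfolding j_def by (intro nn_integral_cong) (subst nn_integral_cmult[symmetric], auto simp: mult_ac)
  also have "\<dots> = (\<integral>\<^sup>+ x. \<integral>\<^sup>+ s. \<integral>\<^sup>+ y. ennreal (1/2) * h (x, y) * q s x y \<partial>\<mu> \<partial>\<nu> \<partial>\<mu>)"
    by (intro nn_integral_cong pn.Fubini'[symmetric]) measurable
  also have "\<dots> = (\<integral>\<^sup>+ s. \<integral>\<^sup>+ x. \<integral>\<^sup>+ y. ennreal (1/2) * h (x, y) * q s x y \<partial>\<mu> \<partial>\<mu> \<partial>\<nu>)"
    by (intro pn.Fubini'[symmetric]) measurable
  finally show ?thesis .
qed

lemma j_symmetric:
  assumes [measurable]: "h \<in> borel_measurable (borel \<Otimes>\<^sub>M borel)"
  shows "(\<integral>\<^sup>+ x. \<integral>\<^sup>+ y. h (x, y) * j x y \<partial>\<mu> \<partial>\<mu>) = (\<integral>\<^sup>+ x. \<integral>\<^sup>+ y. h (y, x) * j x y \<partial>\<mu> \<partial>\<mu>)"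
proof -
  have m: "(\<lambda>z. h (snd z, fst z)) \<in> borel_measurable (borel \<Otimes>\<^sub>M borel)" by measurable
  have "(\<integral>\<^sup>+ s. (\<integral>\<^sup>+ x. \<integral>\<^sup>+ y. ennreal (1/2) * h (x, y) * q s x y \<partial>\<mu> \<partial>\<mu>) \<partial>\<nu>) =
      (\<integral>\<^sup>+ s. (\<integral>\<^sup>+ x. \<integral>\<^sup>+ y. ennreal (1/2) * h (y, x) * q s x y \<partial>\<mu> \<partial>\<mu>) \<partial>\<nu>)"
  proof (rule nn_integral_cong_AE)
    show "AE s in \<nu>. (\<integral>\<^sup>+ x. \<integral>\<^sup>+ y. ennreal (1/2) * h (x, y) * q s x y \<partial>\<mu> \<partial>\<mu>) =
        (\<integral>\<^sup>+ x. \<integral>\<^sup>+ y. ennreal (1/2) * h (y, x) * q s x y \<partial>\<mu> \<partial>\<mu>)"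
      using nu_pos
    proof eventually_elim
      case (elim s)
      show ?case using q_symmetric[OF elim, of "\<lambda>z. ennreal (1/2) * h z"] by simp
    qed
  qed
  then show ?thesis using nn_integral_j[OF assms] nn_integral_j[OF m] by simp
qed

lemma total_energy:
  assumes u: "u \<in> L2 \<mu>"
  shows "(\<integral>\<^sup>+ s. ennreal (gap u s) \<partial>\<nu>) = (\<integral>\<^sup>+ x. \<integral>\<^sup>+ y. ennreal ((u x - u y)\<^sup>2) * j x y \<partial>\<mu> \<partial>\<mu>) +
    (\<integral>\<^sup>+ x. ennreal ((u x)\<^sup>2) * kill x \<partial>\<mu>)"
proof -
  note [measurable] = L2_measurable[OF u]
  interpret nu: sigma_finite_measure \<nu> by (rule sigma_finite_nu)
  interpret pn: pair_sigma_finite \<mu> \<nu> ..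
  have half: "ennreal (r / 2) = ennreal (1/2) * ennreal r" if "r \<ge> 0" for r
    using that by (simp add: ennreal_mult[symmetric] del: ennreal_half)
  have "(\<integral>\<^sup>+ s. ennreal (gap u s) \<partial>\<nu>) = (\<integral>\<^sup>+ s. (\<integral>\<^sup>+ x. \<integral>\<^sup>+ y. ennreal (1/2) * ennreal ((u x - u y)\<^sup>2) * q s x y \<partial>\<mu> \<partial>\<mu>) +
    (\<integral>\<^sup>+ x. ennreal ((u x)\<^sup>2) * (1 - (\<integral>\<^sup>+ y. q s x y \<partial>\<mu>)) \<partial>\<mu>) \<partial>\<nu>)"
  proof (rule nn_integral_cong_AE, use nu_pos in eventually_elim)
    case (elim s)
    have eq: "ennreal ((u x - u y)\<^sup>2 / 2) = ennreal (1/2) * ennreal ((u x - u y)\<^sup>2)" for x y by (rule half) simp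
    show ?case unfolding gap_energy[OF elim u] eq by (rule refl)
  qed
  also have "\<dots> = (\<integral>\<^sup>+ s. (\<integral>\<^sup>+ x. \<integral>\<^sup>+ y. ennreal (1/2) * ennreal ((u x - u y)\<^sup>2) * q s x y \<partial>\<mu> \<partial>\<mu>) \<partial>\<nu>) +
    (\<integral>\<^sup>+ s. (\<integral>\<^sup>+ x. ennreal ((u x)\<^sup>2) * (1 - (\<integral>\<^sup>+ y. q s x y \<partial>\<mu>)) \<partial>\<mu>) \<partial>\<nu>)"
    by (rule nn_integral_add) measurable
  also have "(\<integral>\<^sup>+ s. (\<integral>\<^sup>+ x. \<integral>\<^sup>+ y. ennreal (1/2) * ennreal ((u x - u y)\<^sup>2) * q s x y \<partial>\<mu> \<partial>\<mu>) \<partial>\<nu>) =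
      (\<integral>\<^sup>+ x. \<integral>\<^sup>+ y. ennreal ((u x - u y)\<^sup>2) * j x y \<partial>\<mu> \<partial>\<mu>)"
    using nn_integral_j[of "\<lambda>z. ennreal ((u (fst z) - u (snd z))\<^sup>2)"] by simp
  also have "(\<integral>\<^sup>+ s. (\<integral>\<^sup>+ x. ennreal ((u x)\<^sup>2) * (1 - (\<integral>\<^sup>+ y. q s x y \<partial>\<mu>)) \<partial>\<mu>) \<partial>\<nu>) =
      (\<integral>\<^sup>+ x. (\<integral>\<^sup>+ s. ennreal ((u x)\<^sup>2) * (1 - (\<integral>\<^sup>+ y. q s x y \<partial>\<mu>)) \<partial>\<nu>) \<partial>\<mu>)"
    by (rule pn.Fubini') measurable
  also have "\<dots> = (\<integral>\<^sup>+ x. ennreal ((u x)\<^sup>2) * kill x \<partial>\<mu>)"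
    unfolding kill_def by (intro nn_integral_cong nn_integral_cmult) measurable
  finally show ?thesis .
qed

section \<open>Two-sided estimate of the jump density\<close>

lemma jump_profile_le:
  assumes s: "s > 0" and xy: "x \<noteq> y"
  shows "jump_profile \<mu> \<phi> s x y \<le> 1 / vol \<mu> x (dist x y) * min 1 (s / \<phi> (dist x y))"
proof -
  define r where "r = dist x y"
  have r: "r > 0" using xy by (simp add: r_def)
  have v: "vol \<mu> x r > 0" using vol_pos[OF r] .
  have fr: "\<phi> r > 0" using scale_pos[OF scales(1) r] .
  show ?thesis
  proof (cases "s \<le> \<phi> r")
    case True
    then have "min 1 (s / \<phi> r) = s / \<phi> r" using fr by simp
    then show ?thesis using xy by (simp add: jump_profile_def r_def)
  next
    case False
    \<comment> \<open>Beyond the time \<open>\<phi> r\<close> the on-diagonal term serves as the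
      bound, its ball having radius at least \<open>r\<close>.\<close>
    then have "r \<le> scale_inv \<phi> s" using le_scale_inv_iff[OF scales(1), of r s] r s by simp
    then have "1 / vol \<mu> x (scale_inv \<phi> s) \<le> 1 / vol \<mu> x r" using vol_mono v by (simp add: frac_le)
    moreover have "min 1 (s / \<phi> r) = 1" using False fr by simp
    ultimately show ?thesis using xy by (simp add: jump_profile_def r_def min.coboundedI1)
  qed
qed

text \<open>For \<open>s \<le> \<phi> r\<close> both members of the minimum dominate the left side,
  the on-diagonal one because its ball has radius at most \<open>r\<close>.\<close>

lemma jump_profile_ge:
  assumes s: "s > 0" and xy: "x \<noteq> y" and le: "s \<le> \<phi> (dist x y)"
  shows "1 / vol \<mu> x (dist x y) * (s / \<phi> (dist x y)) \<le> jump_profile \<mu> \<phi> s x y"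
proof -
  define r where "r = dist x y"
  have r: "r > 0" using xy by (simp add: r_def)
  have v: "vol \<mu> x r > 0" using vol_pos[OF r] .
  have fr: "\<phi> r > 0" using scale_pos[OF scales(1) r] .
  have "scale_inv \<phi> s \<le> r" using scale_inv_le_iff[OF scales(1), of r s] r s le by (simp add: r_def)
  moreover have "vol \<mu> x (scale_inv \<phi> s) > 0" by (intro vol_pos scale_inv_pos scales s)
  ultimately have "1 / vol \<mu> x r \<le> 1 / vol \<mu> x (scale_inv \<phi> s)" using vol_mono by (simp add: frac_le)
  moreover have "1 / vol \<mu> x r * (s / \<phi> r) \<le> 1 / vol \<mu> x r * 1"
    using le fr v by (intro mult_left_mono) (auto simp: r_def)
  ultimately have "1 / vol \<mu> x r * (s / \<phi> r) \<le> 1 / vol \<mu> x (scale_inv \<phi> s)" by linarith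
  then show ?thesis using xy by (simp add: jump_profile_def r_def)
qed

lemma j_le:
  assumes N: "x \<notin> N" "y \<notin> N" and xy: "x \<noteq> y"
  shows "j x y \<le> ennreal (c2 / (2 * vol \<mu> x (dist x y))) * (\<integral>\<^sup>+ s. ennreal (min 1 (s / \<phi> (dist x y))) \<partial>\<nu>)"
proof -
  let ?v = "vol \<mu> x (dist x y)" and ?f = "\<phi> (dist x y)"
  have v: "?v > 0" and f: "?f > 0" using xy vol_pos scale_pos[OF scales(1)] by auto
  have "j x y \<le> (\<integral>\<^sup>+ s. ennreal (c2 / (2 * ?v)) * ennreal (min 1 (s / ?f)) \<partial>\<nu>)"
    unfolding j_def
  proof (rule nn_integral_mono_AE)
    show "AE s in \<nu>. ennreal (1/2) * q s x y \<le> ennreal (c2 / (2 * ?v)) * ennreal (min 1 (s / ?f))"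
      using nu_pos
    proof eventually_elim
      case (elim s)
      have "p s x y \<le> c2 * jump_profile \<mu> \<phi> s x y" using p_bounds[OF elim N] by simp
      also have "\<dots> \<le> c2 * (1 / ?v * min 1 (s / ?f))" using c2_pos by (intro mult_left_mono jump_profile_le elim xy) simp
      finally have "1/2 * p s x y \<le> c2 / (2 * ?v) * min 1 (s / ?f)" by simp
      then have "ennreal (1/2 * p s x y) \<le> ennreal (c2 / (2 * ?v) * min 1 (s / ?f))" by (rule ennreal_leI)
      then show ?case
      proof -
        have "ennreal (1/2 * p s x y) = ennreal (1/2) * ennreal (p s x y)"
          by (rule ennreal_mult) (simp_all add: p_nonneg elim)
        moreover have "ennreal (c2 / (2 * ?v) * min 1 (s / ?f)) = ennreal (c2 / (2 * ?v)) * ennreal (min 1 (s / ?f))"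
          by (rule ennreal_mult) (use c2_pos v f elim in simp_all)
        ultimately show ?thesis
          using \<open>ennreal (1/2 * p s x y) \<le> _\<close> unfolding q_pos[OF elim] by metis
      qed
    qed
  qed
  also have "\<dots> = ennreal (c2 / (2 * ?v)) * (\<integral>\<^sup>+ s. ennreal (min 1 (s / ?f)) \<partial>\<nu>)"
    by (rule nn_integral_cmult) measurable
  finally show ?thesis .
qed

lemma j_ge:
  assumes N: "x \<notin> N" "y \<notin> N" and xy: "x \<noteq> y"
  shows "ennreal (c1 / (2 * vol \<mu> x (dist x y))) * (\<integral>\<^sup>+ s. ennreal (s / \<phi> (dist x y)) * indicator {0<..\<phi> (dist x y)} s \<partial>\<nu>) \<le> j x y"
proof -
  let ?v = "vol \<mu> x (dist x y)" and ?f = "\<phi> (dist x y)"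
  have v: "?v > 0" and f: "?f > 0" using xy vol_pos scale_pos[OF scales(1)] by auto
  have "(\<integral>\<^sup>+ s. ennreal (c1 / (2 * ?v)) * (ennreal (s / ?f) * indicator {0<..?f} s) \<partial>\<nu>) \<le> j x y"
    unfolding j_def
  proof (rule nn_integral_mono)
    fix s
    show "ennreal (c1 / (2 * ?v)) * (ennreal (s / ?f) * indicator {0<..?f} s) \<le> ennreal (1/2) * q s x y"
    proof (cases "s \<in> {0<..?f}")
      case True
      then have s: "s > 0" "s \<le> ?f" by auto
      have "c1 * (1 / ?v * (s / ?f)) \<le> c1 * jump_profile \<mu> \<phi> s x y"
        using c1_pos by (intro mult_left_mono jump_profile_ge s xy) simp
      also have "\<dots> \<le> p s x y" using p_bounds[OF s(1) N] by simp
      finally have "c1 / (2 * ?v) * (s / ?f) \<le> 1/2 * p s x y" by simp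
      then have "ennreal (c1 / (2 * ?v) * (s / ?f)) \<le> ennreal (1/2 * p s x y)" by (rule ennreal_leI)
      moreover have "ennreal (c1 / (2 * ?v) * (s / ?f)) = ennreal (c1 / (2 * ?v)) * ennreal (s / ?f)"
        by (rule ennreal_mult) (use c1_pos v f s in simp_all)
      moreover have "ennreal (1/2 * p s x y) = ennreal (1/2) * ennreal (p s x y)"
        by (rule ennreal_mult) (simp_all add: p_nonneg s)
      moreover have "indicator {0<..?f} s = (1::ennreal)" using True by simp
      ultimately show ?thesis unfolding q_pos[OF s(1)] by (metis mult.right_neutral)
    qed simp
  qed
  then show ?thesis by (subst nn_integral_cmult[symmetric]) auto
qed

lemma j_comparison:
  "\<exists>C>0. \<forall>x y. x \<notin> N \<longrightarrow> y \<notin> N \<longrightarrow> x \<noteq> y \<longrightarrow>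
     ennreal (inverse C * (1 / vol \<mu> x (dist x y) * bernstein_fun \<phi> \<psi> (inverse (\<phi> (dist x y))))) \<le> j x y \<and>
     j x y \<le> ennreal (C * (1 / vol \<mu> x (dist x y) * bernstein_fun \<phi> \<psi> (inverse (\<phi> (dist x y)))))"
proof -
  obtain K where K: "K > 0" and B: "\<And>r. r > 0 \<Longrightarrow> 0 \<le> bernstein_fun \<phi> \<psi> (inverse (\<phi> r))"
    "\<And>r. r > 0 \<Longrightarrow> (\<integral>\<^sup>+s. ennreal (min 1 (s / \<phi> r)) \<partial>\<nu>) \<le> ennreal (2 * bernstein_fun \<phi> \<psi> (inverse (\<phi> r)))"
    "\<And>r. r > 0 \<Longrightarrow> ennreal (bernstein_fun \<phi> \<psi> (inverse (\<phi> r))) \<le>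
      ennreal K * (\<integral>\<^sup>+s. ennreal (s / \<phi> r) * indicator {0<..\<phi> r} s \<partial>\<nu>)"
    using bernstein_fun_comparison[OF scales nu_integrable] by blast
  \<comment> \<open>In the upper bound the \<open>1/2\<close> of \<open>j\<close> cancels the
    \<open>2\<close> of \<open>bernstein_fun_comparison\<close>, leaving \<open>c2\<close>; in the
    lower bound it remains, which gives \<open>2 * K / c1\<close>.\<close>
  define C where "C = max c2 (2 * K / c1)"
  have C: "C > 0" "c2 \<le> C" "2 * K / c1 \<le> C" using c2_pos by (auto simp: C_def)
  show ?thesis
  proof (intro exI[of _ C] conjI C allI impI)
    fix x y assume N: "x \<notin> N" "y \<notin> N" and xy: "x \<noteq> y"
    define r where "r = dist x y"
    define v where "v = vol \<mu> x r"
    define b where "b = bernstein_fun \<phi> \<psi> (inverse (\<phi> r))"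
    have r: "r > 0" using xy by (simp add: r_def)
    have v: "v > 0" using vol_pos[OF r] by (simp add: v_def)
    have b: "b \<ge> 0" using B(1)[OF r] by (simp add: b_def)
    have "j x y \<le> ennreal (c2 / (2 * v)) * (\<integral>\<^sup>+ s. ennreal (min 1 (s / \<phi> r)) \<partial>\<nu>)"
      using j_le[OF N xy] by (simp add: r_def v_def)
    also have "\<dots> \<le> ennreal (c2 / (2 * v)) * ennreal (2 * b)"
      using B(2)[OF r] by (intro mult_left_mono) (auto simp: b_def)
    also have "\<dots> = ennreal (c2 / (2 * v) * (2 * b))" using c2_pos v b by (intro ennreal_mult[symmetric]) auto
    also have "\<dots> \<le> ennreal (C * (1 / v * b))"
    proof (rule ennreal_leI)
      have "c2 / (2 * v) * (2 * b) = c2 * (1 / v * b)" by simp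
      also have "\<dots> \<le> C * (1 / v * b)" using C v b by (intro mult_right_mono) auto
      finally show "c2 / (2 * v) * (2 * b) \<le> C * (1 / v * b)" .
    qed
    finally show "j x y \<le> ennreal (C * (1 / vol \<mu> x (dist x y) * bernstein_fun \<phi> \<psi> (inverse (\<phi> (dist x y)))))"
      by (simp add: r_def v_def b_def)
    let ?I = "\<integral>\<^sup>+s. ennreal (s / \<phi> r) * indicator {0<..\<phi> r} s \<partial>\<nu>"
    have "ennreal (inverse C * (1 / v * b)) \<le> ennreal (c1 / (2 * v * K) * b)"
    proof (rule ennreal_leI)
      have "2 * K \<le> C * c1" using C c1_pos by (simp add: field_simps)
      then have "inverse C \<le> c1 / (2 * K)" using C K by (simp add: field_simps)
      then have "inverse C * (1 / v * b) \<le> c1 / (2 * K) * (1 / v * b)" using v b by (intro mult_right_mono) auto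
      also have "\<dots> = c1 / (2 * v * K) * b" by (simp add: field_simps)
      finally show "inverse C * (1 / v * b) \<le> c1 / (2 * v * K) * b" .
    qed
    also have "\<dots> = ennreal (c1 / (2 * v * K)) * ennreal b" using c1_pos v K b by (intro ennreal_mult) auto
    also have "\<dots> \<le> ennreal (c1 / (2 * v * K)) * (ennreal K * ?I)"
      using B(3)[OF r] by (intro mult_left_mono) (auto simp: b_def)
    also have "\<dots> = ennreal (c1 / (2 * v)) * ?I"
    proof -
      have "ennreal (c1 / (2 * v * K)) * ennreal K = ennreal (c1 / (2 * v * K) * K)"
        using c1_pos v K by (intro ennreal_mult[symmetric]) auto
      then show ?thesis using K by (simp add: mult.assoc[symmetric])
    qed
    also have "\<dots> \<le> j x y" using j_ge[OF N xy] by (simp add: r_def v_def)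
    finally show "ennreal (inverse C * (1 / vol \<mu> x (dist x y) * bernstein_fun \<phi> \<psi> (inverse (\<phi> (dist x y))))) \<le> j x y"
      by (simp add: r_def v_def b_def)
  qed
qed

section \<open>The jumping measure and the decomposition of the subordinate form\<close>

lemma AE_off_N: "AE z in \<mu> \<Otimes>\<^sub>M \<mu>. fst z \<notin> N \<and> snd z \<notin> N"
proof (rule AE_I')
  have N: "N \<in> sets borel" "emeasure \<mu> N = 0" using N_null by (auto simp: null_sets_def)
  have "N \<times> UNIV \<in> null_sets (\<mu> \<Otimes>\<^sub>M \<mu>)" "UNIV \<times> N \<in> null_sets (\<mu> \<Otimes>\<^sub>M \<mu>)"
    using N by (auto simp: null_sets_def emeasure_pair_measure_Times)
  then show "N \<times> UNIV \<union> UNIV \<times> N \<in> null_sets (\<mu> \<Otimes>\<^sub>M \<mu>)" by (rule null_sets.Un)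
qed auto

text \<open>The real-valued version that \<open>jump_kernel\<close> asks for; by
  \<open>AE_J0\<close> the conversion loses nothing off the diagonal up to a null set.\<close>

definition J0 :: "'a \<Rightarrow> 'a \<Rightarrow> real" where
  "J0 x y = enn2real (j x y)"

lemma AE_J0: "AE z in \<mu> \<Otimes>\<^sub>M \<mu>. z \<in> off_diagonal \<longrightarrow> ennreal (J0 (fst z) (snd z)) = j (fst z) (snd z)"
proof -
  obtain C where C: "\<And>x y. x \<notin> N \<Longrightarrow> y \<notin> N \<Longrightarrow> x \<noteq> y \<Longrightarrow>
     j x y \<le> ennreal (C * (1 / vol \<mu> x (dist x y) * bernstein_fun \<phi> \<psi> (inverse (\<phi> (dist x y)))))"
    using j_comparison by blast
  show ?thesis
    using AE_off_N
  proof eventually_elim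
    case (elim z)
    show ?case
    proof
      assume "z \<in> off_diagonal"
      then have "fst z \<noteq> snd z" by (auto simp: off_diagonal_def)
      then have "j (fst z) (snd z) < \<infinity>" using C elim by (metis ennreal_less_top infinity_ennreal_def le_less_trans)
      then show "ennreal (J0 (fst z) (snd z)) = j (fst z) (snd z)" by (simp add: J0_def)
    qed
  qed
qed

definition Jm :: "('a \<times> 'a) measure" where
  "Jm = density (\<mu> \<Otimes>\<^sub>M \<mu>) (\<lambda>(x, y). ennreal (J0 x y) * indicator {(x, y). x \<noteq> y} (x, y))"

lemma sets_Jm: "sets Jm = sets (borel \<Otimes>\<^sub>M borel)"
  unfolding Jm_def by (simp cong: sets_pair_measure_cong)

lemma nn_integral_Jm:
  assumes [measurable]: "h \<in> borel_measurable (borel \<Otimes>\<^sub>M borel)"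
  shows "(\<integral>\<^sup>+ z. h z \<partial>Jm) = (\<integral>\<^sup>+ x. \<integral>\<^sup>+ y. h (x, y) * indicator off_diagonal (x, y) * j x y \<partial>\<mu> \<partial>\<mu>)"
proof -
  have [measurable]: "(\<lambda>z. J0 (fst z) (snd z)) \<in> borel_measurable (borel \<Otimes>\<^sub>M borel)" unfolding J0_def by measurable
  have Jm: "Jm = density (\<mu> \<Otimes>\<^sub>M \<mu>) (\<lambda>z. ennreal (J0 (fst z) (snd z)) * indicator off_diagonal z)"
    unfolding Jm_def off_diagonal_def by (rule arg_cong[where f="density _"]) (auto simp: fun_eq_iff)
  have "(\<integral>\<^sup>+ z. h z \<partial>Jm) = (\<integral>\<^sup>+ z. ennreal (J0 (fst z) (snd z)) * indicator off_diagonal z * h z \<partial>(\<mu> \<Otimes>\<^sub>M \<mu>))"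
    unfolding Jm by (rule nn_integral_density) measurable
  also have "\<dots> = (\<integral>\<^sup>+ z. h z * indicator off_diagonal z * j (fst z) (snd z) \<partial>(\<mu> \<Otimes>\<^sub>M \<mu>))"
    by (rule nn_integral_cong_AE, use AE_J0 in eventually_elim) (auto simp: indicator_def mult.commute)
  also have "\<dots> = (\<integral>\<^sup>+ x. \<integral>\<^sup>+ y. h (x, y) * indicator off_diagonal (x, y) * j x y \<partial>\<mu> \<partial>\<mu>)"
    by (subst nn_integral_fst[symmetric]) auto
  finally show ?thesis .
qed

text \<open>On a compact set off the diagonal the distance of the coordinates is bounded below, and
  so are the volumes of balls of this radius centred in the first projection; the upper estimate
  then bounds \<open>j\<close> uniformly outside \<open>N\<close>.\<close>

lemma Jm_compact_finite:
  assumes L: "compact L" and off: "L \<subseteq> off_diagonal"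
  shows "emeasure Jm L < \<infinity>"
proof (cases "L = {}")
  case False
  let ?A = "fst ` L" and ?B = "snd ` L"
  have A: "compact ?A" "compact ?B"
    by (auto intro!: compact_continuous_image L continuous_on_fst continuous_on_snd continuous_on_id)
  have "continuous_on L (\<lambda>z. dist (fst z) (snd z))" by (intro continuous_intros)
  from continuous_attains_inf[OF L False this] obtain z0 where z0: "z0 \<in> L" "\<And>z. z \<in> L \<Longrightarrow> dist (fst z0) (snd z0) \<le> dist (fst z) (snd z)" by blast
  define \<delta> where "\<delta> = dist (fst z0) (snd z0)"
  have \<delta>: "\<delta> > 0" using z0(1) off by (auto simp: \<delta>_def off_diagonal_def)
  obtain c where c: "c > 0" "\<And>x. x \<in> ?A \<Longrightarrow> c \<le> vol \<mu> x \<delta>" using compact_volume_lower_bound[OF A(1) \<delta>] by blast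
  let ?I = "\<integral>\<^sup>+ s. ennreal (min 1 (s / \<phi> \<delta>)) \<partial>\<nu>"
  have I: "?I < \<infinity>"
  proof -
    obtain L where "(\<integral>\<^sup>+s. ennreal (min 1 (s / \<phi> \<delta>)) \<partial>\<nu>) \<le> ennreal (2 * bernstein_fun \<phi> \<psi> (inverse (\<phi> \<delta>)))"
      using bernstein_fun_comparison[OF scales nu_integrable] \<delta> by blast
    then show ?thesis by (simp add: le_less_trans)
  qed
  have le: "j (fst z) (snd z) \<le> ennreal (c2 / (2 * c)) * ?I" if z: "z \<in> L" "fst z \<notin> N" "snd z \<notin> N" for z
  proof -
    define r where "r = dist (fst z) (snd z)"
    have r: "\<delta> \<le> r" using z0 z by (simp add: \<delta>_def r_def)
    have ne: "fst z \<noteq> snd z" using z off by (auto simp: off_diagonal_def)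
    have v: "c \<le> vol \<mu> (fst z) r" using c(2)[of "fst z"] vol_mono[OF r, of "fst z"] z by force
    have f: "0 < \<phi> \<delta>" "\<phi> \<delta> \<le> \<phi> r" using scale_pos[OF scales(1) \<delta>] scale_le_iff[OF scales(1), of \<delta> r] r \<delta> by auto
    have "j (fst z) (snd z) \<le> ennreal (c2 / (2 * vol \<mu> (fst z) r)) * (\<integral>\<^sup>+ s. ennreal (min 1 (s / \<phi> r)) \<partial>\<nu>)"
      using j_le[OF z(2,3) ne] by (simp add: r_def)
    also have "\<dots> \<le> ennreal (c2 / (2 * c)) * ?I"
    proof (rule mult_mono)
      show "ennreal (c2 / (2 * vol \<mu> (fst z) r)) \<le> ennreal (c2 / (2 * c))"
        using v c c2_pos by (intro ennreal_leI frac_le) auto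
      show "(\<integral>\<^sup>+ s. ennreal (min 1 (s / \<phi> r)) \<partial>\<nu>) \<le> ?I"
      proof (rule nn_integral_mono_AE)
        show "AE s in \<nu>. ennreal (min 1 (s / \<phi> r)) \<le> ennreal (min 1 (s / \<phi> \<delta>))"
          using nu_pos by eventually_elim (intro ennreal_leI min.mono frac_le, use f in auto)
      qed
    qed auto
    finally show ?thesis .
  qed
  have LS: "L \<in> sets (borel \<Otimes>\<^sub>M borel)" unfolding borel_prod by (rule borel_closed[OF compact_imp_closed[OF L]])
  have "emeasure Jm L = (\<integral>\<^sup>+ x. \<integral>\<^sup>+ y. indicator L (x, y) * indicator off_diagonal (x, y) * j x y \<partial>\<mu> \<partial>\<mu>)"
    using nn_integral_Jm[of "indicator L"] LS by (simp add: sets_Jm)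
  also have "\<dots> = (\<integral>\<^sup>+ z. indicator L z * indicator off_diagonal z * j (fst z) (snd z) \<partial>(\<mu> \<Otimes>\<^sub>M \<mu>))"
    using LS by (subst nn_integral_fst[symmetric]) auto
  also have "\<dots> \<le> (\<integral>\<^sup>+ z. (ennreal (c2 / (2 * c)) * ?I) * indicator (?A \<times> ?B) z \<partial>(\<mu> \<Otimes>\<^sub>M \<mu>))"
  proof (rule nn_integral_mono_AE)
    show "AE z in \<mu> \<Otimes>\<^sub>M \<mu>. indicator L z * indicator off_diagonal z * j (fst z) (snd z)
        \<le> (ennreal (c2 / (2 * c)) * ?I) * indicator (?A \<times> ?B) z"
      using AE_off_N
    proof eventually_elim
      case (elim z)
      show ?case
      proof (cases "z \<in> L")
        case True
        then have "z \<in> ?A \<times> ?B" by (simp add: mem_Times_iff)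
        moreover have "z \<in> off_diagonal" using True off by blast
        ultimately show ?thesis using True le[OF True] elim by simp
      qed simp
    qed
  qed
  also have "\<dots> = (ennreal (c2 / (2 * c)) * ?I) * (emeasure \<mu> ?A * emeasure \<mu> ?B)"
  proof -
    have "?A \<in> sets \<mu>" "?B \<in> sets \<mu>"
      using borel_closed[OF compact_imp_closed[OF A(1)]] borel_closed[OF compact_imp_closed[OF A(2)]] by (simp_all add: sets_mu)
    then show ?thesis by (simp add: nn_integral_cmult_indicator emeasure_pair_measure_Times)
  qed
  also have "\<dots> < \<infinity>"
    using I compact_finite[OF A(1)] compact_finite[OF A(2)] by (auto simp: ennreal_mult_less_top)
  finally show ?thesis .
qed simp

lemma Jm_radon: "offdiag_radon Jm"
  unfolding offdiag_radon_def
proof (intro conjI allI ballI impI)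
  show "sets Jm = sets borel" unfolding sets_Jm borel_prod ..
  have d: "{(x, y). x = y} = - (off_diagonal :: ('a \<times> 'a) set)" by (auto simp: off_diagonal_def)
  have dm: "- off_diagonal \<in> sets (borel \<Otimes>\<^sub>M borel :: ('a \<times> 'a) measure)"
    unfolding borel_prod by (rule borel_closed) (simp add: closed_def open_off_diagonal)
  have z: "indicator (- off_diagonal) z * indicator off_diagonal z = (0 :: ennreal)" for z :: "'a \<times> 'a"
    by (simp add: indicator_def)
  show "emeasure Jm {(x, y). x = y} = 0"
    unfolding d using nn_integral_Jm[of "indicator (- off_diagonal)"] dm by (simp add: sets_Jm z)
  show "emeasure Jm L < \<infinity>" if "compact L \<and> L \<inter> {(x, y). x = y} = {}" for L
    using that by (intro Jm_compact_finite) (auto simp: off_diagonal_def)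
  fix A :: "('a \<times> 'a) set" assume "A \<in> sets borel"
  then have A[measurable]: "A \<in> sets (borel \<Otimes>\<^sub>M borel)" unfolding borel_prod .
  have "(\<lambda>z. (snd z, fst z)) -` A \<inter> space (borel \<Otimes>\<^sub>M borel) \<in> sets (borel \<Otimes>\<^sub>M borel :: ('a \<times> 'a) measure)"
    by (rule measurable_sets[OF _ A]) measurable
  moreover have "(\<lambda>z. (snd z, fst z)) -` A \<inter> space (borel \<Otimes>\<^sub>M borel) = {(x, y). (y, x) \<in> A}"
    by (auto simp: space_pair_measure)
  ultimately have A'[measurable]: "{(x, y). (y, x) \<in> A} \<in> sets (borel \<Otimes>\<^sub>M borel)" by simp
  have "emeasure Jm A = (\<integral>\<^sup>+ x. \<integral>\<^sup>+ y. indicator A (x, y) * indicator off_diagonal (x, y) * j x y \<partial>\<mu> \<partial>\<mu>)"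
    using nn_integral_Jm[of "indicator A"] by (simp add: sets_Jm)
  also have "\<dots> = (\<integral>\<^sup>+ x. \<integral>\<^sup>+ y. indicator A (y, x) * indicator off_diagonal (y, x) * j x y \<partial>\<mu> \<partial>\<mu>)"
    using j_symmetric[of "\<lambda>z. indicator A z * indicator off_diagonal z"] by simp
  also have "\<dots> = (\<integral>\<^sup>+ x. \<integral>\<^sup>+ y. indicator {(x, y). (y, x) \<in> A} (x, y) * indicator off_diagonal (x, y) * j x y \<partial>\<mu> \<partial>\<mu>)"
    by (intro nn_integral_cong) (auto simp: indicator_def off_diagonal_def)
  also have "\<dots> = emeasure Jm {(x, y). (y, x) \<in> A}"
    using nn_integral_Jm[of "indicator {(x, y). (y, x) \<in> A}"] by (simp add: sets_Jm)
  finally show "emeasure Jm {(x, y). (y, x) \<in> A} = emeasure Jm A" by simp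
qed

definition killing :: "'a measure" where
  "killing = density \<mu> kill"

text \<open>Both parts of \<open>total_energy\<close> are nonnegative with finite sum, so each is
  integrable and the identity descends from \<open>ennreal\<close> to the reals.\<close>

lemma energy_split:
  assumes u: "u \<in> semigroup_domain \<mu> T"
  shows "integrable Jm (\<lambda>z. (u (fst z) - u (snd z))\<^sup>2)" and "integrable killing (\<lambda>x. (u x)\<^sup>2)"
    and "(\<integral>s. gap u s \<partial>\<nu>) = (\<integral>z. (u (fst z) - u (snd z))\<^sup>2 \<partial>Jm) + (\<integral>x. (u x)\<^sup>2 \<partial>killing)"
proof -
  have uL: "u \<in> L2 \<mu>" and ui: "integrable \<nu> (gap u)" using u by (auto simp: domain_eq)
  note [measurable] = L2_measurable[OF uL]
  note sets_Jm[measurable_cong]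
  have g: "(\<integral>\<^sup>+ s. ennreal (gap u s) \<partial>\<nu>) = ennreal (\<integral>s. gap u s \<partial>\<nu>)"
    by (rule nn_integral_eq_integral[OF ui]) (simp add: gap_nonneg[OF uL])
  have a: "(\<integral>\<^sup>+ z. ennreal ((u (fst z) - u (snd z))\<^sup>2) \<partial>Jm) = (\<integral>\<^sup>+ x. \<integral>\<^sup>+ y. ennreal ((u x - u y)\<^sup>2) * j x y \<partial>\<mu> \<partial>\<mu>)"
    by (subst nn_integral_Jm) (auto intro!: nn_integral_cong simp: indicator_def off_diagonal_def)
  have b: "(\<integral>\<^sup>+ x. ennreal ((u x)\<^sup>2) \<partial>killing) = (\<integral>\<^sup>+ x. ennreal ((u x)\<^sup>2) * kill x \<partial>\<mu>)"
    unfolding killing_def by (subst nn_integral_density) (auto simp: mult.commute)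
  have sum: "(\<integral>\<^sup>+ z. ennreal ((u (fst z) - u (snd z))\<^sup>2) \<partial>Jm) + (\<integral>\<^sup>+ x. ennreal ((u x)\<^sup>2) \<partial>killing) = ennreal (\<integral>s. gap u s \<partial>\<nu>)"
    using total_energy[OF uL] by (simp add: a b g)
  then have fin: "(\<integral>\<^sup>+ z. ennreal ((u (fst z) - u (snd z))\<^sup>2) \<partial>Jm) < \<infinity>" "(\<integral>\<^sup>+ x. ennreal ((u x)\<^sup>2) \<partial>killing) < \<infinity>"
    by (auto simp: less_top[symmetric] dest: sym)
  have km[measurable]: "u \<in> borel_measurable killing" by (simp add: killing_def)
  show i1: "integrable Jm (\<lambda>z. (u (fst z) - u (snd z))\<^sup>2)"
    by (rule integrableI_nonneg) (use fin in auto)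
  show i2: "integrable killing (\<lambda>x. (u x)\<^sup>2)"
    by (rule integrableI_nonneg) (use fin in auto)
  have "ennreal (\<integral>s. gap u s \<partial>\<nu>) = ennreal (\<integral>z. (u (fst z) - u (snd z))\<^sup>2 \<partial>Jm) + ennreal (\<integral>x. (u x)\<^sup>2 \<partial>killing)"
    unfolding sum[symmetric] using nn_integral_eq_integral[OF i1] nn_integral_eq_integral[OF i2] by simp
  also have "\<dots> = ennreal ((\<integral>z. (u (fst z) - u (snd z))\<^sup>2 \<partial>Jm) + (\<integral>x. (u x)\<^sup>2 \<partial>killing))"
    by (rule ennreal_plus[symmetric]) (auto intro!: integral_nonneg_AE)
  finally show "(\<integral>s. gap u s \<partial>\<nu>) = (\<integral>z. (u (fst z) - u (snd z))\<^sup>2 \<partial>Jm) + (\<integral>x. (u x)\<^sup>2 \<partial>killing)"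
    by (subst (asm) ennreal_inj) (auto intro!: integral_nonneg_AE add_nonneg_nonneg simp: gap_nonneg[OF uL])
qed

text \<open>A core function that is at least \<open>1/2\<close> on the compact set has finite
  energy, and four times its square dominates the indicator. Local finiteness thus comes from the
  form and not from an estimate of \<open>kill\<close>.\<close>

lemma killing_radon: "radon_measure killing"
  unfolding radon_measure_def
proof (intro conjI allI impI)
  show "sets killing = sets borel" by (simp add: killing_def)
  fix L :: "'a set" assume L: "compact L"
  obtain v where v: "v \<in> F \<inter> C_c" "\<And>x. x \<in> L \<Longrightarrow> v x \<ge> 1/2" using core_ge_on_compact[OF L] by blast
  have vd: "v \<in> semigroup_domain \<mu> T" using v F_subset_domain by auto
  have LS: "L \<in> sets killing" using compact_imp_closed[OF L] by (simp add: killing_def)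
  have "emeasure killing L = (\<integral>\<^sup>+ x. indicator L x \<partial>killing)" using LS by simp
  also have "\<dots> \<le> (\<integral>\<^sup>+ x. ennreal (4 * (v x)\<^sup>2) \<partial>killing)"
  proof (rule nn_integral_mono)
    fix x
    have "1 \<le> 4 * (v x)\<^sup>2" if "x \<in> L"
      using power_mono[OF v(2)[OF that], of 2] by (simp add: power2_eq_square)
    then show "indicator L x \<le> ennreal (4 * (v x)\<^sup>2)" by (auto simp: indicator_def)
  qed
  also have "\<dots> = ennreal (\<integral>x. 4 * (v x)\<^sup>2 \<partial>killing)"
    using energy_split(2)[OF vd] by (intro nn_integral_eq_integral) auto
  also have "\<dots> < \<infinity>" by simp
  finally show "emeasure killing L < \<infinity>" .
qed

lemma cross_energy:
  assumes u: "u \<in> semigroup_domain \<mu> T" and v: "v \<in> semigroup_domain \<mu> T"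
  shows "integrable Jm (\<lambda>z. (u (fst z) - u (snd z)) * (v (fst z) - v (snd z)))"
    and "semigroup_form \<mu> T u v = (\<integral>z. (u (fst z) - u (snd z)) * (v (fst z) - v (snd z)) \<partial>Jm) + (\<integral>x. u x * v x \<partial>killing)"
proof -
  note a = energy_split[OF domain_add(1)[OF u v]] and d = energy_split[OF domain_add(2)[OF u v]]
  have pj: "(u (fst z) - u (snd z)) * (v (fst z) - v (snd z)) =
      (((u (fst z) + v (fst z)) - (u (snd z) + v (snd z)))\<^sup>2 - ((u (fst z) - v (fst z)) - (u (snd z) - v (snd z)))\<^sup>2) / 4" for z
    by (simp add: power2_eq_square algebra_simps)
  have pk: "u x * v x = ((u x + v x)\<^sup>2 - (u x - v x)\<^sup>2) / 4" for x
    by (simp add: power2_eq_square algebra_simps)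
  show "integrable Jm (\<lambda>z. (u (fst z) - u (snd z)) * (v (fst z) - v (snd z)))"
    unfolding pj by (intro integrable_divide Bochner_Integration.integrable_diff a(1) d(1))
  have 1: "(\<integral>z. (u (fst z) - u (snd z)) * (v (fst z) - v (snd z)) \<partial>Jm) =
      ((\<integral>z. ((u (fst z) + v (fst z)) - (u (snd z) + v (snd z)))\<^sup>2 \<partial>Jm) - (\<integral>z. ((u (fst z) - v (fst z)) - (u (snd z) - v (snd z)))\<^sup>2 \<partial>Jm)) / 4"
    unfolding pj using a(1) d(1) by simp
  have 2: "(\<integral>x. u x * v x \<partial>killing) = ((\<integral>x. (u x + v x)\<^sup>2 \<partial>killing) - (\<integral>x. (u x - v x)\<^sup>2 \<partial>killing)) / 4"
    unfolding pk using a(2) d(2) by simp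
  show "semigroup_form \<mu> T u v = (\<integral>z. (u (fst z) - u (snd z)) * (v (fst z) - v (snd z)) \<partial>Jm) + (\<integral>x. u x * v x \<partial>killing)"
    unfolding form_eq[OF u v] a(3) d(3) 1 2 by (simp add: field_simps)
qed

lemma jumping_measure_Jm: "jumping_measure (semigroup_form \<mu> T) (semigroup_domain \<mu> T) Jm"
  unfolding jumping_measure_def
proof (intro conjI exI[of _ "\<lambda>_ _. 0"] exI[of _ killing] ballI)
  show "offdiag_radon Jm" by (rule Jm_radon)
  show "radon_measure killing" by (rule killing_radon)
  show "strongly_local (semigroup_domain \<mu> T \<inter> C_c) (\<lambda>_ _. 0)" by (simp add: strongly_local_def)
  show "symmetric_form (semigroup_domain \<mu> T \<inter> C_c) (\<lambda>_ _. 0)"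
    unfolding symmetric_form_def
    using F_zero F_subset_domain by (auto simp: C_c_closed C_c_zero domain_add domain_scale)
  fix u v assume "u \<in> semigroup_domain \<mu> T \<inter> C_c" "v \<in> semigroup_domain \<mu> T \<inter> C_c"
  then have uv: "u \<in> semigroup_domain \<mu> T" "v \<in> semigroup_domain \<mu> T" by auto
  show "integrable Jm (\<lambda>(x, y). (u x - u y) * (v x - v y))"
    using cross_energy(1)[OF uv] by (simp add: case_prod_beta')
  show "semigroup_form \<mu> T u v = 0 + (LINT (x, y)|Jm. (u x - u y) * (v x - v y)) + (LINT x|killing. u x * v x)"
    using cross_energy(2)[OF uv] by (simp add: case_prod_beta')
qed

lemma jump_kernel_J0: "subordinate_jump_kernel \<mu> P X S J0"
  unfolding subordinate_jump_kernel_def Let_def jump_kernel_def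
proof (intro conjI allI)
  have "(\<lambda>z. J0 (fst z) (snd z)) \<in> borel_measurable (borel \<Otimes>\<^sub>M borel)" unfolding J0_def by measurable
  then show "(\<lambda>(x, y). J0 x y) \<in> borel_measurable borel" by (simp add: borel_prod case_prod_beta')
  show "0 \<le> J0 x y" for x y by (simp add: J0_def)
  show "jumping_measure (semigroup_form \<mu> T) (semigroup_domain \<mu> T)
      (density (\<mu> \<Otimes>\<^sub>M \<mu>) (\<lambda>(x, y). ennreal (J0 x y) * indicator {(x, y). x \<noteq> y} (x, y)))"
    using jumping_measure_Jm unfolding Jm_def .
qed

text \<open>Any other jump kernel yields the same jumping measure by
  \<open>jumping_measure_unique\<close>, and over the sigma-finite product densities of equal
  measures agree almost everywhere.\<close>

lemma subordinate_jump_kernel_AE: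
  assumes "subordinate_jump_kernel \<mu> P X S J"
  shows "AE z in \<mu> \<Otimes>\<^sub>M \<mu>. z \<in> off_diagonal \<longrightarrow> ennreal (J (fst z) (snd z)) = j (fst z) (snd z)"
proof -
  let ?d = "\<lambda>J (x, y). ennreal (J x y) * indicator {(x, y). x \<noteq> y} (x, y)"
  have a: "jump_kernel \<mu> (semigroup_form \<mu> T) (semigroup_domain \<mu> T) J"
    using assms unfolding subordinate_jump_kernel_def Let_def .
  have b: "jump_kernel \<mu> (semigroup_form \<mu> T) (semigroup_domain \<mu> T) J0"
    using jump_kernel_J0 unfolding subordinate_jump_kernel_def Let_def .
  have jm: "jumping_measure E' F' (density (\<mu> \<Otimes>\<^sub>M \<mu>) (?d J'))" if "jump_kernel \<mu> E' F' J'" for E' F' J'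
    using that unfolding jump_kernel_def by (elim conjE)
  have eq: "density (\<mu> \<Otimes>\<^sub>M \<mu>) (?d J) = density (\<mu> \<Otimes>\<^sub>M \<mu>) (?d J0)"
    by (rule jumping_measure_unique[OF jm[OF a] jm[OF b] F_subset_domain])
  have m: "?d J' \<in> borel_measurable (\<mu> \<Otimes>\<^sub>M \<mu>)" if "jump_kernel \<mu> E' F' J'" for E' F' J'
  proof -
    have "(\<lambda>(x, y). J' x y) \<in> borel_measurable borel"
      using that unfolding jump_kernel_def by (rule conjunct1)
    then have "(\<lambda>z. J' (fst z) (snd z)) \<in> borel_measurable borel" by (simp add: case_prod_beta')
    then have [measurable]: "(\<lambda>z. J' (fst z) (snd z)) \<in> borel_measurable (\<mu> \<Otimes>\<^sub>M \<mu>)"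
      by (simp add: measurable_cong_sets[OF sets_prod refl])
    have [measurable]: "off_diagonal \<in> sets (\<mu> \<Otimes>\<^sub>M \<mu>)"
      unfolding sets_prod by (rule borel_open[OF open_off_diagonal])
    have "(\<lambda>z. ennreal (J' (fst z) (snd z)) * indicator off_diagonal z) \<in> borel_measurable (\<mu> \<Otimes>\<^sub>M \<mu>)" by measurable
    then show ?thesis by (simp add: case_prod_beta' off_diagonal_def)
  qed
  have "AE z in \<mu> \<Otimes>\<^sub>M \<mu>. ?d J z = ?d J0 z"
    using eq pair.density_unique_iff[OF m[OF a] m[OF b]] by simp
  then show ?thesis
    using AE_J0 by eventually_elim (auto simp: off_diagonal_def)
qed

text \<open>The constant is that of \<open>j_comparison\<close>, hence common to all versions
  \<open>J\<close>; only the exceptional null set varies with \<open>J\<close>.\<close>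

lemma jump_kernel_comparison:
  "\<exists>C>0. \<forall>J. subordinate_jump_kernel \<mu> P X S J \<longrightarrow>
     (AE (x, y) in \<mu> \<Otimes>\<^sub>M \<mu>. x \<noteq> y \<longrightarrow>
        (let r = dist x y; g = 1 / vol \<mu> x r * bernstein_fun \<phi> \<psi> (inverse (\<phi> r))
         in inverse C * g \<le> J x y \<and> J x y \<le> C * g))"
proof -
  define G where "G x y = 1 / vol \<mu> x (dist x y) * bernstein_fun \<phi> \<psi> (inverse (\<phi> (dist x y)))" for x y
  obtain C where C: "C > 0" "\<And>x y. x \<notin> N \<Longrightarrow> y \<notin> N \<Longrightarrow> x \<noteq> y \<Longrightarrow>
     ennreal (inverse C * G x y) \<le> j x y \<and> j x y \<le> ennreal (C * G x y)"
    using j_comparison unfolding G_def by blast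
  have G: "0 \<le> G x y" if "x \<noteq> y" for x y
  proof -
    have "0 \<le> bernstein_fun \<phi> \<psi> (inverse (\<phi> (dist x y)))"
      using bernstein_fun_comparison[OF scales nu_integrable] that by (metis zero_less_dist_iff)
    then show ?thesis by (simp add: G_def vol_def)
  qed
  show ?thesis
  proof (intro exI[of _ C] conjI C(1) allI impI)
    fix J assume J: "subordinate_jump_kernel \<mu> P X S J"
    have nn: "\<And>x y. 0 \<le> J x y"
      using J[unfolded subordinate_jump_kernel_def Let_def jump_kernel_def, THEN conjunct2, THEN conjunct1] by blast
    show "AE (x, y) in \<mu> \<Otimes>\<^sub>M \<mu>. x \<noteq> y \<longrightarrow>
        (let r = dist x y; g = 1 / vol \<mu> x r * bernstein_fun \<phi> \<psi> (inverse (\<phi> r))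
         in inverse C * g \<le> J x y \<and> J x y \<le> C * g)"
      using subordinate_jump_kernel_AE[OF J] AE_off_N
    proof eventually_elim
      case (elim z)
      obtain x y where z: "z = (x, y)" by (cases z)
      have "inverse C * G x y \<le> J x y \<and> J x y \<le> C * G x y" if ne: "x \<noteq> y"
      proof -
        have "ennreal (J x y) = j x y" using elim(1) ne by (simp add: z off_diagonal_def)
        then have "ennreal (inverse C * G x y) \<le> ennreal (J x y)" "ennreal (J x y) \<le> ennreal (C * G x y)"
          using C(2)[of x y] elim(2) ne by (simp_all add: z)
        then show ?thesis using nn[of x y] G[OF ne] C(1) by (simp add: ennreal_le_iff)
      qed
      then show ?case by (simp add: z G_def Let_def)
    qed
  qed
qed

end

text \<open>The existence clause keeps the estimate for all \<open>J\<close> from holding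
  vacuously.\<close>

theorem proposition3p1:
  fixes \<mu> :: "'a::{metric_space,second_countable_topology} measure"
    and \<phi>\<^sub>j \<psi> :: "real \<Rightarrow> real"
    and E :: "('a \<Rightarrow> real) \<Rightarrow> ('a \<Rightarrow> real) \<Rightarrow> real"
    and F :: "('a \<Rightarrow> real) set"
    and W :: "'w measure"
    and P :: "'a option \<Rightarrow> 'w measure"
    and X :: "ennreal \<Rightarrow> 'w \<Rightarrow> 'a option"
    and S :: "real \<Rightarrow> 'w \<Rightarrow> real"
  assumes "locally_compact_space (euclidean :: 'a topology)"
    and "radon_measure \<mu>" and "full_support \<mu>" and "volume_doubling \<mu>"
    and "scale_function \<phi>\<^sub>j" and "scale_function \<psi>"
    and "(\<integral>\<^sup>+ t\<in>{0<..}. ennreal (min 1 t * levy_density \<phi>\<^sub>j \<psi> t) \<partial>lborel) < \<infinity>"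
    and "regular_dirichlet_form \<mu> E F" and "pure_jump E F"
    and "hunt_process W P X" and "mu_symmetric \<mu> P X" and "associated_process \<mu> E F P X"
    and "HK \<mu> P X \<phi>\<^sub>j"
    and "independent_subordinator W P X S (bernstein_fun \<phi>\<^sub>j \<psi>)"
  shows "(\<exists>J. subordinate_jump_kernel \<mu> P X S J) \<and>
    (\<exists>C>0. \<forall>J. subordinate_jump_kernel \<mu> P X S J \<longrightarrow>
       (AE (x, y) in \<mu> \<Otimes>\<^sub>M \<mu>. x \<noteq> y \<longrightarrow>
          (let r = dist x y;
               g = 1 / vol \<mu> x r * bernstein_fun \<phi>\<^sub>j \<psi> (inverse (\<phi>\<^sub>j r))
           in inverse C * g \<le> J x y \<and> J x y \<le> C * g)))"
proof -
  obtain p N c1 c2 where p: "heat_kernel \<mu> (transition P (real_time X)) p" "properly_exceptional \<mu> P X N" "0 < c1" "0 < c2"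
    "\<forall>t>0. \<forall>x y. x \<notin> N \<and> y \<notin> N \<longrightarrow>
        c1 * jump_profile \<mu> \<phi>\<^sub>j t x y \<le> p t x y \<and> p t x y \<le> c2 * jump_profile \<mu> \<phi>\<^sub>j t x y"
    using assms(13) unfolding HK_def by (elim exE conjE)
  have N: "N \<in> null_sets \<mu>" using p(2) unfolding properly_exceptional_def by (rule conjunct1)
  interpret heat \<mu> E F W P X S \<phi>\<^sub>j \<psi> p N c1 c2
    by unfold_locales (fact assms N p | use p(5) in blast)+
  show ?thesis using jump_kernel_J0 jump_kernel_comparison by blast
qed

end
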